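(* Let $\Gamma$ be a regular (weighted) potential game with mixed-strategy space $X\subset\mathbb{R}^\kappa$. Then for Lebesgue-almost every initial condition $x_0\in X$, every solution $\mathbf{x}$ of the best-response dynamics $\dot{\mathbf{x}}\in \mathrm{BR}(\mathbf{x})-\mathbf{x}$ with $\mathbf{x}(0)=x_0$ converges, as $t\to\infty$, to a pure-strategy Nash equilibrium of $\Gamma$.
   Context: Games. A finite normal-form game $\Gamma$ has $N\ge 2$ players; player $i$ has a finite action set $Y_i=\{y_i^1,\dots,y_i^{K_i}\}$ and a utility $u_i:Y\to\mathbb{R}$, where $Y=\prod_j Y_j$. $\Gamma$ is a (weighted) potential game if there are a function $u:Y\to\mathbb{R}$ and weights $w_1,\dots,w_N>0$ with $u_i(y_i',y_{-i})-u_i(y_i'',y_{-i})=w_i\big(u(y_i',y_{-i})-u(y_i'',y_{-i})\big)$ for all $i$, $y_i',y_i''\in Y_i$ and $y_{-i}\in\prod_{j\ne i}Y_j$. Strategy space. $X_i=\{x_i\in\mathbb{R}^{K_i-1}: x_i^k\ge 0 \text{ for all } k,\ \sum_{k=1}^{K_i-1} x_i^k\le 1\}$, $X=\prod_i X_i\subset\mathbb{R}^\kappa$, $\kappa=\sum_i(K_i-1)$. The point $x_i$ represents the probability distribution $T_i(x_i)$ on $Y_i$ giving mass $1-\sum_{k} x_i^k$ to $y_i^1$ and mass $x_i^k$ to $y_i^{k+1}$. $U(x)$ denotes the expected value of $u$ when the players randomize independently according to $T_1(x_1),\dots,T_N(x_N)$; it is a polynomial in $x$, affine in each $x_i$ separately.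 $\mathrm{BR}_i(x_{-i})=\arg\max_{x_i'\in X_i}U(x_i',x_{-i})$ (equivalently, the maximizers of player $i$'s expected utility) and $\mathrm{BR}(x)=\prod_i\mathrm{BR}_i(x_{-i})$. A Nash equilibrium is an $x^*\in X$ with $x^*\in\mathrm{BR}(x^* )$. A strategy $x$ is pure if every $T_i(x_i)$ is a point mass. Solutions. A solution (best-response process) with initial condition $x_0$ is an absolutely continuous $\mathbf{x}:[0,\infty)\to X$ with $\mathbf{x}(0)=x_0$ and $\dot{\mathbf{x}}(t)\in\mathrm{BR}(\mathbf{x}(t))-\mathbf{x}(t)$ for almost every $t$. Regularity. For an equilibrium $x^*$, let $C_i\subseteq Y_i$ be the support of $T_i(x_i^* )$, $\gamma_i=|C_i|$, and relabel the actions so that $C_i=\{y_i^1,\dots,y_i^{\gamma_i}\}$ (defining the coordinates of $X$ via this labeling). $x^*$ is first-order non-degenerate if $\frac{\partial U}{\partial x_i^k}(x^* )\neq 0$ for all $i$ and all $k=\gamma_i,\dots,K_i-1$. $x^*$ is second-order non-degenerate if the matrix $\Big(\frac{\partial^2U}{\partial x_i^k\partial x_j^\ell}(x^* )\Big)$, indexed by pairs $(i,k),(j,\ell)$ with $\gamma_i,\gamma_j\ge 2$, $1\le k\le\gamma_i-1$, $1\le\ell\le\gamma_j-1$, is invertible (vacuous if $x^*$ is pure). $x^*$ is regular if it is both first- and second-order non-degenerate. $\Gamma$ is regular if all its Nash equilibria are regular. *)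

theory Defs
  imports "HOL-Analysis.Analysis"
begin

section \<open>Finite games and mixed strategies\<close>

text \<open>
  The players are the elements of a finite type. Player \<open>i\<close> has the finite action set \<open>Y i\<close>, and
  \<open>y i 1, \<dots>, y i (card (Y i))\<close> is the enumeration of \<open>Y i\<close> that coordinatises the mixed strategies.
  A mixed strategy \<open>x i\<close> of player \<open>i\<close> is a point of $\mathbb{R}^{K_i-1}$, represented as an
  extensional function on \<open>{1..K\<^sub>i - 1}\<close>, and a strategy profile is a family \<open>x\<close> of mixed strategies.
  Many notions below take the real-valued function \<open>f\<close> on pure profiles as a parameter; they are used
  with \<open>f\<close> the potential of the game.
\<close>

definition labeling :: "('p \<Rightarrow> 'a set) \<Rightarrow> ('p \<Rightarrow> nat \<Rightarrow> 'a) \<Rightarrow> bool" where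
  "labeling Y y \<longleftrightarrow> (\<forall>i. bij_betw (y i) {1..card (Y i)} (Y i))"

definition pure_profiles :: "('p \<Rightarrow> 'a set) \<Rightarrow> ('p \<Rightarrow> 'a) set" where
  "pure_profiles Y = {s. \<forall>i. s i \<in> Y i}"

definition weighted_potential ::
  "('p \<Rightarrow> 'a set) \<Rightarrow> ('p \<Rightarrow> ('p \<Rightarrow> 'a) \<Rightarrow> real) \<Rightarrow> (('p \<Rightarrow> 'a) \<Rightarrow> real) \<Rightarrow> ('p \<Rightarrow> real) \<Rightarrow> bool" where
  "weighted_potential Y util u w \<longleftrightarrow>
     (\<forall>i. w i > 0) \<and>
     (\<forall>i. \<forall>s \<in> pure_profiles Y. \<forall>a \<in> Y i. \<forall>b \<in> Y i.
        util i (s(i := a)) - util i (s(i := b)) = w i * (u (s(i := a)) - u (s(i := b))))"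

definition mixed_strategies :: "nat \<Rightarrow> (nat \<Rightarrow> real) set" where
  "mixed_strategies K = {z \<in> extensional {1..K - 1}. (\<forall>k\<in>{1..K - 1}. z k \<ge> 0) \<and> (\<Sum>k=1..K - 1. z k) \<le> 1}"

definition strategies :: "('p \<Rightarrow> 'a set) \<Rightarrow> ('p \<Rightarrow> nat \<Rightarrow> real) set" where
  "strategies Y = {x. \<forall>i. x i \<in> mixed_strategies (card (Y i))}"

text \<open>Lebesgue measure on $\mathbb{R}^\kappa = \prod_i \mathbb{R}^{K_i-1}$.\<close>

definition strategy_measure :: "('p::finite \<Rightarrow> 'a set) \<Rightarrow> ('p \<Rightarrow> nat \<Rightarrow> real) measure" where
  "strategy_measure Y = (\<Pi>\<^sub>M i\<in>UNIV. \<Pi>\<^sub>M k\<in>{1..card (Y i) - 1}. lborel)"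

text \<open>
  \<open>mixture A e z a\<close> is the mass $T_i(x_i)(a)$, for the action set \<open>A\<close> enumerated by \<open>e\<close> and \<open>x\<^sub>i = z\<close>.
  It is defined for all \<open>z\<close>, not only on the simplex, so that \<open>expectation\<close> is a polynomial on the
  whole of $\mathbb{R}^\kappa$ and its partial derivatives make sense at boundary points.
\<close>

definition mixture :: "'a set \<Rightarrow> (nat \<Rightarrow> 'a) \<Rightarrow> (nat \<Rightarrow> real) \<Rightarrow> 'a \<Rightarrow> real" where
  "mixture A e z a =
     (let m = inv_into {1..card A} e a
      in if m = 1 then 1 - (\<Sum>k=1..card A - 1. z k) else z (m - 1))"

definition expectation ::
  "('p::finite \<Rightarrow> 'a set) \<Rightarrow> ('p \<Rightarrow> nat \<Rightarrow> 'a) \<Rightarrow> (('p \<Rightarrow> 'a) \<Rightarrow> real) \<Rightarrow> ('p \<Rightarrow> nat \<Rightarrow> real) \<Rightarrow> real" where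
  "expectation Y y f x = (\<Sum>s\<in>pure_profiles Y. f s * (\<Prod>i\<in>UNIV. mixture (Y i) (y i) (x i) (s i)))"

definition best_responses ::
  "('p::finite \<Rightarrow> 'a set) \<Rightarrow> ('p \<Rightarrow> nat \<Rightarrow> 'a) \<Rightarrow> (('p \<Rightarrow> 'a) \<Rightarrow> real) \<Rightarrow> 'p \<Rightarrow> ('p \<Rightarrow> nat \<Rightarrow> real)
     \<Rightarrow> (nat \<Rightarrow> real) set" where
  "best_responses Y y f i x =
     {z \<in> mixed_strategies (card (Y i)). \<forall>z' \<in> mixed_strategies (card (Y i)).
        expectation Y y f (x(i := z')) \<le> expectation Y y f (x(i := z))}"

definition BR ::
  "('p::finite \<Rightarrow> 'a set) \<Rightarrow> ('p \<Rightarrow> nat \<Rightarrow> 'a) \<Rightarrow> (('p \<Rightarrow> 'a) \<Rightarrow> real) \<Rightarrow> ('p \<Rightarrow> nat \<Rightarrow> real)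
     \<Rightarrow> ('p \<Rightarrow> nat \<Rightarrow> real) set" where
  "BR Y y f x = {b. \<forall>i. b i \<in> best_responses Y y f i x}"

definition nash ::
  "('p::finite \<Rightarrow> 'a set) \<Rightarrow> ('p \<Rightarrow> nat \<Rightarrow> 'a) \<Rightarrow> (('p \<Rightarrow> 'a) \<Rightarrow> real) \<Rightarrow> ('p \<Rightarrow> nat \<Rightarrow> real) \<Rightarrow> bool" where
  "nash Y y f x \<longleftrightarrow> x \<in> strategies Y \<and> x \<in> BR Y y f x"

definition pure :: "('p \<Rightarrow> 'a set) \<Rightarrow> ('p \<Rightarrow> nat \<Rightarrow> 'a) \<Rightarrow> ('p \<Rightarrow> nat \<Rightarrow> real) \<Rightarrow> bool" where
  "pure Y y x \<longleftrightarrow>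
     (\<forall>i. \<exists>a\<in>Y i. \<forall>b\<in>Y i. mixture (Y i) (y i) (x i) b = (if b = a then 1 else 0))"

lemma sum_mixture:
  assumes "finite A" "A \<noteq> {}" "bij_betw e {1..card A} A"
  shows "(\<Sum>a\<in>A. mixture A e z a) = 1"
proof -
  let ?K = "card A"
  have K: "?K \<ge> 1" using assms(1,2) by (simp add: Suc_le_eq card_gt_0_iff)
  have "(\<Sum>a\<in>A. mixture A e z a) = (\<Sum>m=1..?K. mixture A e z (e m))"
    using sum.reindex_bij_betw[OF assms(3), of "mixture A e z"] by simp
  also have "\<dots> = (\<Sum>m=1..?K. if m = 1 then 1 - (\<Sum>k=1..?K - 1. z k) else z (m - 1))"
    using assms(3) by (intro sum.cong) (auto simp: mixture_def Let_def bij_betw_def inv_into_f_f)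
  also have "\<dots> = (1 - (\<Sum>k=1..?K - 1. z k)) + (\<Sum>m=Suc 1..?K. z (m - 1))"
    using K by (subst sum.atLeast_Suc_atMost) auto
  also have "(\<Sum>m=Suc 1..?K. z (m - 1)) = (\<Sum>k=1..?K - 1. z k)"
    using K by (intro sum.reindex_bij_witness[where i=Suc and j="\<lambda>m. m - 1"]) auto
  finally show ?thesis by simp
qed

lemma expectation_own_action_irrelevant:
  fixes Y :: "'p::finite \<Rightarrow> 'a set"
  assumes fin: "\<And>i. finite (Y i)" and ne: "\<And>i. Y i \<noteq> {}" and lab: "labeling Y y"
    and const: "\<And>s a b. s \<in> pure_profiles Y \<Longrightarrow> a \<in> Y i \<Longrightarrow> b \<in> Y i \<Longrightarrow> g (s(i := a)) = g (s(i := b))"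
  shows "expectation Y y g (x(i := z)) = expectation Y y g (x(i := z'))"
proof -
  obtain a0 where a0: "a0 \<in> Y i" using ne by blast
  define P where "P = {s \<in> pure_profiles Y. s i = a0}"
  define R where "R = (\<lambda>s. \<Prod>j\<in>UNIV - {i}. mixture (Y j) (y j) (x j) (s j))"
  have "expectation Y y g (x(i := z)) = (\<Sum>s\<in>P. g s * R s)" for z
  proof -
    have "expectation Y y g (x(i := z)) =
        (\<Sum>(s, a)\<in>P \<times> Y i. g (s(i := a)) *
           (\<Prod>j\<in>UNIV. mixture (Y j) (y j) ((x(i := z)) j) ((s(i := a)) j)))"
    proof -
      let ?F = "\<lambda>s. g s * (\<Prod>j\<in>UNIV. mixture (Y j) (y j) ((x(i := z)) j) (s j))"
      have "bij_betw (\<lambda>(s, a). s(i := a)) (P \<times> Y i) (pure_profiles Y)"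
      proof (rule bij_betw_byWitness[where f'="\<lambda>s. (s(i := a0), s i)"])
        show "\<forall>p\<in>P \<times> Y i. (\<lambda>s. (s(i := a0), s i)) ((\<lambda>(s, a). s(i := a)) p) = p"
          by (auto simp: P_def fun_upd_idem)
        show "\<forall>s\<in>pure_profiles Y. (\<lambda>(s, a). s(i := a)) (s(i := a0), s i) = s"
          by simp
        show "(\<lambda>(s, a). s(i := a)) ` (P \<times> Y i) \<subseteq> pure_profiles Y"
          by (auto simp: P_def pure_profiles_def)
        show "(\<lambda>s. (s(i := a0), s i)) ` pure_profiles Y \<subseteq> P \<times> Y i"
          using a0 by (auto simp: P_def pure_profiles_def)
      qed
      from sum.reindex_bij_betw[OF this, of ?F] show ?thesis
        unfolding expectation_def case_prod_beta by (rule sym)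
    qed
    also have "\<dots> = (\<Sum>(s, a)\<in>P \<times> Y i. (g s * R s) * mixture (Y i) (y i) z a)"
    proof (rule sum.cong[OF refl], clarify)
      fix s a assume s: "s \<in> P" "a \<in> Y i"
      have "g (s(i := a)) = g (s(i := a0))" using s a0 by (intro const) (auto simp: P_def)
      then have g: "g (s(i := a)) = g s" using s by (auto simp: P_def fun_upd_idem)
      have "(\<Prod>j\<in>UNIV. mixture (Y j) (y j) ((x(i := z)) j) ((s(i := a)) j)) =
            mixture (Y i) (y i) z a *
            (\<Prod>j\<in>UNIV - {i}. mixture (Y j) (y j) ((x(i := z)) j) ((s(i := a)) j))"
        by (subst prod.remove[of UNIV i]) simp_all
      also have "(\<Prod>j\<in>UNIV - {i}. mixture (Y j) (y j) ((x(i := z)) j) ((s(i := a)) j)) = R s"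
        unfolding R_def by (intro prod.cong) auto
      finally show "g (s(i := a)) *
          (\<Prod>j\<in>UNIV. mixture (Y j) (y j) ((x(i := z)) j) ((s(i := a)) j)) =
          (g s * R s) * mixture (Y i) (y i) z a"
        using g by simp
    qed
    also have "\<dots> = (\<Sum>s\<in>P. g s * R s * (\<Sum>a\<in>Y i. mixture (Y i) (y i) z a))"
      by (simp add: sum.cartesian_product[symmetric] sum_distrib_left)
    also have "\<dots> = (\<Sum>s\<in>P. g s * R s)"
      using sum_mixture[OF fin ne] lab by (simp add: labeling_def)
    finally show ?thesis .
  qed
  then show ?thesis by simp
qed

text \<open>
  Maximising the expected potential amounts to maximising the player's own expected utility, so
  \<open>BR Y y u\<close> and \<open>nash Y y u\<close>, for a potential \<open>u\<close>, are best response and Nash equilibrium in the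
  game with utilities \<open>util\<close>.
\<close>

lemma best_responses_utility_eq_potential:
  fixes Y :: "'p::finite \<Rightarrow> 'a set"
  assumes fin: "\<And>i. finite (Y i)" and ne: "\<And>i. Y i \<noteq> {}" and lab: "labeling Y y"
    and pot: "weighted_potential Y util u w"
  shows "best_responses Y y (util i) i x = best_responses Y y u i x"
proof -
  define g where "g = (\<lambda>s. util i s - w i * u s)"
  have w: "w i > 0" using pot by (simp add: weighted_potential_def)
  have const: "g (s(i := a)) = g (s(i := b))" if "s \<in> pure_profiles Y" "a \<in> Y i" "b \<in> Y i" for s a b
  proof -
    have "util i (s(i := a)) - util i (s(i := b)) = w i * (u (s(i := a)) - u (s(i := b)))"
      using pot that unfolding weighted_potential_def by blast
    then show ?thesis by (simp add: g_def algebra_simps)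
  qed
  have split: "expectation Y y (util i) v = w i * expectation Y y u v + expectation Y y g v" for v
    by (simp add: expectation_def g_def sum_distrib_left sum.distrib[symmetric] algebra_simps)
  have "expectation Y y (util i) (x(i := z')) \<le> expectation Y y (util i) (x(i := z)) \<longleftrightarrow>
        expectation Y y u (x(i := z')) \<le> expectation Y y u (x(i := z))" for z z'
    using expectation_own_action_irrelevant[where g=g and i=i and x=x and z=z' and z'=z, OF fin ne lab const] w
    by (simp add: split)
  then show ?thesis by (simp add: best_responses_def)
qed


section \<open>Best-response dynamics\<close>

definition absolutely_continuous_on_interval :: "real \<Rightarrow> real \<Rightarrow> (real \<Rightarrow> real) \<Rightarrow> bool" where
  "absolutely_continuous_on_interval a b g \<longleftrightarrow>
     (\<forall>\<epsilon>>0. \<exists>\<delta>>0. \<forall>n (l :: nat \<Rightarrow> real) r.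
        (\<forall>j<n. a \<le> l j \<and> l j \<le> r j \<and> r j \<le> b) \<longrightarrow>
        disjoint_family_on (\<lambda>j. {l j<..<r j}) {..<n} \<longrightarrow>
        (\<Sum>j<n. r j - l j) < \<delta> \<longrightarrow>
        (\<Sum>j<n. \<bar>g (r j) - g (l j)\<bar>) < \<epsilon>)"

text \<open>
  Absolute continuity on \<open>[0,\<infinity>)\<close> is read as absolute continuity on every compact subinterval; for
  solutions the two coincide, because their velocity is bounded. Only the values of \<open>x\<close> on
  \<open>[0,\<infinity>)\<close> matter.
\<close>

definition br_solution ::
  "('p::finite \<Rightarrow> 'a set) \<Rightarrow> ('p \<Rightarrow> nat \<Rightarrow> 'a) \<Rightarrow> (('p \<Rightarrow> 'a) \<Rightarrow> real) \<Rightarrow> ('p \<Rightarrow> nat \<Rightarrow> real)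
     \<Rightarrow> (real \<Rightarrow> 'p \<Rightarrow> nat \<Rightarrow> real) \<Rightarrow> bool" where
  "br_solution Y y f x0 x \<longleftrightarrow>
     x 0 = x0 \<and>
     (\<forall>t\<ge>0. x t \<in> strategies Y) \<and>
     (\<forall>i. \<forall>k\<in>{1..card (Y i) - 1}. \<forall>c\<ge>0. absolutely_continuous_on_interval 0 c (\<lambda>t. x t i k)) \<and>
     (AE t in lborel. t \<ge> 0 \<longrightarrow>
        (\<exists>b \<in> BR Y y f (x t). \<forall>i. \<forall>k\<in>{1..card (Y i) - 1}.
           ((\<lambda>s. x s i k) has_real_derivative (b i k - x t i k)) (at t within {0..})))"


section \<open>Regularity\<close>

definition partial_deriv :: "'p \<Rightarrow> nat \<Rightarrow> (('p \<Rightarrow> nat \<Rightarrow> real) \<Rightarrow> real) \<Rightarrow> ('p \<Rightarrow> nat \<Rightarrow> real) \<Rightarrow> real" where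
  "partial_deriv i k F x = deriv (\<lambda>s. F (x(i := (x i)(k := s)))) (x i k)"

definition support :: "'a set \<Rightarrow> (nat \<Rightarrow> 'a) \<Rightarrow> (nat \<Rightarrow> real) \<Rightarrow> 'a set" where
  "support A e z = {a \<in> A. mixture A e z a \<noteq> 0}"

definition first_order_nondegenerate ::
  "('p::finite \<Rightarrow> 'a set) \<Rightarrow> ('p \<Rightarrow> nat \<Rightarrow> 'a) \<Rightarrow> (('p \<Rightarrow> 'a) \<Rightarrow> real) \<Rightarrow> ('p \<Rightarrow> nat \<Rightarrow> real) \<Rightarrow> bool" where
  "first_order_nondegenerate Y y f x \<longleftrightarrow>
     (\<forall>i. \<forall>k\<in>{card (support (Y i) (y i) (x i))..card (Y i) - 1}.
        partial_deriv i k (expectation Y y f) x \<noteq> 0)"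

definition invertible_matrix_on :: "'s set \<Rightarrow> ('s \<Rightarrow> 's \<Rightarrow> real) \<Rightarrow> bool" where
  "invertible_matrix_on S H \<longleftrightarrow>
     (\<exists>B. \<forall>p\<in>S. \<forall>q\<in>S.
        (\<Sum>r\<in>S. H p r * B r q) = (if p = q then 1 else 0) \<and>
        (\<Sum>r\<in>S. B p r * H r q) = (if p = q then 1 else 0))"

definition second_order_nondegenerate ::
  "('p::finite \<Rightarrow> 'a set) \<Rightarrow> ('p \<Rightarrow> nat \<Rightarrow> 'a) \<Rightarrow> (('p \<Rightarrow> 'a) \<Rightarrow> real) \<Rightarrow> ('p \<Rightarrow> nat \<Rightarrow> real) \<Rightarrow> bool" where
  "second_order_nondegenerate Y y f x \<longleftrightarrow>
     (let \<gamma> = (\<lambda>i. card (support (Y i) (y i) (x i))) in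
      invertible_matrix_on {(i, k). \<gamma> i \<ge> 2 \<and> 1 \<le> k \<and> k \<le> \<gamma> i - 1}
        (\<lambda>(i, k) (j, l). partial_deriv i k (partial_deriv j l (expectation Y y f)) x))"

text \<open>
  The two conditions above are meant for an enumeration that lists the support of each \<open>x i\<close> first.
  \<open>relabel Y y y' x\<close> gives the coordinates, with respect to the enumeration \<open>y'\<close>, of the mixed
  strategies whose coordinates with respect to \<open>y\<close> are \<open>x\<close>.
\<close>

definition relabel ::
  "('p \<Rightarrow> 'a set) \<Rightarrow> ('p \<Rightarrow> nat \<Rightarrow> 'a) \<Rightarrow> ('p \<Rightarrow> nat \<Rightarrow> 'a) \<Rightarrow> ('p \<Rightarrow> nat \<Rightarrow> real) \<Rightarrow> ('p \<Rightarrow> nat \<Rightarrow> real)" where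
  "relabel Y y y' x = (\<lambda>i. \<lambda>k\<in>{1..card (Y i) - 1}. mixture (Y i) (y i) (x i) (y' i (k + 1)))"

definition adapted_labeling ::
  "('p \<Rightarrow> 'a set) \<Rightarrow> ('p \<Rightarrow> nat \<Rightarrow> 'a) \<Rightarrow> ('p \<Rightarrow> nat \<Rightarrow> real) \<Rightarrow> ('p \<Rightarrow> nat \<Rightarrow> 'a) \<Rightarrow> bool" where
  "adapted_labeling Y y x y' \<longleftrightarrow>
     labeling Y y' \<and>
     (\<forall>i. y' i ` {1..card (support (Y i) (y i) (x i))} = support (Y i) (y i) (x i))"

text \<open>
  An adapted enumeration always exists, and at an equilibrium neither nondegeneracy condition
  depends on which one is chosen.
\<close>

definition regular_equilibrium ::
  "('p::finite \<Rightarrow> 'a set) \<Rightarrow> ('p \<Rightarrow> nat \<Rightarrow> 'a) \<Rightarrow> (('p \<Rightarrow> 'a) \<Rightarrow> real) \<Rightarrow> ('p \<Rightarrow> nat \<Rightarrow> real) \<Rightarrow> bool" where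
  "regular_equilibrium Y y f x \<longleftrightarrow>
     (\<exists>y'. adapted_labeling Y y x y' \<and>
        first_order_nondegenerate Y y' f (relabel Y y y' x) \<and>
        second_order_nondegenerate Y y' f (relabel Y y y' x))"

definition regular_game ::
  "('p::finite \<Rightarrow> 'a set) \<Rightarrow> ('p \<Rightarrow> nat \<Rightarrow> 'a) \<Rightarrow> (('p \<Rightarrow> 'a) \<Rightarrow> real) \<Rightarrow> bool" where
  "regular_game Y y f \<longleftrightarrow> (\<forall>x. nash Y y f x \<longrightarrow> regular_equilibrium Y y f x)"

end

theory Submission
  imports Defs
begin

text \<open>
  In terms of the masses of the actions, a solution \<open>m\<close> makes \<open>exp t * m t i a\<close> nondecreasing in
  \<open>t\<close>, and constant while \<open>a\<close> is not a best response. This weak form is closed under limits, and along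
  it the expected potential is differentiable with derivative \<open>G \<ge> 0\<close>, the sum over the players of the
  gain from a best response, which vanishes exactly at the equilibria. Regular equilibria are isolated,
  so every solution converges to one of them.

  Suppose the limit is mixed. Off its support the masses decay freely. Comparing the potential with its
  value at the state that has the same off-support masses and makes all players indifferent on the
  supports gives a gap \<open>V\<close> with \<open>V' \<ge> const * sqrt \<bar>V\<bar>\<close>, so the solution reaches exact
  indifference between two actions of some player that are not duplicates of each other, and stays
  there; in particular this happens at an integer time.

  The initial conditions of such solutions form a null set. While trajectories are unique, they are
  limits of schemes composed of shears and contractions, which distort volume by a known factor, and the
  indifference set is null because payoff differences are multiaffine. Uniqueness can fail only at a
  tie of two players each of whom influences the tie of the other, or at a tie whose payoff difference
  moves with speed zero. Reaching such a point forces the trajectory to be, at the preceding time of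
  a grid of mesh $\eta$, in a set of measure $O(\eta^{3/2})$, and there are only $O(1/\eta)$ grid times.
\<close>

section \<open>Expected payoffs as functions of the masses\<close>

text \<open>The inclusion has no flow along which sets could be pulled back, so volume estimates are
  available only for starts with a unique trajectory, and the remaining starts must be shown null by
  the same estimates. The circle is broken at the last time of uniqueness: uniqueness holds up to
  and including that time, so the estimates apply at every grid time before it.

  The rate \<open>eta powr (3/2)\<close> has two sources. At a mutual tie two payoff differences are
  \<open>O(eta)\<close> and vary along coordinates of different players, which gives
  \<open>eta\<^sup>2\<close>. At a stalled tie one payoff difference is
  \<open>O(eta\<^sup>2)\<close>, and the sublevel set of height \<open>e\<close> of a nonzero
  multiaffine function has measure \<open>O(e powr (3/4))\<close>.

  The square root in the differential inequality comes from the inverse Hessian: it bounds the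
  distance to the comparison state linearly by the payoff differences on the supports. The gap is
  quadratic in that distance, since its first-order term vanishes at indifference, while its
  derivative is at least linear in the payoff differences.\<close>

lemma prod_lipschitz_on_box:
  fixes B :: real
  assumes "finite A" "B \<ge> 0"
  shows "\<exists>C\<ge>0. \<forall>a b :: 'i \<Rightarrow> real. (\<forall>i\<in>A. \<bar>a i\<bar> \<le> B \<and> \<bar>b i\<bar> \<le> B) \<longrightarrow>
           \<bar>prod b A - prod a A\<bar> \<le> C * (\<Sum>i\<in>A. \<bar>b i - a i\<bar>)"
  using assms(1)
proof (induction A)
  case empty
  show ?case by (auto intro: exI[of _ 0])
next
  case (insert x A)
  then obtain C where C: "C \<ge> 0"
    "\<And>a b :: 'i \<Rightarrow> real. (\<forall>i\<in>A. \<bar>a i\<bar> \<le> B \<and> \<bar>b i\<bar> \<le> B) \<Longrightarrow>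
       \<bar>prod b A - prod a A\<bar> \<le> C * (\<Sum>i\<in>A. \<bar>b i - a i\<bar>)" by blast
  show ?case
  proof (intro exI[of _ "B * C + B ^ card A"] conjI allI impI)
    show "B * C + B ^ card A \<ge> 0" using C assms by simp
    fix a b :: "'i \<Rightarrow> real"
    assume ab: "\<forall>i\<in>insert x A. \<bar>a i\<bar> \<le> B \<and> \<bar>b i\<bar> \<le> B"
    define S where "S = (\<Sum>i\<in>A. \<bar>b i - a i\<bar>)"
    have S: "S \<ge> 0" unfolding S_def by (intro sum_nonneg) auto
    have pa: "\<bar>prod a A\<bar> \<le> B ^ card A"
      unfolding abs_prod using ab by (rule_tac order_trans[OF prod_mono[where g="\<lambda>_. B"]]) auto
    have "prod b (insert x A) - prod a (insert x A) = b x * (prod b A - prod a A) + (b x - a x) * prod a A"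
      using insert.hyps by (simp add: algebra_simps)
    also have "\<bar>\<dots>\<bar> \<le> \<bar>b x\<bar> * \<bar>prod b A - prod a A\<bar> + \<bar>b x - a x\<bar> * \<bar>prod a A\<bar>"
      using abs_triangle_ineq by (metis abs_mult)
    also have "\<dots> \<le> B * (C * S) + \<bar>b x - a x\<bar> * B ^ card A"
    proof (intro add_mono mult_mono)
      show "\<bar>prod b A - prod a A\<bar> \<le> C * S" unfolding S_def using ab by (intro C(2)) simp
    qed (use ab pa assms in auto)
    also have "\<dots> \<le> (B * C + B ^ card A) * (\<bar>b x - a x\<bar> + S)"
      using C(1) S assms by (simp add: algebra_simps)
    finally show "\<bar>prod b (insert x A) - prod a (insert x A)\<bar> \<le>
        (B * C + B ^ card A) * (\<Sum>i\<in>insert x A. \<bar>b i - a i\<bar>)"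
      using insert.hyps by (simp add: S_def)
  qed
qed

text \<open>Splitting off the factor at \<open>x\<close> leaves \<open>a x\<close> times the
  remainder over \<open>A\<close> and the cross term
  \<open>(b x - a x) * (prod b A - prod a A)\<close>, which is of second order by the Lipschitz
  bound.\<close>

lemma prod_taylor_on_box:
  fixes B :: real
  assumes "finite A" "B \<ge> 0"
  shows "\<exists>C\<ge>0. \<forall>a b :: 'i \<Rightarrow> real. (\<forall>i\<in>A. \<bar>a i\<bar> \<le> B \<and> \<bar>b i\<bar> \<le> B) \<longrightarrow>
           \<bar>prod b A - prod a A - (\<Sum>i\<in>A. (b i - a i) * prod a (A - {i}))\<bar> \<le> C * (\<Sum>i\<in>A. \<bar>b i - a i\<bar>)\<^sup>2"
  using assms(1)
proof (induction A)
  case empty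
  show ?case by (auto intro: exI[of _ 0])
next
  case (insert x A)
  then obtain C where C: "C \<ge> 0"
    "\<And>a b :: 'i \<Rightarrow> real. (\<forall>i\<in>A. \<bar>a i\<bar> \<le> B \<and> \<bar>b i\<bar> \<le> B) \<Longrightarrow>
       \<bar>prod b A - prod a A - (\<Sum>i\<in>A. (b i - a i) * prod a (A - {i}))\<bar> \<le> C * (\<Sum>i\<in>A. \<bar>b i - a i\<bar>)\<^sup>2"
    by blast
  obtain L where L: "L \<ge> 0"
    "\<And>a b :: 'i \<Rightarrow> real. (\<forall>i\<in>A. \<bar>a i\<bar> \<le> B \<and> \<bar>b i\<bar> \<le> B) \<Longrightarrow>
       \<bar>prod b A - prod a A\<bar> \<le> L * (\<Sum>i\<in>A. \<bar>b i - a i\<bar>)"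
    using prod_lipschitz_on_box[OF insert.hyps(1) assms(2)] by blast
  show ?case
  proof (intro exI[of _ "B * C + L"] conjI allI impI)
    show "B * C + L \<ge> 0" using C L assms by simp
    fix a b :: "'i \<Rightarrow> real"
    assume ab: "\<forall>i\<in>insert x A. \<bar>a i\<bar> \<le> B \<and> \<bar>b i\<bar> \<le> B"
    define S where "S = (\<Sum>i\<in>A. \<bar>b i - a i\<bar>)"
    define Q where "Q = (\<Sum>i\<in>A. (b i - a i) * prod a (A - {i}))"
    have S: "S \<ge> 0" unfolding S_def by (intro sum_nonneg) auto
    have "(\<Sum>i\<in>insert x A. (b i - a i) * prod a (insert x A - {i})) =
          (b x - a x) * prod a A + (\<Sum>i\<in>A. (b i - a i) * prod a (insert x A - {i}))"
      using insert.hyps by simp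
    also have "(\<Sum>i\<in>A. (b i - a i) * prod a (insert x A - {i})) = a x * Q"
      unfolding Q_def sum_distrib_left
    proof (intro sum.cong refl)
      fix i assume "i \<in> A"
      then have "insert x A - {i} = insert x (A - {i})" using insert.hyps by auto
      then show "(b i - a i) * prod a (insert x A - {i}) = a x * ((b i - a i) * prod a (A - {i}))"
        using insert.hyps by simp
    qed
    finally have "prod b (insert x A) - prod a (insert x A) -
        (\<Sum>i\<in>insert x A. (b i - a i) * prod a (insert x A - {i}))
      = a x * (prod b A - prod a A - Q) + (b x - a x) * (prod b A - prod a A)"
      using insert.hyps by (simp add: algebra_simps)
    also have "\<bar>\<dots>\<bar> \<le> \<bar>a x\<bar> * \<bar>prod b A - prod a A - Q\<bar> + \<bar>b x - a x\<bar> * \<bar>prod b A - prod a A\<bar>"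
      using abs_triangle_ineq by (metis abs_mult)
    also have "\<dots> \<le> B * (C * S\<^sup>2) + \<bar>b x - a x\<bar> * (L * S)"
    proof (intro add_mono mult_mono)
      show "\<bar>prod b A - prod a A - Q\<bar> \<le> C * S\<^sup>2" unfolding S_def Q_def using ab by (intro C(2)) simp
      show "\<bar>prod b A - prod a A\<bar> \<le> L * S" unfolding S_def using ab by (intro L(2)) simp
    qed (use ab assms in auto)
    also have "\<dots> \<le> (B * C + L) * (\<bar>b x - a x\<bar> + S)\<^sup>2"
    proof -
      define e where "e = \<bar>b x - a x\<bar>"
      have e: "e \<ge> 0" by (simp add: e_def)
      have "B * (C * S\<^sup>2) \<le> (B * C) * (e + S)\<^sup>2"
        using e S assms C(1) by (auto simp: mult.assoc intro!: mult_left_mono power_mono)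
      moreover have "e * S \<le> (e + S)\<^sup>2" using e S by (simp add: power2_eq_square algebra_simps)
      then have "e * (L * S) \<le> L * (e + S)\<^sup>2" using L(1) by (metis mult.left_commute mult_left_mono)
      ultimately show ?thesis by (simp add: e_def algebra_simps)
    qed
    finally show "\<bar>prod b (insert x A) - prod a (insert x A) -
        (\<Sum>i\<in>insert x A. (b i - a i) * prod a (insert x A - {i}))\<bar> \<le>
        (B * C + L) * (\<Sum>i\<in>insert x A. \<bar>b i - a i\<bar>)\<^sup>2"
      using insert.hyps by (simp add: S_def)
  qed
qed

definition ind :: "'a \<Rightarrow> 'a \<Rightarrow> real" where
  "ind a = (\<lambda>c. if c = a then 1 else 0)"

text \<open>The signed mass that moves one unit from \<open>b\<close> to \<open>a\<close>.
  Substituted for a player's component, it makes a payoff difference a single value of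
  \<open>U\<close>.\<close>

definition dl :: "'a \<Rightarrow> 'a \<Rightarrow> 'a \<Rightarrow> real" where
  "dl a b = (\<lambda>c. ind a c - ind b c)"

section \<open>The multilinear potential and payoffs in mass coordinates\<close>

locale finite_game =
  fixes Y :: "'p::finite \<Rightarrow> 'a set" and u :: "('p \<Rightarrow> 'a) \<Rightarrow> real"
  assumes fin [simp, intro]: "finite (Y i)" and ne [simp]: "Y i \<noteq> {}"
begin

abbreviation PP :: "('p \<Rightarrow> 'a) set" where "PP \<equiv> pure_profiles Y"

lemma finite_PP [simp, intro]: "finite PP"
proof -
  have "PP = Pi\<^sub>E UNIV Y" by (auto simp: pure_profiles_def)
  then show ?thesis by (simp add: finite_PiE)
qed

lemma PP_mem [simp, intro]: "s \<in> PP \<Longrightarrow> s i \<in> Y i"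
  by (simp add: pure_profiles_def)

text \<open>The multilinear extension of \<open>u\<close> to arbitrary real mass vectors, so that
  increments and signed masses can be inserted for one player.\<close>

definition U :: "('p \<Rightarrow> 'a \<Rightarrow> real) \<Rightarrow> real" where
  "U m = (\<Sum>s\<in>PP. u s * (\<Prod>i\<in>UNIV. m i (s i)))"

definition pay :: "'p \<Rightarrow> 'a \<Rightarrow> ('p \<Rightarrow> 'a \<Rightarrow> real) \<Rightarrow> real" where
  "pay i a m = U (m(i := ind a))"

definition d :: "'p \<Rightarrow> 'a \<Rightarrow> 'a \<Rightarrow> ('p \<Rightarrow> 'a \<Rightarrow> real) \<Rightarrow> real" where
  "d i a b m = pay i a m - pay i b m"

text \<open>Only a pseudometric: values outside \<open>Y i\<close> are ignored, so limits of states
  are determined only on the actions.\<close>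

definition dm :: "('p \<Rightarrow> 'a \<Rightarrow> real) \<Rightarrow> ('p \<Rightarrow> 'a \<Rightarrow> real) \<Rightarrow> real" where
  "dm m m' = (\<Sum>i\<in>UNIV. \<Sum>a\<in>Y i. \<bar>m' i a - m i a\<bar>)"

text \<open>The bound 2 rather than 1 leaves room for states within distance 1 of the simplex; the
  comparison states used near an equilibrium may have negative masses.\<close>

definition bnd :: "('p \<Rightarrow> 'a \<Rightarrow> real) \<Rightarrow> bool" where
  "bnd m \<longleftrightarrow> (\<forall>i. \<forall>a\<in>Y i. \<bar>m i a\<bar> \<le> 2)"

definition sx :: "('p \<Rightarrow> 'a \<Rightarrow> real) \<Rightarrow> bool" where
  "sx m \<longleftrightarrow> (\<forall>i. (\<forall>a\<in>Y i. 0 \<le> m i a) \<and> sum (m i) (Y i) = 1)"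

definition br :: "'p \<Rightarrow> ('p \<Rightarrow> 'a \<Rightarrow> real) \<Rightarrow> 'a set" where
  "br i m = {a \<in> Y i. \<forall>b\<in>Y i. pay i b m \<le> pay i a m}"

definition mx :: "'p \<Rightarrow> ('p \<Rightarrow> 'a \<Rightarrow> real) \<Rightarrow> real" where
  "mx i m = Max ((\<lambda>a. pay i a m) ` Y i)"

definition G :: "('p \<Rightarrow> 'a \<Rightarrow> real) \<Rightarrow> real" where
  "G m = (\<Sum>i\<in>UNIV. mx i m - U m)"

lemma U_upd_eq: "U (m(i := v)) = (\<Sum>s\<in>PP. u s * (v (s i) * (\<Prod>j\<in>UNIV - {i}. m j (s j))))"
  unfolding U_def by (intro sum.cong refl) (subst prod.remove[of _ i], auto)

lemma U_upd_pay: "U (m(i := v)) = (\<Sum>a\<in>Y i. v a * pay i a m)"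
proof -
  have "(\<Sum>a\<in>Y i. v a * pay i a m) =
      (\<Sum>a\<in>Y i. \<Sum>s\<in>PP. u s * (\<Prod>j\<in>UNIV - {i}. m j (s j)) * (v a * ind a (s i)))"
    unfolding pay_def U_upd_eq sum_distrib_left by (intro sum.cong refl) (simp add: algebra_simps)
  also have "\<dots> = (\<Sum>s\<in>PP. u s * (\<Prod>j\<in>UNIV - {i}. m j (s j)) * (\<Sum>a\<in>Y i. v a * ind a (s i)))"
    by (subst sum.swap) (simp add: sum_distrib_left)
  also have "\<dots> = U (m(i := v))"
    unfolding U_upd_eq
  proof (intro sum.cong refl)
    fix s assume s: "s \<in> PP"
    have "(\<Sum>a\<in>Y i. v a * ind a (s i)) = (\<Sum>a\<in>Y i. if a = s i then v a else 0)"
      by (intro sum.cong) (auto simp: ind_def)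
    also have "\<dots> = v (s i)" using s by (simp add: sum.delta)
    finally show "u s * (\<Prod>j\<in>UNIV - {i}. m j (s j)) * (\<Sum>a\<in>Y i. v a * ind a (s i)) =
        u s * (v (s i) * (\<Prod>j\<in>UNIV - {i}. m j (s j)))" by simp
  qed
  finally show ?thesis by simp
qed

lemma U_pay: "U m = (\<Sum>a\<in>Y i. m i a * pay i a m)"
  using U_upd_pay[of m i "m i"] by simp

lemma pay_upd_same [simp]: "pay i a (m(i := v)) = pay i a m"
  by (simp add: pay_def)

lemma d_upd_same [simp]: "d i a b (m(i := v)) = d i a b m"
  by (simp add: d_def)

text \<open>By linearity in player \<open>i\<close>'s component, every estimate for \<open>U\<close>
  becomes an estimate for payoff differences.\<close>

lemma d_eq: "d i a b m = U (m(i := dl a b))"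
  unfolding d_def pay_def U_upd_eq dl_def by (simp add: algebra_simps sum_subtractf)

lemma d_self [simp]: "d i a a m = 0" and d_swap: "d i b a m = - d i a b m"
  by (simp_all add: d_def)

lemma d_upd:
  assumes "j \<noteq> i"
  shows "d i a b (m(j := v)) = (\<Sum>e\<in>Y j. v e * d i a b (m(j := ind e)))"
  unfolding d_eq fun_upd_twist[OF assms] using U_upd_pay[of "m(i := dl a b)" j v] by (simp add: pay_def)

lemma dm_nonneg [simp]: "dm m m' \<ge> 0"
  unfolding dm_def by (intro sum_nonneg) auto

lemma dm_sym: "dm m m' = dm m' m"
  unfolding dm_def by (simp add: abs_minus_commute)

lemma dm_refl [simp]: "dm m m = 0"
  by (simp add: dm_def)

lemma dm_triangle: "dm m m'' \<le> dm m m' + dm m' m''"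
  unfolding dm_def sum.distrib[symmetric] by (intro sum_mono) auto

lemma dm_ge_coord: "a \<in> Y i \<Longrightarrow> \<bar>m' i a - m i a\<bar> \<le> dm m m'"
proof -
  assume a: "a \<in> Y i"
  have "\<bar>m' i a - m i a\<bar> \<le> (\<Sum>a\<in>Y i. \<bar>m' i a - m i a\<bar>)"
    using a by (intro member_le_sum) auto
  also have "\<dots> \<le> dm m m'"
    unfolding dm_def by (rule member_le_sum[where f="\<lambda>i. \<Sum>a\<in>Y i. \<bar>m' i a - m i a\<bar>"]) (auto intro: sum_nonneg)
  finally show ?thesis .
qed

lemma dm_upd_le: "dm (m(i := v)) (m'(i := v)) \<le> dm m m'"
  unfolding dm_def by (intro sum_mono) (auto intro: sum_nonneg)

lemma bnd_upd: "bnd m \<Longrightarrow> (\<And>a. a \<in> Y i \<Longrightarrow> \<bar>v a\<bar> \<le> 2) \<Longrightarrow> bnd (m(i := v))"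
  by (auto simp: bnd_def)

lemma bnd_upd_ind [intro]: "bnd m \<Longrightarrow> bnd (m(i := ind a))"
  by (rule bnd_upd) (auto simp: ind_def)

lemma bnd_upd_dl [intro]: "bnd m \<Longrightarrow> bnd (m(i := dl a b))"
  by (rule bnd_upd) (auto simp: ind_def dl_def)

lemma profile_dist_le:
  assumes "s \<in> PP"
  shows "(\<Sum>i\<in>UNIV. \<bar>m' i (s i) - m i (s i)\<bar>) \<le> dm m m'"
  unfolding dm_def
proof (intro sum_mono)
  fix i
  show "\<bar>m' i (s i) - m i (s i)\<bar> \<le> (\<Sum>a\<in>Y i. \<bar>m' i a - m i a\<bar>)"
    using assms by (intro member_le_sum[where f="\<lambda>a. \<bar>m' i a - m i a\<bar>"]) auto
qed

text \<open>The derivative of a multilinear function replaces one component at a time by its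
  increment. A single constant serves for the Lipschitz bound and for the second-order
  remainder.\<close>

lemma U_bounds_ex:
  "\<exists>K\<ge>1. \<forall>m m'. bnd m \<longrightarrow> bnd m' \<longrightarrow>
     \<bar>U m' - U m\<bar> \<le> K * dm m m' \<and>
     \<bar>U m' - U m - (\<Sum>j\<in>UNIV. U (m(j := \<lambda>a. m' j a - m j a)))\<bar> \<le> K * (dm m m')\<^sup>2"
proof -
  obtain L where L: "L \<ge> 0"
    "\<And>a b :: 'p \<Rightarrow> real. (\<forall>i. \<bar>a i\<bar> \<le> 2 \<and> \<bar>b i\<bar> \<le> 2) \<Longrightarrow>
       \<bar>prod b UNIV - prod a UNIV\<bar> \<le> L * (\<Sum>i\<in>UNIV. \<bar>b i - a i\<bar>)"
    using prod_lipschitz_on_box[of "UNIV :: 'p set" 2] by auto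
  obtain T where T: "T \<ge> 0"
    "\<And>a b :: 'p \<Rightarrow> real. (\<forall>i. \<bar>a i\<bar> \<le> 2 \<and> \<bar>b i\<bar> \<le> 2) \<Longrightarrow>
       \<bar>prod b UNIV - prod a UNIV - (\<Sum>i\<in>UNIV. (b i - a i) * prod a (UNIV - {i}))\<bar> \<le> T * (\<Sum>i\<in>UNIV. \<bar>b i - a i\<bar>)\<^sup>2"
    using prod_taylor_on_box[of "UNIV :: 'p set" 2] by auto
  define W where "W = (\<Sum>s\<in>PP. \<bar>u s\<bar>)"
  have W: "W \<ge> 0" unfolding W_def by (intro sum_nonneg) auto
  show ?thesis
  proof (intro exI[of _ "1 + W * L + W * T"] conjI allI impI)
    show "1 \<le> 1 + W * L + W * T" using L T W by simp
    fix m m' assume b: "bnd m" "bnd m'"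
    have *: "\<forall>i. \<bar>m i (s i)\<bar> \<le> 2 \<and> \<bar>m' i (s i)\<bar> \<le> 2" if "s \<in> PP" for s
      using b that by (auto simp: bnd_def)
    have "\<bar>U m' - U m\<bar> \<le> (\<Sum>s\<in>PP. \<bar>u s\<bar> * \<bar>(\<Prod>i\<in>UNIV. m' i (s i)) - (\<Prod>i\<in>UNIV. m i (s i))\<bar>)"
      unfolding U_def sum_subtractf[symmetric] right_diff_distrib[symmetric] abs_mult[symmetric]
      by (rule sum_abs)
    also have "\<dots> \<le> (\<Sum>s\<in>PP. \<bar>u s\<bar> * (L * dm m m'))"
    proof (intro sum_mono mult_left_mono)
      fix s assume s: "s \<in> PP"
      show "\<bar>(\<Prod>i\<in>UNIV. m' i (s i)) - (\<Prod>i\<in>UNIV. m i (s i))\<bar> \<le> L * dm m m'"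
        using L(2)[OF *[OF s]] mult_left_mono[OF profile_dist_le[OF s, of m' m] L(1)] by linarith
    qed simp
    also have "\<dots> = W * L * dm m m'" by (simp only: W_def sum_distrib_right[symmetric] mult.assoc)
    also have "\<dots> \<le> (1 + W * L + W * T) * dm m m'" using W T by (intro mult_right_mono) auto
    finally show "\<bar>U m' - U m\<bar> \<le> (1 + W * L + W * T) * dm m m'" .
    have "U m' - U m - (\<Sum>j\<in>UNIV. U (m(j := \<lambda>a. m' j a - m j a)))
       = (\<Sum>s\<in>PP. u s * ((\<Prod>i\<in>UNIV. m' i (s i)) - (\<Prod>i\<in>UNIV. m i (s i)) -
            (\<Sum>j\<in>UNIV. (m' j (s j) - m j (s j)) * (\<Prod>i\<in>UNIV - {j}. m i (s i)))))"
    proof -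
      have "(\<Sum>j\<in>UNIV. U (m(j := \<lambda>a. m' j a - m j a))) =
          (\<Sum>s\<in>PP. \<Sum>j\<in>UNIV. u s * ((m' j (s j) - m j (s j)) * (\<Prod>i\<in>UNIV - {j}. m i (s i))))"
        unfolding U_upd_eq by (rule sum.swap)
      then show ?thesis
        by (simp only: U_def right_diff_distrib[of "u _"] sum_subtractf sum_distrib_left)
    qed
    also have "\<bar>\<dots>\<bar> \<le> (\<Sum>s\<in>PP. \<bar>u s\<bar> * \<bar>(\<Prod>i\<in>UNIV. m' i (s i)) - (\<Prod>i\<in>UNIV. m i (s i)) -
            (\<Sum>j\<in>UNIV. (m' j (s j) - m j (s j)) * (\<Prod>i\<in>UNIV - {j}. m i (s i)))\<bar>)"
      unfolding abs_mult[symmetric] by (rule sum_abs)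
    also have "\<dots> \<le> (\<Sum>s\<in>PP. \<bar>u s\<bar> * (T * (dm m m')\<^sup>2))"
    proof (intro sum_mono mult_left_mono)
      fix s assume s: "s \<in> PP"
      have "(\<Sum>i\<in>UNIV. \<bar>m' i (s i) - m i (s i)\<bar>)\<^sup>2 \<le> (dm m m')\<^sup>2"
        using profile_dist_le[OF s] by (intro power_mono sum_nonneg) auto
      from mult_left_mono[OF this T(1)]
      show "\<bar>(\<Prod>i\<in>UNIV. m' i (s i)) - (\<Prod>i\<in>UNIV. m i (s i)) -
            (\<Sum>j\<in>UNIV. (m' j (s j) - m j (s j)) * (\<Prod>i\<in>UNIV - {j}. m i (s i)))\<bar> \<le> T * (dm m m')\<^sup>2"
        using T(2)[OF *[OF s]] by linarith
    qed simp
    also have "\<dots> = W * T * (dm m m')\<^sup>2" by (simp only: W_def sum_distrib_right[symmetric] mult.assoc)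
    also have "\<dots> \<le> (1 + W * L + W * T) * (dm m m')\<^sup>2" using W L by (intro mult_right_mono) auto
    finally show "\<bar>U m' - U m - (\<Sum>j\<in>UNIV. U (m(j := \<lambda>a. m' j a - m j a)))\<bar> \<le> (1 + W * L + W * T) * (dm m m')\<^sup>2" .
  qed
qed

definition K :: real where
  "K = (SOME K. K \<ge> 1 \<and> (\<forall>m m'. bnd m \<longrightarrow> bnd m' \<longrightarrow>
     \<bar>U m' - U m\<bar> \<le> K * dm m m' \<and>
     \<bar>U m' - U m - (\<Sum>j\<in>UNIV. U (m(j := \<lambda>a. m' j a - m j a)))\<bar> \<le> K * (dm m m')\<^sup>2))"

lemma K_ge_1: "K \<ge> 1"
  and U_lipschitz: "bnd m \<Longrightarrow> bnd m' \<Longrightarrow> \<bar>U m' - U m\<bar> \<le> K * dm m m'"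
  and U_taylor: "bnd m \<Longrightarrow> bnd m' \<Longrightarrow>
     \<bar>U m' - U m - (\<Sum>j\<in>UNIV. U (m(j := \<lambda>a. m' j a - m j a)))\<bar> \<le> K * (dm m m')\<^sup>2"
  using someI_ex[OF U_bounds_ex, folded K_def] by blast+

lemma K_pos [simp]: "K > 0" "K \<ge> 0" "K \<noteq> 0"
  using K_ge_1 by auto

lemma U_upd_lipschitz:
  assumes "bnd m" "bnd m'" "\<And>a. a \<in> Y i \<Longrightarrow> \<bar>v a\<bar> \<le> 2"
  shows "\<bar>U (m'(i := v)) - U (m(i := v))\<bar> \<le> K * dm m m'"
proof -
  have "K * dm (m(i := v)) (m'(i := v)) \<le> K * dm m m'"
    by (intro mult_left_mono dm_upd_le) simp
  then show ?thesis
    using U_lipschitz[OF bnd_upd[of m i v, OF assms(1)] bnd_upd[of m' i v, OF assms(2)]] assms(3) by (meson order_trans)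
qed

lemma pay_lipschitz: "bnd m \<Longrightarrow> bnd m' \<Longrightarrow> \<bar>pay i a m' - pay i a m\<bar> \<le> K * dm m m'"
  unfolding pay_def by (rule U_upd_lipschitz) (auto simp: ind_def)

lemma d_lipschitz: "bnd m \<Longrightarrow> bnd m' \<Longrightarrow> \<bar>d i a b m' - d i a b m\<bar> \<le> K * dm m m'"
  unfolding d_eq by (rule U_upd_lipschitz) (auto simp: ind_def dl_def)

text \<open>The direction \<open>w\<close> enters linearly, so moving the base point costs a factor
  proportional to the size of \<open>w\<close>. This allows the derivative at \<open>m\<close> to be
  replaced by the derivative at a fixed equilibrium.\<close>

lemma d_upd_lipschitz:
  assumes "bnd m" "bnd m'" "j \<noteq> i"
  shows "\<bar>d i a b (m'(j := w)) - d i a b (m(j := w))\<bar> \<le> K * dm m m' * (\<Sum>e\<in>Y j. \<bar>w e\<bar>)"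
proof -
  define D where "D e = d i a b (m'(j := ind e)) - d i a b (m(j := ind e))" for e
  have D: "\<bar>D e\<bar> \<le> K * dm m m'" for e
  proof -
    have "K * dm (m(j := ind e)) (m'(j := ind e)) \<le> K * dm m m'"
      by (rule mult_left_mono[OF dm_upd_le]) simp
    then show ?thesis
      using d_lipschitz[OF bnd_upd_ind[OF assms(1)] bnd_upd_ind[OF assms(2)], of i a b j e j e]
      unfolding D_def by (rule order_trans[rotated])
  qed
  have eq: "d i a b (m'(j := w)) - d i a b (m(j := w)) = (\<Sum>e\<in>Y j. w e * D e)"
    by (simp only: D_def d_upd[OF assms(3), where v=w] right_diff_distrib sum_subtractf)
  have "\<bar>\<Sum>e\<in>Y j. w e * D e\<bar> \<le> (\<Sum>e\<in>Y j. \<bar>w e\<bar> * \<bar>D e\<bar>)"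
    unfolding abs_mult[symmetric] by (rule sum_abs)
  also have "\<dots> \<le> (\<Sum>e\<in>Y j. \<bar>w e\<bar> * (K * dm m m'))"
    using D by (intro sum_mono mult_left_mono) auto
  also have "\<dots> = K * dm m m' * (\<Sum>e\<in>Y j. \<bar>w e\<bar>)"
    by (simp only: sum_distrib_right[symmetric] mult.commute[of "K * dm m m'"])
  finally show ?thesis unfolding eq .
qed

lemma d_taylor:
  assumes "bnd m" "bnd m'"
  shows "\<bar>d i a b m' - d i a b m - (\<Sum>j\<in>UNIV - {i}. d i a b (m(j := \<lambda>e. m' j e - m j e)))\<bar> \<le> K * (dm m m')\<^sup>2"
proof -
  let ?n = "m(i := dl a b)" and ?n' = "m'(i := dl a b)"
  have "(\<Sum>j\<in>UNIV. U (?n(j := \<lambda>e. ?n' j e - ?n j e))) =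
      U (?n(i := \<lambda>e. ?n' i e - ?n i e)) + (\<Sum>j\<in>UNIV - {i}. U (?n(j := \<lambda>e. ?n' j e - ?n j e)))"
    by (rule sum.remove) auto
  \<comment> \<open>Both states carry \<open>dl a b\<close> at \<open>i\<close>, so this increment
    is zero: a payoff difference does not see the player's own masses.\<close>
  also have "U (?n(i := \<lambda>e. ?n' i e - ?n i e)) = 0"
    by (simp add: U_upd_pay)
  also have "(\<Sum>j\<in>UNIV - {i}. U (?n(j := \<lambda>e. ?n' j e - ?n j e))) =
      (\<Sum>j\<in>UNIV - {i}. d i a b (m(j := \<lambda>e. m' j e - m j e)))"
  proof (intro sum.cong refl)
    fix j assume "j \<in> UNIV - {i}"
    then have "j \<noteq> i" by simp
    then show "U (?n(j := \<lambda>e. ?n' j e - ?n j e)) = d i a b (m(j := \<lambda>e. m' j e - m j e))"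
      by (simp add: d_eq fun_upd_twist[of j i])
  qed
  finally have "\<bar>d i a b m' - d i a b m - (\<Sum>j\<in>UNIV - {i}. d i a b (m(j := \<lambda>e. m' j e - m j e)))\<bar>
      \<le> K * (dm ?n ?n')\<^sup>2"
    using U_taylor[OF bnd_upd_dl[OF assms(1)] bnd_upd_dl[OF assms(2)], of i a b i a b]
    unfolding d_eq[of i a b m] d_eq[of i a b m'] by linarith
  also have "\<dots> \<le> K * (dm m m')\<^sup>2"
    by (intro mult_left_mono power_mono dm_upd_le) auto
  finally show ?thesis .
qed

lemma sx_le_1: "sx m \<Longrightarrow> a \<in> Y i \<Longrightarrow> m i a \<le> 1"
  using member_le_sum[of a "Y i" "m i"] by (auto simp: sx_def)

lemma sx_nonneg: "sx m \<Longrightarrow> a \<in> Y i \<Longrightarrow> m i a \<ge> 0"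
  by (auto simp: sx_def)

lemma sx_sum: "sx m \<Longrightarrow> sum (m i) (Y i) = 1"
  by (auto simp: sx_def)

lemma sx_bnd [intro]: "sx m \<Longrightarrow> bnd m"
  unfolding bnd_def using sx_le_1[of m] sx_nonneg[of m] by fastforce

lemma mx_ge: "a \<in> Y i \<Longrightarrow> pay i a m \<le> mx i m"
  unfolding mx_def by (intro Max_ge) auto

lemma mx_attained: "\<exists>a\<in>Y i. pay i a m = mx i m"
proof -
  have "mx i m \<in> (\<lambda>a. pay i a m) ` Y i" unfolding mx_def by (intro Max_in) auto
  then show ?thesis by auto
qed

lemma br_iff: "a \<in> br i m \<longleftrightarrow> a \<in> Y i \<and> pay i a m = mx i m"
proof -
  obtain b where b: "b \<in> Y i" "pay i b m = mx i m" using mx_attained by blast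
  then show ?thesis
    unfolding br_def using mx_ge[of _ i m] by fastforce
qed

lemma br_subset: "br i m \<subseteq> Y i"
  by (auto simp: br_def)

lemma br_ne: "br i m \<noteq> {}"
  using mx_attained[of i m] by (auto simp: br_iff)

lemma br_upd_same [simp]: "br i (m(i := v)) = br i m"
  by (simp add: br_def)

lemma mx_lipschitz:
  assumes "bnd m" "bnd m'"
  shows "\<bar>mx i m' - mx i m\<bar> \<le> K * dm m m'"
proof -
  obtain a where a: "a \<in> Y i" "pay i a m = mx i m" using mx_attained by blast
  obtain b where b: "b \<in> Y i" "pay i b m' = mx i m'" using mx_attained by blast
  show ?thesis
    using pay_lipschitz[OF assms, of i a] pay_lipschitz[OF assms, of i b] mx_ge[OF a(1), of m'] mx_ge[OF b(1), of m] a b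
    by linarith
qed

lemma G_eq: "sx m \<Longrightarrow> G m = (\<Sum>i\<in>UNIV. \<Sum>a\<in>Y i. m i a * (mx i m - pay i a m))"
  unfolding G_def
proof (intro sum.cong refl)
  fix i assume "sx m"
  then show "mx i m - U m = (\<Sum>a\<in>Y i. m i a * (mx i m - pay i a m))"
    unfolding U_pay[of m i] by (simp add: right_diff_distrib sum_subtractf sum_distrib_right[symmetric] sx_sum)
qed

lemma G_lipschitz:
  assumes "bnd m" "bnd m'"
  shows "\<bar>G m' - G m\<bar> \<le> 2 * CARD('p) * K * dm m m'"
proof -
  have "\<bar>G m' - G m\<bar> \<le> (\<Sum>i\<in>(UNIV::'p set). \<bar>(mx i m' - U m') - (mx i m - U m)\<bar>)"
    unfolding G_def sum_subtractf[symmetric] by (rule sum_abs)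
  also have "\<dots> \<le> (\<Sum>i\<in>(UNIV::'p set). 2 * (K * dm m m'))"
  proof (intro sum_mono)
    fix i
    show "\<bar>(mx i m' - U m') - (mx i m - U m)\<bar> \<le> 2 * (K * dm m m')"
      using mx_lipschitz[OF assms, of i] U_lipschitz[OF assms] by linarith
  qed
  finally show ?thesis by simp
qed

lemma G_nonneg: "sx m \<Longrightarrow> G m \<ge> 0"
  by (auto simp: G_eq sx_nonneg mx_ge intro!: sum_nonneg mult_nonneg_nonneg)

text \<open>\<open>G\<close> is a sum of nonnegative terms, mass times payoff loss. Its vanishing is
  complementary slackness, that is, the equilibrium condition.\<close>

lemma G_eq_0_iff:
  assumes "sx m"
  shows "G m = 0 \<longleftrightarrow> (\<forall>i. \<forall>a\<in>Y i. m i a \<noteq> 0 \<longrightarrow> a \<in> br i m)"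
proof -
  have nn: "m i a * (mx i m - pay i a m) \<ge> 0" if "a \<in> Y i" for i a
    using that assms by (simp add: sx_nonneg mx_ge)
  have "G m = 0 \<longleftrightarrow> (\<forall>i. (\<Sum>a\<in>Y i. m i a * (mx i m - pay i a m)) = 0)"
    unfolding G_eq[OF assms] by (subst sum_nonneg_eq_0_iff) (auto intro!: sum_nonneg nn)
  also have "\<dots> \<longleftrightarrow> (\<forall>i. \<forall>a\<in>Y i. m i a * (mx i m - pay i a m) = 0)"
    by (subst sum_nonneg_eq_0_iff) (auto intro!: nn)
  finally show ?thesis by (metis br_iff eq_iff_diff_eq_0 mult_eq_0_iff)
qed

end

section \<open>Weak solutions and convergence\<close>

text \<open>The estimates along trajectories come as quadratic bounds between two times, so
  differentiability is deduced from them instead of from differentiability of the trajectory. Both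
  signs of \<open>t - s\<close> are required.\<close>

lemma has_derivative_from_local_quadratic_bound:
  fixes f g :: "real \<Rightarrow> real"
  assumes b: "\<And>s t. a \<le> s \<Longrightarrow> a \<le> t \<Longrightarrow> \<bar>t - s\<bar> \<le> 1 \<Longrightarrow> \<bar>f t - f s - (t - s) * g s\<bar> \<le> C * (t - s)\<^sup>2"
    and "a < t"
  shows "(f has_real_derivative g t) (at t)"
proof -
  have "((\<lambda>r. (f r - f t) / (r - t) - g t) \<longlongrightarrow> 0) (at t)"
  proof (rule Lim_null_comparison)
    have "eventually (\<lambda>r. r > a) (at t)"
      using \<open>a < t\<close> order_tendstoD(1)[OF tendsto_ident_at[of t UNIV]] by auto
    moreover have "eventually (\<lambda>r. r \<noteq> t) (at t)" by (simp add: eventually_at_filter)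
    moreover have "eventually (\<lambda>r. \<bar>r - t\<bar> \<le> 1) (at t)"
      unfolding eventually_at by (intro exI[of _ 1]) (auto simp: dist_real_def)
    ultimately show "eventually (\<lambda>r. norm ((f r - f t) / (r - t) - g t) \<le> C * \<bar>r - t\<bar>) (at t)"
    proof eventually_elim
      case (elim r)
      have "(f r - f t) / (r - t) - g t = (f r - f t - (r - t) * g t) / (r - t)"
        using elim by (simp add: field_simps)
      moreover have "\<bar>f r - f t - (r - t) * g t\<bar> / \<bar>r - t\<bar> \<le> C * (r - t)\<^sup>2 / \<bar>r - t\<bar>"
        using b[of t r] elim \<open>a < t\<close> by (intro divide_right_mono) auto
      moreover have "C * (r - t)\<^sup>2 / \<bar>r - t\<bar> = C * \<bar>r - t\<bar>"
      proof -
        have "(r - t)\<^sup>2 = \<bar>r - t\<bar> * \<bar>r - t\<bar>" by (simp add: power2_eq_square)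
        then show ?thesis
          using elim by (metis mult.assoc nonzero_mult_div_cancel_right abs_eq_0 eq_iff_diff_eq_0)
      qed
      ultimately show ?case by (simp add: abs_divide)
    qed
    have "((\<lambda>r. C * \<bar>r - t\<bar>) \<longlongrightarrow> C * \<bar>t - t\<bar>) (at t)" by (intro tendsto_intros)
    then show "((\<lambda>r. C * \<bar>r - t\<bar>) \<longlongrightarrow> 0) (at t)" by simp
  qed
  then show ?thesis unfolding has_field_derivative_iff by (simp add: LIM_zero_iff)
qed

lemma one_minus_exp_bounds:
  fixes h :: real
  assumes "h \<ge> 0"
  shows "1 - exp (- h) \<le> h" "h - (1 - exp (- h)) \<le> h\<^sup>2" "0 \<le> 1 - exp (- h)"
proof -
  show *: "1 - exp (- h) \<le> h" using exp_ge_add_one_self[of "- h"] by simp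
  show "0 \<le> 1 - exp (- h)" using assms by simp
  have "(1 + h) * exp (- h) \<le> 1"
    using exp_ge_add_one_self[of h] by (simp add: exp_minus field_simps)
  then have "exp (- h) \<le> 1 - h * exp (- h)" by (simp add: algebra_simps)
  moreover have "h * (1 - exp (- h)) \<le> h * h" using * assms by (intro mult_left_mono)
  ultimately show "h - (1 - exp (- h)) \<le> h\<^sup>2" by (simp add: power2_eq_square algebra_simps)
qed

text \<open>Tychonoff's theorem for the pointwise topology on functions.\<close>

lemma compact_pi:
  fixes S :: "'i \<Rightarrow> 'b::topological_space set"
  assumes "\<And>i. compact (S i)"
  shows "compact {f. \<forall>i. f i \<in> S i}"
proof -
  have "compactin (product_topology (\<lambda>i. euclidean) UNIV) (PiE UNIV S)"
    unfolding compactin_PiE using assms by simp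
  moreover have "PiE UNIV S = {f. \<forall>i. f i \<in> S i}" by auto
  ultimately show ?thesis by (simp add: euclidean_product_topology)
qed

lemma tendsto_fun_iff:
  "(f \<longlongrightarrow> (l :: 'i \<Rightarrow> 'b::topological_space)) F \<longleftrightarrow> (\<forall>i. ((\<lambda>x. f x i) \<longlongrightarrow> l i) F)"
proof -
  have "(f \<longlongrightarrow> l) F \<longleftrightarrow> limitin (product_topology (\<lambda>i. euclidean) UNIV) f l F"
    by (simp add: euclidean_product_topology)
  also have "\<dots> \<longleftrightarrow> (\<forall>i. ((\<lambda>x. f x i) \<longlongrightarrow> l i) F)"
    unfolding limitin_componentwise by simp
  finally show ?thesis .
qed

text \<open>Cluster points are phrased as limits along a finer filter, which avoids extracting subsequences.\<close>

lemma compact_cluster_filter: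
  assumes "compact S" "F \<noteq> bot" "\<And>x. f x \<in> S"
  obtains l F' where "l \<in> S" "F' \<le> F" "F' \<noteq> bot" "(f \<longlongrightarrow> l) F'"
proof -
  have "filtermap f F \<noteq> bot" using assms(2) by (simp add: filtermap_bot_iff)
  moreover have "eventually (\<lambda>x. x \<in> S) (filtermap f F)" using assms(3) by (simp add: eventually_filtermap)
  ultimately obtain l where l: "l \<in> S" "inf (nhds l) (filtermap f F) \<noteq> bot"
    using assms(1) unfolding compact_filter by blast
  define F' where "F' = inf F (filtercomap f (nhds l))"
  have "F' \<noteq> bot"
  proof
    assume "F' = bot"
    then have "eventually (\<lambda>x. False) (inf F (filtercomap f (nhds l)))" unfolding F'_def by simp
    then obtain P Q where PQ: "eventually P F" "eventually Q (filtercomap f (nhds l))" "\<And>x. P x \<Longrightarrow> Q x \<Longrightarrow> False"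
      unfolding eventually_inf by blast
    from PQ(2) obtain R where R: "eventually R (nhds l)" "\<And>x. R (f x) \<Longrightarrow> Q x"
      unfolding eventually_filtercomap by blast
    have "eventually (\<lambda>z. \<not> R z) (filtermap f F)"
      unfolding eventually_filtermap using PQ(1) by eventually_elim (use PQ(3) R(2) in blast)
    then have "eventually (\<lambda>z. False) (inf (nhds l) (filtermap f F))"
      unfolding eventually_inf using R(1) by blast
    then show False using l(2) by (simp add: trivial_limit_def)
  qed
  moreover have "(f \<longlongrightarrow> l) F'"
    unfolding filterlim_iff_le_filtercomap F'_def by simp
  ultimately show thesis using l(1) that[of l F'] by (simp add: F'_def)
qed

section \<open>Weak solutions: regularity and averaged targets\<close>

context finite_game
begin

text \<open>For a solution, \<open>exp t * m t i a\<close> has derivative \<open>exp t\<close> times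
  the mass that the current target puts on \<open>a\<close>. The last two clauses keep only that
  this is nonnegative and that it vanishes while \<open>a\<close> is not optimal.\<close>

definition wsol :: "(real \<Rightarrow> 'p \<Rightarrow> 'a \<Rightarrow> real) \<Rightarrow> bool" where
  "wsol m \<longleftrightarrow> (\<forall>t\<ge>0. sx (m t)) \<and>
     (\<forall>i. \<forall>a\<in>Y i. \<forall>s t. 0 \<le> s \<longrightarrow> s \<le> t \<longrightarrow> exp s * m s i a \<le> exp t * m t i a) \<and>
     (\<forall>i. \<forall>a\<in>Y i. \<forall>s t. 0 \<le> s \<longrightarrow> s \<le> t \<longrightarrow> (\<forall>r\<in>{s..t}. a \<notin> br i (m r)) \<longrightarrow> exp t * m t i a = exp s * m s i a)"

definition NY :: real where "NY = (\<Sum>i\<in>(UNIV::'p set). card (Y i))"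

lemma NY_ge: "NY \<ge> CARD('p)" and NY_ge_1: "NY \<ge> 1" and NY_pos [simp]: "NY > 0" "NY \<ge> 0"
proof -
  have "(\<Sum>i\<in>(UNIV::'p set). 1) \<le> (\<Sum>i\<in>(UNIV::'p set). real (card (Y i)))"
    by (intro sum_mono) (simp add: Suc_le_eq card_gt_0_iff)
  then show *: "NY \<ge> CARD('p)" unfolding NY_def by simp
  have "CARD('p) \<ge> 1" by (simp add: Suc_le_eq card_gt_0_iff)
  with * show "NY \<ge> 1" "NY > 0" "NY \<ge> 0" by linarith+
qed

lemma dm_le_NY:
  assumes "\<And>i a. a \<in> Y i \<Longrightarrow> \<bar>m' i a - m i a\<bar> \<le> c"
  shows "dm m m' \<le> NY * c"
proof -
  have "dm m m' \<le> (\<Sum>i\<in>(UNIV::'p set). \<Sum>a\<in>Y i. c)"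
    unfolding dm_def using assms by (intro sum_mono) auto
  also have "\<dots> = NY * c" by (simp add: NY_def sum_distrib_right)
  finally show ?thesis .
qed

lemma dm_tendsto_0I:
  assumes "\<And>i a. a \<in> Y i \<Longrightarrow> ((\<lambda>x. f x i a) \<longlongrightarrow> z i a) F"
  shows "((\<lambda>x. dm z (f x)) \<longlongrightarrow> 0) F"
proof -
  have "((\<lambda>x. dm z (f x)) \<longlongrightarrow> (\<Sum>i\<in>UNIV. \<Sum>a\<in>Y i. \<bar>z i a - z i a\<bar>)) F"
    unfolding dm_def using assms by (intro tendsto_intros) auto
  then show ?thesis by simp
qed

lemma dm_tendsto_0D:
  assumes "((\<lambda>x. dm z (f x)) \<longlongrightarrow> 0) F" "a \<in> Y i"
  shows "((\<lambda>x. f x i a) \<longlongrightarrow> z i a) F"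
proof -
  have "((\<lambda>x. f x i a - z i a) \<longlongrightarrow> 0) F"
    using assms(1) by (rule Lim_null_comparison[rotated]) (auto intro!: always_eventually dm_ge_coord assms(2))
  then show ?thesis by (simp add: LIM_zero_iff)
qed

lemma wsol_sx: "wsol m \<Longrightarrow> t \<ge> 0 \<Longrightarrow> sx (m t)"
  and wsol_mono: "wsol m \<Longrightarrow> a \<in> Y i \<Longrightarrow> 0 \<le> s \<Longrightarrow> s \<le> t \<Longrightarrow> exp s * m s i a \<le> exp t * m t i a"
  and wsol_const: "wsol m \<Longrightarrow> a \<in> Y i \<Longrightarrow> 0 \<le> s \<Longrightarrow> s \<le> t \<Longrightarrow> (\<And>r. s \<le> r \<Longrightarrow> r \<le> t \<Longrightarrow> a \<notin> br i (m r)) \<Longrightarrow>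
        exp t * m t i a = exp s * m s i a"
  unfolding wsol_def atLeastAtMost_iff Ball_def by blast+

text \<open>With \<open>q = exp (s - t)\<close>, every mass at time \<open>t\<close> is at least
  \<open>q\<close> times the mass at time \<open>s\<close>, and the excesses of one player sum to
  \<open>1 - q\<close>. Hence no coordinate gains or loses more than \<open>1 - q\<close>, which is
  at most \<open>t - s\<close>.\<close>

lemma wsol_coord_lipschitz:
  assumes m: "wsol m" and "0 \<le> s" "s \<le> t" "a \<in> Y i"
  shows "\<bar>m t i a - m s i a\<bar> \<le> t - s"
proof -
  have t0: "0 \<le> t" using assms by simp
  define q where "q = exp (- (t - s))"
  have q: "exp s = q * exp t" "1 - q \<le> t - s" "q \<le> 1" "q > 0"
    using one_minus_exp_bounds[of "t - s"] assms by (auto simp: q_def exp_add[symmetric])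
  have low: "q * m s i b \<le> m t i b" if "b \<in> Y i" for b
    using wsol_mono[OF m that assms(2,3)] unfolding q(1) by (simp add: algebra_simps)
  have "(\<Sum>b\<in>Y i. m t i b - q * m s i b) = 1 - q"
    using wsol_sx[OF m assms(2)] wsol_sx[OF m t0]
    by (simp add: sum_subtractf sum_distrib_left[symmetric] sx_sum)
  moreover have "m t i a - q * m s i a \<le> (\<Sum>b\<in>Y i. m t i b - q * m s i b)"
    using assms(4) low by (intro member_le_sum[where f="\<lambda>b. m t i b - q * m s i b"]) auto
  ultimately have up: "m t i a - q * m s i a \<le> 1 - q" by simp
  have ms: "0 \<le> m s i a" "m s i a \<le> 1"
    using wsol_sx[OF m assms(2)] assms(4) by (auto simp: sx_nonneg sx_le_1)
  have "(1 - q) * m s i a \<le> (1 - q) * 1" "0 \<le> (1 - q) * m s i a"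
    using q ms by (intro mult_left_mono mult_nonneg_nonneg; simp)+
  then show ?thesis using up low[OF assms(4)] q by (simp add: algebra_simps abs_le_iff)
qed

lemma wsol_lipschitz:
  assumes "wsol m" "0 \<le> s" "0 \<le> t"
  shows "dm (m s) (m t) \<le> NY * \<bar>t - s\<bar>"
proof (cases "s \<le> t")
  case True
  then show ?thesis using wsol_coord_lipschitz[OF assms(1,2) True] by (intro dm_le_NY) auto
next
  case False
  then show ?thesis using wsol_coord_lipschitz[OF assms(1,3), of s] by (intro dm_le_NY) (auto simp: abs_minus_commute)
qed

lemma wsol_coord_continuous:
  assumes "wsol m" "a \<in> Y i"
  shows "continuous_on {0..} (\<lambda>t. m t i a)"
proof -
  have "1-lipschitz_on {0..} (\<lambda>t. m t i a)"
  proof (rule lipschitz_onI)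
    fix s t :: real assume st: "s \<in> {0..}" "t \<in> {0..}"
    show "dist (m s i a) (m t i a) \<le> 1 * dist s t"
      using wsol_coord_lipschitz[OF assms(1) _ _ assms(2), of s t]
        wsol_coord_lipschitz[OF assms(1) _ _ assms(2), of t s] st
      by (cases "s \<le> t") (auto simp: dist_real_def)
  qed simp
  then show ?thesis by (rule lipschitz_on_continuous_on)
qed

text \<open>At the endpoints more actions may be tied than in between, so optimality is excluded
  only in the open interval and the equality is extended by continuity.\<close>

lemma wsol_const_open:
  assumes m: "wsol m" and a: "a \<in> Y i" and "0 \<le> s" "s < t" "\<And>r. s < r \<Longrightarrow> r < t \<Longrightarrow> a \<notin> br i (m r)"
  shows "exp t * m t i a = exp s * m s i a"
proof -
  define c where "c = (s + t) / 2"
  have c: "s < c" "c < t" using assms(4) by (auto simp: c_def)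
  have cont: "continuous_on (closure {s<..<t}) (\<lambda>r. exp r * m r i a)"
    using assms(3,4) by (intro continuous_intros continuous_on_subset[OF wsol_coord_continuous[OF m a]]) auto
  have eq: "exp r * m r i a = exp c * m c i a" if "r \<in> {s<..<t}" for r
  proof (cases "r \<le> c")
    case True
    then show ?thesis using wsol_const[OF m a, of r c] that c assms(3,5) by simp
  next
    case False
    then show ?thesis using wsol_const[OF m a, of c r] that c assms(3,5) by simp
  qed
  have "exp r * m r i a = exp c * m c i a" if "r \<in> {s..t}" for r
    using continuous_constant_on_closure[OF cont, of "exp c * m c i a" r] eq that assms(4) by auto
  from this[of s] this[of t] show ?thesis using assms(4) by simp
qed

text \<open>The substitute for a velocity: the normalised excess mass gained between
  \<open>s\<close> and \<open>t\<close> is a mixed profile \<open>b\<close>, and it charges only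
  actions that were best responses at some time strictly in between.\<close>

lemma wsol_average:
  assumes m: "wsol m" and st: "0 \<le> s" "s < t"
    and A: "\<And>i r. s < r \<Longrightarrow> r < t \<Longrightarrow> br i (m r) \<subseteq> A i"
  obtains b where "sx b" "\<And>i a. a \<in> Y i \<Longrightarrow> a \<notin> A i \<Longrightarrow> b i a = 0"
    "\<And>i a. a \<in> Y i \<Longrightarrow> m t i a = exp (s - t) * m s i a + (1 - exp (s - t)) * b i a"
proof -
  define q where "q = exp (s - t)"
  have q: "q < 1" "exp s = q * exp t" using st by (auto simp: q_def exp_add[symmetric])
  define b where "b = (\<lambda>i a. (m t i a - q * m s i a) / (1 - q))"
  have nn: "m t i a - q * m s i a \<ge> 0" if "a \<in> Y i" for i a
    using wsol_mono[OF m that, of s t] st unfolding q(2) by (simp add: algebra_simps)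
  have "(\<Sum>a\<in>Y i. b i a) = 1" for i
    using wsol_sx[OF m] st q(1)
    by (simp add: b_def sum_divide_distrib[symmetric] sum_subtractf sum_distrib_left[symmetric] sx_sum)
  then have "sx b" using nn q(1) by (auto simp: sx_def b_def)
  moreover have "b i a = 0" if "a \<in> Y i" "a \<notin> A i" for i a
    using wsol_const_open[OF m that(1) st] A that(2) unfolding q(2) b_def by (auto simp: algebra_simps)
  moreover have "m t i a = exp (s - t) * m s i a + (1 - exp (s - t)) * b i a" for i a
    unfolding q_def[symmetric] b_def using q(1) by simp
  ultimately show thesis using that by blast
qed

section \<open>The potential as a Lyapunov function\<close>

lemma sx_diff:
  assumes "sx m" "sx m'" "a \<in> Y i"
  shows "\<bar>m' i a - m i a\<bar> \<le> 1"
  using sx_nonneg[OF assms(1,3)] sx_nonneg[OF assms(2,3)] sx_le_1[OF assms(1,3)] sx_le_1[OF assms(2,3)] by linarith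

lemma sx_upd:
  assumes "sx m" "\<And>a. a \<in> Y i \<Longrightarrow> 0 \<le> v a" "sum v (Y i) = 1"
  shows "sx (m(i := v))"
  using assms by (auto simp: sx_def)

lemma sx_upd_ind [intro]:
  assumes "sx m" "a \<in> Y i"
  shows "sx (m(i := ind a))"
  using assms by (intro sx_upd) (auto simp: ind_def)

lemma dm_sx_le: "sx m \<Longrightarrow> sx m' \<Longrightarrow> dm m m' \<le> NY"
  using dm_le_NY[of m' m 1] sx_diff[of m m'] by auto

lemma U_bounded: "sx m \<Longrightarrow> sx m' \<Longrightarrow> \<bar>U m' - U m\<bar> \<le> K * NY"
proof -
  assume m: "sx m" "sx m'"
  have "\<bar>U m' - U m\<bar> \<le> K * dm m m'" using m by (intro U_lipschitz sx_bnd)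
  also have "\<dots> \<le> K * NY" using m by (intro mult_left_mono dm_sx_le) auto
  finally show ?thesis .
qed

lemma U_gap_bound: "sx m \<Longrightarrow> a \<in> Y i \<Longrightarrow> \<bar>pay i a m - U m\<bar> \<le> K * NY"
  unfolding pay_def by (intro U_bounded sx_upd_ind)

lemma G_bounded: "sx m \<Longrightarrow> \<bar>G m\<bar> \<le> CARD('p) * (K * NY)"
proof -
  assume m: "sx m"
  have "\<bar>G m\<bar> \<le> (\<Sum>i\<in>(UNIV::'p set). \<bar>mx i m - U m\<bar>)" unfolding G_def by (rule sum_abs)
  also have "\<dots> \<le> (\<Sum>i\<in>(UNIV::'p set). K * NY)"
    using U_gap_bound[OF m] mx_attained[of _ m] by (intro sum_mono) metis
  finally show ?thesis by simp
qed

text \<open>The three summands bound the Taylor remainder, the suboptimality of the averaged target,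
  and the replacement of \<open>1 - exp (- h)\<close> by \<open>h\<close>.\<close>

definition CU :: real where "CU = K * NY\<^sup>2 + 2 * CARD('p) * K * NY + CARD('p) * (K * NY)"

lemma CU_nonneg: "CU \<ge> 0"
  by (auto simp: CU_def intro!: add_nonneg_nonneg mult_nonneg_nonneg)

text \<open>Every action that is optimal at some time in the interval is nearly optimal at time
  \<open>s\<close>. The averaged target therefore gains almost \<open>mx j (m s) - U (m s)\<close>
  for each player \<open>j\<close>, and the first-order change of \<open>U\<close> is close to
  \<open>(t - s) * G (m s)\<close>.\<close>

lemma wsol_U_forward:
  assumes m: "wsol m" and st: "0 \<le> s" "s < t"
  shows "\<bar>U (m t) - U (m s) - (t - s) * G (m s)\<bar> \<le> CU * (t - s)\<^sup>2"
proof -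
  define h where "h = t - s"
  define th where "th = 1 - exp (- h)"
  have h: "h > 0" using st by (simp add: h_def)
  have th: "0 \<le> th" "th \<le> h" "h - th \<le> h\<^sup>2"
    using one_minus_exp_bounds[of h] h by (auto simp: th_def)
  have sx: "sx (m s)" "sx (m t)" using wsol_sx[OF m] st by auto
  \<comment> \<open>Up to time \<open>t\<close> each payoff, and also the maximal payoff, moves by
    at most \<open>K * (NY * h)\<close>; the tolerance is the sum of the two.\<close>
  define A where "A i = {a \<in> Y i. mx i (m s) - pay i a (m s) \<le> 2 * (K * (NY * h))}" for i
  have A: "br i (m r) \<subseteq> A i" if r: "s < r" "r < t" for i r
  proof
    fix a assume a: "a \<in> br i (m r)"
    have "NY * \<bar>r - s\<bar> \<le> NY * h" using r by (intro mult_left_mono) (auto simp: h_def)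
    then have "dm (m s) (m r) \<le> NY * h" using wsol_lipschitz[OF m, of s r] r st by linarith
    then have "K * dm (m s) (m r) \<le> K * (NY * h)" by (intro mult_left_mono) auto
    moreover have "sx (m r)" using wsol_sx[OF m] r st by simp
    ultimately have "\<bar>pay i a (m r) - pay i a (m s)\<bar> \<le> K * (NY * h)" "\<bar>mx i (m r) - mx i (m s)\<bar> \<le> K * (NY * h)"
      using pay_lipschitz[OF sx_bnd[OF sx(1)] sx_bnd, of "m r" i a] mx_lipschitz[OF sx_bnd[OF sx(1)] sx_bnd, of "m r" i]
      by linarith+
    then show "a \<in> A i" using a by (auto simp: A_def br_iff)
  qed
  obtain b where b: "sx b" "\<And>i a. a \<in> Y i \<Longrightarrow> a \<notin> A i \<Longrightarrow> b i a = 0"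
    "\<And>i a. a \<in> Y i \<Longrightarrow> m t i a = exp (s - t) * m s i a + (1 - exp (s - t)) * b i a"
    using wsol_average[OF m st A] by blast
  have th': "exp (s - t) = 1 - th" by (simp add: th_def h_def)
  define E where "E j = U ((m s)(j := b j)) - U (m s)" for j
  have step: "U ((m s)(j := \<lambda>a. m t j a - m s j a)) = th * E j" for j
  proof -
    have "U ((m s)(j := \<lambda>a. m t j a - m s j a)) = (\<Sum>a\<in>Y j. th * (b j a * pay j a (m s)) - th * (m s j a * pay j a (m s)))"
      unfolding U_upd_pay by (intro sum.cong refl) (simp add: b(3) th' algebra_simps)
    also have "\<dots> = th * E j"
      unfolding E_def U_upd_pay U_pay[of "m s" j] by (simp add: sum_subtractf sum_distrib_left right_diff_distrib)
    finally show ?thesis .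
  qed
  have E: "\<bar>E j - (mx j (m s) - U (m s))\<bar> \<le> 2 * (K * (NY * h))" for j
  proof -
    have "mx j (m s) - U ((m s)(j := b j)) = (\<Sum>a\<in>Y j. b j a * (mx j (m s) - pay j a (m s)))"
      unfolding U_upd_pay using b(1) by (simp add: right_diff_distrib sum_subtractf sum_distrib_right[symmetric] sx_sum)
    moreover have "0 \<le> \<dots>" using b(1) by (intro sum_nonneg mult_nonneg_nonneg) (auto simp: sx_nonneg mx_ge)
    moreover have "(\<Sum>a\<in>Y j. b j a * (mx j (m s) - pay j a (m s))) \<le> (\<Sum>a\<in>Y j. b j a * (2 * (K * (NY * h))))"
    proof (intro sum_mono)
      fix a assume a: "a \<in> Y j"
      show "b j a * (mx j (m s) - pay j a (m s)) \<le> b j a * (2 * (K * (NY * h)))"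
        by (cases "a \<in> A j") (use a b(1,2) in \<open>auto simp: A_def sx_nonneg intro!: mult_left_mono\<close>)
    qed
    moreover have "(\<Sum>a\<in>Y j. b j a * (2 * (K * (NY * h)))) = 2 * (K * (NY * h))"
      using b(1) by (simp add: sum_distrib_right[symmetric] sx_sum)
    ultimately show ?thesis unfolding E_def by linarith
  qed
  have SE: "\<bar>(\<Sum>j\<in>UNIV. E j) - G (m s)\<bar> \<le> CARD('p) * (2 * (K * (NY * h)))"
  proof -
    have "\<bar>(\<Sum>j\<in>UNIV. E j) - G (m s)\<bar> \<le> (\<Sum>j\<in>(UNIV::'p set). \<bar>E j - (mx j (m s) - U (m s))\<bar>)"
      unfolding G_def sum_subtractf[symmetric] by (rule sum_abs)
    also have "\<dots> \<le> (\<Sum>j\<in>(UNIV::'p set). 2 * (K * (NY * h)))" using E by (intro sum_mono)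
    finally show ?thesis by simp
  qed
  have 1: "\<bar>U (m t) - U (m s) - th * (\<Sum>j\<in>UNIV. E j)\<bar> \<le> K * NY\<^sup>2 * h\<^sup>2"
  proof -
    have "\<bar>U (m t) - U (m s) - th * (\<Sum>j\<in>UNIV. E j)\<bar> \<le> K * (dm (m s) (m t))\<^sup>2"
      using U_taylor[of "m s" "m t"] sx by (simp add: step sum_distrib_left[symmetric] sx_bnd)
    also have "\<dots> \<le> K * (NY * h)\<^sup>2"
      using wsol_lipschitz[OF m, of s t] st by (intro mult_left_mono power_mono) (auto simp: h_def)
    finally show ?thesis by (simp add: power_mult_distrib)
  qed
  have 2: "\<bar>th * (\<Sum>j\<in>UNIV. E j) - th * G (m s)\<bar> \<le> 2 * CARD('p) * K * NY * h\<^sup>2"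
  proof -
    have "\<bar>th * (\<Sum>j\<in>UNIV. E j) - th * G (m s)\<bar> = th * \<bar>(\<Sum>j\<in>UNIV. E j) - G (m s)\<bar>"
      using th(1) by (simp add: right_diff_distrib[symmetric] abs_mult)
    also have "\<dots> \<le> h * (CARD('p) * (2 * (K * (NY * h))))"
      using th h SE by (intro mult_mono) auto
    finally show ?thesis by (simp add: power2_eq_square algebra_simps)
  qed
  have 3: "\<bar>th * G (m s) - h * G (m s)\<bar> \<le> CARD('p) * (K * NY) * h\<^sup>2"
  proof -
    have "\<bar>th * G (m s) - h * G (m s)\<bar> = (h - th) * \<bar>G (m s)\<bar>"
      using th(2) by (simp add: left_diff_distrib[symmetric] abs_mult)
    also have "\<dots> \<le> h\<^sup>2 * (CARD('p) * (K * NY))"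
      using th G_bounded[OF sx(1)] by (intro mult_mono) auto
    finally show ?thesis by (simp add: algebra_simps)
  qed
  have "\<bar>U (m t) - U (m s) - h * G (m s)\<bar> \<le> CU * h\<^sup>2"
    using 1 2 3 unfolding CU_def distrib_right by linarith
  then show ?thesis by (simp add: h_def)
qed

lemma wsol_U_quadratic:
  assumes m: "wsol m"
  shows "\<exists>C\<ge>0. \<forall>s\<ge>0. \<forall>t\<ge>0. \<bar>U (m t) - U (m s) - (t - s) * G (m s)\<bar> \<le> C * (t - s)\<^sup>2"
proof (intro exI conjI allI impI)
  define L where "L = 2 * CARD('p) * K * NY"
  have L: "L \<ge> 0" by (simp add: L_def)
  show "0 \<le> CU + L" using CU_nonneg L by simp
  fix s t :: real assume st: "0 \<le> s" "0 \<le> t"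
  consider "s < t" | "s = t" | "t < s" by linarith
  then show "\<bar>U (m t) - U (m s) - (t - s) * G (m s)\<bar> \<le> (CU + L) * (t - s)\<^sup>2"
  proof cases
    case 1
    have "CU * (t - s)\<^sup>2 \<le> (CU + L) * (t - s)\<^sup>2" using L by (intro mult_right_mono) auto
    then show ?thesis using wsol_U_forward[OF m st(1) 1] by linarith
  next
    \<comment> \<open>Backwards in time: the forward bound is used from \<open>t\<close>, and
      \<open>G (m t)\<close> is exchanged for \<open>G (m s)\<close> by the Lipschitz bound.\<close>
    case 3
    have "\<bar>G (m t) - G (m s)\<bar> \<le> 2 * CARD('p) * K * dm (m s) (m t)"
      using wsol_sx[OF m] st by (intro G_lipschitz) auto
    also have "\<dots> \<le> 2 * CARD('p) * K * (NY * \<bar>t - s\<bar>)"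
      using wsol_lipschitz[OF m st] by (intro mult_left_mono) auto
    finally have "\<bar>G (m t) - G (m s)\<bar> \<le> L * \<bar>t - s\<bar>" by (simp add: L_def algebra_simps)
    then have "\<bar>t - s\<bar> * \<bar>G (m t) - G (m s)\<bar> \<le> \<bar>t - s\<bar> * (L * \<bar>t - s\<bar>)" by (intro mult_left_mono) auto
    moreover have "(t - s)\<^sup>2 = \<bar>t - s\<bar> * \<bar>t - s\<bar>" by (simp add: power2_eq_square)
    ultimately have "\<bar>(t - s) * (G (m t) - G (m s))\<bar> \<le> L * (t - s)\<^sup>2"
      by (simp add: abs_mult mult.left_commute)
    moreover have "\<bar>U (m s) - U (m t) - (s - t) * G (m t)\<bar> \<le> CU * (t - s)\<^sup>2"
      using wsol_U_forward[OF m st(2) 3] by (simp add: power2_commute)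
    ultimately show ?thesis by (simp add: algebra_simps abs_le_iff)
  qed simp
qed

lemma wsol_U_derivative:
  assumes "wsol m" "t > 0"
  shows "((\<lambda>t. U (m t)) has_real_derivative G (m t)) (at t)"
proof -
  obtain C where C: "C \<ge> 0 \<and> (\<forall>s\<ge>0. \<forall>t\<ge>0. \<bar>U (m t) - U (m s) - (t - s) * G (m s)\<bar> \<le> C * (t - s)\<^sup>2)"
    using wsol_U_quadratic[OF assms(1)] ..
  show ?thesis
    by (rule has_derivative_from_local_quadratic_bound[where a=0 and f="\<lambda>t. U (m t)" and g="\<lambda>t. G (m t)" and C=C, OF _ assms(2)])
      (use C in simp)
qed

lemma wsol_U_mono:
  assumes "wsol m" "0 < s" "s \<le> t"
  shows "U (m s) \<le> U (m t)"
proof (rule DERIV_nonneg_imp_nondecreasing[OF assms(3)])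
  fix r assume "s \<le> r" "r \<le> t"
  then show "\<exists>y. ((\<lambda>t. U (m t)) has_real_derivative y) (at r) \<and> 0 \<le> y"
    using wsol_U_derivative[OF assms(1), of r] G_nonneg[OF wsol_sx[OF assms(1)], of r] assms by fastforce
qed

text \<open>\<open>U\<close> is nondecreasing and bounded, so late increments are small; a value
  \<open>G (m t) \<ge> e\<close> would force an increment larger than what remains below the
  supremum.\<close>

lemma wsol_G_tendsto_0:
  assumes m: "wsol m"
  shows "((\<lambda>t. G (m t)) \<longlongrightarrow> 0) at_top"
proof (rule tendstoI)
  fix e :: real assume e: "e > 0"
  obtain C where C': "C \<ge> 0 \<and> (\<forall>s\<ge>0. \<forall>t\<ge>0. \<bar>U (m t) - U (m s) - (t - s) * G (m s)\<bar> \<le> C * (t - s)\<^sup>2)"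
    using wsol_U_quadratic[OF m] ..
  then have C: "C \<ge> 0" "\<And>s t. 0 \<le> s \<Longrightarrow> 0 \<le> t \<Longrightarrow> \<bar>U (m t) - U (m s) - (t - s) * G (m s)\<bar> \<le> C * (t - s)\<^sup>2"
    by simp_all
  \<comment> \<open>So short that the quadratic error \<open>C * h\<^sup>2\<close> stays below
    \<open>h * (e / 2)\<close>.\<close>
  define h where "h = e / (2 * (C + 1))"
  have h: "h > 0" using e C by (simp add: h_def)
  have Ch: "C * h < e / 2"
    using e C by (simp add: h_def field_simps)
  define l where "l = (SUP t\<in>{1..}. U (m t))"
  have bdd: "bdd_above ((\<lambda>t. U (m t)) ` {1..})"
  proof (rule bdd_aboveI2)
    fix t :: real assume "t \<in> {1..}"
    then show "U (m t) \<le> U (m 1) + K * NY" using U_bounded[OF wsol_sx[OF m, of 1] wsol_sx[OF m, of t]] by auto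
  qed
  have le_l: "U (m t) \<le> l" if "t \<ge> 1" for t unfolding l_def using that bdd by (intro cSUP_upper) auto
  obtain t0 where t0: "t0 \<ge> 1" "l - h * (e / 2) < U (m t0)"
  proof -
    have "l - h * (e / 2) < l" using h e by simp
    then show ?thesis using that less_cSUP_iff[OF _ bdd, of "l - h * (e/2)"] unfolding l_def by auto
  qed
  show "eventually (\<lambda>t. dist (G (m t)) 0 < e) at_top"
  proof (rule eventually_at_top_linorderI)
    fix t assume t: "t \<ge> t0"
    have "U (m t0) \<le> U (m t)" using wsol_U_mono[OF m, of t0 t] t t0 by simp
    moreover have "\<bar>U (m (t + h)) - U (m t) - h * G (m t)\<bar> \<le> C * h\<^sup>2"
      using C(2)[of t "t + h"] t t0 h by simp
    moreover have "U (m (t + h)) \<le> l" using t t0 h by (intro le_l) simp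
    moreover have "C * h\<^sup>2 < h * (e / 2)" using mult_strict_left_mono[OF Ch h] by (simp add: power2_eq_square algebra_simps)
    ultimately have "h * G (m t) < h * (e / 2) + h * (e / 2)" using t0(2) by linarith
    then have "h * G (m t) < h * e" by (simp add: algebra_simps)
    then have "G (m t) < e" using h by simp
    moreover have "G (m t) \<ge> 0" using G_nonneg[OF wsol_sx[OF m]] t t0 by simp
    ultimately show "dist (G (m t)) 0 < e" by simp
  qed
qed

section \<open>Cluster points and convergence to one equilibrium\<close>

lemma G_tendsto:
  assumes "((\<lambda>x. dm z (f x)) \<longlongrightarrow> 0) F" "eventually (\<lambda>x. bnd (f x)) F" "bnd z"
  shows "((\<lambda>x. G (f x)) \<longlongrightarrow> G z) F"
proof -
  have "((\<lambda>x. G (f x) - G z) \<longlongrightarrow> 0) F"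
  proof (rule Lim_null_comparison)
    show "eventually (\<lambda>x. norm (G (f x) - G z) \<le> 2 * CARD('p) * K * dm z (f x)) F"
      using assms(2) by eventually_elim (use G_lipschitz[OF assms(3)] in simp)
    show "((\<lambda>x. 2 * CARD('p) * K * dm z (f x)) \<longlongrightarrow> 0) F"
      using tendsto_mult_right_zero[OF assms(1)] by simp
  qed
  then show ?thesis by (simp add: LIM_zero_iff)
qed

lemma wsol_cluster:
  assumes m: "wsol m" and F: "F \<le> at_top" "F \<noteq> bot"
  obtains z F' where "sx z" "G z = 0" "F' \<le> F" "F' \<noteq> bot" "((\<lambda>t. dm z (m t)) \<longlongrightarrow> 0) F'"
proof -
  \<comment> \<open>The value 0 at negative times and outside the action sets places every
    \<open>f t\<close> in one compact product of unit intervals.\<close>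
  define f where "f t i a = (if a \<in> Y i \<and> 0 \<le> t then m t i a else 0)" for t i a
  define S where "S = {g :: 'p \<Rightarrow> 'a \<Rightarrow> real. \<forall>i. g i \<in> {h. \<forall>a. h a \<in> {0..1}}}"
  have S: "compact S" unfolding S_def by (intro compact_pi) auto
  have fS: "f t \<in> S" for t
    using wsol_sx[OF m, of t] by (auto simp: f_def S_def sx_nonneg sx_le_1)
  obtain z F' where z0: "z \<in> S" and z: "F' \<le> F" "F' \<noteq> bot" "(f \<longlongrightarrow> z) F'"
    by (rule compact_cluster_filter[OF S F(2) fS])
  have ev: "eventually (\<lambda>t. t \<ge> 0) F'"
    by (rule filter_leD[OF order_trans[OF z(1) F(1)] eventually_ge_at_top])
  have lim: "((\<lambda>t. m t i a) \<longlongrightarrow> z i a) F'" if "a \<in> Y i" for i a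
  proof -
    have "((\<lambda>t. f t i a) \<longlongrightarrow> z i a) F'" using z(3) by (simp add: tendsto_fun_iff)
    moreover have "eventually (\<lambda>t. f t i a = m t i a) F'" using ev by eventually_elim (simp add: f_def that)
    ultimately show ?thesis using tendsto_cong by fastforce
  qed
  have dmz: "((\<lambda>t. dm z (m t)) \<longlongrightarrow> 0) F'" using lim by (rule dm_tendsto_0I)
  have "sx z"
    unfolding sx_def
  proof (intro allI conjI ballI)
    fix i a assume a: "a \<in> Y i"
    have "eventually (\<lambda>t. m t i a \<ge> 0) F'" using ev by eventually_elim (use wsol_sx[OF m] a in \<open>auto simp: sx_nonneg\<close>)
    then show "0 \<le> z i a" by (rule tendsto_lowerbound[OF lim[OF a] _ z(2)])
  next
    fix i
    have "((\<lambda>t. \<Sum>a\<in>Y i. m t i a) \<longlongrightarrow> (\<Sum>a\<in>Y i. z i a)) F'" using lim by (intro tendsto_sum)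
    moreover have "eventually (\<lambda>t. (\<Sum>a\<in>Y i. m t i a) = 1) F'" using ev by eventually_elim (use wsol_sx[OF m] in \<open>auto simp: sx_sum\<close>)
    then have "((\<lambda>t. \<Sum>a\<in>Y i. m t i a) \<longlongrightarrow> 1) F'" by (rule tendsto_eventually)
    ultimately show "sum (z i) (Y i) = 1" by (rule tendsto_unique[OF z(2)])
  qed
  moreover have "G z = 0"
  proof -
    have "eventually (\<lambda>t. bnd (m t)) F'" using ev by eventually_elim (use wsol_sx[OF m] in auto)
    then have "((\<lambda>t. G (m t)) \<longlongrightarrow> G z) F'" using G_tendsto[OF dmz _ sx_bnd] \<open>sx z\<close> by simp
    moreover have "((\<lambda>t. G (m t)) \<longlongrightarrow> 0) F'" 
      by (rule tendsto_mono[OF order_trans[OF z(1) F(1)] wsol_G_tendsto_0[OF m]])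
    ultimately show ?thesis by (rule tendsto_unique[OF z(2)])
  qed
  ultimately show thesis by (rule that[OF _ _ z(1,2) dmz])
qed

lemma dm_continuous_wsol:
  assumes "wsol m"
  shows "continuous_on {0..} (\<lambda>t. dm z (m t))"
  unfolding dm_def using wsol_coord_continuous[OF assms] by (intro continuous_intros) auto

text \<open>Around an isolated cluster point the annulus between \<open>e\<close> and
  \<open>r\<close> contains no equilibrium, so the trajectory eventually avoids it. It is inside the
  smaller ball at arbitrarily late times and, by continuity, cannot leave.\<close>

lemma wsol_converges:
  assumes m: "wsol m"
    and iso: "\<And>z. sx z \<Longrightarrow> G z = 0 \<Longrightarrow> \<exists>r>0. \<forall>z'. sx z' \<and> G z' = 0 \<and> dm z z' \<le> r \<longrightarrow> dm z z' = 0"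
  obtains z where "sx z" "G z = 0" "((\<lambda>t. dm z (m t)) \<longlongrightarrow> 0) at_top"
proof -
  obtain z F where z: "sx z" "G z = 0" "F \<le> at_top" "F \<noteq> bot" "((\<lambda>t. dm z (m t)) \<longlongrightarrow> 0) F"
    by (rule wsol_cluster[OF m order_refl trivial_limit_at_top_linorder])
  obtain r where r: "r > 0" "\<And>z'. sx z' \<Longrightarrow> G z' = 0 \<Longrightarrow> dm z z' \<le> r \<Longrightarrow> dm z z' = 0"
    using iso[OF z(1,2)] by blast
  have ann: "eventually (\<lambda>t. \<not> (e \<le> dm z (m t) \<and> dm z (m t) \<le> r)) at_top" if e: "e > 0" for e
  proof (rule ccontr)
    assume "\<not> ?thesis"
    then have fr: "frequently (\<lambda>t. e \<le> dm z (m t) \<and> dm z (m t) \<le> r) at_top" by (simp add: frequently_def)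
    define B where "B = {t. e \<le> dm z (m t) \<and> dm z (m t) \<le> r}"
    have ne: "inf at_top (principal B) \<noteq> bot"
      using fr by (auto simp: B_def frequently_def trivial_limit_def eventually_inf_principal)
    obtain z' F' where z': "sx z'" "G z' = 0" "F' \<le> inf at_top (principal B)" "F' \<noteq> bot" "((\<lambda>t. dm z' (m t)) \<longlongrightarrow> 0) F'"
      by (rule wsol_cluster[OF m inf_le1 ne])
    have evB: "eventually (\<lambda>t. t \<in> B) F'"
      using z'(3) by (auto simp: le_inf_iff le_principal)
    have lim: "((\<lambda>t. dm z (m t)) \<longlongrightarrow> dm z z') F'"
      unfolding dm_def using dm_tendsto_0D[OF z'(5)] by (intro tendsto_intros) auto
    have "e \<le> dm z z'"
      by (rule tendsto_lowerbound[OF lim _ z'(4)]) (rule eventually_mono[OF evB], simp add: B_def)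
    moreover have "dm z z' \<le> r"
      by (rule tendsto_upperbound[OF lim _ z'(4)]) (rule eventually_mono[OF evB], simp add: B_def)
    ultimately show False using r(2)[OF z'(1,2)] e by simp
  qed
  have "((\<lambda>t. dm z (m t)) \<longlongrightarrow> 0) at_top"
  proof (rule tendstoI)
    fix e0 :: real assume "e0 > 0"
    define e where "e = min e0 r"
    have e: "e > 0" "e \<le> r" "e \<le> e0" using \<open>e0 > 0\<close> r(1) by (auto simp: e_def)
    obtain T where T: "\<And>t. t \<ge> T \<Longrightarrow> \<not> (e \<le> dm z (m t) \<and> dm z (m t) \<le> r)"
      using ann[OF e(1)] unfolding eventually_at_top_linorder by blast
    have "eventually (\<lambda>t. dm z (m t) < e) F" using order_tendstoD(2)[OF z(5) e(1)] .
    moreover have "eventually (\<lambda>t. t \<ge> max T 0) F" by (rule filter_leD[OF z(3) eventually_ge_at_top])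
    ultimately have "eventually (\<lambda>t. dm z (m t) < e \<and> t \<ge> max T 0) F" by eventually_elim simp
    then obtain s where s: "dm z (m s) < e" "s \<ge> max T 0" using z(4) eventually_happens by blast
    have "dm z (m t) < e" if t: "t \<ge> s" for t
    proof (rule ccontr)
      assume "\<not> dm z (m t) < e"
      moreover have "continuous_on {s..t} (\<lambda>t. dm z (m t))"
        using s(2) by (intro continuous_on_subset[OF dm_continuous_wsol[OF m]]) auto
      ultimately obtain r' where "s \<le> r'" "r' \<le> t" "dm z (m r') = e"
        using IVT'[of "\<lambda>t. dm z (m t)" s e t] s(1) t by auto
      then show False using T[of r'] s(2) e(2) by simp
    qed
    then show "eventually (\<lambda>t. dist (dm z (m t)) 0 < e0) at_top"
      using e(3) by (intro eventually_at_top_linorderI[of s]) (auto intro: less_le_trans)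
  qed
  then show thesis by (rule that[OF z(1,2)])
qed

end

section \<open>Sublevel sets of multiaffine functions\<close>

text \<open>Tonelli with coordinate \<open>i\<close> integrated first: an inequality of integrals
  along every line in that direction passes to the whole product.\<close>

lemma (in product_sigma_finite) nn_integral_PiM_compare:
  assumes I: "finite I" "i \<in> I"
    and f: "f \<in> borel_measurable (Pi\<^sub>M I M)" and g: "g \<in> borel_measurable (Pi\<^sub>M I M)"
    and le: "\<And>x. x \<in> space (Pi\<^sub>M I M) \<Longrightarrow> (\<integral>\<^sup>+v. f (x(i := v)) \<partial>M i) \<le> (\<integral>\<^sup>+v. g (x(i := v)) \<partial>M i)"
  shows "integral\<^sup>N (Pi\<^sub>M I M) f \<le> integral\<^sup>N (Pi\<^sub>M I M) g"
proof -
  define I' where "I' = I - {i}"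
  have I': "finite I'" "i \<notin> I'" "insert i I' = I" using I by (auto simp: I'_def)
  have "integral\<^sup>N (Pi\<^sub>M I M) f = (\<integral>\<^sup>+x. (\<integral>\<^sup>+v. f (x(i := v)) \<partial>M i) \<partial>Pi\<^sub>M I' M)"
    using product_nn_integral_insert[OF I'(1,2), of f] f I'(3) by simp
  also have "\<dots> \<le> (\<integral>\<^sup>+x. (\<integral>\<^sup>+v. g (x(i := v)) \<partial>M i) \<partial>Pi\<^sub>M I' M)"
  proof (rule nn_integral_mono)
    fix x assume x: "x \<in> space (Pi\<^sub>M I' M)"
    show "(\<integral>\<^sup>+v. f (x(i := v)) \<partial>M i) \<le> (\<integral>\<^sup>+v. g (x(i := v)) \<partial>M i)"
    proof (cases "space (M i) = {}")
      case True
      then show ?thesis by (intro nn_integral_mono) simp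
    next
      case False
      then obtain v0 where "v0 \<in> space (M i)" by blast
      then have "x(i := v0) \<in> space (Pi\<^sub>M I M)"
        using x I'(3) by (auto simp: space_PiM PiE_iff extensional_def)
      from le[OF this] show ?thesis by simp
    qed
  qed
  also have "\<dots> = integral\<^sup>N (Pi\<^sub>M I M) g"
    using product_nn_integral_insert[OF I'(1,2), of g] g I'(3) by simp
  finally show ?thesis .
qed

text \<open>The singular kernel $|r|^{-3/4}$; any exponent strictly between $1/2$ and $1$ would do.\<close>

definition psi :: "real \<Rightarrow> ennreal" where
  "psi r = (if r = 0 then \<infinity> else ennreal (\<bar>r\<bar> powr (-3/4)))"

lemma psi_measurable [measurable]: "psi \<in> borel_measurable borel"
  unfolding psi_def by measurable

lemma psi_pos: "psi r > 0"
  by (auto simp: psi_def ennreal_zero_less_top)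

lemma psi_minus [simp]: "psi (- r) = psi r"
  by (simp add: psi_def)

lemma psi_mult:
  assumes "b \<noteq> 0"
  shows "psi (b * r) = psi b * psi r"
proof (cases "r = 0")
  case True
  then show ?thesis using assms psi_pos[of b] by (simp add: psi_def ennreal_mult_top)
next
  case False
  then show ?thesis using assms by (simp add: psi_def abs_mult powr_mult ennreal_mult)
qed

lemma psi_ge_1: "psi r \<le> 1" if "\<bar>r\<bar> \<ge> 1"
proof -
  have "\<bar>r\<bar> powr (-3/4) \<le> \<bar>r\<bar> powr 0" using that by (intro powr_mono) auto
  then show ?thesis using that by (auto simp: psi_def ennreal_le_1)
qed

lemma psi_integral_unit: "(\<integral>\<^sup>+r. psi r * indicator {0..1} r \<partial>lborel) = 4"
proof -
  have "(\<integral>\<^sup>+r. psi r * indicator {0..1} r \<partial>lborel) = (\<integral>\<^sup>+r. ennreal (indicator {0..1} r * (r powr (-3/4))) \<partial>lborel)"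
  proof (rule nn_integral_cong_AE)
    have "AE r in lborel. r \<noteq> (0::real)" by (rule AE_lborel_singleton)
    then show "AE r in lborel. psi r * indicator {0..1} r = ennreal (indicator {0..1} r * (r powr (-3/4)))"
      by eventually_elim (auto simp: psi_def split: split_indicator)
  qed
  also have "\<dots> = ennreal 4"
  proof (rule nn_integral_has_integral_lborel)
    have "((\<lambda>r::real. r powr (-3/4)) has_integral (1 powr (-3/4 + 1) / (-3/4 + 1))) {0..1}"
      by (rule has_integral_powr_from_0) auto
    then have "((\<lambda>r::real. r powr (-3/4)) has_integral 4) {0..1}" by simp
    then show "((\<lambda>r::real. indicator {0..1} r * (r powr (-3/4))) has_integral 4) UNIV"
      unfolding has_integral_restrict_UNIV[symmetric, of "\<lambda>r. r powr (-3/4)" 4 "{0..1}"]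
      by (rule has_integral_eq[rotated]) (auto split: split_indicator)
  qed auto
  finally show ?thesis by simp
qed

text \<open>The kernel is multiplicative, so the slope \<open>b\<close> factors out and the rest is
  bounded uniformly in \<open>a\<close>. Integrating one variable thus replaces the function by its
  slope inside \<open>psi\<close>; for \<open>b = 0\<close> the right-hand side is infinite.\<close>

lemma psi_affine_integral:
  "(\<integral>\<^sup>+v. psi (a + b * v) * indicator {0..1} v \<partial>lborel) \<le> 9 * psi b"
proof (cases "b = 0")
  case True
  then show ?thesis by (simp add: psi_def ennreal_mult_top)
next
  case False
  have sym: "(\<integral>\<^sup>+r. psi r * indicator {-1..0} r \<partial>lborel) = 4"
    by (subst nn_integral_real_affine[where c="-1" and t=0])
      (auto simp: psi_integral_unit[symmetric] intro!: nn_integral_cong split: split_indicator)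
  define g where "g = a / b"
  \<comment> \<open>The constant 9 is 4 from each of the two unit intervals next to the singularity,
    plus 1 for the rest, where \<open>psi\<close> is at most 1.\<close>
  have "(\<integral>\<^sup>+v. psi (v + g) * indicator {0..1} v \<partial>lborel) \<le>
      (\<integral>\<^sup>+v. (psi (v + g) * indicator {-1..0} (v + g) + psi (v + g) * indicator {0..1} (v + g)) + indicator {0..1} v \<partial>lborel)"
    by (intro nn_integral_mono) (auto split: split_indicator intro: psi_ge_1)
  also have "\<dots> = (\<integral>\<^sup>+v. psi (v + g) * indicator {-1..0} (v + g) \<partial>lborel)
      + (\<integral>\<^sup>+v. psi (v + g) * indicator {0..1} (v + g) \<partial>lborel) + 1"
    by (simp add: nn_integral_add)
  also have "(\<integral>\<^sup>+v. psi (v + g) * indicator {-1..0} (v + g) \<partial>lborel) = 4"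
    using sym nn_integral_real_affine[of "\<lambda>r. psi r * indicator {-1..0} r" 1 g] by (simp add: add.commute)
  also have "(\<integral>\<^sup>+v. psi (v + g) * indicator {0..1} (v + g) \<partial>lborel) = 4"
    using psi_integral_unit nn_integral_real_affine[of "\<lambda>r. psi r * indicator {0..1} r" 1 g] by (simp add: add.commute)
  finally have *: "(\<integral>\<^sup>+v. psi (v + g) * indicator {0..1} v \<partial>lborel) \<le> 9" by simp
  have "(\<integral>\<^sup>+v. psi (a + b * v) * indicator {0..1} v \<partial>lborel) = (\<integral>\<^sup>+v. psi b * (psi (v + g) * indicator {0..1} v) \<partial>lborel)"
  proof (intro nn_integral_cong)
    fix v
    have "a + b * v = b * (v + g)" using False by (simp add: g_def field_simps)
    then show "psi (a + b * v) * indicator {0..1} v = psi b * (psi (v + g) * indicator {0..1} v)"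
      using psi_mult[OF False] by (simp add: mult.assoc)
  qed
  also have "\<dots> = psi b * (\<integral>\<^sup>+v. psi (v + g) * indicator {0..1} v \<partial>lborel)"
    by (intro nn_integral_cmult) measurable
  also have "\<dots> \<le> psi b * 9" using * by (intro mult_left_mono) auto
  finally show ?thesis by (simp add: mult.commute)
qed

lemma emeasure_affine_strip:
  fixes a b e de :: real
  assumes "0 < de" "de < \<bar>b\<bar>" "0 < e"
  shows "emeasure lborel {v. \<bar>a + b * v\<bar> < e} \<le> ennreal (2 * e / de)"
proof -
  have b: "b \<noteq> 0" using assms by auto
  have "{v. \<bar>a + b * v\<bar> < e} = {- a / b - e / \<bar>b\<bar> <..< - a / b + e / \<bar>b\<bar>}"
  proof (rule set_eqI)
    fix v
    have "\<bar>a + b * v\<bar> = \<bar>b\<bar> * \<bar>v + a / b\<bar>" using b by (simp add: abs_mult[symmetric] field_simps)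
    then have "\<bar>a + b * v\<bar> < e \<longleftrightarrow> \<bar>v + a / b\<bar> < e / \<bar>b\<bar>" using b by (simp add: pos_less_divide_eq mult.commute)
    then show "v \<in> {v. \<bar>a + b * v\<bar> < e} \<longleftrightarrow> v \<in> {- a / b - e / \<bar>b\<bar> <..< - a / b + e / \<bar>b\<bar>}"
      by (auto simp: abs_less_iff)
  qed
  then have "emeasure lborel {v. \<bar>a + b * v\<bar> < e} = ennreal (2 * (e / \<bar>b\<bar>))"
    using assms by simp
  also have "\<dots> \<le> ennreal (2 * e / de)"
    using assms by (intro ennreal_leI) (simp add: frac_le)
  finally show ?thesis .
qed

definition upd :: "'p \<Rightarrow> nat \<Rightarrow> real \<Rightarrow> ('p \<Rightarrow> nat \<Rightarrow> real) \<Rightarrow> 'p \<Rightarrow> nat \<Rightarrow> real" where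
  "upd i k v x = x(i := (x i)(k := v))"

lemma upd_same [simp]: "upd i k v (upd i k w x) = upd i k v x"
  and upd_triv [simp]: "upd i k (x i k) x = x"
  and upd_apply: "upd i k v x j l = (if j = i \<and> l = k then v else x j l)"
  by (auto simp: upd_def fun_eq_iff)

lemma upd_commute: "(i, k) \<noteq> (j, l) \<Longrightarrow> upd i k v (upd j l w x) = upd j l w (upd i k v x)"
  by (auto simp: upd_def fun_eq_iff)

section \<open>Lebesgue measure in the strategy coordinates\<close>

context finite_game
begin

definition J :: "'p \<Rightarrow> nat set" where "J i = {1..card (Y i) - 1}"

lemma finite_J [simp, intro]: "finite (J i)" by (simp add: J_def)

abbreviation P :: "'p \<Rightarrow> (nat \<Rightarrow> real) measure" where "P i \<equiv> Pi\<^sub>M (J i) (\<lambda>_. lborel)"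
abbreviation S :: "('p \<Rightarrow> nat \<Rightarrow> real) measure" where "S \<equiv> strategy_measure Y"

lemma S_eq: "S = Pi\<^sub>M UNIV P"
  by (simp add: strategy_measure_def J_def)

lemma lborel_product: "product_sigma_finite (\<lambda>_::nat. lborel :: real measure)"
  by standard

lemma P_sigma_finite: "sigma_finite_measure (P i)"
  using product_sigma_finite.sigma_finite[OF lborel_product] by blast

lemma P_product: "product_sigma_finite P"
  by (rule product_sigma_finite.intro) (rule P_sigma_finite)

lemma space_S: "x \<in> space S \<longleftrightarrow> (\<forall>i. x i \<in> extensional (J i))"
  by (auto simp: S_eq space_PiM PiE_iff)

lemma measurable_into_S:
  assumes "\<And>i k. k \<in> J i \<Longrightarrow> (\<lambda>w. F w i k) \<in> borel_measurable N"
    and "\<And>w i. w \<in> space N \<Longrightarrow> F w i \<in> extensional (J i)"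
  shows "F \<in> measurable N S"
proof -
  have "(\<lambda>w. \<lambda>i\<in>UNIV. \<lambda>k\<in>J i. F w i k) \<in> measurable N (Pi\<^sub>M UNIV P)"
    using assms(1) by (intro measurable_restrict) auto
  moreover have "(\<lambda>w. \<lambda>i\<in>UNIV. \<lambda>k\<in>J i. F w i k) w = F w" if "w \<in> space N" for w
    using assms(2)[OF that] by (auto simp: fun_eq_iff restrict_def extensional_def)
  ultimately show ?thesis unfolding S_eq using measurable_cong by force
qed

lemma measurable_coord: "k \<in> J i \<Longrightarrow> (\<lambda>x. x i k) \<in> borel_measurable S"
proof -
  assume k: "k \<in> J i"
  have "(\<lambda>x. x i) \<in> measurable S (P i)" unfolding S_eq by (rule measurable_component_singleton) simp
  moreover have "(\<lambda>z. z k) \<in> measurable (P i) lborel" using k by (rule measurable_component_singleton)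
  ultimately show ?thesis by (simp add: measurable_compose[where N="P i"] cong: measurable_cong_sets)
qed

lemma upd_in_space: "x \<in> space S \<Longrightarrow> k \<in> J i \<Longrightarrow> upd i k v x \<in> space S"
  by (auto simp: space_S upd_def extensional_def)

lemma measurable_upd:
  assumes "k \<in> J i" "x \<in> space S"
  shows "(\<lambda>v. upd i k v x) \<in> measurable borel S"
proof (rule measurable_into_S)
  fix j l assume "l \<in> J j"
  show "(\<lambda>v. upd i k v x j l) \<in> borel_measurable borel"
    unfolding upd_apply by (cases "j = i \<and> l = k") auto
next
  fix v :: real and j
  show "upd i k v x j \<in> extensional (J j)" using upd_in_space[OF assms(2,1)] by (simp add: space_S)
qed

lemma measurable_upd_const:
  assumes "k \<in> J i"
  shows "upd i k v \<in> measurable S S"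
proof (rule measurable_into_S)
  fix j l assume "l \<in> J j"
  then show "(\<lambda>x. upd i k v x j l) \<in> borel_measurable S"
    unfolding upd_apply using measurable_coord[of l j] by (cases "j = i \<and> l = k") auto
next
  fix x j assume "x \<in> space S"
  then show "upd i k v x j \<in> extensional (J j)" using upd_in_space[OF _ assms] by (simp add: space_S)
qed

text \<open>The measure is a product over players of products over coordinates, so the
  one-coordinate comparison is applied once inside a player and once across the players.\<close>

lemma S_compare:
  assumes k: "k \<in> J i" and f: "f \<in> borel_measurable S" and g: "g \<in> borel_measurable S"
    and le: "\<And>x. x \<in> space S \<Longrightarrow> (\<integral>\<^sup>+v. f (upd i k v x) \<partial>lborel) \<le> (\<integral>\<^sup>+v. g (upd i k v x) \<partial>lborel)"
  shows "integral\<^sup>N S f \<le> integral\<^sup>N S g"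
proof -
  interpret lp: product_sigma_finite "\<lambda>_::nat. lborel :: real measure" by (rule lborel_product)
  interpret P: product_sigma_finite P by (rule P_product)
  have upd_space: "x(i := z) \<in> space S" if "x \<in> space S" "z \<in> space (P i)" for x z
    using that by (auto simp: space_S space_PiM PiE_iff)
  have meas: "(\<lambda>z. h (x(i := z))) \<in> borel_measurable (P i)"
    if h: "h \<in> borel_measurable S" and x: "x \<in> space S" for h :: "_ \<Rightarrow> ennreal" and x
  proof -
    have "(\<lambda>z. x(i := z)) \<in> measurable (P i) S"
    proof (rule measurable_into_S)
      fix j l assume "l \<in> J j"
      then show "(\<lambda>z. (x(i := z)) j l) \<in> borel_measurable (P i)"
        using measurable_component_singleton[of l "J i" "\<lambda>_. lborel :: real measure"]
        by (cases "j = i") auto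
    next
      fix z j assume "z \<in> space (P i)"
      then show "(x(i := z)) j \<in> extensional (J j)" using upd_space[OF x] by (simp add: space_S)
    qed
    then show ?thesis using h by (rule measurable_compose)
  qed
  have inner: "(\<integral>\<^sup>+z. f (x(i := z)) \<partial>P i) \<le> (\<integral>\<^sup>+z. g (x(i := z)) \<partial>P i)" if x: "x \<in> space S" for x
  proof (rule lp.nn_integral_PiM_compare[OF finite_J k meas[OF f x] meas[OF g x]])
    fix z assume z: "z \<in> space (P i)"
    show "(\<integral>\<^sup>+v. f (x(i := z(k := v))) \<partial>lborel) \<le> (\<integral>\<^sup>+v. g (x(i := z(k := v))) \<partial>lborel)"
      using le[OF upd_space[OF x z]] by (simp add: upd_def)
  qed
  show ?thesis
    unfolding S_eq
  proof (rule P.nn_integral_PiM_compare[of UNIV i])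
    fix x assume "x \<in> space (Pi\<^sub>M UNIV P)"
    then show "(\<integral>\<^sup>+z. f (x(i := z)) \<partial>P i) \<le> (\<integral>\<^sup>+z. g (x(i := z)) \<partial>P i)"
      using inner by (simp add: S_eq)
  qed (use f g in \<open>auto simp: S_eq\<close>)
qed

text \<open>The shift \<open>w\<close> does not depend on player \<open>i\<close>'s coordinates, so
  on each coordinate line of that player the map is a one-dimensional affine substitution and costs
  a factor \<open>1 / c\<close>.\<close>

lemma shift_integral:
  fixes w :: "('p \<Rightarrow> nat \<Rightarrow> real) \<Rightarrow> nat \<Rightarrow> real"
  assumes c: "c > 0" and f: "f \<in> borel_measurable S"
    and w: "\<And>k. k \<in> J i \<Longrightarrow> (\<lambda>x. w x k) \<in> borel_measurable S"
    and indep: "\<And>x z. w (x(i := z)) = w x"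
  shows "(\<integral>\<^sup>+x. f (x(i := \<lambda>k\<in>J i. c * x i k + w x k)) \<partial>S) \<le> ennreal ((1 / c) ^ card (J i)) * integral\<^sup>N S f"
proof -
  \<comment> \<open>Transforming only the coordinates in \<open>B\<close> makes the estimate an
    induction over single coordinates.\<close>
  define T where "T B x = x(i := \<lambda>k\<in>J i. if k \<in> B then c * x i k + w x k else x i k)" for B x
  have T: "T B \<in> measurable S S" for B
  proof (rule measurable_into_S)
    fix j l assume l: "l \<in> J j"
    show "(\<lambda>x. T B x j l) \<in> borel_measurable S"
      using l w[of l] measurable_coord[of l j] by (cases "j = i"; cases "l \<in> B") (auto simp: T_def)
  next
    fix x j assume "x \<in> space S"
    then show "T B x j \<in> extensional (J j)" by (auto simp: T_def space_S)
  qed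
  have "B \<subseteq> J i \<Longrightarrow> (\<integral>\<^sup>+x. f (T B x) \<partial>S) \<le> ennreal ((1 / c) ^ card B) * integral\<^sup>N S f" if "finite B" for B
    using that
  proof (induction B)
    case empty
    have "(\<integral>\<^sup>+x. f (T {} x) \<partial>S) = integral\<^sup>N S f"
    proof (intro nn_integral_cong)
      fix x assume "x \<in> space S"
      then have "T {} x = x" by (auto simp: T_def space_S fun_eq_iff restrict_def extensional_def)
      then show "f (T {} x) = f x" by simp
    qed
    then show ?case by simp
  next
    case (insert k B)
    have k: "k \<in> J i" using insert by auto
    have "(\<integral>\<^sup>+x. f (T (insert k B) x) \<partial>S) \<le> (\<integral>\<^sup>+x. ennreal (1 / c) * f (T B x) \<partial>S)"
    proof (rule S_compare[OF k])
      show "(\<lambda>x. f (T (insert k B) x)) \<in> borel_measurable S" using T f by (rule measurable_compose)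
      show "(\<lambda>x. ennreal (1 / c) * f (T B x)) \<in> borel_measurable S"
        using measurable_compose[OF T f] by simp
      fix x assume x: "x \<in> space S"
      have m: "(\<lambda>v. f (T B (upd i k v x))) \<in> borel_measurable borel"
        using measurable_compose[OF measurable_compose[OF measurable_upd[OF k x] T] f] .
      have "T (insert k B) (upd i k v x) = T B (upd i k (w x k + c * v) x)" for v
        using insert.hyps(2) k indep[of x] by (auto simp: T_def upd_def fun_eq_iff)
      then have "(\<integral>\<^sup>+v. f (T (insert k B) (upd i k v x)) \<partial>lborel) = (\<integral>\<^sup>+v. f (T B (upd i k (w x k + c * v) x)) \<partial>lborel)"
        by simp
      also have "\<dots> = ennreal (1 / c) * (ennreal c * (\<integral>\<^sup>+v. f (T B (upd i k (w x k + c * v) x)) \<partial>lborel))"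
        using c by (simp add: mult.assoc[symmetric] ennreal_mult[symmetric])
      also have "ennreal c * (\<integral>\<^sup>+v. f (T B (upd i k (w x k + c * v) x)) \<partial>lborel) = (\<integral>\<^sup>+v. f (T B (upd i k v x)) \<partial>lborel)"
        using nn_integral_real_affine[OF m, of c "w x k"] c by simp
      finally show "(\<integral>\<^sup>+v. f (T (insert k B) (upd i k v x)) \<partial>lborel) \<le> (\<integral>\<^sup>+v. ennreal (1 / c) * f (T B (upd i k v x)) \<partial>lborel)"
        using m by (simp add: nn_integral_cmult)
    qed
    also have "\<dots> = ennreal (1 / c) * (\<integral>\<^sup>+x. f (T B x) \<partial>S)"
      using measurable_compose[OF T f] by (rule nn_integral_cmult)
    also have "\<dots> \<le> ennreal (1 / c) * (ennreal ((1 / c) ^ card B) * integral\<^sup>N S f)"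
      using insert by (intro mult_left_mono) auto
    also have "\<dots> = ennreal ((1 / c) ^ card (insert k B)) * integral\<^sup>N S f"
      using c insert.hyps by (simp add: mult.assoc[symmetric] ennreal_mult[symmetric])
    finally show ?case .
  qed
  from this[of "J i"] show ?thesis by (simp add: T_def cong: restrict_cong)
qed

section \<open>Sublevel sets and strips in the unit cube\<close>

definition cube :: "('p \<Rightarrow> nat \<Rightarrow> real) set" where
  "cube = {x \<in> space S. \<forall>i. \<forall>k\<in>J i. 0 \<le> x i k \<and> x i k \<le> 1}"

lemma cube_sets [measurable]: "cube \<in> sets S"
proof -
  have "cube = (\<Inter>i\<in>UNIV. {x \<in> space S. \<forall>k\<in>J i. 0 \<le> x i k \<and> x i k \<le> 1})"
    by (auto simp: cube_def)
  also have "\<dots> \<in> sets S"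
  proof (rule sets.finite_INT)
    fix i
    have "{x \<in> space S. \<forall>k\<in>J i. 0 \<le> x i k \<and> x i k \<le> 1} \<in> sets S"
    proof (rule sets.sets_Collect_finite_All)
      fix k assume "k \<in> J i"
      note measurable_coord[OF this, measurable]
      show "{x \<in> space S. 0 \<le> x i k \<and> x i k \<le> 1} \<in> sets S" by measurable
    qed simp
    then show "{x \<in> space S. \<forall>k\<in>J i. 0 \<le> x i k \<and> x i k \<le> 1} \<in> sets S" .
  qed auto
  finally show ?thesis .
qed

lemma emeasure_cube: "emeasure S cube \<le> 1"
proof -
  interpret lp: product_sigma_finite "\<lambda>_::nat. lborel :: real measure" by (rule lborel_product)
  interpret P: product_sigma_finite P by (rule P_product)
  have "cube = Pi\<^sub>E UNIV (\<lambda>i. Pi\<^sub>E (J i) (\<lambda>_. {0..1}))"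
    unfolding cube_def space_S PiE_iff set_eq_iff by auto
  then have "emeasure S cube = (\<Prod>i\<in>UNIV. emeasure (P i) (Pi\<^sub>E (J i) (\<lambda>_. {0..1})))"
    unfolding S_eq by (simp add: P.emeasure_PiM sets_PiM_I_finite)
  also have "\<dots> = 1" by (simp add: lp.emeasure_PiM)
  finally show ?thesis by simp
qed

lemma upd_cube_iff:
  assumes "x \<in> space S" "k \<in> J i" "v \<in> {0..1}" "w \<in> {0..1}"
  shows "upd i k v x \<in> cube \<longleftrightarrow> upd i k w x \<in> cube"
  using assms by (auto simp: cube_def upd_in_space upd_apply)

lemma upd_cube_unit: "upd i k v x \<in> cube \<Longrightarrow> k \<in> J i \<Longrightarrow> v \<in> {0..1}"
  by (auto simp: cube_def upd_apply dest!: spec[of _ i] bspec[of _ _ k])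

text \<open>For a function that is affine in this coordinate, the unit difference is exactly the
  partial derivative.\<close>

definition slope :: "'p \<Rightarrow> nat \<Rightarrow> (('p \<Rightarrow> nat \<Rightarrow> real) \<Rightarrow> real) \<Rightarrow> ('p \<Rightarrow> nat \<Rightarrow> real) \<Rightarrow> real" where
  "slope i k F x = F (upd i k 1 x) - F (upd i k 0 x)"

definition multiaffine :: "(('p \<Rightarrow> nat \<Rightarrow> real) \<Rightarrow> real) \<Rightarrow> bool" where
  "multiaffine F \<longleftrightarrow> (\<forall>i k x v. k \<in> J i \<longrightarrow> F (upd i k v x) = F (upd i k 0 x) + slope i k F x * v)"

lemma multiaffineD: "multiaffine F \<Longrightarrow> k \<in> J i \<Longrightarrow> F (upd i k v x) = F (upd i k 0 x) + slope i k F x * v"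
  unfolding multiaffine_def by blast

lemma slope_upd_same [simp]: "slope i k F (upd i k v x) = slope i k F x"
  by (simp add: slope_def)

lemma multiaffine_slope:
  assumes "multiaffine F"
  shows "multiaffine (slope i k F)"
  unfolding multiaffine_def
proof (intro allI impI)
  fix j l x v assume l: "l \<in> J j"
  show "slope i k F (upd j l v x) = slope i k F (upd j l 0 x) + slope j l (slope i k F) x * v"
  proof (cases "(i, k) = (j, l)")
    case True
    then show ?thesis by (simp add: slope_def)
  next
    case False
    have "F (upd i k c (upd j l v x)) = F (upd j l 0 (upd i k c x)) + slope j l F (upd i k c x) * v" for c
      unfolding upd_commute[OF False] by (rule multiaffineD[OF assms l])
    moreover have "slope j l (slope i k F) x = slope j l F (upd i k 1 x) - slope j l F (upd i k 0 x)"
      unfolding slope_def upd_commute[OF False] by simp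
    moreover have "slope i k F z = F (upd i k 1 z) - F (upd i k 0 z)" for z
      by (simp add: slope_def)
    moreover have "F (upd i k c (upd j l 0 x)) = F (upd j l 0 (upd i k c x))" for c
      unfolding upd_commute[OF False] ..
    ultimately show ?thesis by (simp only:) (simp add: algebra_simps)
  qed
qed

lemma slope_measurable:
  assumes "k \<in> J i" "F \<in> borel_measurable S"
  shows "slope i k F \<in> borel_measurable S"
  unfolding slope_def
  using measurable_compose[OF measurable_upd_const[OF assms(1)] assms(2)] by (intro borel_measurable_diff)

text \<open>Induction over the set \<open>C\<close> of coordinates on which \<open>F\<close>
  depends. Integrating one of them bounds the integral of \<open>psi (F x)\<close> by 9 times that
  of the slope, a nonzero multiaffine function of fewer coordinates; if the slope vanishes
  identically, \<open>F\<close> itself does not depend on that coordinate. A nonzero constant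
  remains at the end.\<close>

lemma psi_integral_finite_aux:
  assumes "finite C"
  shows "\<lbrakk>F \<in> borel_measurable S; multiaffine F; C \<subseteq> (SIGMA i:UNIV. J i); F x0 \<noteq> 0;
    \<And>x x'. (\<forall>(i, k)\<in>C. x i k = x' i k) \<Longrightarrow> F x = F x'\<rbrakk>
    \<Longrightarrow> (\<integral>\<^sup>+x. psi (F x) * indicator cube x \<partial>S) < \<infinity>"
  using assms
proof (induction C arbitrary: F x0)
  case empty
  have "psi (F x) * indicator cube x = psi (F x0) * indicator cube x" for x
    using empty.prems(5)[of x x0] by simp
  then have "(\<integral>\<^sup>+x. psi (F x) * indicator cube x \<partial>S) = (\<integral>\<^sup>+x. psi (F x0) * indicator cube x \<partial>S)"
    by (rule nn_integral_cong)
  also have "\<dots> = psi (F x0) * emeasure S cube"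
    by (rule nn_integral_cmult_indicator) measurable
  finally have "(\<integral>\<^sup>+x. psi (F x) * indicator cube x \<partial>S) = psi (F x0) * emeasure S cube" .
  also have "\<dots> < \<infinity>"
  proof (rule ennreal_mult_less_top[THEN iffD2, OF disjI2[OF disjI2[OF conjI]], unfolded infinity_ennreal_def[symmetric]])
    show "psi (F x0) < \<infinity>" using empty.prems(4) by (simp add: psi_def)
    show "emeasure S cube < \<infinity>" using emeasure_cube by (simp add: less_top order_le_less_trans)
  qed
  finally show ?case .
next
  case (insert c C)
  obtain i k where c: "c = (i, k)" by (cases c)
  have k: "k \<in> J i" using insert.prems(3) c by auto
  have C: "C \<subseteq> (SIGMA i:UNIV. J i)" using insert.prems(3) by auto
  show ?case
  proof (cases "\<forall>x. slope i k F x = 0")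
    case True
    have "F x = F x'" if "\<forall>(i, k)\<in>C. x i k = x' i k" for x x'
    proof -
      have "F (upd i k (x' i k) x) = F (upd i k (x i k) x)"
        using multiaffineD[OF insert.prems(2) k, of "x' i k" x] multiaffineD[OF insert.prems(2) k, of "x i k" x] True by simp
      moreover have "F (upd i k (x' i k) x) = F x'"
        using that insert.hyps c by (intro insert.prems(5)) (auto simp: upd_apply)
      ultimately show ?thesis by simp
    qed
    then show ?thesis by (rule insert.IH[OF insert.prems(1,2) C insert.prems(4)])
  next
    case False
    then obtain x1 where x1: "slope i k F x1 \<noteq> 0" by blast
    let ?b = "slope i k F"
    have bm: "?b \<in> borel_measurable S" by (rule slope_measurable[OF k insert.prems(1)])
    have "?b x = ?b x'" if "\<forall>(i, k)\<in>C. x i k = x' i k" for x x'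
    proof -
      have "F (upd i k v x) = F (upd i k v x')" for v
        using that insert.hyps c by (intro insert.prems(5)) (auto simp: upd_apply)
      then show ?thesis by (simp add: slope_def)
    qed
    then have IH: "(\<integral>\<^sup>+x. psi (?b x) * indicator cube x \<partial>S) < \<infinity>"
      by (rule insert.IH[OF bm multiaffine_slope[OF insert.prems(2)] C x1])
    have "(\<integral>\<^sup>+x. psi (F x) * indicator cube x \<partial>S) \<le> (\<integral>\<^sup>+x. 9 * (psi (?b x) * indicator cube x) \<partial>S)"
    proof (rule S_compare[OF k])
      show "(\<lambda>x. psi (F x) * indicator cube x) \<in> borel_measurable S" using insert.prems(1) by measurable
      show "(\<lambda>x. 9 * (psi (?b x) * indicator cube x)) \<in> borel_measurable S" using bm by measurable
      fix x assume x: "x \<in> space S"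
      show "(\<integral>\<^sup>+v. psi (F (upd i k v x)) * indicator cube (upd i k v x) \<partial>lborel)
        \<le> (\<integral>\<^sup>+v. 9 * (psi (?b (upd i k v x)) * indicator cube (upd i k v x)) \<partial>lborel)"
      proof (cases "upd i k 0 x \<in> cube")
        case True
        have ib: "indicator cube (upd i k v x) = (indicator {0..1} v :: ennreal)" for v
        proof -
          have "upd i k v x \<in> cube \<longleftrightarrow> v \<in> {0..1}"
          proof
            assume "upd i k v x \<in> cube"
            then show "v \<in> {0..1}" by (rule upd_cube_unit[OF _ k])
          next
            assume v: "v \<in> {0..1}"
            show "upd i k v x \<in> cube" by (rule upd_cube_iff[OF x k _ v, of 0, THEN iffD1, OF _ True]) simp
          qed
          then show ?thesis unfolding indicator_def by simp
        qed
        have "(\<integral>\<^sup>+v. psi (F (upd i k v x)) * indicator cube (upd i k v x) \<partial>lborel)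
           = (\<integral>\<^sup>+v. psi (F (upd i k 0 x) + ?b x * v) * indicator {0..1} v \<partial>lborel)"
          unfolding ib by (rule nn_integral_cong) (simp only: multiaffineD[OF insert.prems(2) k, of _ x, symmetric])
        also have "\<dots> \<le> 9 * psi (?b x)" by (rule psi_affine_integral)
        also have "\<dots> = (\<integral>\<^sup>+v. 9 * (psi (?b (upd i k v x)) * indicator cube (upd i k v x)) \<partial>lborel)"
          unfolding ib by (simp add: nn_integral_cmult mult.assoc[symmetric])
        finally show ?thesis .
      next
        case False
        have "upd i k v x \<notin> cube" for v
        proof
          assume v: "upd i k v x \<in> cube"
          have "upd i k 0 x \<in> cube"
            by (rule upd_cube_iff[OF x k upd_cube_unit[OF v k], of 0, THEN iffD1, OF _ v]) simp
          with False show False ..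
        qed
        then show ?thesis by simp
      qed
    qed
    also have "\<dots> = 9 * (\<integral>\<^sup>+x. psi (?b x) * indicator cube x \<partial>S)"
      by (intro nn_integral_cmult borel_measurable_times_ennreal measurable_compose[OF bm psi_measurable]
          borel_measurable_indicator cube_sets)
    also have "\<dots> < \<infinity>" using IH by (simp add: ennreal_mult_eq_top_iff less_top[symmetric])
    finally show ?thesis .
  qed
qed

text \<open>Markov's inequality for \<open>psi (F x)\<close>, which is at least
  \<open>e powr (-3/4)\<close> where \<open>\<bar>F x\<bar> < e\<close>.\<close>

lemma multiaffine_sublevel:
  assumes "F \<in> borel_measurable S" "multiaffine F" "F x0 \<noteq> 0"
    and "\<And>x x'. (\<And>i k. k \<in> J i \<Longrightarrow> x i k = x' i k) \<Longrightarrow> F x = F x'"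
  shows "\<exists>C::real. C \<ge> 0 \<and> (\<forall>e>0. emeasure S {x \<in> cube. \<bar>F x\<bar> < e} \<le> ennreal (C * e powr (3/4)))"
proof -
  let ?I = "\<integral>\<^sup>+x. psi (F x) * indicator cube x \<partial>S"
  have I: "?I < \<infinity>"
  proof (rule psi_integral_finite_aux[where C="SIGMA i:UNIV. J i" and ?x0.0=x0])
    fix x x' :: "'p \<Rightarrow> nat \<Rightarrow> real" assume "\<forall>(i, k)\<in>(SIGMA i:UNIV. J i). x i k = x' i k"
    then show "F x = F x'" by (intro assms(4)) auto
  qed (use assms(1-3) in auto)
  define C where "C = enn2real ?I"
  have C: "?I = ennreal C" using I by (simp add: C_def)
  have "emeasure S {x \<in> cube. \<bar>F x\<bar> < e} \<le> ennreal (C * e powr (3/4))" if e: "e > 0" for e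
  proof -
    have [measurable]: "{x \<in> cube. \<bar>F x\<bar> < e} \<in> sets S"
    proof -
      have "{x \<in> space S. \<bar>F x\<bar> < e} \<in> sets S" using assms(1) by measurable
      then have "cube \<inter> {x \<in> space S. \<bar>F x\<bar> < e} \<in> sets S" by (intro sets.Int cube_sets)
      moreover have "cube \<inter> {x \<in> space S. \<bar>F x\<bar> < e} = {x \<in> cube. \<bar>F x\<bar> < e}" by (auto simp: cube_def)
      ultimately show ?thesis by simp
    qed
    have "emeasure S {x \<in> cube. \<bar>F x\<bar> < e} = (\<integral>\<^sup>+x. indicator {x \<in> cube. \<bar>F x\<bar> < e} x \<partial>S)" by simp
    also have "\<dots> \<le> (\<integral>\<^sup>+x. ennreal (e powr (3/4)) * (psi (F x) * indicator cube x) \<partial>S)"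
    proof (intro nn_integral_mono)
      fix x
      show "indicator {x \<in> cube. \<bar>F x\<bar> < e} x \<le> ennreal (e powr (3/4)) * (psi (F x) * indicator cube x)"
      proof (cases "x \<in> cube \<and> \<bar>F x\<bar> < e")
        case True
        show ?thesis
        proof (cases "F x = 0")
          case True
          then show ?thesis using \<open>x \<in> cube \<and> \<bar>F x\<bar> < e\<close> e by (simp add: psi_def ennreal_mult_top)
        next
          case False
          have "1 = e powr (3/4) * e powr (-3/4)" using e by (simp add: powr_add[symmetric])
          also have "\<dots> \<le> e powr (3/4) * \<bar>F x\<bar> powr (-3/4)"
            using True False e by (intro mult_left_mono powr_mono2') auto
          finally have "1 \<le> ennreal (e powr (3/4)) * ennreal (\<bar>F x\<bar> powr (-3/4))"
            by (simp add: ennreal_mult[symmetric])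
          then show ?thesis using True False by (simp add: psi_def)
        qed
      qed auto
    qed
    also have "\<dots> = ennreal (e powr (3/4)) * ?I"
      by (intro nn_integral_cmult borel_measurable_times_ennreal measurable_compose[OF assms(1) psi_measurable]
          borel_measurable_indicator cube_sets)
    also have "\<dots> = ennreal (C * e powr (3/4))"
      unfolding C by (simp add: ennreal_mult'[symmetric] mult.commute C_def)
    finally show ?thesis .
  qed
  then show ?thesis by (intro exI[of _ C]) (auto simp: C_def)
qed

text \<open>Where the slope exceeds \<open>de\<close>, the condition
  \<open>\<bar>F x\<bar> < e\<close> cuts each line in a piece of length at most
  \<open>2 * e / de\<close>. The hypothesis \<open>indep\<close> makes \<open>B\<close> a cylinder
  in this coordinate over the unit interval, so the gain is relative to the measure of
  \<open>B\<close> and estimates for several coordinates can be multiplied.\<close>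

lemma strip_measure:
  assumes k: "k \<in> J i" and F: "F \<in> borel_measurable S" "multiaffine F" and e: "e > 0" and de: "de > 0"
    and B: "B \<in> sets S" "B \<subseteq> cube"
    and indep: "\<And>x v w. x \<in> space S \<Longrightarrow> v \<in> {0..1} \<Longrightarrow> w \<in> {0..1} \<Longrightarrow> upd i k v x \<in> B \<Longrightarrow> upd i k w x \<in> B"
  shows "emeasure S {x \<in> B. \<bar>F x\<bar> < e \<and> \<bar>slope i k F x\<bar> > de} \<le> ennreal (2 * e / de) * emeasure S B"
proof -
  let ?A = "{x \<in> B. \<bar>F x\<bar> < e \<and> \<bar>slope i k F x\<bar> > de}"
  have bm: "slope i k F \<in> borel_measurable S" by (rule slope_measurable[OF k F(1)])
  have A [measurable]: "?A \<in> sets S"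
  proof -
    have "{x \<in> space S. \<bar>F x\<bar> < e \<and> \<bar>slope i k F x\<bar> > de} \<in> sets S" using F(1) bm by measurable
    then have "B \<inter> {x \<in> space S. \<bar>F x\<bar> < e \<and> \<bar>slope i k F x\<bar> > de} \<in> sets S" using B by (intro sets.Int)
    moreover have "B \<inter> {x \<in> space S. \<bar>F x\<bar> < e \<and> \<bar>slope i k F x\<bar> > de} = ?A" using B(2) by (auto simp: cube_def)
    ultimately show ?thesis by simp
  qed
  have "emeasure S ?A = (\<integral>\<^sup>+x. indicator ?A x \<partial>S)" by simp
  also have "\<dots> \<le> (\<integral>\<^sup>+x. ennreal (2 * e / de) * indicator B x \<partial>S)"
  proof (rule S_compare[OF k])
    show "indicator ?A \<in> borel_measurable S" by measurable
    show "(\<lambda>x. ennreal (2 * e / de) * indicator B x) \<in> borel_measurable S" using B by measurable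
    fix x assume x: "x \<in> space S"
    show "(\<integral>\<^sup>+v. indicator ?A (upd i k v x) \<partial>lborel) \<le> (\<integral>\<^sup>+v. ennreal (2 * e / de) * indicator B (upd i k v x) \<partial>lborel)"
    proof (cases "upd i k 0 x \<in> B \<and> \<bar>slope i k F x\<bar> > de")
      case True
      have ib: "indicator B (upd i k v x) = (indicator {0..1} v :: ennreal)" for v
      proof -
        have "upd i k v x \<in> B \<longleftrightarrow> v \<in> {0..1}"
        proof
          assume "upd i k v x \<in> B"
          with B(2) show "v \<in> {0..1}" by (intro upd_cube_unit[OF _ k, of v x]) blast
        next
          assume v: "v \<in> {0..1}"
          show "upd i k v x \<in> B" by (rule indep[OF x _ v, of 0]) (use True in auto)
        qed
        then show ?thesis unfolding indicator_def by simp
      qed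
      have "(\<integral>\<^sup>+v. indicator ?A (upd i k v x) \<partial>lborel) \<le> (\<integral>\<^sup>+v. indicator {v. \<bar>F (upd i k 0 x) + slope i k F x * v\<bar> < e} v \<partial>lborel)"
        by (intro nn_integral_mono) (auto simp: multiaffineD[OF F(2) k, of _ x, symmetric] split: split_indicator)
      also have "\<dots> = emeasure lborel {v. \<bar>F (upd i k 0 x) + slope i k F x * v\<bar> < e}"
        by (intro nn_integral_indicator) measurable
      also have "\<dots> \<le> ennreal (2 * e / de)" using True de e by (intro emeasure_affine_strip) auto
      also have "\<dots> = (\<integral>\<^sup>+v. ennreal (2 * e / de) * indicator B (upd i k v x) \<partial>lborel)"
        unfolding ib by (simp add: nn_integral_cmult)
      finally show ?thesis .
    next
      case False
      have "upd i k v x \<notin> ?A" for v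
      proof
        assume v: "upd i k v x \<in> ?A"
        then have "v \<in> {0..1}" using B(2) by (intro upd_cube_unit[OF _ k, of v x]) blast
        then have "upd i k 0 x \<in> B" by (rule indep[OF x, of v 0]) (use v in auto)
        then show False using False v by auto
      qed
      then show ?thesis by simp
    qed
  qed
  also have "\<dots> = ennreal (2 * e / de) * emeasure S B" using B by (simp add: nn_integral_cmult)
  finally show ?thesis .
qed

end

section \<open>Duplicate actions and discrete schemes\<close>

text \<open>A weight that is constant on the classes of \<open>E\<close> sees a vector only through
  its class sums.\<close>

lemma sum_cong_class_sums:
  fixes v v' w :: "'b \<Rightarrow> real"
  assumes fin: "finite A" and E_refl: "\<And>a. a \<in> A \<Longrightarrow> E a a"
    and E_sym: "\<And>a b. E a b \<Longrightarrow> E b a" and E_trans: "\<And>a b c. E a b \<Longrightarrow> E b c \<Longrightarrow> E a c"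
    and w: "\<And>a b. a \<in> A \<Longrightarrow> b \<in> A \<Longrightarrow> E a b \<Longrightarrow> w a = w b"
    and eq: "\<And>a. a \<in> A \<Longrightarrow> (\<Sum>b\<in>{b\<in>A. E a b}. v b) = (\<Sum>b\<in>{b\<in>A. E a b}. v' b)"
  shows "(\<Sum>a\<in>A. v a * w a) = (\<Sum>a\<in>A. v' a * w a)"
proof -
  define N where "N a = real (card {b\<in>A. E a b})" for a
  \<comment> \<open>Every member \<open>b\<close> of a class receives the share
    \<open>w b / N b\<close> of the class sum, which avoids choosing representatives.\<close>
  have key: "(\<Sum>a\<in>A. f a * w a) = (\<Sum>b\<in>A. (w b / N b) * (\<Sum>a\<in>{a\<in>A. E b a}. f a))" for f :: "'b \<Rightarrow> real"
  proof -
    have "(\<Sum>b\<in>A. (w b / N b) * (\<Sum>a\<in>{a\<in>A. E b a}. f a)) = (\<Sum>b\<in>A. \<Sum>a\<in>A. if E b a then (w b / N b) * f a else 0)"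
    proof (intro sum.cong refl)
      fix b
      have "(w b / N b) * (\<Sum>a\<in>{a\<in>A. E b a}. f a) = (\<Sum>a\<in>{a\<in>A. E b a}. (w b / N b) * f a)"
        by (rule sum_distrib_left)
      also have "\<dots> = (\<Sum>a\<in>A. if E b a then (w b / N b) * f a else 0)"
        by (rule sum.inter_filter[OF fin])
      finally show "(w b / N b) * (\<Sum>a\<in>{a\<in>A. E b a}. f a) = (\<Sum>a\<in>A. if E b a then (w b / N b) * f a else 0)" .
    qed
    also have "\<dots> = (\<Sum>a\<in>A. \<Sum>b\<in>A. if E b a then (w b / N b) * f a else 0)" by (rule sum.swap)
    also have "\<dots> = (\<Sum>a\<in>A. \<Sum>b\<in>A. if E a b then (w a / N a) * f a else 0)"
    proof (intro sum.cong refl)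
      fix a b assume ab: "a \<in> A" "b \<in> A"
      have "E b a = E a b" using E_sym by blast
      moreover have "N b = N a \<and> w b = w a" if "E a b"
      proof -
        have "{c\<in>A. E a c} = {c\<in>A. E b c}" using that E_sym E_trans by blast
        then show ?thesis using w[OF ab that] by (simp add: N_def)
      qed
      ultimately show "(if E b a then (w b / N b) * f a else 0) = (if E a b then (w a / N a) * f a else 0)" by auto
    qed
    also have "\<dots> = (\<Sum>a\<in>A. N a * ((w a / N a) * f a))"
      unfolding sum.inter_filter[OF fin, symmetric] by (simp add: N_def)
    also have "\<dots> = (\<Sum>a\<in>A. f a * w a)"
    proof (intro sum.cong refl)
      fix a assume "a \<in> A"
      then have "N a \<noteq> 0" using E_refl fin by (auto simp: N_def)
      then show "N a * ((w a / N a) * f a) = f a * w a" by simp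
    qed
    finally show ?thesis by simp
  qed
  show ?thesis unfolding key[of v] key[of v'] using eq by (intro sum.cong refl) simp
qed

section \<open>Duplicate actions and closedness of best responses\<close>

context finite_game
begin

definition dup :: "'p \<Rightarrow> 'a \<Rightarrow> 'a \<Rightarrow> bool" where
  "dup i a b \<longleftrightarrow> (\<forall>s\<in>PP. u (s(i := a)) = u (s(i := b)))"

definition class_mass :: "'p \<Rightarrow> 'a \<Rightarrow> ('p \<Rightarrow> 'a \<Rightarrow> real) \<Rightarrow> real" where
  "class_mass i a m = (\<Sum>b\<in>{b\<in>Y i. dup i a b}. m i b)"

text \<open>
  Duplicate actions leave the split of mass between them undetermined, so trajectories can be
  unique only up to this equivalence.
\<close>

definition eqv :: "('p \<Rightarrow> 'a \<Rightarrow> real) \<Rightarrow> ('p \<Rightarrow> 'a \<Rightarrow> real) \<Rightarrow> bool" where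
  "eqv m m' \<longleftrightarrow> (\<forall>i. \<forall>a\<in>Y i. class_mass i a m = class_mass i a m')"

lemma dup_refl [simp]: "dup i a a" and dup_sym: "dup i a b \<Longrightarrow> dup i b a"
  and dup_trans: "dup i a b \<Longrightarrow> dup i b c \<Longrightarrow> dup i a c"
  by (auto simp: dup_def)

lemma eqv_refl [simp]: "eqv m m" and eqv_sym: "eqv m m' \<Longrightarrow> eqv m' m"
  and eqv_trans: "eqv m m' \<Longrightarrow> eqv m' m'' \<Longrightarrow> eqv m m''"
  by (auto simp: eqv_def)

lemma PP_upd: "s \<in> PP \<Longrightarrow> a \<in> Y i \<Longrightarrow> s(i := a) \<in> PP"
  unfolding pure_profiles_def mem_Collect_eq by simp

text \<open>All payoffs of player \<open>i\<close> are written over the same profiles, those with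
  \<open>s i = c\<close>, so that two actions can be compared term by term.\<close>

lemma pay_alt:
  assumes "a \<in> Y i" "c \<in> Y i"
  shows "pay i a m = (\<Sum>s\<in>{s\<in>PP. s i = c}. u (s(i := a)) * (\<Prod>j\<in>UNIV - {i}. m j (s j)))"
proof -
  have "pay i a m = (\<Sum>s\<in>PP. if s i = a then u s * (\<Prod>j\<in>UNIV - {i}. m j (s j)) else 0)"
    unfolding pay_def U_upd_eq by (intro sum.cong) (auto simp: ind_def)
  also have "\<dots> = (\<Sum>s\<in>{s\<in>PP. s i = a}. u s * (\<Prod>j\<in>UNIV - {i}. m j (s j)))"
    by (simp add: sum.inter_filter)
  also have "\<dots> = (\<Sum>s\<in>{s\<in>PP. s i = c}. u (s(i := a)) * (\<Prod>j\<in>UNIV - {i}. m j (s j)))"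
  proof (rule sum.reindex_bij_witness[where i="\<lambda>s. s(i := a)" and j="\<lambda>s. s(i := c)"])
    fix s assume s: "s \<in> {s\<in>PP. s i = a}"
    then have "s(i := c, i := a) = s" by auto
    then show "s(i := c, i := a) = s" .
    show "s(i := c) \<in> {s\<in>PP. s i = c}" using s assms by (simp add: PP_upd)
    have "(\<Prod>j\<in>UNIV - {i}. m j ((s(i := c)) j)) = (\<Prod>j\<in>UNIV - {i}. m j (s j))"
      by (intro prod.cong) auto
    then show "u (s(i := c, i := a)) * (\<Prod>j\<in>UNIV - {i}. m j ((s(i := c)) j)) = u s * (\<Prod>j\<in>UNIV - {i}. m j (s j))"
      using s by auto
  next
    fix s assume s: "s \<in> {s\<in>PP. s i = c}"
    then show "s(i := a, i := c) = s" by auto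
    show "s(i := a) \<in> {s\<in>PP. s i = a}" using s assms by (simp add: PP_upd)
  qed
  finally show ?thesis .
qed

lemma pay_dup: "a \<in> Y i \<Longrightarrow> b \<in> Y i \<Longrightarrow> dup i a b \<Longrightarrow> pay i a m = pay i b m"
  unfolding pay_alt[of a i a m] pay_alt[of b i a m] by (intro sum.cong) (auto simp: dup_def)

lemma d_dup: "a \<in> Y i \<Longrightarrow> b \<in> Y i \<Longrightarrow> dup i a b \<Longrightarrow> d i a b m = 0"
  using pay_dup[of a i b m] by (simp add: d_def)

text \<open>The players' components are exchanged one at a time; \<open>U\<close> is linear in each,
  with coefficients that agree on duplicates.\<close>

lemma eqv_U:
  assumes "eqv m m'"
  shows "U m = U m'"
proof -
  define M where "M B = (\<lambda>j. if j \<in> B then m' j else m j)" for B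
  have "U (M B) = U m" if "finite B" for B :: "'p set"
    using that
  proof induction
    case empty
    then show ?case by (simp add: M_def)
  next
    case (insert i B)
    have "M (insert i B) = (M B)(i := m' i)" by (auto simp: M_def)
    then have "U (M (insert i B)) = (\<Sum>a\<in>Y i. m' i a * pay i a (M B))" by (simp add: U_upd_pay)
    also have "\<dots> = (\<Sum>a\<in>Y i. m i a * pay i a (M B))"
    proof (rule sum_cong_class_sums[where E="dup i", OF fin dup_refl dup_sym dup_trans pay_dup])
      fix a assume "a \<in> Y i"
      then show "(\<Sum>b\<in>{b\<in>Y i. dup i a b}. m' i b) = (\<Sum>b\<in>{b\<in>Y i. dup i a b}. m i b)"
        using assms by (simp add: eqv_def class_mass_def)
    qed
    also have "\<dots> = (\<Sum>a\<in>Y i. M B i a * pay i a (M B))" using insert.hyps by (simp add: M_def)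
    also have "\<dots> = U (M B)" by (rule U_pay[symmetric])
    finally show ?case using insert.IH by simp
  qed
  from this[of UNIV] show ?thesis by (simp add: M_def)
qed

lemma eqv_upd: "eqv m m' \<Longrightarrow> eqv (m(i := v)) (m'(i := v))"
  by (auto simp: eqv_def class_mass_def)

lemma eqv_pay: "eqv m m' \<Longrightarrow> pay i a m = pay i a m'"
  unfolding pay_def by (intro eqv_U eqv_upd)

lemma eqv_d: "eqv m m' \<Longrightarrow> d i a b m = d i a b m'"
  by (simp add: d_def eqv_pay[of m m'])

lemma eqv_br: "eqv m m' \<Longrightarrow> br i m = br i m'"
  by (simp add: br_def eqv_pay[of m m'])

lemma eqv_coordwise: "(\<And>i a. a \<in> Y i \<Longrightarrow> m i a = m' i a) \<Longrightarrow> eqv m m'"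
  unfolding eqv_def class_mass_def by (intro allI ballI sum.cong) auto

lemma br_cong: "(\<And>i a. a \<in> Y i \<Longrightarrow> m i a = m' i a) \<Longrightarrow> br i m = br i m'"
  by (intro eqv_br eqv_coordwise)

lemma sx_cong:
  assumes "\<And>i a. a \<in> Y i \<Longrightarrow> m i a = m' i a"
  shows "sx m = sx m'"
proof -
  have "sum (m i) (Y i) = sum (m' i) (Y i)" for i using assms by (intro sum.cong) auto
  then show ?thesis using assms by (simp add: sx_def)
qed

text \<open>The closed graph property of best responses, in the filter form needed for cluster
  points.\<close>

lemma br_closed:
  assumes "((\<lambda>x. dm z (g x)) \<longlongrightarrow> 0) F" "F \<noteq> bot" "eventually (\<lambda>x. bnd (g x) \<and> a \<in> br i (g x)) F" "bnd z"
  shows "a \<in> br i z"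
proof -
  have lim: "((\<lambda>x. pay i b (g x)) \<longlongrightarrow> pay i b z) F" for b
  proof -
    have "((\<lambda>x. pay i b (g x) - pay i b z) \<longlongrightarrow> 0) F"
    proof (rule Lim_null_comparison)
      show "eventually (\<lambda>x. norm (pay i b (g x) - pay i b z) \<le> K * dm z (g x)) F"
        using assms(3) by eventually_elim (use pay_lipschitz[OF assms(4)] in simp)
      show "((\<lambda>x. K * dm z (g x)) \<longlongrightarrow> 0) F" using tendsto_mult_right_zero[OF assms(1)] by simp
    qed
    then show ?thesis by (simp add: LIM_zero_iff)
  qed
  have aY: "a \<in> Y i"
  proof -
    have "eventually (\<lambda>x. a \<in> Y i) F" using assms(3) by (rule eventually_mono) (simp add: br_def)
    then show ?thesis using assms(2) by (simp add: eventually_const)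
  qed
  have "pay i b z \<le> pay i a z" if b: "b \<in> Y i" for b
  proof (rule tendsto_le[OF assms(2) lim lim])
    show "eventually (\<lambda>x. pay i b (g x) \<le> pay i a (g x)) F"
      using assms(3) by (rule eventually_mono) (use b in \<open>simp add: br_def\<close>)
  qed
  with aY show ?thesis by (simp add: br_def)
qed

lemma U_measurable:
  assumes "\<And>i a. a \<in> Y i \<Longrightarrow> (\<lambda>x. f x i a) \<in> borel_measurable M"
  shows "(\<lambda>x. U (f x)) \<in> borel_measurable M"
  unfolding U_def using assms by (intro borel_measurable_sum borel_measurable_times borel_measurable_const borel_measurable_prod) auto

lemma pay_measurable:
  assumes "\<And>i a. a \<in> Y i \<Longrightarrow> (\<lambda>x. f x i a) \<in> borel_measurable M"
  shows "(\<lambda>x. pay i a (f x)) \<in> borel_measurable M"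
  unfolding pay_def
proof (rule U_measurable)
  fix j b assume "b \<in> Y j"
  then show "(\<lambda>x. ((f x)(i := ind a)) j b) \<in> borel_measurable M" using assms by (cases "j = i") auto
qed

lemma d_measurable:
  assumes "\<And>i a. a \<in> Y i \<Longrightarrow> (\<lambda>x. f x i a) \<in> borel_measurable M"
  shows "(\<lambda>x. d i a b (f x)) \<in> borel_measurable M"
  unfolding d_def using assms by (intro borel_measurable_diff pay_measurable)

end

section \<open>Coordinates, measurable selection and single-player moves\<close>

locale labeled_game = finite_game Y u
  for Y :: "'p::finite \<Rightarrow> 'a set" and u :: "('p \<Rightarrow> 'a) \<Rightarrow> real" +
  fixes y :: "'p \<Rightarrow> nat \<Rightarrow> 'a"
  assumes lab: "labeling Y y"
begin

abbreviation mass :: "('p \<Rightarrow> nat \<Rightarrow> real) \<Rightarrow> 'p \<Rightarrow> 'a \<Rightarrow> real" where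
  "mass x \<equiv> (\<lambda>i. mixture (Y i) (y i) (x i))"

abbreviation X :: "('p \<Rightarrow> nat \<Rightarrow> real) set" where "X \<equiv> strategies Y"

lemma bij: "bij_betw (y i) {1..card (Y i)} (Y i)"
  using lab by (simp add: labeling_def)

lemma card_pos: "card (Y i) \<ge> 1"
  by (simp add: Suc_le_eq card_gt_0_iff)

lemma J_Suc: "k \<in> J i \<Longrightarrow> Suc k \<in> {1..card (Y i)}"
  by (auto simp: J_def)

lemma y_mem: "n \<in> {1..card (Y i)} \<Longrightarrow> y i n \<in> Y i"
  using bij[of i] by (auto simp: bij_betw_def)

lemma y_inj: "n \<in> {1..card (Y i)} \<Longrightarrow> n' \<in> {1..card (Y i)} \<Longrightarrow> y i n = y i n' \<Longrightarrow> n = n'"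
  using inj_onD[OF bij_betw_imp_inj_on[OF bij[of i]], of n n'] by blast

lemma y1_mem [simp]: "y i (Suc 0) \<in> Y i"
  using y_mem[of 1 i] card_pos[of i] by simp

lemma y_surj: "a \<in> Y i \<Longrightarrow> \<exists>n. n \<in> {1..card (Y i)} \<and> a = y i n"
  using bij[of i] unfolding bij_betw_def by (metis imageE)

lemma inv_y: "n \<in> {1..card (Y i)} \<Longrightarrow> inv_into {1..card (Y i)} (y i) (y i n) = n"
  by (rule inv_into_f_f[OF bij_betw_imp_inj_on[OF bij]])

lemma mixture_Suc: "k \<in> J i \<Longrightarrow> mixture (Y i) (y i) z (y i (Suc k)) = z k"
  unfolding mixture_def Let_def inv_y[OF J_Suc] by (auto simp: J_def)

lemma mixture_1: "mixture (Y i) (y i) z (y i (Suc 0)) = 1 - (\<Sum>k\<in>J i. z k)"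
  using inv_y[of 1 i] card_pos[of i] by (simp add: mixture_def Let_def J_def)

lemma action_cases:
  assumes "a \<in> Y i"
  obtains "a = y i (Suc 0)" | k where "k \<in> J i" "a = y i (Suc k)"
proof -
  obtain n where n: "n \<in> {1..card (Y i)}" "a = y i n"
    using y_surj[OF assms] by blast
  show thesis
  proof (cases "n = 1")
    case True
    then show ?thesis using that(1) n by simp
  next
    case False
    then have "n - 1 \<in> J i" "a = y i (Suc (n - 1))" using n by (auto simp: J_def)
    then show ?thesis by (rule that(2))
  qed
qed

lemma sum_Y: "(\<Sum>a\<in>Y i. f a) = f (y i (Suc 0)) + (\<Sum>k\<in>J i. f (y i (Suc k)))"
proof -
  have "(\<Sum>a\<in>Y i. f a) = (\<Sum>n\<in>{1..card (Y i)}. f (y i n))"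
    by (rule sum.reindex_bij_betw[OF bij, symmetric])
  also have "{1..card (Y i)} = insert 1 (Suc ` J i)"
    using card_pos[of i] by (auto simp: J_def image_iff Bex_def)
  also have "(\<Sum>n\<in>insert 1 (Suc ` J i). f (y i n)) = f (y i (Suc 0)) + (\<Sum>n\<in>Suc ` J i. f (y i n))"
    by (subst sum.insert) (auto simp: J_def)
  also have "(\<Sum>n\<in>Suc ` J i. f (y i n)) = (\<Sum>k\<in>J i. f (y i (Suc k)))"
    by (subst sum.reindex) (auto simp: inj_on_def)
  finally show ?thesis .
qed

lemma sum_mass: "(\<Sum>a\<in>Y i. mass x i a) = 1"
  unfolding sum_Y by (simp add: mixture_1 mixture_Suc)

lemma expectation_U: "expectation Y y u x = U (mass x)"
  by (simp add: expectation_def U_def)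

lemma mass_upd: "mass (x(i := z)) = (mass x)(i := mixture (Y i) (y i) z)"
  by (auto simp: fun_eq_iff)

lemma X_iff: "x \<in> X \<longleftrightarrow> x \<in> space S \<and> sx (mass x)"
proof -
  have "(\<forall>a\<in>Y i. 0 \<le> mass x i a) \<longleftrightarrow> (\<forall>k\<in>J i. 0 \<le> x i k) \<and> (\<Sum>k\<in>J i. x i k) \<le> 1" for i
  proof
    assume *: "\<forall>a\<in>Y i. 0 \<le> mass x i a"
    have "0 \<le> x i k" if "k \<in> J i" for k
      using bspec[OF * y_mem[OF J_Suc[OF that]]] mixture_Suc[OF that, of "x i"] by simp
    moreover have "(\<Sum>k\<in>J i. x i k) \<le> 1" using bspec[OF * y1_mem] by (simp add: mixture_1)
    ultimately show "(\<forall>k\<in>J i. 0 \<le> x i k) \<and> (\<Sum>k\<in>J i. x i k) \<le> 1" by blast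
  next
    assume *: "(\<forall>k\<in>J i. 0 \<le> x i k) \<and> (\<Sum>k\<in>J i. x i k) \<le> 1"
    show "\<forall>a\<in>Y i. 0 \<le> mass x i a"
    proof
      fix a assume "a \<in> Y i"
      then show "0 \<le> mass x i a" by (cases rule: action_cases) (use * in \<open>auto simp: mixture_1 mixture_Suc\<close>)
    qed
  qed
  then show ?thesis
    unfolding sx_def sum_mass strategies_def mixed_strategies_def space_S J_def[symmetric] by auto
qed

lemma X_sx: "x \<in> X \<Longrightarrow> sx (mass x)" and X_space: "x \<in> X \<Longrightarrow> x \<in> space S"
  by (simp_all add: X_iff)

lemma X_cube: "X \<subseteq> cube"
proof
  fix x assume x: "x \<in> X"
  have "0 \<le> x i k \<and> x i k \<le> 1" if k: "k \<in> J i" for i k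
    using sx_nonneg[OF X_sx[OF x] y_mem[OF J_Suc[OF k]]] sx_le_1[OF X_sx[OF x] y_mem[OF J_Suc[OF k]]]
    by (simp add: mixture_Suc[OF k])
  then show "x \<in> cube" using X_space[OF x] by (simp add: cube_def)
qed

lemma mass_measurable: "a \<in> Y i \<Longrightarrow> (\<lambda>x. mass x i a) \<in> borel_measurable S"
proof -
  assume a: "a \<in> Y i"
  then show ?thesis
  proof (cases rule: action_cases)
    case 1
    then show ?thesis unfolding 1 mixture_1 using measurable_coord
      by (intro borel_measurable_diff borel_measurable_const borel_measurable_sum) auto
  next
    case (2 k)
    then show ?thesis unfolding 2(2) mixture_Suc[OF 2(1)] by (intro measurable_coord)
  qed
qed

lemma X_sets: "X \<in> sets S"
proof -
  have "X = {x \<in> space S. \<forall>i. \<forall>a\<in>Y i. 0 \<le> mass x i a}"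
    by (simp only: set_eq_iff mem_Collect_eq X_iff sx_def sum_mass) simp
  also have "\<dots> = (\<Inter>i\<in>UNIV. {x \<in> space S. \<forall>a\<in>Y i. 0 \<le> mass x i a})" by auto
  also have "\<dots> \<in> sets S"
  proof (rule sets.finite_INT)
    fix i
    show "{x \<in> space S. \<forall>a\<in>Y i. 0 \<le> mass x i a} \<in> sets S"
    proof (rule sets.sets_Collect_finite_All)
      fix a assume a: "a \<in> Y i"
      note mass_measurable[OF a, measurable]
      show "{x \<in> space S. 0 \<le> mass x i a} \<in> sets S" by measurable
    qed simp
  qed auto
  finally show ?thesis .
qed

lemma mass_tendsto:
  assumes "\<And>i k. k \<in> J i \<Longrightarrow> ((\<lambda>n. f n i k) \<longlongrightarrow> l i k) F" "a \<in> Y i"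
  shows "((\<lambda>n. mass (f n) i a) \<longlongrightarrow> mass l i a) F"
  using assms(2)
proof (cases rule: action_cases)
  case 1
  show ?thesis unfolding 1 mixture_1 using assms(1) by (intro tendsto_intros) auto
next
  case (2 k)
  show ?thesis unfolding 2(2) mixture_Suc[OF 2(1)] using assms(1) 2(1) by blast
qed

text \<open>Breaking ties by the smallest label makes the selection measurable, and it depends only
  on the masses of the other players.\<close>

definition sel :: "'p \<Rightarrow> ('p \<Rightarrow> 'a \<Rightarrow> real) \<Rightarrow> 'a" where
  "sel i m = y i (LEAST n. n \<in> {1..card (Y i)} \<and> y i n \<in> br i m)"

lemma sel_index:
  "(LEAST n. n \<in> {1..card (Y i)} \<and> y i n \<in> br i m) \<in> {1..card (Y i)} \<and> sel i m \<in> br i m"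
proof -
  obtain a where a: "a \<in> br i m" using br_ne by blast
  then have "a \<in> Y i" using br_subset by blast
  then obtain n where "n \<in> {1..card (Y i)}" "a = y i n" using y_surj by blast
  then have "\<exists>n. n \<in> {1..card (Y i)} \<and> y i n \<in> br i m" using a by blast
  from LeastI_ex[OF this] show ?thesis by (simp add: sel_def)
qed

lemma sel_br: "sel i m \<in> br i m" and sel_Y [simp]: "sel i m \<in> Y i"
  using sel_index br_subset by blast+

lemma sel_eq_iff:
  assumes n: "n \<in> {1..card (Y i)}"
  shows "sel i m = y i n \<longleftrightarrow> y i n \<in> br i m \<and> (\<forall>n'\<in>{1..<n}. y i n' \<notin> br i m)"
proof
  let ?P = "\<lambda>n. n \<in> {1..card (Y i)} \<and> y i n \<in> br i m"
  assume s: "sel i m = y i n"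
  then have L: "(LEAST n. ?P n) = n" using y_inj[OF conjunct1[OF sel_index] n] by (simp add: sel_def)
  have "y i n' \<notin> br i m" if "n' \<in> {1..<n}" for n'
    using not_less_Least[of n' ?P] that n L by auto
  then show "y i n \<in> br i m \<and> (\<forall>n'\<in>{1..<n}. y i n' \<notin> br i m)" using sel_br[of i m] s by auto
next
  let ?P = "\<lambda>n. n \<in> {1..card (Y i)} \<and> y i n \<in> br i m"
  assume s: "y i n \<in> br i m \<and> (\<forall>n'\<in>{1..<n}. y i n' \<notin> br i m)"
  have "(LEAST n. ?P n) = n"
  proof (rule Least_equality)
    show "?P n" using s n by simp
    fix n' assume "?P n'"
    then show "n \<le> n'" using s by (meson atLeastAtMost_iff atLeastLessThan_iff not_le)
  qed
  then show "sel i m = y i n" by (simp add: sel_def)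
qed

lemma br_sets: "{x \<in> space S. a \<in> br i (mass x)} \<in> sets S"
proof (cases "a \<in> Y i")
  case True
  have "{x \<in> space S. a \<in> br i (mass x)} = {x \<in> space S. \<forall>b\<in>Y i. pay i b (mass x) \<le> pay i a (mass x)}"
    using True by (auto simp: br_def)
  also have "\<dots> \<in> sets S"
  proof (rule sets.sets_Collect_finite_All)
    fix b
    note pay_measurable[OF mass_measurable, measurable]
    show "{x \<in> space S. pay i b (mass x) \<le> pay i a (mass x)} \<in> sets S" by measurable
  qed simp
  finally show ?thesis .
qed (simp add: br_def)

lemma sel_sets: "a \<in> Y i \<Longrightarrow> {x \<in> space S. sel i (mass x) = a} \<in> sets S"
proof -
  assume "a \<in> Y i"
  then obtain n where n: "n \<in> {1..card (Y i)}" "a = y i n" using y_surj by blast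
  have "{x \<in> space S. sel i (mass x) = a} = {x \<in> space S. y i n \<in> br i (mass x)} \<inter>
      (\<Inter>n'\<in>{1..<n}. space S - {x \<in> space S. y i n' \<in> br i (mass x)}) \<inter> space S"
    unfolding n(2) sel_eq_iff[OF n(1)] by auto
  also have "\<dots> = {x \<in> space S. y i n \<in> br i (mass x)} - (\<Union>n'\<in>{1..<n}. {x \<in> space S. y i n' \<in> br i (mass x)})"
    by auto
  also have "\<dots> \<in> sets S"
    using br_sets by (intro sets.Diff sets.finite_UN) auto
  finally show ?thesis .
qed

text \<open>One player moves the fraction \<open>th\<close> towards a pure best response while the
  others stay fixed. In that player's coordinates this is a contraction by \<open>1 - th\<close> and
  a shift determined by the others.\<close>

definition step :: "real \<Rightarrow> 'p \<Rightarrow> ('p \<Rightarrow> nat \<Rightarrow> real) \<Rightarrow> 'p \<Rightarrow> nat \<Rightarrow> real" where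
  "step th i x = x(i := \<lambda>k\<in>J i. (1 - th) * x i k + th * ind (sel i (mass x)) (y i (Suc k)))"

lemma mass_step:
  assumes "a \<in> Y j"
  shows "mass (step th i x) j a = (if j = i then (1 - th) * mass x i a + th * ind (sel i (mass x)) a else mass x j a)"
proof (cases "j = i")
  case True
  have a: "a \<in> Y i" using assms True by simp
  then show ?thesis
  proof (cases rule: action_cases)
    case 1
    have "1 = (\<Sum>b\<in>Y i. ind (sel i (mass x)) b)" by (simp add: ind_def)
    then have *: "ind (sel i (mass x)) (y i (Suc 0)) = 1 - (\<Sum>k\<in>J i. ind (sel i (mass x)) (y i (Suc k)))"
      unfolding sum_Y by simp
    have e: "(\<Sum>k\<in>J i. step th i x i k) =
        (1 - th) * (\<Sum>k\<in>J i. x i k) + th * (\<Sum>k\<in>J i. ind (sel i (mass x)) (y i (Suc k)))"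
      by (simp add: step_def sum.distrib sum_distrib_left)
    show ?thesis unfolding 1 True mixture_1 e * by (simp add: algebra_simps)
  next
    case (2 k)
    show ?thesis unfolding 2(2) True step_def by (simp add: mixture_Suc 2(1))
  qed
qed (simp add: step_def)

lemma step_X:
  assumes "x \<in> X" "0 \<le> th" "th \<le> 1"
  shows "step th i x \<in> X"
proof -
  have sp: "step th i x \<in> space S" using X_space[OF assms(1)] by (auto simp: space_S step_def)
  have "0 \<le> mass (step th i x) j a" if "a \<in> Y j" for j a
    unfolding mass_step[OF that] using assms sx_nonneg[OF X_sx[OF assms(1)]] that by (auto simp: ind_def)
  then show ?thesis using sp by (simp add: X_iff sx_def sum_mass)
qed

lemma step_dm:
  assumes "x \<in> X" "0 \<le> th" "th \<le> 1"
  shows "dm (mass x) (mass (step th i x)) \<le> NY * th"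
proof (rule dm_le_NY)
  fix j a assume a: "a \<in> Y j"
  have m: "0 \<le> mass x i a" "mass x i a \<le> 1" if "j = i"
    using sx_nonneg[OF X_sx[OF assms(1)]] sx_le_1[OF X_sx[OF assms(1)]] a that by auto
  have "\<bar>th * (ind (sel i (mass x)) a - mass x i a)\<bar> \<le> th * 1" if "j = i"
    unfolding abs_mult using m[OF that] assms by (intro mult_mono) (auto simp: ind_def)
  then show "\<bar>mass (step th i x) j a - mass x j a\<bar> \<le> th"
    unfolding mass_step[OF a] using assms by (auto simp: algebra_simps)
qed

lemma step_measurable: "step th i \<in> measurable S S"
  and step_shift_measurable: "k \<in> J i \<Longrightarrow> (\<lambda>x. th * ind (sel i (mass x)) (y i (Suc k))) \<in> borel_measurable S"
proof -
  have *: "(\<lambda>x. ind (sel i (mass x)) (y i (Suc k))) \<in> borel_measurable S" if k: "k \<in> J i" for k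
  proof -
    have "{x \<in> space S. sel i (mass x) = y i (Suc k)} \<in> sets S" using y_mem[OF J_Suc[OF k]] by (rule sel_sets)
    then have "(\<lambda>x. if sel i (mass x) = y i (Suc k) then 1 else 0 :: real) \<in> borel_measurable S"
      by (intro measurable_If) auto
    then show ?thesis unfolding ind_def by (simp add: eq_commute)
  qed
  then show "k \<in> J i \<Longrightarrow> (\<lambda>x. th * ind (sel i (mass x)) (y i (Suc k))) \<in> borel_measurable S" by auto
  show "step th i \<in> measurable S S"
  proof (rule measurable_into_S)
    fix j l assume l: "l \<in> J j"
    show "(\<lambda>x. step th i x j l) \<in> borel_measurable S"
      using l measurable_coord[OF l] *[of l] by (cases "j = i") (auto simp: step_def)
  next
    fix x j assume "x \<in> space S"
    then show "step th i x j \<in> extensional (J j)" by (auto simp: step_def space_S)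
  qed
qed

lemma step_measure:
  assumes "th < 1" "A \<in> sets S"
  shows "emeasure S (step th i -` A \<inter> space S) \<le> ennreal ((1 / (1 - th)) ^ card (J i)) * emeasure S A"
proof -
  have m: "step th i -` A \<inter> space S \<in> sets S" by (rule measurable_sets[OF step_measurable assms(2)])
  then have "emeasure S (step th i -` A \<inter> space S) = (\<integral>\<^sup>+x. indicator (step th i -` A \<inter> space S) x \<partial>S)" by simp
  also have "\<dots> = (\<integral>\<^sup>+x. indicator A (step th i x) \<partial>S)"
    by (intro nn_integral_cong) (auto split: split_indicator)
  also have "\<dots> = (\<integral>\<^sup>+x. indicator A (x(i := \<lambda>k\<in>J i. (1 - th) * x i k + th * ind (sel i (mass x)) (y i (Suc k)))) \<partial>S)"
    unfolding step_def ..
  also have "\<dots> \<le> ennreal ((1 / (1 - th)) ^ card (J i)) * (\<integral>\<^sup>+x. indicator A x \<partial>S)"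
  proof (rule shift_integral[where w="\<lambda>x k. th * ind (sel i (mass x)) (y i (Suc k))"])
    show "indicator A \<in> borel_measurable S" using assms(2) by simp
    show "(\<lambda>x. th * ind (sel i (mass x)) (y i (Suc k))) \<in> borel_measurable S" if "k \<in> J i" for k
      using that by (rule step_shift_measurable)
    \<comment> \<open>The selection does not change with player \<open>i\<close>'s own coordinates;
      this is what makes the move a shear followed by a contraction.\<close>
    show "(\<lambda>k. th * ind (sel i (mass (x(i := z)))) (y i (Suc k))) = (\<lambda>k. th * ind (sel i (mass x)) (y i (Suc k)))" for x z
      unfolding mass_upd sel_def by simp
  qed (use assms in auto)
  finally show ?thesis using assms(2) by simp
qed

text \<open>The players move in sequence, each reacting to the already updated state. A simultaneous
  move would not have this shear structure, and its volume distortion could not be read off.\<close>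

primrec sweep :: "real \<Rightarrow> 'p list \<Rightarrow> ('p \<Rightarrow> nat \<Rightarrow> real) \<Rightarrow> 'p \<Rightarrow> nat \<Rightarrow> real" where
  "sweep th [] x = x"
| "sweep th (i # is) x = sweep th is (step th i x)"

lemma sweep_X: "x \<in> X \<Longrightarrow> 0 \<le> th \<Longrightarrow> th \<le> 1 \<Longrightarrow> sweep th is x \<in> X"
  by (induction "is" arbitrary: x) (auto simp: step_X)

lemma sweep_untouched: "j \<notin> set is \<Longrightarrow> a \<in> Y j \<Longrightarrow> mass (sweep th is x) j a = mass x j a"
  by (induction "is" arbitrary: x) (auto simp: mass_step)

text \<open>Player \<open>j\<close> responds to an intermediate state \<open>z\<close> of the sweep,
  which has moved from the initial one by at most \<open>NY * th\<close> per player. In the limit of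
  small \<open>th\<close> the sequential order is therefore harmless.\<close>

lemma sweep_touched:
  assumes "0 \<le> th" "th \<le> 1"
  shows "x \<in> X \<Longrightarrow> distinct is \<Longrightarrow> j \<in> set is \<Longrightarrow>
    \<exists>z\<in>X. \<exists>a. a \<in> br j (mass z) \<and> dm (mass x) (mass z) \<le> NY * th * length is \<and>
      (\<forall>b\<in>Y j. mass (sweep th is x) j b = (1 - th) * mass x j b + th * ind a b)"
proof (induction "is" arbitrary: x)
  case Nil
  then show ?case by simp
next
  case (Cons i "is")
  show ?case
  proof (cases "j = i")
    case True
    have "j \<notin> set is" using Cons.prems True by simp
    then have "\<forall>b\<in>Y j. mass (sweep th (i # is) x) j b = (1 - th) * mass x j b + th * ind (sel j (mass x)) b"
      using True by (simp add: sweep_untouched mass_step)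
    moreover have "dm (mass x) (mass x) \<le> NY * th * length (i # is)" using assms by simp
    ultimately show ?thesis using sel_br[of j "mass x"] Cons.prems(1) by blast
  next
    case False
    have "step th i x \<in> X" using step_X[OF Cons.prems(1) assms] .
    then obtain z a where z: "z \<in> X" "a \<in> br j (mass z)" "dm (mass (step th i x)) (mass z) \<le> NY * th * length is"
      "\<forall>b\<in>Y j. mass (sweep th is (step th i x)) j b = (1 - th) * mass (step th i x) j b + th * ind a b"
      using Cons.IH[of "step th i x"] Cons.prems False by auto
    have "dm (mass x) (mass z) \<le> NY * th + NY * th * length is"
      using step_dm[OF Cons.prems(1) assms, of i] z(3) dm_triangle[of "mass x" "mass z" "mass (step th i x)"] by linarith
    then have "dm (mass x) (mass z) \<le> NY * th * length (i # is)" by (simp add: algebra_simps)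
    moreover have "\<forall>b\<in>Y j. mass (sweep th (i # is) x) j b = (1 - th) * mass x j b + th * ind a b"
      using z(4) False by (simp add: mass_step)
    ultimately show ?thesis using z(1,2) by blast
  qed
qed

lemma sweep_measurable: "sweep th is \<in> measurable S S"
proof (induction "is")
  case Nil
  then show ?case by simp
next
  case (Cons i "is")
  have "(\<lambda>x. sweep th is (step th i x)) \<in> measurable S S"
    using step_measurable Cons by (rule measurable_compose)
  then show ?case by simp
qed

lemma sweep_measure:
  assumes "th < 1" "A \<in> sets S"
  shows "emeasure S (sweep th is -` A \<inter> space S) \<le> ennreal ((1 / (1 - th)) ^ (\<Sum>i\<leftarrow>is. card (J i))) * emeasure S A"
proof (induction "is")
  case Nil
  show ?case using assms(2) by (simp add: sets.Int_space_eq2)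
next
  case (Cons i "is")
  let ?B = "sweep th is -` A \<inter> space S"
  have B: "?B \<in> sets S" by (rule measurable_sets[OF sweep_measurable assms(2)])
  have "sweep th (i # is) -` A \<inter> space S = step th i -` ?B \<inter> space S"
    using measurable_space[OF step_measurable] by auto
  then have "emeasure S (sweep th (i # is) -` A \<inter> space S) \<le> ennreal ((1 / (1 - th)) ^ card (J i)) * emeasure S ?B"
    using step_measure[OF assms(1) B] by simp
  also have "\<dots> \<le> ennreal ((1 / (1 - th)) ^ card (J i)) * (ennreal ((1 / (1 - th)) ^ (\<Sum>i\<leftarrow>is. card (J i))) * emeasure S A)"
    using Cons by (intro mult_left_mono) auto
  also have "\<dots> = ennreal ((1 / (1 - th)) ^ (\<Sum>i\<leftarrow>i # is. card (J i))) * emeasure S A"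
    using assms(1) by (simp add: mult.assoc[symmetric] ennreal_mult[symmetric] power_add)
  finally show ?case .
qed

end

section \<open>Volume distortion of unique trajectories\<close>

context finite_game
begin

lemma wsolI:
  assumes "\<And>t. t \<ge> 0 \<Longrightarrow> sx (m t)"
    and "\<And>i a s t. a \<in> Y i \<Longrightarrow> 0 \<le> s \<Longrightarrow> s \<le> t \<Longrightarrow> exp s * m s i a \<le> exp t * m t i a"
    and "\<And>i a s t. a \<in> Y i \<Longrightarrow> 0 \<le> s \<Longrightarrow> s \<le> t \<Longrightarrow> (\<And>r. s \<le> r \<Longrightarrow> r \<le> t \<Longrightarrow> a \<notin> br i (m r)) \<Longrightarrow>
        exp t * m t i a = exp s * m s i a"
  shows "wsol m"
  unfolding wsol_def Ball_def atLeastAtMost_iff using assms by blast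

end

section \<open>Iterated sweeps\<close>

context labeled_game
begin

definition players :: "'p list" where "players = (SOME ps. distinct ps \<and> set ps = UNIV)"

lemma players: "distinct players" "set players = UNIV"
proof -
  have "\<exists>ps :: 'p list. distinct ps \<and> set ps = UNIV"
    using finite_distinct_list[of "UNIV :: 'p set"] by auto
  from someI_ex[OF this] show "distinct players" "set players = UNIV" by (auto simp: players_def)
qed

text \<open>With \<open>th = 1 - exp (- h)\<close>, one sweep follows for time \<open>h\<close> the
  exact exponential approach to a fixed target, so \<open>exp (h * n)\<close> times a mass obeys the
  discrete form of the weak conditions.\<close>

definition traj :: "real \<Rightarrow> nat \<Rightarrow> ('p \<Rightarrow> nat \<Rightarrow> real) \<Rightarrow> 'p \<Rightarrow> nat \<Rightarrow> real" where
  "traj h n = sweep (1 - exp (- h)) players ^^ n"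

lemma traj_0 [simp]: "traj h 0 x = x"
  and traj_Suc: "traj h (Suc n) x = sweep (1 - exp (- h)) players (traj h n x)"
  by (simp_all add: traj_def)

lemma th_bounds:
  assumes "h > (0::real)"
  shows "0 \<le> 1 - exp (- h)" "1 - exp (- h) \<le> 1" "1 - exp (- h) < 1" "1 - exp (- h) \<le> h"
  using one_minus_exp_bounds[of h] assms by auto

lemma traj_X: "x \<in> X \<Longrightarrow> h > 0 \<Longrightarrow> traj h n x \<in> X"
  by (induction n) (simp_all add: traj_Suc sweep_X)

definition NP :: real where "NP = length players"

lemma traj_step:
  assumes "x \<in> X" "h > 0"
  shows "\<exists>z\<in>X. \<exists>a. a \<in> br i (mass z) \<and> dm (mass (traj h n x)) (mass z) \<le> NY * h * NP \<and>
    (\<forall>b\<in>Y i. mass (traj h (Suc n) x) i b = exp (- h) * mass (traj h n x) i b + (1 - exp (- h)) * ind a b)"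
proof -
  obtain z a where z: "z \<in> X" "a \<in> br i (mass z)"
    "dm (mass (traj h n x)) (mass z) \<le> NY * (1 - exp (- h)) * length players"
    "\<forall>b\<in>Y i. mass (traj h (Suc n) x) i b =
       (1 - (1 - exp (- h))) * mass (traj h n x) i b + (1 - exp (- h)) * ind a b"
    using sweep_touched[OF th_bounds(1,2)[OF assms(2)] traj_X[OF assms] players(1), of i n] players(2)
    unfolding traj_Suc by blast
  have "NY * (1 - exp (- h)) * length players \<le> NY * h * NP"
    unfolding NP_def using th_bounds(4)[OF assms(2)] by (intro mult_right_mono mult_left_mono) auto
  then have "dm (mass (traj h n x)) (mass z) \<le> NY * h * NP" using z(3) by linarith
  moreover have "\<forall>b\<in>Y i. mass (traj h (Suc n) x) i b = exp (- h) * mass (traj h n x) i b + (1 - exp (- h)) * ind a b"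
    using z(4) by simp
  ultimately show ?thesis using z(1,2) by blast
qed

lemma exp_Suc_mult: "exp (h * real (Suc n)) * exp (- h) = exp (h * real n)"
  by (simp add: exp_add[symmetric] algebra_simps)

lemma traj_mono:
  assumes "x \<in> X" "h > 0" "a \<in> Y i" "n \<le> n'"
  shows "exp (h * n) * mass (traj h n x) i a \<le> exp (h * n') * mass (traj h n' x) i a"
proof (rule lift_Suc_mono_le[OF _ assms(4)])
  fix n
  obtain c where c: "\<forall>b\<in>Y i. mass (traj h (Suc n) x) i b = exp (- h) * mass (traj h n x) i b + (1 - exp (- h)) * ind c b"
    using traj_step[OF assms(1,2), of i n] by blast
  have "(1 - exp (- h)) * ind c a \<ge> 0" using th_bounds(1)[OF assms(2)] by (simp add: ind_def)
  then have "exp (- h) * mass (traj h n x) i a \<le> mass (traj h (Suc n) x) i a" using c assms(3) by simp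
  then have "exp (h * real (Suc n)) * (exp (- h) * mass (traj h n x) i a) \<le> exp (h * real (Suc n)) * mass (traj h (Suc n) x) i a"
    by (intro mult_left_mono) auto
  then show "exp (h * n) * mass (traj h n x) i a \<le> exp (h * Suc n) * mass (traj h (Suc n) x) i a"
    unfolding mult.assoc[symmetric] exp_Suc_mult .
qed

text \<open>The discrete form of the constancy clause of \<open>wsol\<close>. Optimality must be
  excluded in a neighbourhood of each iterate, because the player responds to a nearby intermediate
  state.\<close>

lemma traj_const:
  assumes "x \<in> X" "h > 0" "a \<in> Y i" "n \<le> n'"
    and "\<And>j z. n \<le> j \<Longrightarrow> j < n' \<Longrightarrow> z \<in> X \<Longrightarrow> dm (mass (traj h j x)) (mass z) \<le> NY * h * NP \<Longrightarrow> a \<notin> br i (mass z)"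
  shows "exp (h * n') * mass (traj h n' x) i a = exp (h * n) * mass (traj h n x) i a"
  using assms(4,5)
proof (induction n' rule: dec_induct)
  case base
  show ?case by simp
next
  case (step j)
  obtain z c where c: "z \<in> X" "c \<in> br i (mass z)" "dm (mass (traj h j x)) (mass z) \<le> NY * h * NP"
    "\<forall>b\<in>Y i. mass (traj h (Suc j) x) i b = exp (- h) * mass (traj h j x) i b + (1 - exp (- h)) * ind c b"
    using traj_step[OF assms(1,2), of i j] by blast
  have "a \<notin> br i (mass z)" using step.prems[OF step.hyps(1) lessI c(1,3)] .
  then have "a \<noteq> c" using c(2) by blast
  then have "mass (traj h (Suc j) x) i a = exp (- h) * mass (traj h j x) i a"
    using c(4) assms(3) by (simp add: ind_def)
  then have "exp (h * Suc j) * mass (traj h (Suc j) x) i a = exp (h * Suc j) * exp (- h) * mass (traj h j x) i a"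
    by simp
  also have "\<dots> = exp (h * j) * mass (traj h j x) i a" unfolding exp_Suc_mult ..
  also have "\<dots> = exp (h * n) * mass (traj h n x) i a"
    by (rule step.IH) (use step.prems in \<open>meson less_Suc_eq\<close>)
  finally show ?case .
qed

lemma traj_lipschitz:
  assumes "x \<in> X" "h > 0" "n \<le> n'"
  shows "dm (mass (traj h n x)) (mass (traj h n' x)) \<le> NY * h * (real n' - real n)"
  using assms(3)
proof (induction n' rule: dec_induct)
  case base
  show ?case by simp
next
  case (step j)
  have "dm (mass (traj h j x)) (mass (traj h (Suc j) x)) \<le> NY * h"
  proof (rule dm_le_NY)
    fix i b assume b: "b \<in> Y i"
    obtain c where c: "\<forall>b\<in>Y i. mass (traj h (Suc j) x) i b = exp (- h) * mass (traj h j x) i b + (1 - exp (- h)) * ind c b"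
      using traj_step[OF assms(1,2), of i j] by blast
    have sx: "sx (mass (traj h j x))" by (rule X_sx[OF traj_X[OF assms(1,2)]])
    have "mass (traj h (Suc j) x) i b - mass (traj h j x) i b = (1 - exp (- h)) * (ind c b - mass (traj h j x) i b)"
      using c b by (simp add: algebra_simps)
    also have "\<bar>\<dots>\<bar> \<le> h * 1"
      unfolding abs_mult using th_bounds[OF assms(2)] assms(2) sx_nonneg[OF sx b] sx_le_1[OF sx b]
      by (intro mult_mono) (auto simp: ind_def)
    finally show "\<bar>mass (traj h (Suc j) x) i b - mass (traj h j x) i b\<bar> \<le> h" by simp
  qed
  then have "dm (mass (traj h n x)) (mass (traj h (Suc j) x)) \<le> NY * h * (real j - real n) + NY * h"
    using step.IH dm_triangle[of "mass (traj h n x)" "mass (traj h (Suc j) x)" "mass (traj h j x)"] by linarith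
  then show ?case by (simp add: algebra_simps)
qed

definition total_dim :: nat where "total_dim = (\<Sum>i\<in>UNIV. card (J i))"

lemma traj_measurable: "traj h n \<in> measurable S S"
proof (induction n)
  case 0
  then show ?case by (simp add: traj_def)
next
  case (Suc n)
  have "(\<lambda>x. sweep (1 - exp (- h)) players (traj h n x)) \<in> measurable S S"
    using Suc sweep_measurable by (rule measurable_compose)
  then show ?case by (simp add: traj_Suc)
qed

text \<open>Each coordinate is contracted by \<open>exp (- h)\<close> once per sweep, so preimages
  grow by \<open>exp (h * total_dim)\<close> per sweep and the bound depends on the elapsed time
  \<open>h * n\<close> only.\<close>

lemma traj_measure:
  assumes "h > 0" "A \<in> sets S"
  shows "emeasure S (traj h n -` A \<inter> space S) \<le> ennreal (exp (h * n * total_dim)) * emeasure S A"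
proof (induction n)
  case 0
  show ?case using assms(2) by (simp add: traj_def sets.Int_space_eq2)
next
  case (Suc n)
  let ?th = "1 - exp (- h)"
  let ?B = "sweep ?th players -` A \<inter> space S"
  have B: "?B \<in> sets S" by (rule measurable_sets[OF sweep_measurable assms(2)])
  have "traj h (Suc n) -` A \<inter> space S = traj h n -` ?B \<inter> space S"
    using measurable_space[OF traj_measurable] by (auto simp: traj_Suc)
  then have "emeasure S (traj h (Suc n) -` A \<inter> space S) = emeasure S (traj h n -` ?B \<inter> space S)" by simp
  have sl: "(\<Sum>i\<leftarrow>players. card (J i)) = total_dim"
    unfolding total_dim_def using players by (simp add: sum_list_distinct_conv_sum_set)
  have "emeasure S (traj h (Suc n) -` A \<inter> space S) \<le> emeasure S (sweep ?th players -` (traj h n -` A \<inter> space S) \<inter> space S)"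
  proof -
    have "traj h (Suc n) x = traj h n (sweep ?th players x)" for x
      unfolding traj_def by (simp add: funpow_swap1)
    then have "traj h (Suc n) -` A \<inter> space S = sweep ?th players -` (traj h n -` A \<inter> space S) \<inter> space S"
      using measurable_space[OF sweep_measurable] by auto
    then show ?thesis by simp
  qed
  also have "\<dots> \<le> ennreal ((1 / (1 - ?th)) ^ total_dim) * emeasure S (traj h n -` A \<inter> space S)"
    using sweep_measure[OF th_bounds(3)[OF assms(1)] measurable_sets[OF traj_measurable assms(2)], of players]
    unfolding sl .
  also have "\<dots> \<le> ennreal ((1 / (1 - ?th)) ^ total_dim) * (ennreal (exp (h * n * total_dim)) * emeasure S A)"
    using Suc by (intro mult_left_mono) auto
  also have "(1 / (1 - ?th)) ^ total_dim = exp (h * total_dim)"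
    by (simp add: exp_minus field_simps exp_of_nat_mult[symmetric])
  also have "ennreal (exp (h * total_dim)) * (ennreal (exp (h * n * total_dim)) * emeasure S A) =
      ennreal (exp (h * Suc n * total_dim)) * emeasure S A"
  proof -
    have "exp (h * total_dim) * exp (h * n * total_dim) = exp (h * Suc n * total_dim)"
      by (simp add: exp_add[symmetric] algebra_simps)
    then show ?thesis by (simp only: mult.assoc[symmetric] ennreal_mult[symmetric] exp_ge_zero)
  qed
  finally show ?case .
qed

section \<open>Limits of schemes as the mesh tends to zero\<close>

definition mesh :: "nat \<Rightarrow> real" where "mesh n = 1 / real (Suc n)"
definition idx :: "nat \<Rightarrow> real \<Rightarrow> nat" where "idx n t = nat \<lfloor>t / mesh n\<rfloor>"
definition scheme :: "nat \<Rightarrow> real \<Rightarrow> ('p \<Rightarrow> nat \<Rightarrow> real) \<Rightarrow> 'p \<Rightarrow> nat \<Rightarrow> real" where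
  "scheme n t x = traj (mesh n) (idx n t) x"

lemma mesh_pos [simp]: "mesh n > 0" "mesh n \<ge> 0" by (simp_all add: mesh_def)

lemma mesh_tendsto: "mesh \<longlonglongrightarrow> 0"
  unfolding mesh_def using LIMSEQ_inverse_real_of_nat by (simp add: inverse_eq_divide)

lemma idx_bounds:
  assumes "t \<ge> 0"
  shows "mesh n * idx n t \<le> t" "t < mesh n * idx n t + mesh n"
proof -
  have f: "real (idx n t) = of_int \<lfloor>t / mesh n\<rfloor>" using assms by (simp add: idx_def)
  have "of_int \<lfloor>t / mesh n\<rfloor> \<le> t / mesh n" "t / mesh n < of_int \<lfloor>t / mesh n\<rfloor> + 1" by linarith+
  then show "mesh n * idx n t \<le> t" "t < mesh n * idx n t + mesh n"
    unfolding f using mult_left_mono[of "of_int \<lfloor>t / mesh n\<rfloor>" "t / mesh n" "mesh n"]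
      mult_strict_left_mono[of "t / mesh n" "of_int \<lfloor>t / mesh n\<rfloor> + 1" "mesh n"] mesh_pos[of n]
    by (simp_all add: distrib_left del: mesh_pos)
qed

lemma idx_mono: "0 \<le> s \<Longrightarrow> s \<le> t \<Longrightarrow> idx n s \<le> idx n t"
  unfolding idx_def by (intro nat_mono floor_mono divide_right_mono) auto

lemma idx_tendsto:
  assumes "t \<ge> 0" "F \<le> sequentially"
  shows "((\<lambda>n. mesh n * idx n t) \<longlongrightarrow> t) F"
proof -
  have "((\<lambda>n. mesh n * idx n t - t) \<longlongrightarrow> 0) F"
  proof (rule Lim_null_comparison)
    show "eventually (\<lambda>n. norm (mesh n * idx n t - t) \<le> mesh n) F"
      using idx_bounds[OF assms(1)] by (intro always_eventually allI) (smt (verit) real_norm_def)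
    show "(mesh \<longlongrightarrow> 0) F" by (rule tendsto_mono[OF assms(2) mesh_tendsto])
  qed
  then show ?thesis by (simp add: LIM_zero_iff)
qed

definition starts :: "(real \<Rightarrow> 'p \<Rightarrow> 'a \<Rightarrow> real) \<Rightarrow> ('p \<Rightarrow> nat \<Rightarrow> real) \<Rightarrow> bool" where
  "starts m x0 \<longleftrightarrow> (\<forall>i. \<forall>a\<in>Y i. m 0 i a = mass x0 i a)"

text \<open>Uniqueness is up to duplicates, and it quantifies over all weak solutions, so that it
  also covers the limits of schemes.\<close>

definition uniq :: "('p \<Rightarrow> nat \<Rightarrow> real) \<Rightarrow> real \<Rightarrow> bool" where
  "uniq x0 t \<longleftrightarrow> (\<forall>m m'. wsol m \<longrightarrow> wsol m' \<longrightarrow> starts m x0 \<longrightarrow> starts m' x0 \<longrightarrow> (\<forall>s\<in>{0..t}. eqv (m s) (m' s)))"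

lemma uniqD:
  assumes "uniq x0 t" "wsol m" "wsol m'" "starts m x0" "starts m' x0" "0 \<le> s" "s \<le> t"
  shows "eqv (m s) (m' s)"
  using assms(1)[unfolded uniq_def, rule_format, OF assms(2-5), of s] assms(6,7) by simp

text \<open>Monotonicity passes to the limit directly. For the constancy clause, suppose infinitely
  many schemes respond with \<open>a\<close> somewhere in the interval: the times of these responses
  cluster at some \<open>q\<close>, the states responded to converge to the limit at
  \<open>q\<close>, and closedness makes \<open>a\<close> a best response there.\<close>

lemma scheme_limit:
  assumes F: "F \<le> sequentially" "F \<noteq> bot" and x0: "x0 \<in> X"
    and lim: "\<And>t i k. t \<ge> 0 \<Longrightarrow> k \<in> J i \<Longrightarrow> ((\<lambda>n. scheme n t x0 i k) \<longlongrightarrow> f t i k) F"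
  shows "wsol (\<lambda>t. mass (f t))" "starts (\<lambda>t. mass (f t)) x0"
proof -
  have ml: "((\<lambda>n. mass (scheme n t x0) i a) \<longlongrightarrow> mass (f t) i a) F" if "t \<ge> 0" "a \<in> Y i" for t i a
    by (rule mass_tendsto[OF lim[OF that(1)] that(2)])
  have sxs: "sx (mass (scheme n t x0))" for n t
    unfolding scheme_def by (intro X_sx traj_X x0 mesh_pos)
  have dml: "((\<lambda>n. dm (mass (f t)) (mass (scheme n t x0))) \<longlongrightarrow> 0) F" if "t \<ge> 0" for t
    by (rule dm_tendsto_0I) (rule ml[OF that])
  have sxf: "sx (mass (f t))" if t: "t \<ge> 0" for t
  proof -
    have "0 \<le> mass (f t) i a" if a: "a \<in> Y i" for i a
      by (rule tendsto_lowerbound[OF ml[OF t a] _ F(2)]) (use sx_nonneg[OF sxs a] in auto)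
    then show ?thesis by (simp add: sx_def sum_mass)
  qed
  have el: "((\<lambda>n. exp (mesh n * idx n t) * mass (scheme n t x0) i a) \<longlongrightarrow> exp t * mass (f t) i a) F"
    if "t \<ge> 0" "a \<in> Y i" for t i a
    using that by (intro tendsto_intros idx_tendsto ml F)
  show "wsol (\<lambda>t. mass (f t))"
  proof (rule wsolI)
    fix t :: real assume "t \<ge> 0" then show "sx (mass (f t))" by (rule sxf)
  next
    fix i a and s t :: real assume a: "a \<in> Y i" and st: "0 \<le> s" "s \<le> t"
    then have t0: "0 \<le> t" by simp
    show "exp s * mass (f s) i a \<le> exp t * mass (f t) i a"
    proof (rule tendsto_le[OF F(2) el[OF t0 a] el[OF st(1) a]], intro always_eventually allI)
      fix n
      show "exp (mesh n * idx n s) * mass (scheme n s x0) i a \<le> exp (mesh n * idx n t) * mass (scheme n t x0) i a"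
        unfolding scheme_def by (rule traj_mono[OF x0 mesh_pos(1) a idx_mono[OF st]])
    qed
  next
    fix i a and s t :: real
    assume a: "a \<in> Y i" and st: "0 \<le> s" "s \<le> t" and nb: "\<And>r. s \<le> r \<Longrightarrow> r \<le> t \<Longrightarrow> a \<notin> br i (mass (f r))"
    from st have t0: "0 \<le> t" by simp
    \<comment> \<open>A witness that step \<open>j\<close> of the scheme may add mass to
      \<open>a\<close>: a state \<open>z\<close> close to the iterate at which \<open>a\<close> is
      optimal.\<close>
    define bad where "bad n j z \<longleftrightarrow> idx n s \<le> j \<and> j < idx n t \<and> z \<in> X \<and>
      dm (mass (traj (mesh n) j x0)) (mass z) \<le> NY * mesh n * NP \<and> a \<in> br i (mass z)" for n j z
    have ev: "eventually (\<lambda>n. \<not> (\<exists>j z. bad n j z)) F"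
    proof (rule ccontr)
      assume "\<not> ?thesis"
      then have fr: "frequently (\<lambda>n. \<exists>j z. bad n j z) F" by (simp add: frequently_def)
      define B where "B = {n. \<exists>j z. bad n j z}"
      have ne: "inf F (principal B) \<noteq> bot"
        using fr by (auto simp: B_def frequently_def trivial_limit_def eventually_inf_principal)
      have "\<forall>n. \<exists>p. n \<in> B \<longrightarrow> bad n (fst p) (snd p)" by (auto simp: B_def)
      then obtain p where p: "\<And>n. n \<in> B \<Longrightarrow> bad n (fst (p n)) (snd (p n))" by metis
      \<comment> \<open>The grid time of the bad step can precede \<open>s\<close> by less than one
        mesh width, so it is moved up to \<open>s\<close>; outside \<open>B\<close> the value
        \<open>s\<close> is a default.\<close>
      define r where "r n = (if n \<in> B then max s (mesh n * fst (p n)) else s)" for n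
      have rst: "r n \<in> {s..t}" for n
      proof (cases "n \<in> B")
        case True
        have "mesh n * fst (p n) \<le> mesh n * idx n t"
          using p[OF True] by (intro mult_left_mono) (auto simp: bad_def)
        then have "mesh n * fst (p n) \<le> t" using idx_bounds(1)[OF t0] by (rule order_trans)
        then show ?thesis using st by (auto simp: r_def)
      qed (use st in \<open>simp add: r_def\<close>)
      obtain q F' where q: "q \<in> {s..t}" "F' \<le> inf F (principal B)" "F' \<noteq> bot" "(r \<longlongrightarrow> q) F'"
        by (rule compact_cluster_filter[OF compact_Icc ne rst])
      have q0: "q \<ge> 0" using q(1) st by simp
      have F': "F' \<le> F" "F' \<le> sequentially" using q(2) F(1) by (auto intro: order_trans)
      have evB: "eventually (\<lambda>n. n \<in> B) F'" using q(2) by (auto simp: le_inf_iff le_principal)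
      define zz where "zz n = mass (snd (p n))" for n
      \<comment> \<open>The contributions are the convergence of the scheme at the fixed time
        \<open>q\<close>, the time offset including rounding to the grid, and the displacement
        within one sweep.\<close>
      have bnd_ev: "eventually (\<lambda>n. norm (dm (mass (f q)) (zz n)) \<le>
          dm (mass (f q)) (mass (scheme n q x0)) + (NY * (\<bar>r n - q\<bar> + 2 * mesh n) + NY * mesh n * NP)) F'"
        using evB
      proof eventually_elim
        case (elim n)
        define j where "j = fst (p n)"
        have b: "bad n j (snd (p n))" using p[OF elim] by (simp add: j_def)
        have "mesh n * real j - mesh n \<le> r n" "r n \<le> mesh n * real j + mesh n"
        proof -
          have "mesh n * idx n s \<le> mesh n * j" using b by (intro mult_left_mono) (auto simp: bad_def)
          then have "s \<le> mesh n * j + mesh n" using idx_bounds(2)[OF st(1), of n] by linarith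
          then show "mesh n * real j - mesh n \<le> r n" "r n \<le> mesh n * real j + mesh n"
            using elim mesh_pos(1)[of n] by (auto simp: r_def j_def max_def)
        qed
        moreover have "mesh n * idx n q \<le> q" "q \<le> mesh n * idx n q + mesh n"
          using idx_bounds[OF q0, of n] by auto
        ultimately have jd: "\<bar>mesh n * (real j - real (idx n q))\<bar> \<le> \<bar>r n - q\<bar> + 2 * mesh n"
          by (simp add: algebra_simps abs_le_iff) linarith
        have "dm (mass (scheme n q x0)) (mass (traj (mesh n) j x0)) \<le> NY * \<bar>mesh n * (real j - real (idx n q))\<bar>"
        proof (cases "idx n q \<le> j")
          case True
          then show ?thesis using traj_lipschitz[OF x0 mesh_pos(1) True, of n] by (simp add: scheme_def abs_mult)
        next
          case False
          then show ?thesis using traj_lipschitz[OF x0 mesh_pos(1), of j "idx n q" n] by (simp add: scheme_def abs_mult dm_sym)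
        qed
        also have "\<dots> \<le> NY * (\<bar>r n - q\<bar> + 2 * mesh n)" using jd by (intro mult_left_mono) auto
        finally have 1: "dm (mass (scheme n q x0)) (mass (traj (mesh n) j x0)) \<le> NY * (\<bar>r n - q\<bar> + 2 * mesh n)" .
        have 2: "dm (mass (traj (mesh n) j x0)) (zz n) \<le> NY * mesh n * NP"
          using b by (simp add: bad_def zz_def)
        show ?case
          using 1 2 dm_triangle[of "mass (f q)" "zz n" "mass (scheme n q x0)"]
            dm_triangle[of "mass (scheme n q x0)" "zz n" "mass (traj (mesh n) j x0)"] by simp
      qed
      have "((\<lambda>n. dm (mass (f q)) (mass (scheme n q x0)) + (NY * (\<bar>r n - q\<bar> + 2 * mesh n) + NY * mesh n * NP))
          \<longlongrightarrow> 0 + (NY * (\<bar>q - q\<bar> + 2 * 0) + NY * 0 * NP)) F'"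
        by (intro tendsto_intros tendsto_mono[OF F'(1) dml[OF q0]] q(4) tendsto_mono[OF F'(2) mesh_tendsto])
      then have "((\<lambda>n. dm (mass (f q)) (mass (scheme n q x0)) + (NY * (\<bar>r n - q\<bar> + 2 * mesh n) + NY * mesh n * NP))
          \<longlongrightarrow> 0) F'" by simp
      with bnd_ev have "((\<lambda>n. dm (mass (f q)) (zz n)) \<longlongrightarrow> 0) F'" by (rule Lim_null_comparison)
      moreover have "eventually (\<lambda>n. bnd (zz n) \<and> a \<in> br i (zz n)) F'"
        using evB
      proof eventually_elim
        case (elim n)
        from p[OF elim] show ?case unfolding bad_def zz_def using sx_bnd[OF X_sx] by blast
      qed
      ultimately have "a \<in> br i (mass (f q))" using q(3) sx_bnd[OF sxf[OF q0]] by (intro br_closed)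
      moreover have "a \<notin> br i (mass (f q))" using q(1) by (intro nb) auto
      ultimately show False by simp
    qed
    have "eventually (\<lambda>n. exp (mesh n * idx n t) * mass (scheme n t x0) i a = exp (mesh n * idx n s) * mass (scheme n s x0) i a) F"
      using ev
    proof eventually_elim
      case (elim n)
      show ?case
        unfolding scheme_def
      proof (rule traj_const[OF x0 mesh_pos(1) a idx_mono[OF st]])
        fix j z assume "idx n s \<le> j" "j < idx n t" "z \<in> X" "dm (mass (traj (mesh n) j x0)) (mass z) \<le> NY * mesh n * NP"
        then show "a \<notin> br i (mass z)" using elim unfolding bad_def by blast
      qed
    qed
    then have "((\<lambda>n. exp (mesh n * idx n t) * mass (scheme n t x0) i a) \<longlongrightarrow> exp s * mass (f s) i a) F"
      using el[OF st(1) a] tendsto_cong by fastforce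
    then show "exp t * mass (f t) i a = exp s * mass (f s) i a"
      by (rule tendsto_unique[OF F(2) el[OF t0 a]])
  qed
  show "starts (\<lambda>t. mass (f t)) x0"
    unfolding starts_def
  proof (intro allI ballI)
    fix i a assume a: "a \<in> Y i"
    have "scheme n 0 x0 = x0" for n by (simp add: scheme_def idx_def)
    then have "((\<lambda>n. mass x0 i a) \<longlongrightarrow> mass (f 0) i a) F" using ml[of 0 a i] a by simp
    then show "mass (f 0) i a = mass x0 i a" using tendsto_unique[OF F(2) _ tendsto_const] by blast
  qed
qed

text \<open>Only pointwise convergence in \<open>t\<close> is required, so compactness of a product
  over all real times suffices and no equicontinuity is involved.\<close>

lemma scheme_cluster:
  assumes F: "F \<le> sequentially" "F \<noteq> bot" and x0: "x0 \<in> X"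
  obtains f F' where "F' \<le> F" "F' \<noteq> bot" "wsol (\<lambda>t. mass (f t))" "starts (\<lambda>t. mass (f t)) x0"
    "\<forall>t. ((\<lambda>n. dm (mass (f t)) (mass (scheme n t x0))) \<longlongrightarrow> 0) F'"
proof -
  \<comment> \<open>Coordinates outside \<open>J i\<close> are confined to the single value
    \<open>undefined\<close>, which keeps the product compact and matches the extensional
    representation.\<close>
  define C where "C = {g :: real \<Rightarrow> 'p \<Rightarrow> nat \<Rightarrow> real. \<forall>t. g t \<in> {x. \<forall>i. x i \<in> {z. \<forall>k. z k \<in> (if k \<in> J i then {0..1} else {undefined})}}}"
  have C: "compact C" unfolding C_def by (intro compact_pi) auto
  have inC: "(\<lambda>t. scheme n t x0) \<in> C" for n
  proof -
    have "scheme n t x0 \<in> cube" for t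
      unfolding scheme_def using traj_X[OF x0 mesh_pos(1)] X_cube by blast
    then show ?thesis unfolding C_def cube_def space_S by (auto simp: extensional_def)
  qed
  obtain f F' where f: "f \<in> C" "F' \<le> F" "F' \<noteq> bot" "((\<lambda>n t. scheme n t x0) \<longlongrightarrow> f) F'"
    by (rule compact_cluster_filter[OF C F(2) inC])
  have F': "F' \<le> sequentially" using f(2) F(1) by (rule order_trans)
  have lim: "((\<lambda>n. scheme n t x0 i k) \<longlongrightarrow> f t i k) F'" for t i k
    using f(4) by (simp add: tendsto_fun_iff)
  show thesis
  proof (rule that[OF f(2,3)])
    show "wsol (\<lambda>t. mass (f t))" "starts (\<lambda>t. mass (f t)) x0"
      using scheme_limit[OF F' f(3) x0 lim] by auto
    show "\<forall>t. ((\<lambda>n. dm (mass (f t)) (mass (scheme n t x0))) \<longlongrightarrow> 0) F'"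
      by (intro allI dm_tendsto_0I) (rule mass_tendsto[OF lim])
  qed
qed

text \<open>
  As long as trajectories are unique, they cannot concentrate on small sets: they are limits of
  schemes which, being compositions of shears and contractions, distort volume by an exact factor.
\<close>

lemma unique_flow_compression:
  fixes t :: real
  assumes t: "t \<ge> 0"
    and Qopen: "\<And>m. sx m \<Longrightarrow> Q m \<Longrightarrow> \<exists>e>0. \<forall>m'. sx m' \<longrightarrow> dm m m' < e \<longrightarrow> Q m'"
    and Qeqv: "\<And>m m'. sx m \<Longrightarrow> sx m' \<Longrightarrow> eqv m m' \<Longrightarrow> Q m \<Longrightarrow> Q m'"
    and Qmeas: "{x \<in> X. Q (mass x)} \<in> sets S"
  shows "\<exists>N\<in>sets S. {x0 \<in> X. uniq x0 t \<and> (\<exists>m. wsol m \<and> starts m x0 \<and> Q (m t))} \<subseteq> N \<and>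
    emeasure S N \<le> ennreal (exp (total_dim * t)) * emeasure S {x \<in> X. Q (mass x)}"
proof -
  define A where "A = {x \<in> X. Q (mass x)}"
  have A: "A \<in> sets S" using Qmeas by (simp add: A_def)
  \<comment> \<open>The starts whose schemes all lie in \<open>A\<close> from index \<open>n\<close>
    on. These sets increase with \<open>n\<close>, so the uniform bound carries over to their union,
    as in Fatou's lemma.\<close>
  define D where "D n = (\<Inter>k\<in>{n..}. scheme k t -` A \<inter> space S)" for n
  have sm: "scheme k t -` A \<inter> space S \<in> sets S" for k
    unfolding scheme_def by (rule measurable_sets[OF traj_measurable A])
  have D: "D n \<in> sets S" for n unfolding D_def using sm by (intro sets.countable_INT) auto
  have bound: "emeasure S (D n) \<le> ennreal (exp (total_dim * t)) * emeasure S A" for n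
  proof -
    have "emeasure S (D n) \<le> emeasure S (scheme n t -` A \<inter> space S)"
      using sm by (intro emeasure_mono) (auto simp: D_def)
    also have "\<dots> \<le> ennreal (exp (mesh n * idx n t * total_dim)) * emeasure S A"
      unfolding scheme_def by (rule traj_measure[OF mesh_pos(1) A])
    also have "\<dots> \<le> ennreal (exp (total_dim * t)) * emeasure S A"
    proof (intro mult_right_mono ennreal_leI)
      have "mesh n * idx n t * total_dim \<le> t * total_dim" using idx_bounds(1)[OF t] by (intro mult_right_mono) auto
      then show "exp (mesh n * idx n t * total_dim) \<le> exp (total_dim * t)" by (simp add: mult.commute)
    qed simp
    finally show ?thesis .
  qed
  have inc: "incseq D" unfolding D_def by (intro incseq_SucI INF_superset_mono) auto
  have "emeasure S (\<Union>n. D n) = (SUP n. emeasure S (D n))"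
    using D inc by (intro SUP_emeasure_incseq[symmetric]) auto
  also have "\<dots> \<le> ennreal (exp (total_dim * t)) * emeasure S A" using bound by (intro SUP_least)
  finally have le: "emeasure S (\<Union>n. D n) \<le> ennreal (exp (total_dim * t)) * emeasure S A" .
  \<comment> \<open>Otherwise infinitely many schemes miss \<open>A\<close> at time
    \<open>t\<close>. A cluster point along exactly these indices is a weak solution, agrees with
    \<open>m t\<close> up to duplicates by uniqueness, hence satisfies the open condition
    \<open>Q\<close>, and so do the nearby schemes.\<close>
  have sub: "x0 \<in> (\<Union>n. D n)" if x0: "x0 \<in> X" "uniq x0 t" and m: "wsol m" "starts m x0" "Q (m t)" for x0 m
  proof (rule ccontr)
    assume nin: "x0 \<notin> (\<Union>n. D n)"
    define B where "B = {k. scheme k t x0 \<notin> A}"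
    have "\<exists>k\<ge>n. k \<in> B" for n
      using nin X_space[OF x0(1)] by (auto simp: D_def B_def)
    then have ne: "inf sequentially (principal B) \<noteq> bot"
      by (auto simp: trivial_limit_def eventually_inf_principal eventually_sequentially)
    obtain f F where f: "F \<le> inf sequentially (principal B)" "F \<noteq> bot" "wsol (\<lambda>t. mass (f t))" "starts (\<lambda>t. mass (f t)) x0"
      "\<forall>t. ((\<lambda>n. dm (mass (f t)) (mass (scheme n t x0))) \<longlongrightarrow> 0) F"
      by (rule scheme_cluster[OF inf_le1 ne x0(1)])
    have evB: "eventually (\<lambda>n. n \<in> B) F" using f(1) by (auto simp: le_inf_iff le_principal)
    have sxf: "sx (mass (f t))" using wsol_sx[OF f(3) t] .
    have "eqv (m t) (mass (f t))"
      by (rule uniqD[OF x0(2) m(1) f(3) m(2) f(4) t order_refl])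
    then have "Q (mass (f t))" using Qeqv[OF wsol_sx[OF m(1) t] sxf] m(3) by blast
    then obtain e where e: "e > 0" "\<And>m'. sx m' \<Longrightarrow> dm (mass (f t)) m' < e \<Longrightarrow> Q m'"
      using Qopen[OF sxf] by blast
    have "eventually (\<lambda>n. dm (mass (f t)) (mass (scheme n t x0)) < e) F"
      by (rule order_tendstoD(2)[OF f(5)[THEN spec] e(1)])
    with evB have "eventually (\<lambda>n. False) F"
    proof eventually_elim
      case (elim n)
      have "scheme n t x0 \<in> X" unfolding scheme_def by (intro traj_X x0 mesh_pos)
      then have "scheme n t x0 \<in> A" using e(2)[OF X_sx elim(2)] by (simp add: A_def)
      then show False using elim(1) by (simp add: B_def)
    qed
    then show False using f(2) by (simp add: trivial_limit_def)
  qed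
  show ?thesis
  proof (intro bexI[of _ "\<Union>n. D n"] conjI)
    show "{x0 \<in> X. uniq x0 t \<and> (\<exists>m. wsol m \<and> starts m x0 \<and> Q (m t))} \<subseteq> (\<Union>n. D n)" using sub by blast
    show "emeasure S (\<Union>n. D n) \<le> ennreal (exp (total_dim * t)) * emeasure S {x \<in> X. Q (mass x)}" using le by (simp add: A_def)
    show "(\<Union>n. D n) \<in> sets S" using D by (intro sets.countable_UN) auto
  qed
qed

end

section \<open>Covering hitting times by a grid\<close>

lemma prod_ind_eq: "(\<Prod>j\<in>UNIV. ind (s j) (s' j)) = (if s' = s then 1 else (0::real))"
  for s s' :: "'p::finite \<Rightarrow> 'a"
proof (cases "s' = s")
  case False
  then obtain j where "s' j \<noteq> s j" by auto
  then show ?thesis using False by (auto simp: ind_def)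
qed (simp add: ind_def)

section \<open>Mixed second differences of the potential\<close>

context finite_game
begin

lemma U_pure: "s \<in> PP \<Longrightarrow> U (\<lambda>j. ind (s j)) = u s"
  unfolding U_def prod_ind_eq by (simp add: if_distrib cong: if_cong)

lemma d_pure:
  assumes "s \<in> PP" "a \<in> Y i" "b \<in> Y i"
  shows "d i a b (\<lambda>j. ind (s j)) = u (s(i := a)) - u (s(i := b))"
proof -
  have "pay i c (\<lambda>j. ind (s j)) = u (s(i := c))" if "c \<in> Y i" for c
  proof -
    have "(\<lambda>j. ind (s j))(i := ind c) = (\<lambda>j. ind ((s(i := c)) j))" by (auto simp: fun_eq_iff)
    then show ?thesis unfolding pay_def using U_pure[OF PP_upd[OF assms(1) that]] by simp
  qed
  then show ?thesis using assms by (simp add: d_def)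
qed

text \<open>The influence of player \<open>j\<close>'s choice between \<open>e\<close> and
  \<open>f\<close> on player \<open>i\<close>'s comparison of \<open>a\<close> and
  \<open>b\<close>.\<close>

definition dd :: "'p \<Rightarrow> 'a \<Rightarrow> 'a \<Rightarrow> 'p \<Rightarrow> 'a \<Rightarrow> 'a \<Rightarrow> ('p \<Rightarrow> 'a \<Rightarrow> real) \<Rightarrow> real" where
  "dd i a b j e f m = d i a b (m(j := ind e)) - d i a b (m(j := ind f))"

text \<open>Both sides are the value of \<open>U\<close> with \<open>dl a b\<close> for player
  \<open>i\<close> and \<open>dl e f\<close> for player \<open>j\<close>. The symmetry reflects that
  all players share one potential.\<close>

lemma dd_commute:
  assumes "i \<noteq> j" "a \<in> Y i" "b \<in> Y i"
  shows "dd i a b j e f m = dd j e f i a b m"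
proof -
  let ?n = "m(i := dl a b)"
  have "dd i a b j e f m = pay j e ?n - pay j f ?n"
    unfolding dd_def d_eq pay_def using assms(1) by (simp add: fun_upd_twist)
  also have "\<dots> = d j e f ?n" by (simp add: d_def)
  also have "\<dots> = (\<Sum>c\<in>Y i. dl a b c * d j e f (m(i := ind c)))" by (rule d_upd[OF assms(1)])
  also have "\<dots> = (\<Sum>c\<in>Y i. ind a c * d j e f (m(i := ind c))) - (\<Sum>c\<in>Y i. ind b c * d j e f (m(i := ind c)))"
    by (simp add: dl_def left_diff_distrib sum_subtractf)
  also have "\<dots> = dd j e f i a b m"
    using assms(2,3) by (simp add: ind_def dd_def if_distrib[of "\<lambda>x. x * _"] cong: if_cong)
  finally show ?thesis .
qed

lemma dd_self [simp]: "dd i a b i e f m = 0"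
  unfolding dd_def by simp

lemma dd_lipschitz:
  assumes "bnd m" "bnd m'"
  shows "\<bar>dd i a b j e f m' - dd i a b j e f m\<bar> \<le> 2 * K * dm m m'"
proof -
  have *: "\<bar>d i a b (m'(j := ind c)) - d i a b (m(j := ind c))\<bar> \<le> K * dm m m'" for c
  proof -
    have "K * dm (m(j := ind c)) (m'(j := ind c)) \<le> K * dm m m'" by (rule mult_left_mono[OF dm_upd_le]) simp
    then show ?thesis
      using d_lipschitz[OF bnd_upd_ind[OF assms(1)] bnd_upd_ind[OF assms(2)], of i a b j c j c] by linarith
  qed
  show ?thesis using *[of e] *[of f] unfolding dd_def by linarith
qed

lemma eqv_dd: "eqv m m' \<Longrightarrow> dd i a b j e f m = dd i a b j e f m'"
  unfolding dd_def using eqv_d[OF eqv_upd] by metis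

lemma dd_measurable:
  assumes "\<And>i a. a \<in> Y i \<Longrightarrow> (\<lambda>x. g x i a) \<in> borel_measurable M"
  shows "(\<lambda>x. dd i a b j e f (g x)) \<in> borel_measurable M"
proof -
  have "(\<lambda>x. d i a b ((g x)(j := ind c))) \<in> borel_measurable M" for c
  proof (rule d_measurable)
    fix i' a' assume "a' \<in> Y i'"
    then show "(\<lambda>x. ((g x)(j := ind c)) i' a') \<in> borel_measurable M" using assms by (cases "i' = j") auto
  qed
  then show ?thesis unfolding dd_def by (intro borel_measurable_diff)
qed

end

text \<open>Covering by a null set, since the exceptional sets of starts are defined through
  trajectories and are not known to be measurable.\<close>

definition (in finite_game) negl :: "('p \<Rightarrow> nat \<Rightarrow> real) set \<Rightarrow> bool" where
  "negl A \<longleftrightarrow> (\<exists>N\<in>null_sets S. A \<subseteq> N)"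

lemma (in finite_game) negl_subset: "negl B \<Longrightarrow> A \<subseteq> B \<Longrightarrow> negl A"
  unfolding negl_def by blast

lemma (in finite_game) negl_UN:
  assumes "countable I" "\<And>i. i \<in> I \<Longrightarrow> negl (A i)"
  shows "negl (\<Union>i\<in>I. A i)"
proof -
  have "\<forall>i\<in>I. \<exists>N. N \<in> null_sets S \<and> A i \<subseteq> N" using assms(2) unfolding negl_def by blast
  then obtain N where N: "\<And>i. i \<in> I \<Longrightarrow> N i \<in> null_sets S" "\<And>i. i \<in> I \<Longrightarrow> A i \<subseteq> N i" by metis
  have "(\<Union>i\<in>I. N i) \<in> null_sets S" using assms(1) N(1) by (rule null_sets_UN')
  moreover have "(\<Union>i\<in>I. A i) \<subseteq> (\<Union>i\<in>I. N i)" using N(2) by (rule UN_mono[OF order_refl])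
  ultimately show ?thesis unfolding negl_def by blast
qed

text \<open>The intersection of covers of measure at most \<open>1 / Suc n\<close> is a null
  set.\<close>

lemma (in finite_game) neglI:
  assumes "\<And>e::real. e > 0 \<Longrightarrow> \<exists>N\<in>sets S. A \<subseteq> N \<and> emeasure S N \<le> ennreal e"
  shows "negl A"
proof -
  have "\<forall>n::nat. \<exists>N. N \<in> sets S \<and> A \<subseteq> N \<and> emeasure S N \<le> ennreal (1 / Suc n)"
  proof
    fix n :: nat
    have "(0::real) < 1 / Suc n" by simp
    from assms[OF this] show "\<exists>N. N \<in> sets S \<and> A \<subseteq> N \<and> emeasure S N \<le> ennreal (1 / Suc n)" by blast
  qed
  then obtain N where N: "\<And>n::nat. N n \<in> sets S" "\<And>n. A \<subseteq> N n" "\<And>n. emeasure S (N n) \<le> ennreal (1 / Suc n)" by metis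
  have m: "(\<Inter>n. N n) \<in> sets S" using N(1) by (intro sets.countable_INT) auto
  have "emeasure S (\<Inter>n. N n) \<le> ennreal e" if e: "e > 0" for e
  proof -
    obtain n :: nat where n: "1 / Suc n < e" using nat_approx_posE[OF e] by blast
    have "emeasure S (\<Inter>n. N n) \<le> emeasure S (N n)" using N(1) by (intro emeasure_mono) auto
    also have "\<dots> \<le> ennreal (1 / Suc n)" by (rule N(3))
    also have "\<dots> \<le> ennreal e" using n by (intro ennreal_leI) simp
    finally show ?thesis .
  qed
  note small = this
  have "emeasure S (\<Inter>n. N n) \<le> 0"
  proof (rule ennreal_le_epsilon)
    fix e :: real assume "0 < e"
    then show "emeasure S (\<Inter>n. N n) \<le> 0 + ennreal e" using small by simp
  qed
  then have "(\<Inter>n. N n) \<in> null_sets S" using m by (simp add: null_sets_def)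
  moreover have "A \<subseteq> (\<Inter>n. N n)" using N(2) by blast
  ultimately show ?thesis unfolding negl_def by blast
qed

section \<open>Measure of near-ties and covering by grid times\<close>

context labeled_game
begin

text \<open>Coordinate \<open>k\<close> is the mass of action number \<open>k + 1\<close>, and
  raising it takes mass from the first action.\<close>

lemma mixture_upd:
  assumes "k \<in> J j" "e \<in> Y j"
  shows "mixture (Y j) (y j) (z(k := v)) e = mixture (Y j) (y j) (z(k := 0)) e + v * dl (y j (Suc k)) (y j (Suc 0)) e"
  using assms(2)
proof (cases rule: action_cases)
  case 1
  have ne: "y j (Suc k) \<noteq> y j (Suc 0)"
    using y_inj[of "Suc k" j "Suc 0"] J_Suc[OF assms(1)] card_pos[of j] assms(1) by (auto simp: J_def)
  have "(\<Sum>l\<in>J j. (z(k := v)) l) = v + (\<Sum>l\<in>J j - {k}. z l)" for v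
    by (subst sum.remove[OF finite_J assms(1)]) (auto intro: sum.cong)
  then show ?thesis unfolding 1 mixture_1 using ne by (simp add: dl_def ind_def)
next
  case (2 l)
  have "y j (Suc l) = y j (Suc k) \<longleftrightarrow> l = k"
    using y_inj[of "Suc l" j "Suc k"] J_Suc[OF assms(1)] J_Suc[OF 2(1)] by auto
  moreover have "y j (Suc l) \<noteq> y j (Suc 0)"
    using y_inj[of "Suc l" j "Suc 0"] J_Suc[OF 2(1)] card_pos[of j] 2(1) by (auto simp: J_def)
  ultimately show ?thesis unfolding 2(2) mixture_Suc[OF 2(1)] by (simp add: dl_def ind_def)
qed

lemma mass_upd_coord: "mass (upd j k v x) = (mass x)(j := mixture (Y j) (y j) ((x j)(k := v)))"
  unfolding upd_def by (rule mass_upd)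

lemma d_upd_coord:
  assumes "k \<in> J j" "i \<noteq> j"
  shows "d i a b (mass (upd j k v x)) = d i a b (mass (upd j k 0 x)) + dd i a b j (y j (Suc k)) (y j (Suc 0)) (mass x) * v"
proof -
  let ?m = "mass x" and ?w = "\<lambda>v. mixture (Y j) (y j) ((x j)(k := v))"
  have ji: "j \<noteq> i" using assms by simp
  have "d i a b (mass (upd j k v x)) = (\<Sum>e\<in>Y j. ?w v e * d i a b (?m(j := ind e)))"
    unfolding mass_upd_coord by (rule d_upd[OF ji])
  also have "\<dots> = (\<Sum>e\<in>Y j. ?w 0 e * d i a b (?m(j := ind e)) + v * (dl (y j (Suc k)) (y j (Suc 0)) e * d i a b (?m(j := ind e))))"
    by (intro sum.cong refl) (simp add: mixture_upd[OF assms(1), of _ _ v] algebra_simps)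
  also have "\<dots> = (\<Sum>e\<in>Y j. ?w 0 e * d i a b (?m(j := ind e))) + v * (\<Sum>e\<in>Y j. dl (y j (Suc k)) (y j (Suc 0)) e * d i a b (?m(j := ind e)))"
    by (simp add: sum.distrib sum_distrib_left)
  also have "(\<Sum>e\<in>Y j. ?w 0 e * d i a b (?m(j := ind e))) = d i a b (mass (upd j k 0 x))"
    unfolding mass_upd_coord by (rule d_upd[OF ji, symmetric])
  also have "(\<Sum>e\<in>Y j. dl (y j (Suc k)) (y j (Suc 0)) e * d i a b (?m(j := ind e))) = dd i a b j (y j (Suc k)) (y j (Suc 0)) ?m"
    using y_mem[OF J_Suc[OF assms(1)]]
    by (simp add: dl_def ind_def dd_def left_diff_distrib sum_subtractf if_distrib[of "\<lambda>x. x * _"] cong: if_cong)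
  finally show ?thesis by (simp add: mult.commute)
qed

lemma d_upd_coord_same: "d i a b (mass (upd i k v x)) = d i a b (mass x)"
  unfolding mass_upd_coord by simp

lemma slope_d:
  assumes "k \<in> J j" "i \<noteq> j"
  shows "slope j k (\<lambda>x. d i a b (mass x)) x = dd i a b j (y j (Suc k)) (y j (Suc 0)) (mass x)"
  unfolding slope_def using d_upd_coord[OF assms, of a b 1 x] by simp

lemma d_multiaffine: "multiaffine (\<lambda>x. d i a b (mass x))"
  unfolding multiaffine_def
proof (intro allI impI)
  fix j k x v assume k: "k \<in> J j"
  show "d i a b (mass (upd j k v x)) = d i a b (mass (upd j k 0 x)) + slope j k (\<lambda>x. d i a b (mass x)) x * v"
  proof (cases "i = j")
    case True
    then show ?thesis by (simp add: d_upd_coord_same slope_def)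
  next
    case False
    show ?thesis unfolding slope_d[OF k False] by (rule d_upd_coord[OF k False])
  qed
qed

lemma d_mass_measurable: "(\<lambda>x. d i a b (mass x)) \<in> borel_measurable S"
  by (rule d_measurable) (rule mass_measurable)

lemma dd_mass_measurable: "(\<lambda>x. dd i a b j e f (mass x)) \<in> borel_measurable S"
  by (rule dd_measurable) (rule mass_measurable)

text \<open>If \<open>a\<close> and \<open>b\<close> are not duplicates, some pure profile separates
  them; its coordinates are the witness.\<close>

lemma d_nonzero:
  assumes "a \<in> Y i" "b \<in> Y i" "\<not> dup i a b"
  shows "\<exists>x. d i a b (mass x) \<noteq> 0"
proof -
  obtain s where s: "s \<in> PP" "u (s(i := a)) \<noteq> u (s(i := b))" using assms(3) unfolding dup_def by blast
  define x where "x = (\<lambda>j. \<lambda>k\<in>J j. ind (s j) (y j (Suc k)))"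
  have "mass x j e = ind (s j) e" if e: "e \<in> Y j" for j e
    using e
  proof (cases rule: action_cases)
    case 1
    have "1 = (\<Sum>e\<in>Y j. ind (s j) e)" using PP_mem[OF s(1), of j] by (simp add: ind_def)
    then show ?thesis unfolding 1 mixture_1 sum_Y by (simp add: x_def)
  next
    case (2 k)
    then show ?thesis unfolding 2(2) mixture_Suc[OF 2(1)] by (simp add: x_def)
  qed
  then have "d i a b (mass x) = d i a b (\<lambda>j. ind (s j))" by (intro eqv_d eqv_coordwise) auto
  then show ?thesis using d_pure[OF s(1) assms(1,2)] s(2) by (intro exI[of _ x]) simp
qed

lemma d_sublevel:
  assumes "a \<in> Y i" "b \<in> Y i" "\<not> dup i a b"
  shows "\<exists>C\<ge>0. \<forall>e>0. emeasure S {x \<in> X. \<bar>d i a b (mass x)\<bar> < e} \<le> ennreal (C * e powr (3/4))"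
proof -
  obtain x0 where x0: "d i a b (mass x0) \<noteq> 0" using d_nonzero[OF assms] by blast
  have dep: "d i a b (mass x) = d i a b (mass x')" if "\<And>i k. k \<in> J i \<Longrightarrow> x i k = x' i k" for x x'
  proof (intro eqv_d eqv_coordwise)
    fix j e assume "e \<in> Y j"
    then show "mass x j e = mass x' j e"
    proof (cases rule: action_cases)
      case 1
      show ?thesis unfolding 1 mixture_1 using that by simp
    next
      case (2 k)
      show ?thesis unfolding 2(2) mixture_Suc[OF 2(1)] using that 2(1) by simp
    qed
  qed
  obtain C where C: "C \<ge> 0" "\<And>e. e > 0 \<Longrightarrow> emeasure S {x \<in> cube. \<bar>d i a b (mass x)\<bar> < e} \<le> ennreal (C * e powr (3/4))"
    using multiaffine_sublevel[OF d_mass_measurable d_multiaffine x0 dep] by auto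
  have "emeasure S {x \<in> X. \<bar>d i a b (mass x)\<bar> < e} \<le> ennreal (C * e powr (3/4))" if e: "e > 0" for e
  proof -
    have "{x \<in> cube. \<bar>d i a b (mass x)\<bar> < e} = cube \<inter> {x \<in> space S. \<bar>d i a b (mass x)\<bar> < e}"
      by (auto simp: cube_def)
    also have "\<dots> \<in> sets S" using d_mass_measurable[of i a b] by (intro sets.Int cube_sets) measurable
    finally have "emeasure S {x \<in> X. \<bar>d i a b (mass x)\<bar> < e} \<le> emeasure S {x \<in> cube. \<bar>d i a b (mass x)\<bar> < e}"
      using X_cube by (intro emeasure_mono) auto
    then show ?thesis using C(2)[OF e] by (rule order_trans)
  qed
  then show ?thesis using C(1) by blast
qed

text \<open>The payoff difference of player \<open>i\<close> does not depend on \<open>i\<close>'s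
  coordinates and that of \<open>j\<close> not on \<open>j\<close>'s. Each can be made small only
  along a coordinate of the other player, so two independent strip estimates multiply.\<close>

lemma d_pair_strip:
  fixes a b e f :: 'a and ep de :: real
  assumes ij: "i \<noteq> j" and k: "k \<in> J j" and l: "l \<in> J i" and e: "ep > 0" and de: "de > 0"
  defines "F1 \<equiv> \<lambda>x. d i a b (mass x)" and "F2 \<equiv> \<lambda>x. d j e f (mass x)"
  shows "{x \<in> cube. \<bar>F1 x\<bar> < ep \<and> \<bar>F2 x\<bar> < ep \<and> \<bar>slope j k F1 x\<bar> > de \<and> \<bar>slope i l F2 x\<bar> > de} \<in> sets S"
    "emeasure S {x \<in> cube. \<bar>F1 x\<bar> < ep \<and> \<bar>F2 x\<bar> < ep \<and> \<bar>slope j k F1 x\<bar> > de \<and> \<bar>slope i l F2 x\<bar> > de}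
      \<le> ennreal ((2 * ep / de)\<^sup>2)"
proof -
  have F: "F1 \<in> borel_measurable S" "multiaffine F1" "F2 \<in> borel_measurable S" "multiaffine F2"
    unfolding F1_def F2_def by (intro d_mass_measurable d_multiaffine)+
  have sm: "slope j k F1 \<in> borel_measurable S" "slope i l F2 \<in> borel_measurable S"
    using slope_measurable k l F by blast+
  \<comment> \<open>Both conditions are independent of player \<open>j\<close>'s coordinates, so
    within the cube \<open>B\<close> is a cylinder in coordinate \<open>k\<close> and the strip of
    \<open>F1\<close> is cut relative to it.\<close>
  define B where "B = {x \<in> cube. \<bar>F2 x\<bar> < ep \<and> \<bar>slope i l F2 x\<bar> > de}"
  have B: "B \<in> sets S"
  proof -
    have "B = cube \<inter> {x \<in> space S. \<bar>F2 x\<bar> < ep \<and> \<bar>slope i l F2 x\<bar> > de}" by (auto simp: B_def cube_def)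
    also have "\<dots> \<in> sets S"
    proof (rule sets.Int[OF cube_sets])
      show "{x \<in> space S. \<bar>F2 x\<bar> < ep \<and> \<bar>slope i l F2 x\<bar> > de} \<in> sets S" using F(3) sm(2) by measurable
    qed
    finally show ?thesis .
  qed
  have eq: "{x \<in> cube. \<bar>F1 x\<bar> < ep \<and> \<bar>F2 x\<bar> < ep \<and> \<bar>slope j k F1 x\<bar> > de \<and> \<bar>slope i l F2 x\<bar> > de} =
      {x \<in> B. \<bar>F1 x\<bar> < ep \<and> \<bar>slope j k F1 x\<bar> > de}" by (auto simp: B_def)
  show "{x \<in> cube. \<bar>F1 x\<bar> < ep \<and> \<bar>F2 x\<bar> < ep \<and> \<bar>slope j k F1 x\<bar> > de \<and> \<bar>slope i l F2 x\<bar> > de} \<in> sets S"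
  proof -
    have "{x \<in> B. \<bar>F1 x\<bar> < ep \<and> \<bar>slope j k F1 x\<bar> > de} = B \<inter> {x \<in> space S. \<bar>F1 x\<bar> < ep \<and> \<bar>slope j k F1 x\<bar> > de}"
      by (auto simp: B_def cube_def)
    also have "\<dots> \<in> sets S"
    proof (rule sets.Int[OF B])
      show "{x \<in> space S. \<bar>F1 x\<bar> < ep \<and> \<bar>slope j k F1 x\<bar> > de} \<in> sets S" using F(1) sm(1) by measurable
    qed
    finally show ?thesis unfolding eq .
  qed
  have "emeasure S {x \<in> B. \<bar>F1 x\<bar> < ep \<and> \<bar>slope j k F1 x\<bar> > de} \<le> ennreal (2 * ep / de) * emeasure S B"
  proof (rule strip_measure[OF k F(1,2) e de B])
    show "B \<subseteq> cube" by (auto simp: B_def)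
    fix x and v w :: real assume x: "x \<in> space S" and vw: "v \<in> {0..1}" "w \<in> {0..1}" and v: "upd j k v x \<in> B"
    have "upd j k w x \<in> cube" using upd_cube_iff[OF x k vw] v by (simp add: B_def)
    moreover have "F2 (upd j k w x) = F2 (upd j k v x)" unfolding F2_def d_upd_coord_same ..
    moreover have "slope i l F2 (upd j k w x) = slope i l F2 (upd j k v x)"
    proof -
      have "F2 (upd i l c (upd j k v' x)) = F2 (upd i l c x)" for c v'
      proof -
        have "upd i l c (upd j k v' x) = upd j k v' (upd i l c x)"
          by (rule upd_commute) (use ij in simp)
        then show ?thesis by (simp only: F2_def d_upd_coord_same)
      qed
      then show ?thesis unfolding slope_def by simp
    qed
    ultimately show "upd j k w x \<in> B" using v by (simp add: B_def)
  qed
  also have "emeasure S B \<le> ennreal (2 * ep / de) * emeasure S cube"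
    unfolding B_def
  proof (rule strip_measure[OF l F(3,4) e de cube_sets order_refl])
    fix x and v w :: real assume "x \<in> space S" "v \<in> {0..1}" "w \<in> {0..1}" "upd i l v x \<in> cube"
    then show "upd i l w x \<in> cube" using upd_cube_iff[OF _ l] by blast
  qed
  also have "\<dots> \<le> ennreal (2 * ep / de) * 1" using emeasure_cube by (intro mult_left_mono) auto
  finally have "emeasure S {x \<in> B. \<bar>F1 x\<bar> < ep \<and> \<bar>slope j k F1 x\<bar> > de} \<le> ennreal (2 * ep / de) * ennreal (2 * ep / de)"
    by (simp add: mult_left_mono)
  also have "\<dots> = ennreal ((2 * ep / de)\<^sup>2)"
    using e de by (simp add: ennreal_mult[symmetric] power2_eq_square)
  finally show "emeasure S {x \<in> cube. \<bar>F1 x\<bar> < ep \<and> \<bar>F2 x\<bar> < ep \<and> \<bar>slope j k F1 x\<bar> > de \<and> \<bar>slope i l F2 x\<bar> > de}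
      \<le> ennreal ((2 * ep / de)\<^sup>2)" unfolding eq .
qed

text \<open>Subtracting the reference to the first action of \<open>j\<close> splits the second
  difference in two, one of which exceeds \<open>de / 2\<close>; it cannot belong to the first
  action, for which the difference is 0.\<close>

lemma dd_large_coord:
  assumes "e \<in> Y j" "f \<in> Y j" "\<bar>dd i a b j e f m\<bar> > de" "de > 0"
  shows "\<exists>k\<in>J j. \<bar>dd i a b j (y j (Suc k)) (y j (Suc 0)) m\<bar> > de / 2"
proof -
  let ?s = "\<lambda>e. dd i a b j e (y j (Suc 0)) m"
  have "dd i a b j e f m = ?s e - ?s f" by (simp add: dd_def)
  then have "\<bar>?s e\<bar> > de / 2 \<or> \<bar>?s f\<bar> > de / 2" using assms(3) by linarith
  moreover have "\<exists>k\<in>J j. \<bar>?s (y j (Suc k))\<bar> > de / 2" if "c \<in> Y j" "\<bar>?s c\<bar> > de / 2" for c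
    using that(1)
  proof (cases rule: action_cases)
    case 1
    then show ?thesis using that(2) assms(4) by (simp add: dd_def)
  next
    case (2 k)
    then show ?thesis using that(2) by blast
  qed
  ultimately show ?thesis using assms(1,2) by blast
qed

text \<open>By symmetry of \<open>dd\<close> a large interaction yields a steep coordinate for each
  of the two players. Their slopes exceed \<open>de / 2\<close>, whence the factor 4, and the pair
  of coordinates ranges over \<open>J j \<times> J i\<close>.\<close>

lemma d_pair_sublevel:
  assumes ij: "i \<noteq> j" and ab: "a \<in> Y i" "b \<in> Y i" and ef: "e \<in> Y j" "f \<in> Y j" and ep: "ep > 0" and de: "de > 0"
  shows "emeasure S {x \<in> X. \<bar>d i a b (mass x)\<bar> < ep \<and> \<bar>d j e f (mass x)\<bar> < ep \<and> \<bar>dd i a b j e f (mass x)\<bar> > de}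
    \<le> ennreal (card (J j \<times> J i) * (4 * ep / de)\<^sup>2)"
proof -
  define F1 where "F1 = (\<lambda>x. d i a b (mass x))"
  define F2 where "F2 = (\<lambda>x. d j e f (mass x))"
  define A where "A p = {x \<in> cube. \<bar>F1 x\<bar> < ep \<and> \<bar>F2 x\<bar> < ep \<and> \<bar>slope j (fst p) F1 x\<bar> > de / 2 \<and> \<bar>slope i (snd p) F2 x\<bar> > de / 2}" for p
  have A: "A p \<in> sets S" "emeasure S (A p) \<le> ennreal ((4 * ep / de)\<^sup>2)" if "p \<in> J j \<times> J i" for p
    using d_pair_strip[OF ij, of "fst p" "snd p" ep "de / 2" a b e f] that ep de by (auto simp: A_def F1_def F2_def)
  have "{x \<in> X. \<bar>d i a b (mass x)\<bar> < ep \<and> \<bar>d j e f (mass x)\<bar> < ep \<and> \<bar>dd i a b j e f (mass x)\<bar> > de} \<subseteq> (\<Union>p\<in>J j \<times> J i. A p)"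
  proof
    fix x assume x: "x \<in> {x \<in> X. \<bar>d i a b (mass x)\<bar> < ep \<and> \<bar>d j e f (mass x)\<bar> < ep \<and> \<bar>dd i a b j e f (mass x)\<bar> > de}"
    then have dd: "\<bar>dd i a b j e f (mass x)\<bar> > de" by simp
    obtain k where k1: "k \<in> J j" "\<bar>dd i a b j (y j (Suc k)) (y j (Suc 0)) (mass x)\<bar> > de / 2"
      using dd_large_coord[OF ef dd de] by blast
    then have k: "k \<in> J j" "\<bar>slope j k F1 x\<bar> > de / 2"
      unfolding F1_def slope_d[OF k1(1) ij] .
    have dd': "\<bar>dd j e f i a b (mass x)\<bar> > de" using dd dd_commute[OF ij ab] by simp
    obtain l where l1: "l \<in> J i" "\<bar>dd j e f i (y i (Suc l)) (y i (Suc 0)) (mass x)\<bar> > de / 2"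
      using dd_large_coord[OF ab dd' de] by blast
    then have l: "l \<in> J i" "\<bar>slope i l F2 x\<bar> > de / 2"
      unfolding F2_def slope_d[OF l1(1) ij[symmetric]] .
    have "x \<in> A (k, l)" using x k l X_cube by (auto simp: A_def F1_def F2_def)
    then show "x \<in> (\<Union>p\<in>J j \<times> J i. A p)" using k l by blast
  qed
  then have "emeasure S {x \<in> X. \<bar>d i a b (mass x)\<bar> < ep \<and> \<bar>d j e f (mass x)\<bar> < ep \<and> \<bar>dd i a b j e f (mass x)\<bar> > de}
      \<le> emeasure S (\<Union>p\<in>J j \<times> J i. A p)" using A(1) by (intro emeasure_mono sets.finite_UN) auto
  also have "\<dots> \<le> (\<Sum>p\<in>J j \<times> J i. emeasure S (A p))" using A(1) by (intro emeasure_subadditive_finite) auto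
  also have "\<dots> \<le> (\<Sum>p\<in>J j \<times> J i. ennreal ((4 * ep / de)\<^sup>2))" using A(2) by (intro sum_mono)
  also have "\<dots> = ennreal (card (J j \<times> J i) * (4 * ep / de)\<^sup>2)"
    by (simp add: ennreal_mult ennreal_of_nat_eq_real_of_nat)
  finally show ?thesis .
qed

text \<open>
  A trajectory that hits a bad point at time \<open>\<tau>\<close> already satisfies \<open>Q \<eta>\<close> at the grid time preceding \<open>\<tau>\<close>;
  there are \<open>O(1/\<eta>)\<close> grid times, so any bound on the measure that is \<open>o(\<eta>)\<close> suffices.
\<close>

lemma grid_negligible:
  fixes T C eta0 :: real
  assumes T: "T \<ge> 0" and C: "C \<ge> 0" and eta0: "eta0 > 0"
    and Qopen: "\<And>eta m. 0 < eta \<Longrightarrow> eta < eta0 \<Longrightarrow> sx m \<Longrightarrow> Q eta m \<Longrightarrow> \<exists>e>0. \<forall>m'. sx m' \<longrightarrow> dm m m' < e \<longrightarrow> Q eta m'"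
    and Qeqv: "\<And>eta m m'. 0 < eta \<Longrightarrow> eta < eta0 \<Longrightarrow> sx m \<Longrightarrow> sx m' \<Longrightarrow> eqv m m' \<Longrightarrow> Q eta m \<Longrightarrow> Q eta m'"
    and Qmeas: "\<And>eta. 0 < eta \<Longrightarrow> eta < eta0 \<Longrightarrow> {x \<in> X. Q eta (mass x)} \<in> sets S"
    and Qbound: "\<And>eta. 0 < eta \<Longrightarrow> eta < eta0 \<Longrightarrow> emeasure S {x \<in> X. Q eta (mass x)} \<le> ennreal (C * eta powr (3/2))"
    and H: "\<And>x0 eta. x0 \<in> H \<Longrightarrow> 0 < eta \<Longrightarrow> eta < eta0 \<Longrightarrow> x0 \<in> X \<and> (\<exists>tau m. 0 \<le> tau \<and> tau \<le> T \<and> uniq x0 tau \<and> wsol m \<and> starts m x0 \<and>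
        (\<forall>t. 0 \<le> t \<longrightarrow> tau - eta < t \<longrightarrow> t \<le> tau \<longrightarrow> Q eta (m t)))"
  shows "negl H"
proof (rule neglI)
  fix e :: real assume e: "e > 0"
  define M where "M = (T + 1) * (exp (total_dim * T) * C)"
  have M: "M \<ge> 0" using T C by (simp add: M_def)
  \<comment> \<open>At most \<open>(T + 1) / eta\<close> grid times contribute, each
    \<open>exp (total_dim * T) * C * eta powr (3/2)\<close>. The total is
    \<open>M * sqrt eta\<close>, and \<open>eta\<close> is chosen to make it at most
    \<open>e\<close>.\<close>
  define eta where "eta = min (eta0 / 2) (min (1/2) ((e / (M + 1))\<^sup>2))"
  have eta: "0 < eta" "eta < eta0" "eta \<le> 1" and eta_e: "eta \<le> (e / (M + 1))\<^sup>2"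
    using eta0 e M by (auto simp: eta_def)
  have rt: "M * sqrt eta \<le> e"
  proof -
    have "sqrt eta \<le> sqrt ((e / (M + 1))\<^sup>2)" using eta_e by (rule real_sqrt_le_mono)
    also have "\<dots> = e / (M + 1)" using e M by simp
    finally have "M * sqrt eta \<le> M * (e / (M + 1))" using M by (intro mult_left_mono)
    also have "\<dots> \<le> e" using e M by (simp add: field_simps)
    finally show ?thesis .
  qed
  define n where "n = nat \<lfloor>T / eta\<rfloor>"
  have n: "real n \<le> T / eta" using T eta by (simp add: n_def)
  have nT: "real j * eta \<le> T" if "j \<le> n" for j
  proof -
    have "real j \<le> T / eta" using that n by linarith
    then show ?thesis using eta(1) by (simp add: pos_le_divide_eq)
  qed
  define R where "R j = {x0 \<in> X. uniq x0 (real j * eta) \<and> (\<exists>m. wsol m \<and> starts m x0 \<and> Q eta (m (real j * eta)))}" for j :: nat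
  define Eb where "Eb j = ennreal (exp (total_dim * (real j * eta))) * emeasure S {x \<in> X. Q eta (mass x)}" for j :: nat
  have "\<exists>N. N \<in> sets S \<and> R j \<subseteq> N \<and> emeasure S N \<le> Eb j" for j
  proof -
    have "0 \<le> real j * eta" using eta by simp
    then have "\<exists>N\<in>sets S. R j \<subseteq> N \<and> emeasure S N \<le> Eb j"
      unfolding R_def Eb_def
    proof (rule unique_flow_compression[where Q="Q eta"])
      show "\<exists>e>0. \<forall>m'. sx m' \<longrightarrow> dm m m' < e \<longrightarrow> Q eta m'" if "sx m" "Q eta m" for m
        by (rule Qopen[OF eta(1,2) that])
      show "Q eta m'" if "sx m" "sx m'" "eqv m m'" "Q eta m" for m m'
        by (rule Qeqv[OF eta(1,2) that])
      show "{x \<in> X. Q eta (mass x)} \<in> sets S" by (rule Qmeas[OF eta(1,2)])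
    qed
    then show ?thesis unfolding Bex_def .
  qed
  then obtain N where N: "\<And>j. N j \<in> sets S" "\<And>j. R j \<subseteq> N j" "\<And>j. emeasure S (N j) \<le> Eb j"
    by metis
  have NB: "emeasure S (N j) \<le> ennreal (exp (total_dim * T) * (C * eta powr (3/2)))" if j: "j \<le> n" for j
  proof -
    have "emeasure S (N j) \<le> ennreal (exp (total_dim * (real j * eta))) * ennreal (C * eta powr (3/2))"
      by (rule order_trans[OF N(3)[unfolded Eb_def] mult_left_mono[OF Qbound[OF eta(1,2)]]]) simp
    also have "\<dots> = ennreal (exp (total_dim * (real j * eta)) * (C * eta powr (3/2)))"
      using C by (simp add: ennreal_mult)
    also have "\<dots> \<le> ennreal (exp (total_dim * T) * (C * eta powr (3/2)))"
      using nT[OF j] C by (intro ennreal_leI mult_right_mono) (auto intro: mult_left_mono)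
    finally show ?thesis .
  qed
  show "\<exists>N\<in>sets S. H \<subseteq> N \<and> emeasure S N \<le> ennreal e"
  proof (intro bexI conjI)
    show "(\<Union>j\<in>{..n}. N j) \<in> sets S" using N(1) by (intro sets.finite_UN) auto
    show "H \<subseteq> (\<Union>j\<in>{..n}. N j)"
    proof
      fix x0 assume "x0 \<in> H"
      from H[OF this eta(1,2)] obtain tau m where x0: "x0 \<in> X" and tau: "0 \<le> tau" "tau \<le> T" "uniq x0 tau" "wsol m" "starts m x0"
        "\<forall>t. 0 \<le> t \<longrightarrow> tau - eta < t \<longrightarrow> t \<le> tau \<longrightarrow> Q eta (m t)" by blast
      \<comment> \<open>The last grid time not after \<open>tau\<close>. It lies within
        \<open>eta\<close> of \<open>tau\<close>, so \<open>Q eta\<close> holds there, and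
        uniqueness up to \<open>tau\<close> gives uniqueness up to it.\<close>
      define j where "j = nat \<lfloor>tau / eta\<rfloor>"
      have fl: "real j = of_int \<lfloor>tau / eta\<rfloor>" using tau eta by (simp add: j_def)
      have "real j \<le> tau / eta" "tau / eta < real j + 1" unfolding fl by linarith+
      then have je: "real j * eta \<le> tau" "tau < (real j + 1) * eta"
        using eta(1) by (simp_all add: pos_le_divide_eq pos_divide_less_eq)
      have "tau / eta \<le> T / eta" using tau(2) eta(1) by (simp add: divide_right_mono)
      then have "j \<le> n" unfolding j_def n_def by (intro nat_mono floor_mono)
      have "Q eta (m (real j * eta))"
        using tau(6) je eta(1) by (auto simp: distrib_right)
      moreover have "uniq x0 (real j * eta)" using tau(3) je(1) unfolding uniq_def by auto
      ultimately have "x0 \<in> R j" unfolding R_def using x0 tau(4,5) by blast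
      then have "x0 \<in> N j" using N(2)[of j] by blast
      then show "x0 \<in> (\<Union>j\<in>{..n}. N j)" using \<open>j \<le> n\<close> by blast
    qed
    have "emeasure S (\<Union>j\<in>{..n}. N j) \<le> (\<Sum>j\<in>{..n}. emeasure S (N j))"
      using N(1) by (intro emeasure_subadditive_finite) auto
    also have "\<dots> \<le> (\<Sum>j\<in>{..n}. ennreal (exp (total_dim * T) * (C * eta powr (3/2))))" using NB by (intro sum_mono) auto
    also have "\<dots> = ennreal (real (Suc n) * (exp (total_dim * T) * (C * eta powr (3/2))))"
      using C by (simp add: ennreal_mult ennreal_of_nat_eq_real_of_nat)
    also have "\<dots> \<le> ennreal e"
    proof (rule ennreal_leI)
      have p: "eta powr (3/2) = eta * sqrt eta"
      proof -
        have "eta powr (3/2) = eta powr (1 + 1/2)" by simp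
        also have "\<dots> = eta * sqrt eta" unfolding powr_add using eta(1) by (simp add: powr_half_sqrt)
        finally show ?thesis .
      qed
      have "real (Suc n) * eta \<le> T + 1"
        using nT[of n] eta(3) by (simp add: distrib_right)
      then have "(real (Suc n) * eta) * (exp (total_dim * T) * C * sqrt eta) \<le> (T + 1) * (exp (total_dim * T) * C * sqrt eta)"
        using C eta(1) by (intro mult_right_mono) auto
      also have "\<dots> = M * sqrt eta" by (simp add: M_def)
      finally show "real (Suc n) * (exp (total_dim * T) * (C * eta powr (3/2))) \<le> e"
        using rt unfolding p by (simp add: mult_ac)
    qed
    finally show "emeasure S (\<Union>j\<in>{..n}. N j) \<le> ennreal e" .
  qed
qed

end

section \<open>Branching and resonance\<close>

context finite_game
begin

lemma NY_neq_0 [simp]: "NY \<noteq> 0"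
  using NY_ge_1 by linarith

lemma K_NY_pos [simp]: "0 < K * NY\<^sup>2"
  by (intro mult_pos_pos zero_less_power K_pos NY_pos)

text \<open>The losses of non-optimal actions at \<open>z\<close> have a positive minimum, so small
  perturbations create no new best responses. The base point is allowed to be an equivalent
  \<open>z'\<close>, because trajectories are compared only up to duplicates.\<close>

lemma br_gap:
  assumes z: "sx z"
  shows "\<exists>g>0. \<forall>z' m. eqv z' z \<longrightarrow> sx z' \<longrightarrow> sx m \<longrightarrow> dm z' m < g \<longrightarrow> (\<forall>j. br j m \<subseteq> br j z)"
proof -
  \<comment> \<open>The inserted 1 keeps the set nonempty when every action is optimal.\<close>
  define V where "V = insert 1 (\<Union>j\<in>UNIV. (\<lambda>a. mx j z - pay j a z) ` (Y j - br j z))"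
  have V: "finite V" "V \<noteq> {}" unfolding V_def by auto
  have "Min V \<in> V" using V by (rule Min_in)
  then have pos: "Min V > 0"
    using mx_ge[of _ _ z] by (fastforce simp: V_def br_iff)
  have Vle: "Min V \<le> mx j z - pay j a z" if "a \<in> Y j" "a \<notin> br j z" for j a
    using that V(1) by (intro Min_le) (auto simp: V_def)
  have "br j m \<subseteq> br j z" if h: "eqv z' z" "sx z'" "sx m" "dm z' m < Min V / (2 * K)" for z' m j
  proof
    fix a assume a: "a \<in> br j m"
    have aY: "a \<in> Y j" using a br_subset by blast
    show "a \<in> br j z"
    proof (rule ccontr)
      assume "a \<notin> br j z"
      then have "Min V \<le> mx j z - pay j a z" by (rule Vle[OF aY])
      moreover have "pay j a z = pay j a z'" by (rule eqv_pay[OF h(1), symmetric])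
      moreover obtain b where b: "b \<in> Y j" "pay j b z = mx j z" using mx_attained by blast
      moreover have "pay j b z = pay j b z'" by (rule eqv_pay[OF h(1), symmetric])
      moreover have "\<bar>pay j a m - pay j a z'\<bar> \<le> K * dm z' m" "\<bar>pay j b m - pay j b z'\<bar> \<le> K * dm z' m"
        using pay_lipschitz[OF sx_bnd[OF h(2)] sx_bnd[OF h(3)]] by blast+
      moreover have "pay j b m \<le> pay j a m" using a b(1) by (simp add: br_def)
      moreover have "K * dm z' m < Min V / 2"
        using mult_strict_left_mono[OF h(4) K_pos(1)] by simp
      ultimately show False by linarith
    qed
  qed
  then show ?thesis using pos by (intro exI[of _ "Min V / (2 * K)"]) auto
qed

text \<open>No player's choice among their own best responses at \<open>z\<close> affects the
  comparison of \<open>a\<close> and \<open>b\<close>, so its first-order change does not depend on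
  which best responses are followed.\<close>

definition flat :: "'p \<Rightarrow> 'a \<Rightarrow> 'a \<Rightarrow> ('p \<Rightarrow> 'a \<Rightarrow> real) \<Rightarrow> bool" where
  "flat i a b z \<longleftrightarrow> (\<forall>j e f. e \<in> br j z \<longrightarrow> f \<in> br j z \<longrightarrow> dd i a b j e f z = 0)"

definition some_br :: "('p \<Rightarrow> 'a \<Rightarrow> real) \<Rightarrow> 'p \<Rightarrow> 'a" where
  "some_br z j = (SOME e. e \<in> br j z)"

text \<open>The first-order change of \<open>d i a b\<close> at \<open>z\<close> in the direction of the best responses of the other players.\<close>

definition drift :: "'p \<Rightarrow> 'a \<Rightarrow> 'a \<Rightarrow> ('p \<Rightarrow> 'a \<Rightarrow> real) \<Rightarrow> real" where
  "drift i a b z = (\<Sum>j\<in>UNIV - {i}. d i a b (z(j := ind (some_br z j))))"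

lemma some_br_br: "some_br z j \<in> br j z"
  unfolding some_br_def using br_ne[of j z] by (simp add: some_in_eq)

lemma drift_swap: "drift i b a z = - drift i a b z"
  by (simp add: drift_def d_swap[of i b a] sum_negf)

lemma eqv_flat: "eqv z z' \<Longrightarrow> flat i a b z = flat i a b z'"
  by (simp add: flat_def eqv_br[of z z'] eqv_dd[of z z'])

lemma eqv_drift: "eqv z z' \<Longrightarrow> drift i a b z = drift i a b z'"
  unfolding drift_def some_br_def using eqv_d[OF eqv_upd] by (simp add: eqv_br[of z z'])

text \<open>The linear term for player \<open>j\<close> is \<open>th\<close> times the difference of
  \<open>d i a a'\<close> between the target and \<open>z\<close>. The value at \<open>z\<close> is
  0, and flatness makes the value at the target the same for every target supported on best
  responses. \<open>th\<close> may be negative, which serves the states before a tie.\<close>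

lemma d_first_order:
  assumes z: "sx z" and b: "sx b" and supp: "\<And>j e. e \<in> Y j \<Longrightarrow> e \<notin> br j z \<Longrightarrow> b j e = 0"
    and d0: "d i a a' z = 0" and fl: "flat i a a' z"
    and m: "bnd m" "\<And>j e. e \<in> Y j \<Longrightarrow> m j e = z j e + th * (b j e - z j e)"
  shows "\<bar>d i a a' m - th * drift i a a' z\<bar> \<le> K * (NY * \<bar>th\<bar>)\<^sup>2"
proof -
  have incr: "d i a a' (z(j := \<lambda>e. m j e - z j e)) = th * d i a a' (z(j := ind (some_br z j)))" if ji: "j \<noteq> i" for j
  proof -
    let ?D = "\<lambda>e. d i a a' (z(j := ind e))"
    have "d i a a' (z(j := \<lambda>e. m j e - z j e)) = (\<Sum>e\<in>Y j. (m j e - z j e) * ?D e)" by (rule d_upd[OF ji])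
    also have "\<dots> = (\<Sum>e\<in>Y j. th * (b j e * ?D e) - th * (z j e * ?D e))"
      by (intro sum.cong refl) (simp add: m(2) algebra_simps)
    also have "\<dots> = th * (\<Sum>e\<in>Y j. b j e * ?D e) - th * (\<Sum>e\<in>Y j. z j e * ?D e)"
      by (simp add: sum_subtractf sum_distrib_left)
    also have "(\<Sum>e\<in>Y j. z j e * ?D e) = d i a a' (z(j := z j))" by (rule d_upd[OF ji, symmetric])
    also have "d i a a' (z(j := z j)) = 0" using d0 by simp
    also have "(\<Sum>e\<in>Y j. b j e * ?D e) = (\<Sum>e\<in>Y j. b j e * ?D (some_br z j))"
    proof (intro sum.cong refl)
      fix e assume e: "e \<in> Y j"
      show "b j e * ?D e = b j e * ?D (some_br z j)"
      proof (cases "e \<in> br j z")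
        case True
        then have "dd i a a' j e (some_br z j) z = 0" using fl some_br_br unfolding flat_def by blast
        then show ?thesis by (simp add: dd_def)
      next
        case False
        then show ?thesis using supp[OF e] by simp
      qed
    qed
    also have "\<dots> = ?D (some_br z j)" using b by (simp add: sum_distrib_right[symmetric] sx_sum)
    finally show ?thesis by (simp only: mult_zero_right diff_zero)
  qed
  have "(\<Sum>j\<in>UNIV - {i}. d i a a' (z(j := \<lambda>e. m j e - z j e))) = th * drift i a a' z"
    unfolding drift_def sum_distrib_left using incr by (intro sum.cong refl) simp
  then have "\<bar>d i a a' m - th * drift i a a' z\<bar> \<le> K * (dm z m)\<^sup>2"
    using d_taylor[OF sx_bnd[OF z] m(1), of i a a'] d0 by simp
  also have "\<dots> \<le> K * (NY * \<bar>th\<bar>)\<^sup>2"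
  proof (intro mult_left_mono power_mono)
    show "dm z m \<le> NY * \<bar>th\<bar>"
    proof (rule dm_le_NY)
      fix j e assume e: "e \<in> Y j"
      have "\<bar>th * (b j e - z j e)\<bar> \<le> \<bar>th\<bar> * 1"
        unfolding abs_mult using sx_diff[OF z b e] by (intro mult_left_mono) auto
      then show "\<bar>m j e - z j e\<bar> \<le> \<bar>th\<bar>" using m(2)[OF e] by simp
    qed
  qed auto
  finally show ?thesis .
qed

lemma class_mass_pure:
  assumes b: "sx b" and supp: "\<And>e. e \<in> Y i \<Longrightarrow> e \<notin> A \<Longrightarrow> b i e = 0" and A: "A \<subseteq> Y i"
    and mut: "\<And>e f. e \<in> A \<Longrightarrow> f \<in> A \<Longrightarrow> dup i e f"
  shows "class_mass i c b = (if \<exists>e\<in>A. dup i c e then 1 else 0)"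
proof (cases "\<exists>e\<in>A. dup i c e")
  case True
  then obtain e where e: "e \<in> A" "dup i c e" by blast
  have "class_mass i c b = (\<Sum>f\<in>Y i. b i f)"
    unfolding class_mass_def
  proof (rule sum.mono_neutral_left)
    show "\<forall>f\<in>Y i - {f \<in> Y i. dup i c f}. b i f = 0"
    proof
      fix f assume f: "f \<in> Y i - {f \<in> Y i. dup i c f}"
      have "f \<notin> A" using dup_trans[OF e(2) mut[OF e(1), of f]] f by blast
      then show "b i f = 0" using supp f by blast
    qed
  qed auto
  then show ?thesis using True b by (simp add: sx_sum)
next
  case False
  have "class_mass i c b = 0"
    unfolding class_mass_def
  proof (rule sum.neutral, rule ballI)
    fix f assume f: "f \<in> {f \<in> Y i. dup i c f}"
    then show "b i f = 0" using supp False by blast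
  qed
  then show ?thesis using False by simp
qed

end

section \<open>The last time of uniqueness\<close>

context labeled_game
begin

lemma class_mass_continuous:
  assumes "wsol m"
  shows "continuous_on {0..} (\<lambda>t. class_mass i a (m t))"
  unfolding class_mass_def using wsol_coord_continuous[OF assms] by (intro continuous_on_sum) auto

lemma uniq_0: "uniq x0 0"
  unfolding uniq_def
proof (intro allI impI ballI)
  fix m m' s assume *: "starts m x0" "starts m' x0" "s \<in> {0..0::real}"
  have "s = 0" using *(3) by simp
  then show "eqv (m s) (m' s)" using *(1,2) by (intro eqv_coordwise) (simp add: starts_def)
qed

lemma uniq_mono: "uniq x0 t \<Longrightarrow> s \<le> t \<Longrightarrow> uniq x0 s"
  unfolding uniq_def by auto

text \<open>Uniqueness before \<open>tau\<close> extends to \<open>tau\<close> itself because class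
  masses are continuous along weak solutions.\<close>

lemma uniq_Sup:
  assumes "\<not> uniq x0 T" "0 \<le> T"
  obtains tau where "0 \<le> tau" "tau \<le> T" "uniq x0 tau" "\<And>t. tau < t \<Longrightarrow> \<not> uniq x0 t"
proof -
  define A where "A = {t. 0 \<le> t \<and> uniq x0 t}"
  have le: "t \<le> T" if "t \<in> A" for t
    using that uniq_mono[of x0 t T] assms(1) by (force simp: A_def)
  have A0: "0 \<in> A" by (simp add: A_def uniq_0)
  have bdd: "bdd_above A" using le by (rule bdd_aboveI)
  define tau where "tau = Sup A"
  have tau0: "0 \<le> tau" unfolding tau_def by (rule cSup_upper[OF A0 bdd])
  have tauT: "tau \<le> T" unfolding tau_def using A0 le by (intro cSup_least) auto
  have lt: "uniq x0 s" if "s < tau" for s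
  proof -
    have "\<exists>t\<in>A. s < t" using that A0 bdd less_cSup_iff[of A s] unfolding tau_def by blast
    then show ?thesis using uniq_mono[of x0 _ s] by (auto simp: A_def)
  qed
  have "uniq x0 tau"
    unfolding uniq_def
  proof (intro allI impI ballI)
    fix m m' s assume w: "wsol m" "wsol m'" "starts m x0" "starts m' x0" and s: "s \<in> {0..tau}"
    have early: "eqv (m r) (m' r)" if "0 \<le> r" "r < tau" for r
      using uniqD[OF lt[OF that(2)] w(1,2,3,4) that(1) order_refl] .
    show "eqv (m s) (m' s)"
    proof (cases "s < tau")
      case True
      then show ?thesis using early s by simp
    next
      case False
      then have st: "s = tau" using s by simp
      show ?thesis
      proof (cases "tau = 0")
        case True
        then show ?thesis using uniqD[OF uniq_0 w, of 0] st by simp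
      next
        case False
        then have pos: "0 < tau" using tau0 by simp
        show ?thesis
          unfolding eqv_def st
        proof (intro allI ballI)
          fix i a assume a: "a \<in> Y i"
          have "continuous_on (closure {0<..<tau}) (\<lambda>t. class_mass i a (m t) - class_mass i a (m' t))"
            using pos by (intro continuous_on_diff continuous_on_subset[OF class_mass_continuous[OF w(1)]]
              continuous_on_subset[OF class_mass_continuous[OF w(2)]]) auto
          moreover have "class_mass i a (m r) - class_mass i a (m' r) = 0" if "r \<in> {0<..<tau}" for r
            using early[of r] that a by (simp add: eqv_def)
          moreover have "tau \<in> closure {0<..<tau}" unfolding closure_greaterThanLessThan[OF pos] using pos by simp
          ultimately have "class_mass i a (m tau) - class_mass i a (m' tau) = 0"
            by (rule continuous_constant_on_closure)
          then show "class_mass i a (m tau) = class_mass i a (m' tau)" by simp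
        qed
      qed
    qed
  qed
  moreover have "\<not> uniq x0 t" if "tau < t" for t
  proof
    assume "uniq x0 t"
    then have "t \<in> A" using that tau0 by (simp add: A_def)
    then have "t \<le> tau" unfolding tau_def using bdd by (rule cSup_upper)
    then show False using that by simp
  qed
  ultimately show thesis by (rule that[OF tau0 tauT])
qed

text \<open>The case \<open>i = j\<close> is excluded by \<open>dd_self\<close>, and by
  \<open>dd_commute\<close> the influence always goes both ways.\<close>

definition mutual_tie :: "('p \<Rightarrow> 'a \<Rightarrow> real) \<Rightarrow> bool" where
  "mutual_tie z \<longleftrightarrow> (\<exists>i a b j e f. a \<in> br i z \<and> b \<in> br i z \<and> e \<in> br j z \<and> f \<in> br j z \<and> dd i a b j e f z \<noteq> 0)"

definition stalled_tie :: "('p \<Rightarrow> 'a \<Rightarrow> real) \<Rightarrow> bool" where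
  "stalled_tie z \<longleftrightarrow> (\<exists>i a b. a \<in> br i z \<and> b \<in> br i z \<and> \<not> dup i a b \<and> flat i a b z \<and> drift i a b z = 0)"

lemma d_br_0: "a \<in> br i z \<Longrightarrow> b \<in> br i z \<Longrightarrow> d i a b z = 0"
  by (simp add: br_iff d_def)

text \<open>
  Away from mutual and stalled ties, every tie is resolved at once, and in a way that is independent of the
  trajectory, because the payoff differences of tied actions move with nonzero speed.
\<close>

lemma branch_point_bad:
  assumes un: "uniq x0 tau" and tau: "0 \<le> tau" and nun: "\<And>t. tau < t \<Longrightarrow> \<not> uniq x0 t"
    and m0: "wsol m0" "starts m0 x0"
  shows "mutual_tie (m0 tau) \<or> stalled_tie (m0 tau)"
proof (rule ccontr)
  assume nb: "\<not> (mutual_tie (m0 tau) \<or> stalled_tie (m0 tau))"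
  define z where "z = m0 tau"
  have z: "sx z" unfolding z_def by (rule wsol_sx[OF m0(1) tau])
  have fl: "flat i a b z" if "a \<in> br i z" "b \<in> br i z" for i a b
    using nb that unfolding mutual_tie_def flat_def z_def by blast
  have lam0: "drift i a b z \<noteq> 0" if "a \<in> br i z" "b \<in> br i z" "\<not> dup i a b" for i a b
    using nb that fl[OF that(1,2)] unfolding stalled_tie_def z_def by blast
  obtain g where g: "g > 0" "\<And>z' m j. eqv z' z \<Longrightarrow> sx z' \<Longrightarrow> sx m \<Longrightarrow> dm z' m < g \<Longrightarrow> br j m \<subseteq> br j z"
    using br_gap[OF z] by blast
  define L where "L = insert 1 ((\<lambda>(i, a, b). \<bar>drift i a b z\<bar>) ` {(i, a, b). a \<in> br i z \<and> b \<in> br i z \<and> \<not> dup i a b})"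
  have "{(i, a, b). a \<in> br i z \<and> b \<in> br i z \<and> \<not> dup i a b} \<subseteq> (SIGMA i:UNIV. Y i \<times> Y i)"
    using br_subset by fastforce
  then have "finite {(i, a, b). a \<in> br i z \<and> b \<in> br i z \<and> \<not> dup i a b}"
    by (rule finite_subset) auto
  then have L: "finite L" unfolding L_def by simp
  have "Min L \<in> L" using L by (intro Min_in) (auto simp: L_def)
  then have Lpos: "Min L > 0" using lam0 by (auto simp: L_def)
  have Lle: "Min L \<le> \<bar>drift i a b z\<bar>" if "a \<in> br i z" "b \<in> br i z" "\<not> dup i a b" for i a b
    using L that by (intro Min_le) (auto simp: L_def intro!: image_eqI[of _ _ "(i, a, b)"])
  \<comment> \<open>The first bound keeps the states close enough that no new best responses appear;
    the second keeps the quadratic error below half of the smallest drift, so the sign of a payoff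
    difference is the sign of its drift.\<close>
  define de where "de = min (g / (2 * NY)) (Min L / (2 * (K * NY\<^sup>2)))"
  have de: "de > 0" 
  proof -
    have "0 < g / (2 * NY)" using g(1) by simp
    moreover have "0 < Min L / (2 * (K * NY\<^sup>2))" by (rule divide_pos_pos[OF Lpos mult_pos_pos[OF zero_less_numeral K_NY_pos]])
    ultimately show ?thesis by (simp only: de_def min_less_iff_conj simp_thms)
  qed
  \<comment> \<open>The tied actions that win at first order against every tied action that is not
    their duplicate. This set is determined by \<open>z\<close> alone, not by the
    trajectory.\<close>
  define A where "A i = {a \<in> br i z. \<forall>b\<in>br i z. \<not> dup i a b \<longrightarrow> drift i a b z > 0}" for i
  have mut: "dup i a b" if "a \<in> A i" "b \<in> A i" for i a b
  proof (rule ccontr)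
    assume nd: "\<not> dup i a b"
    then have "\<not> dup i b a" using dup_sym by blast
    with nd have "drift i a b z > 0" "drift i b a z > 0" using that unfolding A_def by auto
    then show False using drift_swap[of i b a z] by simp
  qed
  \<comment> \<open>Right after \<open>tau\<close> only actions in \<open>A i\<close> are best
    responses, and these are mutual duplicates, so all new mass enters one class and the class
    masses are given by a formula in \<open>z\<close> and \<open>t\<close>.\<close>
  have key: "class_mass i c (m t) = exp (tau - t) * class_mass i c z + (1 - exp (tau - t)) * (if \<exists>e\<in>A i. dup i c e then 1 else 0)"
    if m: "wsol m" "starts m x0" and t: "tau < t" "t \<le> tau + de" and c: "c \<in> Y i" for m t i c
  proof -
    define z' where "z' = m tau"
    have z': "sx z'" unfolding z'_def by (rule wsol_sx[OF m(1) tau])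
    have ez: "eqv z' z" unfolding z_def z'_def by (rule uniqD[OF un m(1) m0(1) m(2) m0(2) tau order_refl])
    have near: "br j (m r) \<subseteq> br j z" if r: "tau \<le> r" "r \<le> tau + de" for j r
    proof (rule g(2)[OF ez z'])
      show "sx (m r)" using wsol_sx[OF m(1)] tau r by simp
      have "dm z' (m r) \<le> NY * \<bar>r - tau\<bar>" unfolding z'_def by (rule wsol_lipschitz[OF m(1) tau]) (use tau r in simp)
      also have "\<dots> \<le> NY * de" using r by (intro mult_left_mono) auto
      also have "\<dots> \<le> NY * (g / (2 * NY))" by (intro mult_left_mono) (auto simp: de_def)
      also have "\<dots> = g / 2" by simp
      also have "\<dots> < g" using g(1) by simp
      finally show "dm z' (m r) < g" .
    qed
    have brA: "br j (m r) \<subseteq> A j" if r: "tau < r" "r < t" for j r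
    proof
      fix a assume a: "a \<in> br j (m r)"
      have rde: "r \<le> tau + de" using r t by simp
      have az: "a \<in> br j z" using near[of r j] r rde a by auto
      show "a \<in> A j"
        unfolding A_def
      proof (intro CollectI conjI ballI impI az)
        fix b assume b: "b \<in> br j z" and nd: "\<not> dup j a b"
        obtain bb where bb: "sx bb" "\<And>i e. e \<in> Y i \<Longrightarrow> e \<notin> br i z \<Longrightarrow> bb i e = 0"
          "\<And>i e. e \<in> Y i \<Longrightarrow> m r i e = exp (tau - r) * m tau i e + (1 - exp (tau - r)) * bb i e"
          by (rule wsol_average[OF m(1) tau r(1), of "\<lambda>i. br i z"]) (use near rde in auto)
        define th where "th = 1 - exp (tau - r)"
        have thb: "0 < th" "th \<le> de"
          using one_minus_exp_bounds(1)[of "r - tau"] r rde by (auto simp: th_def)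
        have brz: "br i z' = br i z" for i by (rule eqv_br[OF ez])
        have "\<bar>d j a b (m r) - th * drift j a b z'\<bar> \<le> K * (NY * \<bar>th\<bar>)\<^sup>2"
        proof (rule d_first_order[OF z' bb(1)])
          show "bb i e = 0" if "e \<in> Y i" "e \<notin> br i z'" for i e using bb(2) that by (simp add: brz)
          show "d j a b z' = 0" using az b by (intro d_br_0) (simp_all add: brz)
          show "flat j a b z'" using fl[OF az b] eqv_flat[OF ez] by simp
          show "bnd (m r)" using wsol_sx[OF m(1), of r] tau r by (intro sx_bnd) simp
          show "m r i e = z' i e + th * (bb i e - z' i e)" if "e \<in> Y i" for i e
            using bb(3)[OF that] by (simp add: th_def z'_def algebra_simps)
        qed
        moreover have "drift j a b z' = drift j a b z" by (rule eqv_drift[OF ez])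
        moreover have "K * (NY * \<bar>th\<bar>)\<^sup>2 < th * \<bar>drift j a b z\<bar>"
        proof -
          have "K * (NY * \<bar>th\<bar>)\<^sup>2 = th * (K * NY\<^sup>2 * th)"
            using thb by (simp add: power2_eq_square algebra_simps)
          also have "K * NY\<^sup>2 * th \<le> K * NY\<^sup>2 * (Min L / (2 * (K * NY\<^sup>2)))"
            using thb by (intro mult_left_mono) (auto simp: de_def)
          also have "\<dots> = Min L / 2" by simp
          also have "\<dots> < \<bar>drift j a b z\<bar>" using Lle[OF az b nd] Lpos by linarith
          finally show ?thesis using thb by simp
        qed
        ultimately have sgn: "\<bar>d j a b (m r) - th * drift j a b z\<bar> < th * \<bar>drift j a b z\<bar>" by simp
        have "d j a b (m r) \<ge> 0" using a b br_subset by (auto simp: br_def d_def)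
        show "drift j a b z > 0"
        proof (rule ccontr)
          assume "\<not> drift j a b z > 0"
          then have "\<bar>drift j a b z\<bar> = - drift j a b z" by simp
          then have "\<bar>d j a b (m r) - th * drift j a b z\<bar> < - (th * drift j a b z)" using sgn by simp
          then show False using \<open>d j a b (m r) \<ge> 0\<close> by linarith
        qed
      qed
    qed
    obtain bb where bb: "sx bb" "\<And>i e. e \<in> Y i \<Longrightarrow> e \<notin> A i \<Longrightarrow> bb i e = 0"
      "\<And>i e. e \<in> Y i \<Longrightarrow> m t i e = exp (tau - t) * m tau i e + (1 - exp (tau - t)) * bb i e"
      by (rule wsol_average[OF m(1) tau t(1), of A]) (use brA in auto)
    have "class_mass i c (m t) = exp (tau - t) * class_mass i c z' + (1 - exp (tau - t)) * class_mass i c bb"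
      unfolding class_mass_def by (simp add: bb(3) z'_def sum.distrib sum_distrib_left)
    moreover have "class_mass i c z' = class_mass i c z" using ez c by (simp add: eqv_def)
    moreover have "class_mass i c bb = (if \<exists>e\<in>A i. dup i c e then 1 else 0)"
    proof (rule class_mass_pure[OF bb(1)])
      show "A i \<subseteq> Y i" using br_subset by (auto simp: A_def)
    qed (use bb(2) mut in auto)
    ultimately show ?thesis by simp
  qed
  have "uniq x0 (tau + de)"
    unfolding uniq_def
  proof (intro allI impI ballI)
    fix m m' s assume w: "wsol m" "wsol m'" "starts m x0" "starts m' x0" and s: "s \<in> {0..tau + de}"
    show "eqv (m s) (m' s)"
    proof (cases "s \<le> tau")
      case True
      then show ?thesis using uniqD[OF un w, of s] s by simp
    next
      case False
      then show ?thesis using key[OF w(1,3), of s] key[OF w(2,4), of s] s by (simp add: eqv_def)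
    qed
  qed
  then show False using nun[of "tau + de"] de by simp
qed

section \<open>Starts that reach a tie are negligible\<close>

lemma open_abs_less:
  assumes "\<And>m m'. sx m \<Longrightarrow> sx m' \<Longrightarrow> \<bar>F m' - F m\<bar> \<le> C * dm m m'" "sx m" "\<bar>F m\<bar> < c" "C > 0"
  shows "\<exists>e>0. \<forall>m'. sx m' \<longrightarrow> dm m m' < e \<longrightarrow> \<bar>F m'\<bar> < (c::real)"
proof (intro exI[of _ "(c - \<bar>F m\<bar>) / C"] conjI allI impI)
  show "(c - \<bar>F m\<bar>) / C > 0" using assms by simp
  fix m' assume m': "sx m'" "dm m m' < (c - \<bar>F m\<bar>) / C"
  then have "C * dm m m' < c - \<bar>F m\<bar>" using assms(4) by (simp add: pos_less_divide_eq mult.commute)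
  then show "\<bar>F m'\<bar> < c" using assms(1)[OF assms(2) m'(1)] by linarith
qed

lemma open_abs_greater:
  assumes "\<And>m m'. sx m \<Longrightarrow> sx m' \<Longrightarrow> \<bar>F m' - F m\<bar> \<le> C * dm m m'" "sx m" "\<bar>F m\<bar> > c" "C > 0"
  shows "\<exists>e>0. \<forall>m'. sx m' \<longrightarrow> dm m m' < e \<longrightarrow> \<bar>F m'\<bar> > (c::real)"
proof (intro exI[of _ "(\<bar>F m\<bar> - c) / C"] conjI allI impI)
  show "(\<bar>F m\<bar> - c) / C > 0" using assms by simp
  fix m' assume m': "sx m'" "dm m m' < (\<bar>F m\<bar> - c) / C"
  then have "C * dm m m' < \<bar>F m\<bar> - c" using assms(4) by (simp add: pos_less_divide_eq mult.commute)
  then show "\<bar>F m'\<bar> > c" using assms(1)[OF assms(2) m'(1)] by linarith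
qed

lemma d_sx_lipschitz: "sx m \<Longrightarrow> sx m' \<Longrightarrow> \<bar>d i a b m' - d i a b m\<bar> \<le> K * dm m m'"
  by (intro d_lipschitz sx_bnd)

lemma dd_sx_lipschitz: "sx m \<Longrightarrow> sx m' \<Longrightarrow> \<bar>dd i a b j e f m' - dd i a b j e f m\<bar> \<le> (2 * K) * dm m m'"
  by (intro dd_lipschitz sx_bnd)

text \<open>Within time \<open>eta\<close> of the hit both payoff differences are below
  \<open>C * eta\<close> and the interaction is still above \<open>de\<close>. The two-strip
  estimate gives measure \<open>O(eta\<^sup>2)\<close>.\<close>

lemma mutual_tie_negligible:
  assumes ab: "a \<in> Y i" "b \<in> Y i" and ef: "e \<in> Y j" "f \<in> Y j" and T: "T \<ge> 0"
  shows "negl {x0 \<in> X. \<exists>tau m. 0 \<le> tau \<and> tau \<le> T \<and> uniq x0 tau \<and> wsol m \<and> starts m x0 \<and>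
    d i a b (m tau) = 0 \<and> d j e f (m tau) = 0 \<and> \<bar>dd i a b j e f (m tau)\<bar> > 1 / real (Suc n)}" (is "negl ?H")
proof (cases "i = j")
  case True
  then have "?H = {}" by simp
  then show ?thesis unfolding negl_def by auto
next
  case False
  define C where "C = 2 * K * NY"
  \<comment> \<open>Half of the lower bound at the hit; the other half absorbs the variation of the
    interaction before the hit.\<close>
  define de where "de = 1 / (2 * real (Suc n))"
  have C: "C > 0" and de: "de > 0" by (simp_all add: C_def de_def)
  \<comment> \<open>Guarantees \<open>C * eta < de\<close>, and \<open>C * eta\<close> bounds the
    variation of \<open>dd\<close> during time \<open>eta\<close>. The bound 1 lets
    \<open>eta\<^sup>2\<close> be estimated by \<open>eta powr (3/2)\<close>.\<close>
  define eta0 where "eta0 = min 1 (de / C)"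
  define B where "B = card (J j \<times> J i) * (4 * C / de)\<^sup>2"
  define Q where "Q eta m \<longleftrightarrow> \<bar>d i a b m\<bar> < C * eta \<and> \<bar>d j e f m\<bar> < C * eta \<and> \<bar>dd i a b j e f m\<bar> > de" for eta m
  show ?thesis
  proof (rule grid_negligible[OF T, where C=B and ?eta0.0=eta0 and Q=Q])
    show "B \<ge> 0" by (simp add: B_def)
    show "eta0 > 0" using C de by (simp add: eta0_def)
  next
    fix eta m assume eta: "0 < eta" "eta < eta0" and m: "sx m" "Q eta m"
    obtain e1 where e1: "e1 > 0" "\<And>m'. sx m' \<Longrightarrow> dm m m' < e1 \<Longrightarrow> \<bar>d i a b m'\<bar> < C * eta"
      using open_abs_less[of "d i a b" K m "C * eta", OF d_sx_lipschitz m(1)] m(2) unfolding Q_def by auto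
    obtain e2 where e2: "e2 > 0" "\<And>m'. sx m' \<Longrightarrow> dm m m' < e2 \<Longrightarrow> \<bar>d j e f m'\<bar> < C * eta"
      using open_abs_less[of "d j e f" K m "C * eta", OF d_sx_lipschitz m(1)] m(2) unfolding Q_def by auto
    obtain e3 where e3: "e3 > 0" "\<And>m'. sx m' \<Longrightarrow> dm m m' < e3 \<Longrightarrow> \<bar>dd i a b j e f m'\<bar> > de"
      using open_abs_greater[of "dd i a b j e f" "2 * K" m de, OF dd_sx_lipschitz m(1)] m(2) unfolding Q_def by auto
    show "\<exists>e>0. \<forall>m'. sx m' \<longrightarrow> dm m m' < e \<longrightarrow> Q eta m'"
      using e1 e2 e3 unfolding Q_def by (intro exI[of _ "min e1 (min e2 e3)"]) simp
  next
    fix eta m m' assume "eqv m m'" "Q eta m"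
    then show "Q eta m'" unfolding Q_def using eqv_d[of m m'] eqv_dd[of m m'] by simp
  next
    fix eta :: real
    note d_mass_measurable[measurable] dd_mass_measurable[measurable]
    have "{x \<in> X. Q eta (mass x)} = X \<inter> {x \<in> space S. \<bar>d i a b (mass x)\<bar> < C * eta \<and> \<bar>d j e f (mass x)\<bar> < C * eta \<and> \<bar>dd i a b j e f (mass x)\<bar> > de}"
      using X_space by (auto simp: Q_def)
    also have "\<dots> \<in> sets S"
    proof (rule sets.Int[OF X_sets])
      show "{x \<in> space S. \<bar>d i a b (mass x)\<bar> < C * eta \<and> \<bar>d j e f (mass x)\<bar> < C * eta \<and> \<bar>dd i a b j e f (mass x)\<bar> > de} \<in> sets S"
        by measurable
    qed
    finally show "{x \<in> X. Q eta (mass x)} \<in> sets S" .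
  next
    fix eta assume eta: "0 < eta" "eta < eta0"
    have "emeasure S {x \<in> X. Q eta (mass x)} \<le> ennreal (card (J j \<times> J i) * (4 * (C * eta) / de)\<^sup>2)"
      unfolding Q_def using C eta(1) by (intro d_pair_sublevel[OF False ab ef _ de]) simp
    also have "\<dots> \<le> ennreal (B * eta powr (3/2))"
    proof (rule ennreal_leI)
      have "eta powr 2 \<le> eta powr (3/2)" using eta by (intro powr_mono') (auto simp: eta0_def)
      then have "B * eta\<^sup>2 \<le> B * eta powr (3/2)" using eta by (intro mult_left_mono) (auto simp: B_def)
      moreover have "card (J j \<times> J i) * (4 * (C * eta) / de)\<^sup>2 = B * eta\<^sup>2"
        by (simp add: B_def power2_eq_square)
      ultimately show "card (J j \<times> J i) * (4 * (C * eta) / de)\<^sup>2 \<le> B * eta powr (3/2)" by simp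
    qed
    finally show "emeasure S {x \<in> X. Q eta (mass x)} \<le> ennreal (B * eta powr (3/2))" .
  next
    fix x0 eta assume x0: "x0 \<in> ?H" and eta: "0 < eta" "eta < eta0"
    then obtain tau m where tm: "x0 \<in> X" "0 \<le> tau" "tau \<le> T" "uniq x0 tau" "wsol m" "starts m x0"
      "d i a b (m tau) = 0" "d j e f (m tau) = 0" "\<bar>dd i a b j e f (m tau)\<bar> > 1 / real (Suc n)" by blast
    have "Q eta (m t)" if t: "0 \<le> t" "tau - eta < t" "t \<le> tau" for t
    proof -
      have sx: "sx (m tau)" "sx (m t)" using wsol_sx[OF tm(5)] tm(2) t by auto
      have "dm (m tau) (m t) \<le> NY * \<bar>t - tau\<bar>" by (rule wsol_lipschitz[OF tm(5,2) t(1)])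
      also have "\<dots> < NY * eta" using t by (intro mult_strict_left_mono) auto
      finally have dmt: "K * dm (m tau) (m t) < K * (NY * eta)" by (intro mult_strict_left_mono) auto
      have KC: "2 * (K * (NY * eta)) = C * eta" by (simp add: C_def)
      have pos: "0 \<le> K * dm (m tau) (m t)" by simp
      have Ce: "C * eta < de"
      proof -
        have "eta < de / C" using eta(2) by (simp add: eta0_def)
        then show ?thesis using C by (simp add: pos_less_divide_eq mult.commute)
      qed
      have "2 * de = 1 / real (Suc n)" by (simp add: de_def field_simps)
      then show ?thesis
        unfolding Q_def using d_sx_lipschitz[OF sx, of i a b] d_sx_lipschitz[OF sx, of j e f]
          dd_sx_lipschitz[OF sx, of i a b j e f] tm(7,8,9) dmt KC Ce pos by linarith
    qed
    then show "x0 \<in> X \<and> (\<exists>tau m. 0 \<le> tau \<and> tau \<le> T \<and> uniq x0 tau \<and> wsol m \<and> starts m x0 \<and>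
        (\<forall>t. 0 \<le> t \<longrightarrow> tau - eta < t \<longrightarrow> t \<le> tau \<longrightarrow> Q eta (m t)))" using tm(1-6) by blast
  qed
qed

text \<open>Near a stalled tie the payoff difference is quadratically small in the time to the hit.\<close>

lemma stalled_tie_negligible:
  assumes ab: "a \<in> Y i" "b \<in> Y i" and nd: "\<not> dup i a b" and T: "T \<ge> 0"
  shows "negl {x0 \<in> X. \<exists>tau m. 0 \<le> tau \<and> tau \<le> T \<and> uniq x0 tau \<and> wsol m \<and> starts m x0 \<and>
    d i a b (m tau) = 0 \<and> flat i a b (m tau) \<and> drift i a b (m tau) = 0 \<and>
    (\<forall>m' j. sx m' \<longrightarrow> dm (m tau) m' < 1 / real (Suc n) \<longrightarrow> br j m' \<subseteq> br j (m tau))}" (is "negl ?H")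
proof -
  \<comment> \<open>The error bound obtained below is
    \<open>4 * K * NY\<^sup>2 * eta\<^sup>2\<close>; the 5 makes the inequality strict, as an open
    condition needs.\<close>
  define C where "C = 5 * K * NY\<^sup>2"
  have C: "C > 0" using K_NY_pos by (simp add: C_def mult.assoc)
  \<comment> \<open>During the last \<open>eta\<close> time units the state stays within
    \<open>1 / real (Suc n)\<close> of the tie, so only actions optimal at the tie are followed;
    \<open>eta < 1\<close> serves the exponential bound.\<close>
  define eta0 where "eta0 = min 1 (1 / (NY * real (Suc n)))"
  obtain D where D: "D \<ge> 0" "\<And>e. e > 0 \<Longrightarrow> emeasure S {x \<in> X. \<bar>d i a b (mass x)\<bar> < e} \<le> ennreal (D * e powr (3/4))"
    using d_sublevel[OF ab nd] by blast
  define B where "B = D * C powr (3/4)"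
  define Q where "Q eta m \<longleftrightarrow> \<bar>d i a b m\<bar> < C * eta\<^sup>2" for eta m
  show ?thesis
  proof (rule grid_negligible[OF T, where C=B and ?eta0.0=eta0 and Q=Q])
    show "B \<ge> 0" using D(1) by (simp add: B_def)
    show "eta0 > 0" by (simp add: eta0_def)
  next
    fix eta m assume eta: "0 < eta" "eta < eta0" and m: "sx m" "Q eta m"
    then show "\<exists>e>0. \<forall>m'. sx m' \<longrightarrow> dm m m' < e \<longrightarrow> Q eta m'"
      using open_abs_less[of "d i a b" K m "C * eta\<^sup>2", OF d_sx_lipschitz m(1)] unfolding Q_def by simp
  next
    fix eta m m' assume "eqv m m'" "Q eta m"
    then show "Q eta m'" unfolding Q_def using eqv_d[of m m'] by simp
  next
    fix eta :: real
    note d_mass_measurable[measurable]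
    have "{x \<in> X. Q eta (mass x)} = X \<inter> {x \<in> space S. \<bar>d i a b (mass x)\<bar> < C * eta\<^sup>2}"
      using X_space by (auto simp: Q_def)
    also have "\<dots> \<in> sets S"
    proof (rule sets.Int[OF X_sets])
      show "{x \<in> space S. \<bar>d i a b (mass x)\<bar> < C * eta\<^sup>2} \<in> sets S" by measurable
    qed
    finally show "{x \<in> X. Q eta (mass x)} \<in> sets S" .
  next
    fix eta assume eta: "0 < eta" "eta < eta0"
    have "emeasure S {x \<in> X. Q eta (mass x)} \<le> ennreal (D * (C * eta\<^sup>2) powr (3/4))"
      unfolding Q_def using C eta by (intro D(2)) simp
    also have "(C * eta\<^sup>2) powr (3/4) = C powr (3/4) * eta powr (3/2)"
    proof -
      have "(eta\<^sup>2) powr (3/4) = (eta powr 2) powr (3/4)" using eta by simp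
      also have "\<dots> = eta powr (3/2)" unfolding powr_powr by simp
      finally show ?thesis using C eta by (simp add: powr_mult)
    qed
    finally show "emeasure S {x \<in> X. Q eta (mass x)} \<le> ennreal (B * eta powr (3/2))"
      by (simp add: B_def mult.assoc)
  next
    fix x0 eta assume x0: "x0 \<in> ?H" and eta: "0 < eta" "eta < eta0"
    then obtain tau m where tm: "x0 \<in> X" "0 \<le> tau" "tau \<le> T" "uniq x0 tau" "wsol m" "starts m x0"
      "d i a b (m tau) = 0" "flat i a b (m tau)" "drift i a b (m tau) = 0"
      "\<forall>m' j. sx m' \<longrightarrow> dm (m tau) m' < 1 / real (Suc n) \<longrightarrow> br j m' \<subseteq> br j (m tau)" by blast
    have eta1: "eta < 1" using eta by (simp add: eta0_def)
    have "eta < 1 / (NY * real (Suc n))" using eta by (simp add: eta0_def)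
    then have eta2: "NY * eta < 1 / real (Suc n)"
      by (simp add: pos_less_divide_eq mult_ac del: of_nat_Suc)
    have sxt: "sx (m tau)" by (rule wsol_sx[OF tm(5,2)])
    have Ce: "0 < C * eta\<^sup>2" using C eta by simp
    have "Q eta (m t)" if t: "0 \<le> t" "tau - eta < t" "t \<le> tau" for t
    proof (cases "t = tau")
      case True
      then show ?thesis using tm(7) Ce by (simp add: Q_def)
    next
      case False
      then have tt: "t < tau" using t by simp
      have near: "br j (m r) \<subseteq> br j (m tau)" if r: "t < r" "r < tau" for j r
      proof -
        have r0: "0 \<le> r" using r t by simp
        have "dm (m tau) (m r) \<le> NY * \<bar>r - tau\<bar>" by (rule wsol_lipschitz[OF tm(5,2) r0])
        also have "\<dots> \<le> NY * eta" using r t by (intro mult_left_mono) auto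
        also have "\<dots> < 1 / real (Suc n)" by (rule eta2)
        finally show ?thesis using tm(10) wsol_sx[OF tm(5) r0] by blast
      qed
      obtain bb where bb: "sx bb" "\<And>i e. e \<in> Y i \<Longrightarrow> e \<notin> br i (m tau) \<Longrightarrow> bb i e = 0"
        "\<And>i e. e \<in> Y i \<Longrightarrow> m tau i e = exp (t - tau) * m t i e + (1 - exp (t - tau)) * bb i e"
        by (rule wsol_average[OF tm(5) t(1) tt, of "\<lambda>i. br i (m tau)"]) (use near in auto)
      define h where "h = tau - t"
      have h: "0 < h" "h < eta" using tt t by (auto simp: h_def)
      \<comment> \<open>Negative: the state at \<open>t\<close> is expressed from the tie by running
        backwards, as an extrapolation away from the averaged target.\<close>
      define th where "th = 1 - exp h"
      have eh: "exp h * exp (t - tau) = 1" by (simp add: exp_add[symmetric] h_def)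
      have mt: "m t k e = m tau k e + th * (bb k e - m tau k e)" if "e \<in> Y k" for k e
      proof -
        have "exp h * m tau k e = (exp h * exp (t - tau)) * m t k e + (exp h - exp h * exp (t - tau)) * bb k e"
          unfolding bb(3)[OF that] by (simp add: algebra_simps)
        then have "exp h * m tau k e = m t k e + (exp h - 1) * bb k e" unfolding eh by simp
        then show ?thesis by (simp add: th_def algebra_simps)
      qed
      have thb: "\<bar>th\<bar> \<le> 2 * eta"
      proof -
        have "exp h \<le> 1 + h + h\<^sup>2" using h eta1 by (intro exp_bound) auto
        moreover have "h\<^sup>2 \<le> h" using h eta1 by (simp add: power2_eq_square mult_left_le)
        moreover have "exp h \<ge> 1" using h by simp
        ultimately show ?thesis using h by (simp add: th_def)
      qed
      have "\<bar>d i a b (m t) - th * drift i a b (m tau)\<bar> \<le> K * (NY * \<bar>th\<bar>)\<^sup>2"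
        by (rule d_first_order[OF sxt bb(1,2) tm(7,8) _ mt]) (use wsol_sx[OF tm(5) t(1)] in auto)
      also have "\<dots> \<le> K * (NY * (2 * eta))\<^sup>2"
        using thb by (intro mult_left_mono power_mono) auto
      also have "\<dots> = 4 * K * NY\<^sup>2 * eta\<^sup>2" by (simp add: power_mult_distrib)
      also have "\<dots> < C * eta\<^sup>2"
      proof -
        have "0 < (K * NY\<^sup>2) * eta\<^sup>2" by (rule mult_pos_pos[OF K_NY_pos]) (use eta in simp)
        moreover have "C * eta\<^sup>2 - 4 * K * NY\<^sup>2 * eta\<^sup>2 = (K * NY\<^sup>2) * eta\<^sup>2"
          by (simp add: C_def algebra_simps)
        ultimately show ?thesis by linarith
      qed
      finally show ?thesis using tm(9) by (simp add: Q_def)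
    qed
    then show "x0 \<in> X \<and> (\<exists>tau m. 0 \<le> tau \<and> tau \<le> T \<and> uniq x0 tau \<and> wsol m \<and> starts m x0 \<and>
        (\<forall>t. 0 \<le> t \<longrightarrow> tau - eta < t \<longrightarrow> t \<le> tau \<longrightarrow> Q eta (m t)))" using tm(1-6) by blast
  qed
qed

lemma negl_Un: "negl A \<Longrightarrow> negl B \<Longrightarrow> negl (A \<union> B)"
  unfolding negl_def by (meson Un_mono null_sets.Un)

text \<open>At the last time of uniqueness there is a mutual or a stalled tie. The index
  \<open>n\<close> makes quantitative the size of the interaction, respectively the radius without
  new best responses, so countably many of the previous null sets suffice.\<close>

lemma not_unique_negligible:
  assumes T: "T \<ge> 0"
  shows "negl {x0 \<in> X. \<not> uniq x0 T}"
proof -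
  define H1 where "H1 i a b j e f n = {x0 \<in> X. \<exists>tau m. 0 \<le> tau \<and> tau \<le> T \<and> uniq x0 tau \<and> wsol m \<and> starts m x0 \<and>
    d i a b (m tau) = 0 \<and> d j e f (m tau) = 0 \<and> \<bar>dd i a b j e f (m tau)\<bar> > 1 / real (Suc n)}" for i a b j e f n
  define H2 where "H2 i a b n = {x0 \<in> X. \<exists>tau m. 0 \<le> tau \<and> tau \<le> T \<and> uniq x0 tau \<and> wsol m \<and> starts m x0 \<and>
    d i a b (m tau) = 0 \<and> flat i a b (m tau) \<and> drift i a b (m tau) = 0 \<and>
    (\<forall>m' j. sx m' \<longrightarrow> dm (m tau) m' < 1 / real (Suc n) \<longrightarrow> br j m' \<subseteq> br j (m tau))}" for i a b n
  have n1: "negl (\<Union>i\<in>UNIV. \<Union>a\<in>Y i. \<Union>b\<in>Y i. \<Union>j\<in>UNIV. \<Union>e\<in>Y j. \<Union>f\<in>Y j. \<Union>n\<in>UNIV. H1 i a b j e f n)"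
    by (intro negl_UN countable_finite fin finite countableI_type) (unfold H1_def, rule mutual_tie_negligible[OF _ _ _ _ T])
  have n2: "negl (\<Union>i\<in>UNIV. \<Union>a\<in>Y i. \<Union>b\<in>{b \<in> Y i. \<not> dup i a b}. \<Union>n\<in>UNIV. H2 i a b n)"
  proof (intro negl_UN)
    fix i a b n assume "a \<in> Y i" "b \<in> {b \<in> Y i. \<not> dup i a b}"
    then show "negl (H2 i a b n)" unfolding H2_def by (intro stalled_tie_negligible[OF _ _ _ T]) auto
  qed (simp_all add: countable_finite)
  have "{x0 \<in> X. \<not> uniq x0 T} \<subseteq>
      (\<Union>i\<in>UNIV. \<Union>a\<in>Y i. \<Union>b\<in>Y i. \<Union>j\<in>UNIV. \<Union>e\<in>Y j. \<Union>f\<in>Y j. \<Union>n\<in>UNIV. H1 i a b j e f n) \<union>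
      (\<Union>i\<in>UNIV. \<Union>a\<in>Y i. \<Union>b\<in>{b \<in> Y i. \<not> dup i a b}. \<Union>n\<in>UNIV. H2 i a b n)" (is "_ \<subseteq> ?A \<union> ?B")
  proof
    fix x0 assume "x0 \<in> {x0 \<in> X. \<not> uniq x0 T}"
    then have x0: "x0 \<in> X" and nu: "\<not> uniq x0 T" by auto
    obtain tau where tau: "0 \<le> tau" "tau \<le> T" "uniq x0 tau" and nun: "\<And>t. tau < t \<Longrightarrow> \<not> uniq x0 t"
      using uniq_Sup[OF nu T] by metis
    obtain m where m: "wsol m" "starts m x0" using nu unfolding uniq_def by blast
    have sxm: "sx (m tau)" by (rule wsol_sx[OF m(1) tau(1)])
    have "mutual_tie (m tau) \<or> stalled_tie (m tau)" by (rule branch_point_bad[OF tau(3,1) nun m])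
    then show "x0 \<in> ?A \<union> ?B"
    proof
      assume "mutual_tie (m tau)"
      then obtain i a b j e f where h: "a \<in> br i (m tau)" "b \<in> br i (m tau)" "e \<in> br j (m tau)" "f \<in> br j (m tau)"
        "dd i a b j e f (m tau) \<noteq> 0" unfolding mutual_tie_def by blast
      obtain n :: nat where n: "1 / Suc n < \<bar>dd i a b j e f (m tau)\<bar>"
        using nat_approx_posE[of "\<bar>dd i a b j e f (m tau)\<bar>"] h(5) by auto
      have x1: "x0 \<in> H1 i a b j e f n"
        unfolding H1_def using x0 tau m n d_br_0[OF h(1,2)] d_br_0[OF h(3,4)] by blast
      have hy: "a \<in> Y i" "b \<in> Y i" "e \<in> Y j" "f \<in> Y j" using h(1-4) br_subset by blast+
      show ?thesis
        by (rule UnI1, rule UN_I[OF UNIV_I], rule UN_I[OF hy(1)], rule UN_I[OF hy(2)], rule UN_I[OF UNIV_I],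
          rule UN_I[OF hy(3)], rule UN_I[OF hy(4)], rule UN_I[OF UNIV_I], rule x1)
    next
      assume "stalled_tie (m tau)"
      then obtain i a b where h: "a \<in> br i (m tau)" "b \<in> br i (m tau)" "\<not> dup i a b" "flat i a b (m tau)" "drift i a b (m tau) = 0"
        unfolding stalled_tie_def by blast
      obtain g where g: "g > 0" "\<forall>z' m'. eqv z' (m tau) \<longrightarrow> sx z' \<longrightarrow> sx m' \<longrightarrow> dm z' m' < g \<longrightarrow> (\<forall>j. br j m' \<subseteq> br j (m tau))"
        using br_gap[OF sxm] by blast
      obtain n :: nat where n: "1 / Suc n < g" using nat_approx_posE[OF g(1)] by blast
      have "\<forall>m' j. sx m' \<longrightarrow> dm (m tau) m' < 1 / real (Suc n) \<longrightarrow> br j m' \<subseteq> br j (m tau)"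
      proof (intro allI impI)
        fix m' j assume sm: "sx m'" and "dm (m tau) m' < 1 / real (Suc n)"
        then have "dm (m tau) m' < g" using n by linarith
        then show "br j m' \<subseteq> br j (m tau)" by (rule g(2)[rule_format, OF eqv_refl sxm sm])
      qed
      then have x2: "x0 \<in> H2 i a b n"
        unfolding H2_def using x0 tau m d_br_0[OF h(1,2)] h(4,5) by blast
      have hy: "a \<in> Y i" "b \<in> {b \<in> Y i. \<not> dup i a b}" using h(1-3) br_subset by blast+
      show ?thesis
        by (rule UnI2, rule UN_I[OF UNIV_I], rule UN_I[OF hy(1)], rule UN_I[OF hy(2)], rule UN_I[OF UNIV_I], rule x2)
    qed
  qed
  then show ?thesis by (rule negl_subset[OF negl_Un[OF n1 n2]])
qed

text \<open>The set where the payoff difference vanishes is approximated by the open sets where it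
  is smaller than \<open>ep\<close>, to which the compression bound applies.\<close>

lemma zero_negligible:
  assumes ab: "a \<in> Y i" "b \<in> Y i" "\<not> dup i a b" and t: "t \<ge> 0"
  shows "negl {x0 \<in> X. uniq x0 t \<and> (\<exists>m. wsol m \<and> starts m x0 \<and> d i a b (m t) = 0)}"
proof (rule neglI)
  fix e :: real assume e: "e > 0"
  obtain C where C: "C \<ge> 0" "\<And>e. e > 0 \<Longrightarrow> emeasure S {x \<in> X. \<bar>d i a b (mass x)\<bar> < e} \<le> ennreal (C * e powr (3/4))"
    using d_sublevel[OF ab] by blast
  define M where "M = exp (total_dim * t) * C"
  have M: "M \<ge> 0" using C by (simp add: M_def)
  \<comment> \<open>Solves \<open>ep powr (3/4) = e / (M + 1)\<close>, so that the final bound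
    \<open>M * (e / (M + 1))\<close> is at most \<open>e\<close>.\<close>
  define ep where "ep = (e / (M + 1)) powr (4/3)"
  have ep: "ep > 0" using e M by (simp add: ep_def)
  have epp: "ep powr (3/4) = e / (M + 1)" using e M by (simp add: ep_def powr_powr)
  have "\<exists>N\<in>sets S. {x0 \<in> X. uniq x0 t \<and> (\<exists>m. wsol m \<and> starts m x0 \<and> \<bar>d i a b (m t)\<bar> < ep)} \<subseteq> N \<and>
    emeasure S N \<le> ennreal (exp (total_dim * t)) * emeasure S {x \<in> X. \<bar>d i a b (mass x)\<bar> < ep}"
  proof (rule unique_flow_compression[OF t, where Q="\<lambda>m. \<bar>d i a b m\<bar> < ep"])
    show "\<exists>e>0. \<forall>m'. sx m' \<longrightarrow> dm m m' < e \<longrightarrow> \<bar>d i a b m'\<bar> < ep" if "sx m" "\<bar>d i a b m\<bar> < ep" for m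
      by (rule open_abs_less[of "d i a b" K, OF d_sx_lipschitz that K_pos(1)])
    show "\<bar>d i a b m'\<bar> < ep" if "eqv m m'" "\<bar>d i a b m\<bar> < ep" for m m'
      using that eqv_d[of m m'] by simp
    note d_mass_measurable[measurable]
    have "{x \<in> X. \<bar>d i a b (mass x)\<bar> < ep} = X \<inter> {x \<in> space S. \<bar>d i a b (mass x)\<bar> < ep}"
      using X_space by auto
    also have "\<dots> \<in> sets S"
    proof (rule sets.Int[OF X_sets])
      show "{x \<in> space S. \<bar>d i a b (mass x)\<bar> < ep} \<in> sets S" by measurable
    qed
    finally show "{x \<in> X. \<bar>d i a b (mass x)\<bar> < ep} \<in> sets S" .
  qed
  then obtain N where N: "N \<in> sets S"
    "{x0 \<in> X. uniq x0 t \<and> (\<exists>m. wsol m \<and> starts m x0 \<and> \<bar>d i a b (m t)\<bar> < ep)} \<subseteq> N"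
    "emeasure S N \<le> ennreal (exp (total_dim * t)) * emeasure S {x \<in> X. \<bar>d i a b (mass x)\<bar> < ep}" by blast
  have sub: "{x0 \<in> X. uniq x0 t \<and> (\<exists>m. wsol m \<and> starts m x0 \<and> d i a b (m t) = 0)} \<subseteq> N"
  proof
    fix x0 assume "x0 \<in> {x0 \<in> X. uniq x0 t \<and> (\<exists>m. wsol m \<and> starts m x0 \<and> d i a b (m t) = 0)}"
    then obtain m where m: "x0 \<in> X" "uniq x0 t" "wsol m" "starts m x0" "d i a b (m t) = 0" by blast
    then have "\<bar>d i a b (m t)\<bar> < ep" using ep by simp
    with m(1-4) N(2) show "x0 \<in> N" by blast
  qed
  have "emeasure S N \<le> ennreal (exp (total_dim * t)) * ennreal (C * ep powr (3/4))"
    by (rule order_trans[OF N(3) mult_left_mono[OF C(2)[OF ep]]]) simp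
  also have "\<dots> = ennreal (M * (e / (M + 1)))"
    using C(1) by (simp add: ennreal_mult'[symmetric] epp M_def mult.assoc)
  also have "\<dots> \<le> ennreal e"
    using e M by (intro ennreal_leI) (simp add: field_simps)
  finally show "\<exists>N\<in>sets S. {x0 \<in> X. uniq x0 t \<and> (\<exists>m. wsol m \<and> starts m x0 \<and> d i a b (m t) = 0)} \<subseteq> N \<and> emeasure S N \<le> ennreal e"
    using N(1) sub by blast
qed

text \<open>Restricting ties to integer times keeps the union countable; starts that are not unique
  up to such a time are discarded separately.\<close>

lemma resonant_start_negligible:
  "negl {x0 \<in> X. \<exists>m. wsol m \<and> starts m x0 \<and>
    (\<exists>n :: nat. \<exists>i a b. a \<in> Y i \<and> b \<in> Y i \<and> \<not> dup i a b \<and> d i a b (m (real n)) = 0)}" (is "negl ?H")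
proof -
  define A where "A n = {x0 \<in> X. \<not> uniq x0 (real n)}" for n :: nat
  define B where "B n i a b = {x0 \<in> X. uniq x0 (real n) \<and> (\<exists>m. wsol m \<and> starts m x0 \<and> d i a b (m (real n)) = 0)}" for n :: nat and i a b
  have nA: "negl (\<Union>n\<in>UNIV. A n)"
    by (rule negl_UN) (auto simp: A_def not_unique_negligible)
  have nB: "negl (\<Union>n\<in>UNIV. \<Union>i\<in>UNIV. \<Union>a\<in>Y i. \<Union>b\<in>{b \<in> Y i. \<not> dup i a b}. B n i a b)"
  proof (intro negl_UN)
    fix n :: nat and i a b assume "a \<in> Y i" "b \<in> {b \<in> Y i. \<not> dup i a b}"
    then show "negl (B n i a b)" unfolding B_def by (intro zero_negligible) auto
  qed (simp_all add: countable_finite)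
  have "?H \<subseteq> (\<Union>n\<in>UNIV. A n) \<union> (\<Union>n\<in>UNIV. \<Union>i\<in>UNIV. \<Union>a\<in>Y i. \<Union>b\<in>{b \<in> Y i. \<not> dup i a b}. B n i a b)" (is "_ \<subseteq> ?A \<union> ?B")
  proof
    fix x0 assume "x0 \<in> ?H"
    then obtain m n i a b where h: "x0 \<in> X" "wsol m" "starts m x0" "a \<in> Y i" "b \<in> Y i" "\<not> dup i a b" "d i a b (m (real n)) = 0"
      by blast
    show "x0 \<in> ?A \<union> ?B"
    proof (cases "uniq x0 (real n)")
      case True
      then have x1: "x0 \<in> B n i a b" unfolding B_def using h by blast
      have hy: "b \<in> {b \<in> Y i. \<not> dup i a b}" using h(5,6) by simp
      show ?thesis
        by (rule UnI2, rule UN_I[OF UNIV_I], rule UN_I[OF UNIV_I], rule UN_I[OF h(4)], rule UN_I[OF hy], rule x1)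
    next
      case False
      then have "x0 \<in> A n" using h(1) by (simp add: A_def)
      then show ?thesis by blast
    qed
  qed
  then show ?thesis by (rule negl_subset[OF negl_Un[OF nA nB]])
qed

end

section \<open>Regular equilibria in mass coordinates\<close>

text \<open>The map contracts by 1/2 on the ball only, and the centre moves by at most
  \<open>r / 2\<close>, so the geometric series keeps all iterates in the ball. \<open>N A\<close>
  ignores values outside \<open>A\<close>, hence the limit is taken coordinate by coordinate on
  \<open>A\<close>.\<close>

lemma finite_contraction_fixpoint:
  fixes F :: "('s \<Rightarrow> real) \<Rightarrow> 's \<Rightarrow> real"
  defines "N \<equiv> \<lambda>A p p'. \<Sum>s\<in>A. \<bar>p' s - p s\<bar> :: real"
  assumes A: "finite A" and r: "r > 0"
    and contr: "\<And>p p'. N A c p \<le> r \<Longrightarrow> N A c p' \<le> r \<Longrightarrow> N A (F p) (F p') \<le> N A p p' / 2"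
    and c: "N A c (F c) \<le> r / 2"
  shows "\<exists>p. N A c p \<le> r \<and> (\<forall>s\<in>A. F p s = p s)"
proof -
  have tri: "N A p p'' \<le> N A p p' + N A p' p''" for p p' p''
    unfolding N_def sum.distrib[symmetric] by (intro sum_mono) auto
  have nn: "N A p p' \<ge> 0" for p p' unfolding N_def by (intro sum_nonneg) auto
  have symm: "N A p p' = N A p' p" for p p' unfolding N_def by (simp add: abs_minus_commute)
  have cc: "N A c c \<le> r" using r by (simp add: N_def)
  define x where "x n = (F ^^ n) c" for n
  have x_Suc: "x (Suc n) = F (x n)" for n by (simp add: x_def)
  have main: "N A c (x n) \<le> r * (1 - (1/2) ^ n) \<and> N A (x n) (x (Suc n)) \<le> r / 2 * (1/2) ^ n" for n
  proof (induction n)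
    case 0
    show ?case using c by (simp add: x_def N_def)
  next
    case (Suc n)
    have le: "r * (1 - (1/2) ^ m) \<le> r" for m :: nat using r by (simp add: mult_left_le)
    have 1: "N A c (x (Suc n)) \<le> r * (1 - (1/2) ^ Suc n)"
      using Suc tri[of c "x (Suc n)" "x n"] by (simp add: algebra_simps)
    have "N A (F (x n)) (F (x (Suc n))) \<le> N A (x n) (x (Suc n)) / 2"
      using Suc 1 le[of n] le[of "Suc n"] by (intro contr) linarith+
    then show ?case using Suc 1 by (simp add: x_Suc)
  qed
  have conv: "convergent (\<lambda>n. x n s)" if s: "s \<in> A" for s
  proof -
    have "\<bar>x (Suc n) s - x n s\<bar> \<le> N A (x n) (x (Suc n))" for n
      unfolding N_def using s A by (intro member_le_sum[where f="\<lambda>s. \<bar>x (Suc n) s - x n s\<bar>"]) auto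
    then have "\<bar>x (Suc n) s - x n s\<bar> \<le> r / 2 * (1/2) ^ n" for n using main[of n] by (meson order_trans)
    note bound = this
    have "summable (\<lambda>n. r / 2 * (1/2 :: real) ^ n)" by (intro summable_mult summable_geometric) simp
    then have "summable (\<lambda>n. x (Suc n) s - x n s)"
      by (rule summable_comparison_test'[where N=0]) (use bound in simp)
    then have "convergent (\<lambda>n. \<Sum>k<n. x (Suc k) s - x k s)" by (simp add: summable_iff_convergent)
    then have "convergent (\<lambda>n. x n s - x 0 s)"
      by (simp add: sum_lessThan_telescope[of "\<lambda>n. x n s"])
    then have "convergent (\<lambda>n. (x n s - x 0 s) + x 0 s)"
      by (intro convergent_add convergent_const)
    then show ?thesis by simp
  qed
  define l where "l s = lim (\<lambda>n. x n s)" for s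
  have lim: "(\<lambda>n. x n s) \<longlonglongrightarrow> l s" if "s \<in> A" for s
    using conv[OF that] unfolding l_def by (simp add: convergent_LIMSEQ_iff)
  have Nlim: "(\<lambda>n. N A q (x n)) \<longlonglongrightarrow> N A q l" for q
    unfolding N_def using lim by (intro tendsto_intros) auto
  have le: "N A c (x n) \<le> r" for n
  proof -
    have "r * (1 - (1/2) ^ n) \<le> r" using r by (simp add: mult_left_le)
    then show ?thesis using main[of n] by linarith
  qed
  have lr: "N A c l \<le> r" by (rule LIMSEQ_le_const2[OF Nlim]) (use le in auto)
  have "N A (F l) l \<le> 0"
  proof (rule LIMSEQ_le_const2)
    have "(\<lambda>n. N A l (x n)) \<longlonglongrightarrow> 0" using Nlim[of l] by (simp add: N_def)
    moreover have "(\<lambda>n. N A (F l) (x (Suc n))) \<longlonglongrightarrow> N A (F l) l" using Nlim[of "F l"] by (rule LIMSEQ_Suc)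
    ultimately show "(\<lambda>n. N A (F l) (x (Suc n)) - N A l (x n)) \<longlonglongrightarrow> N A (F l) l"
      using tendsto_diff by fastforce
    have "N A (F l) (x (Suc n)) \<le> N A l (x n)" for n
      using contr[OF lr le[of n]] nn[of l "x n"] by (simp add: x_Suc)
    then show "\<exists>M. \<forall>n\<ge>M. N A (F l) (x (Suc n)) - N A l (x n) \<le> 0" by simp
  qed
  then have "N A (F l) l = 0" using nn[of "F l" l] by simp
  then have "\<forall>s\<in>A. F l s = l s"
    unfolding N_def using A by (subst (asm) sum_nonneg_eq_0_iff) auto
  then show ?thesis using lr by blast
qed

text \<open>\<open>V\<close> increases to 0, and while it is negative \<open>sqrt (- V t)\<close>
  decreases at rate at least \<open>c / 2\<close>, which is possible only for a bounded
  time.\<close>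

lemma finite_time_extinction:
  fixes V V' :: "real \<Rightarrow> real"
  assumes der: "\<And>t. T < t \<Longrightarrow> (V has_real_derivative V' t) (at t)"
    and low: "\<And>t. T < t \<Longrightarrow> V' t \<ge> c * sqrt \<bar>V t\<bar>" and c: "c > 0"
    and lim: "(V \<longlongrightarrow> 0) at_top"
  shows "\<exists>T1>T. \<forall>t\<ge>T1. V t = 0"
proof -
  have V'0: "V' t \<ge> 0" if "T < t" for t
  proof -
    have "0 \<le> c * sqrt \<bar>V t\<bar>" using c by simp
    then show ?thesis using low[OF that] by linarith
  qed
  have mono: "V s \<le> V t" if "T < s" "s \<le> t" for s t
  proof (rule DERIV_nonneg_imp_nondecreasing[OF that(2)])
    fix r assume "s \<le> r" "r \<le> t"
    then have "T < r" using that by simp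
    then show "\<exists>y. (V has_real_derivative y) (at r) \<and> 0 \<le> y" using der V'0 by blast
  qed
  have le0: "V t \<le> 0" if "T < t" for t
  proof (rule tendsto_lowerbound[OF lim])
    show "eventually (\<lambda>s. V t \<le> V s) at_top"
      by (rule eventually_at_top_linorderI[of t]) (use mono that in auto)
  qed simp
  have "\<exists>t1>T. V t1 = 0"
  proof (rule ccontr)
    assume "\<not> ?thesis"
    then have neg: "V t < 0" if "T < t" for t using le0[OF that] that by force
    define w where "w t = sqrt (- V t)" for t
    have wder: "(w has_real_derivative (- V' t) * (inverse (sqrt (- V t)) / 2)) (at t)" if t: "T < t" for t
      unfolding w_def using neg[OF t] der[OF t] by (auto intro!: derivative_eq_intros)
    have wle: "(- V' t) * (inverse (sqrt (- V t)) / 2) \<le> - c / 2" if t: "T < t" for t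
    proof -
      have sp: "sqrt (- V t) > 0" using neg[OF t] by simp
      have "c * sqrt (- V t) \<le> V' t" using low[OF t] neg[OF t] by simp
      then have "c \<le> V' t * inverse (sqrt (- V t))" using sp by (simp add: field_simps)
      then show ?thesis by simp
    qed
    define a where "a = T + 1"
    \<comment> \<open>After this time the decrease would be at least \<open>w a + 1\<close>, forcing
      \<open>w b\<close> below 0.\<close>
    define b where "b = a + 2 * (w a + 1) / c"
    have wa: "w a \<ge> 0" using le0[of a] by (simp add: w_def a_def)
    have ab: "a < b" using wa c by (simp add: b_def)
    obtain q where q: "a < q" "q < b" "w b - w a = (b - a) * ((- V' q) * (inverse (sqrt (- V q)) / 2))"
      using MVT2[OF ab, of w "\<lambda>t. (- V' t) * (inverse (sqrt (- V t)) / 2)"] wder by (auto simp: a_def)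
    have "w b - w a \<le> (b - a) * (- c / 2)"
      unfolding q(3) using ab q(1) by (intro mult_left_mono wle) (auto simp: a_def)
    also have "\<dots> = - (w a + 1)" using c by (simp add: b_def field_simps)
    finally have "w b < 0" by simp
    moreover have "w b \<ge> 0" using le0[of b] ab by (simp add: w_def a_def)
    ultimately show False by simp
  qed
  then obtain t1 where t1: "T < t1" "V t1 = 0" by blast
  have "V t = 0" if "t \<ge> t1" for t using mono[OF t1(1) that] le0[of t] t1 that by simp
  then show ?thesis using t1(1) by blast
qed

context finite_game
begin

definition supp :: "('p \<Rightarrow> 'a \<Rightarrow> real) \<Rightarrow> 'p \<Rightarrow> 'a set" where
  "supp m i = {a \<in> Y i. m i a \<noteq> 0}"

lemma supp_subset: "supp m i \<subseteq> Y i" by (auto simp: supp_def)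

lemma finite_supp [simp, intro]: "finite (supp m i)"
  by (rule finite_subset[OF supp_subset]) simp

end

text \<open>
  A regular equilibrium in mass coordinates: every best response is played, and the Hessian of the
  potential along the supports, relative to the base actions \<open>a0\<close>, has the inverse \<open>B\<close>.
\<close>

locale regular_point = finite_game Y u
  for Y :: "'p::finite \<Rightarrow> 'a set" and u :: "('p \<Rightarrow> 'a) \<Rightarrow> real" +
  fixes z :: "'p \<Rightarrow> 'a \<Rightarrow> real" and a0 :: "'p \<Rightarrow> 'a" and B :: "'p \<times> 'a \<Rightarrow> 'p \<times> 'a \<Rightarrow> real"
  assumes z: "sx z" and a0: "a0 i \<in> supp z i" and br_supp: "br i z = supp z i"
    and inverse_B: "\<And>p q. p \<in> (SIGMA i:UNIV. supp z i - {a0 i}) \<Longrightarrow> q \<in> (SIGMA i:UNIV. supp z i - {a0 i}) \<Longrightarrow>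
       (\<Sum>r\<in>(SIGMA i:UNIV. supp z i - {a0 i}). dd (fst p) (snd p) (a0 (fst p)) (fst r) (snd r) (a0 (fst r)) z * B r q) = (if p = q then 1 else 0) \<and>
       (\<Sum>r\<in>(SIGMA i:UNIV. supp z i - {a0 i}). B p r * dd (fst r) (snd r) (a0 (fst r)) (fst q) (snd q) (a0 (fst q)) z) = (if p = q then 1 else 0)"
begin

section \<open>A quantitative inverse function theorem along the supports\<close>

definition I :: "('p \<times> 'a) set" where "I = (SIGMA i:UNIV. supp z i - {a0 i})"
definition H :: "'p \<times> 'a \<Rightarrow> 'p \<times> 'a \<Rightarrow> real" where
  "H p r = dd (fst p) (snd p) (a0 (fst p)) (fst r) (snd r) (a0 (fst r)) z"
definition g :: "'p \<times> 'a \<Rightarrow> ('p \<Rightarrow> 'a \<Rightarrow> real) \<Rightarrow> real" where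
  "g p m = d (fst p) (snd p) (a0 (fst p)) m"
definition off :: "('p \<Rightarrow> 'a \<Rightarrow> real) \<Rightarrow> ('p \<Rightarrow> 'a \<Rightarrow> real) \<Rightarrow> real" where
  "off m m' = (\<Sum>i\<in>UNIV. \<Sum>a\<in>Y i - supp z i. \<bar>m' i a - m i a\<bar>)"
definition np :: "('p \<Rightarrow> 'a \<Rightarrow> real) \<Rightarrow> ('p \<Rightarrow> 'a \<Rightarrow> real) \<Rightarrow> real" where
  "np m m' = (\<Sum>p\<in>I. \<bar>m' (fst p) (snd p) - m (fst p) (snd p)\<bar>)"
text \<open>The mass constraint without the sign constraints: comparison states need not lie in the
  simplex.\<close>

definition aff :: "('p \<Rightarrow> 'a \<Rightarrow> real) \<Rightarrow> bool" where
  "aff m \<longleftrightarrow> (\<forall>i. sum (m i) (Y i) = 1)"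
definition Gam :: "('p \<Rightarrow> 'a \<Rightarrow> real) \<Rightarrow> ('p \<Rightarrow> 'a \<Rightarrow> real) \<Rightarrow> real" where
  "Gam m m' = (\<Sum>p\<in>I. \<bar>g p m' - g p m\<bar>)"

lemma HB: "p \<in> I \<Longrightarrow> q \<in> I \<Longrightarrow> (\<Sum>r\<in>I. H p r * B r q) = (if p = q then 1 else 0)"
  and BH: "p \<in> I \<Longrightarrow> q \<in> I \<Longrightarrow> (\<Sum>r\<in>I. B p r * H r q) = (if p = q then 1 else 0)"
  using inverse_B[of p q] unfolding I_def H_def by blast+

lemma finite_I [simp, intro]: "finite I"
  unfolding I_def by (intro finite_SigmaI) auto

lemma a0_Y [simp]: "a0 i \<in> Y i" using a0 supp_subset by blast

lemma sx_aff: "sx m \<Longrightarrow> aff m" by (simp add: aff_def sx_sum)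

lemma z_aff: "aff z" using z by (rule sx_aff)

lemma sum_Y_split: "(\<Sum>a\<in>Y i. h a) = h (a0 i) + (\<Sum>a\<in>supp z i - {a0 i}. h a) + (\<Sum>a\<in>Y i - supp z i. h a)"
proof -
  have "Y i = supp z i \<union> (Y i - supp z i)" using supp_subset by blast
  then have "(\<Sum>a\<in>Y i. h a) = (\<Sum>a\<in>supp z i \<union> (Y i - supp z i). h a)" by simp
  also have "\<dots> = (\<Sum>a\<in>supp z i. h a) + (\<Sum>a\<in>Y i - supp z i. h a)" by (rule sum.union_disjoint) auto
  also have "(\<Sum>a\<in>supp z i. h a) = h (a0 i) + (\<Sum>a\<in>supp z i - {a0 i}. h a)"
    by (rule sum.remove) (auto simp: a0)
  finally show ?thesis .
qed

lemma sum_I: "(\<Sum>p\<in>I. h (fst p) (snd p)) = (\<Sum>i\<in>UNIV. \<Sum>a\<in>supp z i - {a0 i}. h i a)"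
  unfolding I_def by (subst sum.Sigma) (auto simp: case_prod_beta)

lemma off_nonneg [simp]: "off m m' \<ge> 0" and np_nonneg [simp]: "np m m' \<ge> 0" and Gam_nonneg [simp]: "Gam m m' \<ge> 0"
  unfolding off_def np_def Gam_def by (auto intro!: sum_nonneg)

lemma off_le_dm: "off m m' \<le> dm m m'"
  unfolding off_def dm_def by (intro sum_mono sum_mono2) auto

text \<open>The mass of the base action is determined by the other masses, so its change is at most
  the sum of theirs; this is the factor 2.\<close>

lemma dm_le_np_off:
  assumes "aff m" "aff m'"
  shows "dm m m' \<le> 2 * np m m' + 2 * off m m'"
proof -
  define w where "w i a = m' i a - m i a" for i a
  have W: "\<bar>w i (a0 i)\<bar> \<le> (\<Sum>a\<in>supp z i - {a0 i}. \<bar>w i a\<bar>) + (\<Sum>a\<in>Y i - supp z i. \<bar>w i a\<bar>)" for i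
  proof -
    have "(\<Sum>a\<in>Y i. w i a) = 0" using assms by (simp add: w_def sum_subtractf aff_def)
    then have "w i (a0 i) = - (\<Sum>a\<in>supp z i - {a0 i}. w i a) - (\<Sum>a\<in>Y i - supp z i. w i a)"
      unfolding sum_Y_split by linarith
    moreover have "\<bar>\<Sum>a\<in>supp z i - {a0 i}. w i a\<bar> \<le> (\<Sum>a\<in>supp z i - {a0 i}. \<bar>w i a\<bar>)" by (rule sum_abs)
    moreover have "\<bar>\<Sum>a\<in>Y i - supp z i. w i a\<bar> \<le> (\<Sum>a\<in>Y i - supp z i. \<bar>w i a\<bar>)" by (rule sum_abs)
    ultimately show ?thesis by linarith
  qed
  have "(\<Sum>a\<in>Y i. \<bar>w i a\<bar>) \<le> 2 * (\<Sum>a\<in>supp z i - {a0 i}. \<bar>w i a\<bar>) + 2 * (\<Sum>a\<in>Y i - supp z i. \<bar>w i a\<bar>)" for i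
    unfolding sum_Y_split using W[of i] by linarith
  then have "(\<Sum>i\<in>UNIV. \<Sum>a\<in>Y i. \<bar>w i a\<bar>) \<le> (\<Sum>i\<in>UNIV. 2 * (\<Sum>a\<in>supp z i - {a0 i}. \<bar>w i a\<bar>) + 2 * (\<Sum>a\<in>Y i - supp z i. \<bar>w i a\<bar>))"
    by (intro sum_mono)
  also have "\<dots> = 2 * np m m' + 2 * off m m'"
    unfolding np_def off_def sum_I[of "\<lambda>i a. \<bar>m' i a - m i a\<bar>"] w_def by (simp add: sum.distrib sum_distrib_left)
  finally show ?thesis by (simp add: dm_def w_def)
qed

lemma bnd_near: "dm z m \<le> 1 \<Longrightarrow> bnd m"
  unfolding bnd_def
proof (intro allI ballI)
  fix i a assume "dm z m \<le> 1" and a: "a \<in> Y i"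
  then have "\<bar>m i a - z i a\<bar> \<le> 1" using dm_ge_coord[OF a, of m z] by linarith
  then show "\<bar>m i a\<bar> \<le> 2" using sx_nonneg[OF z a] sx_le_1[OF z a] by linarith
qed

lemma dd_bound: "\<bar>dd i a b j e f z\<bar> \<le> 2 * (K * NY)" if "a \<in> Y i" "b \<in> Y i" "e \<in> Y j" "f \<in> Y j"
proof -
  have "\<bar>d i a b m\<bar> \<le> K * NY" if m: "sx m" for m
    unfolding d_def pay_def using m \<open>a \<in> Y i\<close> \<open>b \<in> Y i\<close> by (intro U_bounded sx_upd_ind)
  from this[OF sx_upd_ind[OF z that(3)]] this[OF sx_upd_ind[OF z that(4)]]
  show ?thesis unfolding dd_def by linarith
qed

lemma card_I_le: "real (card I) \<le> NY"
proof -
  have "card I = (\<Sum>i\<in>UNIV. card (supp z i - {a0 i}))" unfolding I_def by (rule card_SigmaI) auto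
  also have "\<dots> \<le> (\<Sum>i\<in>UNIV. card (Y i))" by (intro sum_mono card_mono) (use supp_subset in auto)
  finally show ?thesis unfolding NY_def by (simp flip: of_nat_sum)
qed

text \<open>Three errors: the Taylor remainder at \<open>m\<close>, at most
  \<open>2 * K * rho * dm m m'\<close>; the passage of the derivative from \<open>m\<close> to
  \<open>z\<close>, at most \<open>K * rho * dm m m'\<close>; and the off-support increments.
  Because the increments of each player sum to 0, the remaining linear part is expressed through
  second differences against the base actions, which is the matrix \<open>H\<close>.\<close>

lemma g_linearization:
  assumes p: "p \<in> I" and m: "aff m" "aff m'" and rho: "dm z m \<le> rho" "dm z m' \<le> rho" "rho \<le> 1"
  shows "\<bar>g p m' - g p m - (\<Sum>r\<in>I. H p r * (m' (fst r) (snd r) - m (fst r) (snd r)))\<bar>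
    \<le> 3 * K * rho * dm m m' + 2 * (K * NY) * off m m'"
proof -
  obtain i a where pi: "p = (i, a)" "a \<in> supp z i" using p by (auto simp: I_def)
  have aY: "a \<in> Y i" using pi supp_subset by blast
  define w where "w j e = m' j e - m j e" for j e
  have bnd: "bnd m" "bnd m'" using rho bnd_near by auto
  have dm2: "dm m m' \<le> 2 * rho" using dm_triangle[of m m' z] rho dm_sym[of m z] by linarith
  have w0: "(\<Sum>e\<in>Y j. w j e) = 0" for j using m by (simp add: w_def sum_subtractf aff_def)
  let ?h = "\<lambda>j e. w j e * dd i a (a0 i) j e (a0 j) z"
  have lin: "d i a (a0 i) (z(j := w j)) = (\<Sum>e\<in>supp z j - {a0 j}. ?h j e) + (\<Sum>e\<in>Y j - supp z j. ?h j e)" if ji: "j \<noteq> i" for j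
  proof -
    have "d i a (a0 i) (z(j := w j)) = (\<Sum>e\<in>Y j. w j e * d i a (a0 i) (z(j := ind e)))" by (rule d_upd[OF ji])
    also have "\<dots> = (\<Sum>e\<in>Y j. ?h j e) + (\<Sum>e\<in>Y j. w j e) * d i a (a0 i) (z(j := ind (a0 j)))"
      unfolding dd_def by (simp add: right_diff_distrib sum_subtractf sum_distrib_right)
    also have "\<dots> = (\<Sum>e\<in>Y j. ?h j e)" by (simp add: w0)
    also have "\<dots> = (\<Sum>e\<in>supp z j - {a0 j}. ?h j e) + (\<Sum>e\<in>Y j - supp z j. ?h j e)"
      unfolding sum_Y_split by (simp add: dd_def)
    finally show ?thesis .
  qed
  have "(\<Sum>j\<in>UNIV - {i}. d i a (a0 i) (z(j := w j))) = (\<Sum>j\<in>UNIV - {i}. (\<Sum>e\<in>supp z j - {a0 j}. ?h j e) + (\<Sum>e\<in>Y j - supp z j. ?h j e))"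
    using lin by (intro sum.cong refl) simp
  also have "\<dots> = (\<Sum>j\<in>UNIV. (\<Sum>e\<in>supp z j - {a0 j}. ?h j e) + (\<Sum>e\<in>Y j - supp z j. ?h j e))"
    by (rule sum.mono_neutral_left) auto
  also have "\<dots> = (\<Sum>r\<in>I. H p r * w (fst r) (snd r)) + (\<Sum>j\<in>UNIV. \<Sum>e\<in>Y j - supp z j. ?h j e)"
    unfolding sum.distrib using sum_I[of ?h] by (simp add: H_def pi(1) mult.commute)
  finally have L: "(\<Sum>j\<in>UNIV - {i}. d i a (a0 i) (z(j := w j))) =
      (\<Sum>r\<in>I. H p r * w (fst r) (snd r)) + (\<Sum>j\<in>UNIV. \<Sum>e\<in>Y j - supp z j. ?h j e)" .
  have O: "\<bar>\<Sum>j\<in>UNIV. \<Sum>e\<in>Y j - supp z j. ?h j e\<bar> \<le> 2 * (K * NY) * off m m'"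
  proof -
    have "\<bar>\<Sum>j\<in>UNIV. \<Sum>e\<in>Y j - supp z j. ?h j e\<bar> \<le> (\<Sum>j\<in>UNIV. \<Sum>e\<in>Y j - supp z j. \<bar>?h j e\<bar>)"
      by (rule order_trans[OF sum_abs sum_mono[OF sum_abs]])
    also have "\<dots> \<le> (\<Sum>j\<in>UNIV. \<Sum>e\<in>Y j - supp z j. \<bar>w j e\<bar> * (2 * (K * NY)))"
      unfolding abs_mult using aY by (intro sum_mono mult_left_mono dd_bound) auto
    finally show ?thesis by (simp add: off_def w_def sum_distrib_left sum_distrib_right mult.commute)
  qed
  have M: "\<bar>(\<Sum>j\<in>UNIV - {i}. d i a (a0 i) (m(j := w j))) - (\<Sum>j\<in>UNIV - {i}. d i a (a0 i) (z(j := w j)))\<bar> \<le> K * rho * dm m m'"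
  proof -
    have "\<bar>(\<Sum>j\<in>UNIV - {i}. d i a (a0 i) (m(j := w j))) - (\<Sum>j\<in>UNIV - {i}. d i a (a0 i) (z(j := w j)))\<bar>
        \<le> (\<Sum>j\<in>UNIV - {i}. \<bar>d i a (a0 i) (m(j := w j)) - d i a (a0 i) (z(j := w j))\<bar>)"
      unfolding sum_subtractf[symmetric] by (rule sum_abs)
    also have "\<dots> \<le> (\<Sum>j\<in>UNIV - {i}. K * dm z m * (\<Sum>e\<in>Y j. \<bar>w j e\<bar>))"
      using d_upd_lipschitz[OF sx_bnd[OF z] bnd(1)] by (intro sum_mono) auto
    also have "\<dots> \<le> (\<Sum>j\<in>UNIV. K * dm z m * (\<Sum>e\<in>Y j. \<bar>w j e\<bar>))"
      by (intro sum_mono2) (auto intro!: mult_nonneg_nonneg sum_nonneg)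
    also have "\<dots> = K * dm z m * dm m m'" by (simp add: dm_def[of m m'] w_def sum_distrib_left)
    also have "\<dots> \<le> K * rho * dm m m'" using rho by (intro mult_right_mono mult_left_mono) auto
    finally show ?thesis .
  qed
  have "\<bar>d i a (a0 i) m' - d i a (a0 i) m - (\<Sum>j\<in>UNIV - {i}. d i a (a0 i) (m(j := w j)))\<bar> \<le> K * (dm m m')\<^sup>2"
    using d_taylor[OF bnd, of i a "a0 i"] unfolding w_def .
  also have "K * (dm m m')\<^sup>2 \<le> K * (2 * rho * dm m m')"
    unfolding power2_eq_square using dm2 by (intro mult_left_mono mult_right_mono) auto
  finally have T: "\<bar>d i a (a0 i) m' - d i a (a0 i) m - (\<Sum>j\<in>UNIV - {i}. d i a (a0 i) (m(j := w j)))\<bar> \<le> 2 * (K * rho * dm m m')"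
    by (simp add: mult_ac)
  have "g p m' - g p m = d i a (a0 i) m' - d i a (a0 i) m" by (simp add: g_def pi(1))
  then show ?thesis using T M O L unfolding w_def by linarith
qed

text \<open>A crude bound for the operator norm of the inverse Hessian in the sum norm, enlarged by
  1 so that it can be divided by.\<close>

definition inv_bound :: real where "inv_bound = 1 + (\<Sum>r\<in>I. \<Sum>p\<in>I. \<bar>B r p\<bar>)"

lemma inv_bound_ge_1: "inv_bound \<ge> 1"
  unfolding inv_bound_def by (auto intro!: sum_nonneg)

lemma inv_bound_pos [simp]: "inv_bound > 0" "inv_bound \<ge> 0" "inv_bound \<noteq> 0" using inv_bound_ge_1 by auto

lemma B_apply_le:
  assumes x: "\<And>p. p \<in> I \<Longrightarrow> \<bar>x p\<bar> \<le> h p"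
  shows "(\<Sum>r\<in>I. \<bar>\<Sum>p\<in>I. B r p * x p\<bar>) \<le> inv_bound * (\<Sum>p\<in>I. h p)"
proof -
  have h0: "0 \<le> h p" if "p \<in> I" for p using x[OF that] by linarith
  have "(\<Sum>r\<in>I. \<bar>\<Sum>p\<in>I. B r p * x p\<bar>) \<le> (\<Sum>r\<in>I. \<Sum>p\<in>I. \<bar>B r p\<bar> * \<bar>x p\<bar>)"
    unfolding abs_mult[symmetric] by (intro sum_mono sum_abs)
  also have "\<dots> \<le> (\<Sum>r\<in>I. \<Sum>p\<in>I. \<bar>B r p\<bar> * (\<Sum>q\<in>I. h q))"
  proof (intro sum_mono mult_left_mono)
    fix p assume p: "p \<in> I"
    have "h p \<le> (\<Sum>q\<in>I. h q)" using p h0 by (intro member_le_sum) auto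
    then show "\<bar>x p\<bar> \<le> (\<Sum>q\<in>I. h q)" using x[OF p] by linarith
  qed auto
  also have "\<dots> = (\<Sum>r\<in>I. \<Sum>p\<in>I. \<bar>B r p\<bar>) * (\<Sum>q\<in>I. h q)" by (simp add: sum_distrib_right)
  also have "\<dots> \<le> inv_bound * (\<Sum>q\<in>I. h q)"
    using h0 by (intro mult_right_mono sum_nonneg) (auto simp: inv_bound_def)
  finally show ?thesis .
qed

text \<open>The 12 turns the linearisation error \<open>3 * K * rad * dm m m'\<close>, after
  applying the inverse to at most \<open>NY\<close> components, into
  \<open>dm m m' / 4\<close>.\<close>

definition rad :: real where "rad = 1 / (12 * inv_bound * NY * K)"

lemma rad_pos [simp]: "rad > 0" "rad \<ge> 0" and rad_le: "rad \<le> 1" and rad_eq: "inv_bound * NY * K * rad = 1 / 12"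
proof -
  have c: "inv_bound * NY * K \<ge> 1"
    using mult_mono[OF mult_mono[OF inv_bound_ge_1 NY_ge_1] K_ge_1] by simp
  show "rad > 0" "rad \<ge> 0" by (auto simp: rad_def)
  show "inv_bound * NY * K * rad = 1 / 12"
    using c by (simp add: rad_def)
  show "rad \<le> 1" unfolding rad_def using c by (simp add: divide_le_eq_1)
qed

text \<open>The constant left after \<open>dm m m' / 4\<close> from the residual, doubled by
  \<open>dm_le_np_off\<close>, has been absorbed on the left.\<close>

definition kN :: real where "kN = 4 * inv_bound + 4 * inv_bound * NY * (2 * (K * NY)) + 4"

lemma kN_pos [simp]: "kN > 0" "kN \<ge> 0"
  by (auto simp: kN_def intro!: add_nonneg_pos add_nonneg_nonneg mult_nonneg_nonneg)

text \<open>Since \<open>B\<close> inverts \<open>H\<close>, the residual is \<open>B\<close>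
  applied to the linearisation error of the payoff differences.\<close>

lemma newton_residual:
  assumes "aff m" "aff m'" "dm z m \<le> rad" "dm z m' \<le> rad"
  shows "(\<Sum>r\<in>I. \<bar>(m' (fst r) (snd r) - m (fst r) (snd r)) - (\<Sum>p\<in>I. B r p * (g p m' - g p m))\<bar>)
    \<le> dm m m' / 4 + inv_bound * NY * (2 * (K * NY)) * off m m'"
proof -
  define w where "w r = m' (fst r) (snd r) - m (fst r) (snd r)" for r
  have "(\<Sum>r\<in>I. \<bar>w r - (\<Sum>p\<in>I. B r p * (g p m' - g p m))\<bar>) =
      (\<Sum>r\<in>I. \<bar>\<Sum>p\<in>I. B r p * (g p m' - g p m - (\<Sum>s\<in>I. H p s * w s))\<bar>)"
  proof (intro sum.cong refl)
    fix r assume r: "r \<in> I"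
    have "(\<Sum>p\<in>I. B r p * (\<Sum>s\<in>I. H p s * w s)) = (\<Sum>p\<in>I. \<Sum>s\<in>I. B r p * H p s * w s)"
      by (simp add: sum_distrib_left mult.assoc)
    also have "\<dots> = (\<Sum>s\<in>I. (\<Sum>p\<in>I. B r p * H p s) * w s)" by (subst sum.swap) (simp add: sum_distrib_right)
    also have "\<dots> = (\<Sum>s\<in>I. if r = s then w s else 0)" using r by (intro sum.cong refl) (simp add: BH)
    also have "\<dots> = w r" using r by simp
    finally have "(\<Sum>p\<in>I. B r p * (g p m' - g p m - (\<Sum>s\<in>I. H p s * w s))) = (\<Sum>p\<in>I. B r p * (g p m' - g p m)) - w r"
      by (simp add: right_diff_distrib sum_subtractf)
    then show "\<bar>w r - (\<Sum>p\<in>I. B r p * (g p m' - g p m))\<bar> = \<bar>\<Sum>p\<in>I. B r p * (g p m' - g p m - (\<Sum>s\<in>I. H p s * w s))\<bar>"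
      by (simp add: abs_minus_commute)
  qed
  also have "\<dots> \<le> inv_bound * (\<Sum>p\<in>I. 3 * K * rad * dm m m' + 2 * (K * NY) * off m m')"
    using g_linearization[OF _ assms rad_le] by (intro B_apply_le) (simp add: w_def)
  also have "\<dots> = inv_bound * (real (card I) * (3 * K * rad * dm m m' + 2 * (K * NY) * off m m'))" by simp
  also have "\<dots> \<le> inv_bound * (NY * (3 * K * rad * dm m m' + 2 * (K * NY) * off m m'))"
    using card_I_le by (intro mult_left_mono mult_right_mono add_nonneg_nonneg mult_nonneg_nonneg) auto
  also have "\<dots> = 3 * (inv_bound * NY * K * rad) * dm m m' + inv_bound * NY * (2 * (K * NY)) * off m m'"
    by (simp add: algebra_simps)
  also have "\<dots> = dm m m' / 4 + inv_bound * NY * (2 * (K * NY)) * off m m'" unfolding rad_eq by simp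
  finally show ?thesis unfolding w_def .
qed

text \<open>Two states near \<open>z\<close> with equal payoff differences on the supports and equal
  off-support masses coincide on the actions, with a linear modulus. This single estimate gives
  isolation of \<open>z\<close>, regularity of the comparison state in time and the bound on the
  potential gap.\<close>

lemma nondegenerate:
  assumes "aff m" "aff m'" "dm z m \<le> rad" "dm z m' \<le> rad"
  shows "dm m m' \<le> kN * (Gam m m' + off m m')"
proof -
  have "np m m' \<le> (\<Sum>r\<in>I. \<bar>\<Sum>p\<in>I. B r p * (g p m' - g p m)\<bar>) +
     (\<Sum>r\<in>I. \<bar>(m' (fst r) (snd r) - m (fst r) (snd r)) - (\<Sum>p\<in>I. B r p * (g p m' - g p m))\<bar>)"
    unfolding np_def sum.distrib[symmetric] by (intro sum_mono) linarith
  also have "\<dots> \<le> inv_bound * Gam m m' + (dm m m' / 4 + inv_bound * NY * (2 * (K * NY)) * off m m')"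
    unfolding Gam_def using newton_residual[OF assms] by (intro add_mono B_apply_le) auto
  finally have n: "np m m' \<le> inv_bound * Gam m m' + (dm m m' / 4 + inv_bound * NY * (2 * (K * NY)) * off m m')" .
  have "dm m m' \<le> 4 * inv_bound * Gam m m' + (4 * inv_bound * NY * (2 * (K * NY)) + 4) * off m m'"
    using n dm_le_np_off[OF assms(1,2)] by (simp add: algebra_simps)
  also have "\<dots> \<le> kN * Gam m m' + kN * off m m'"
    by (intro add_mono mult_right_mono) (auto simp: kN_def intro!: add_nonneg_nonneg mult_nonneg_nonneg)
  finally show ?thesis by (simp add: distrib_left)
qed

lemma Gam_le: "bnd m \<Longrightarrow> bnd m' \<Longrightarrow> Gam m m' \<le> NY * (K * dm m m')"
proof -
  assume b: "bnd m" "bnd m'"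
  have "Gam m m' \<le> (\<Sum>p\<in>I. K * dm m m')"
    unfolding Gam_def g_def by (intro sum_mono d_lipschitz b)
  also have "\<dots> = real (card I) * (K * dm m m')" by simp
  also have "\<dots> \<le> NY * (K * dm m m')" using card_I_le by (intro mult_right_mono) auto
  finally show ?thesis .
qed

lemma g_z: "p \<in> I \<Longrightarrow> g p z = 0"
proof -
  assume "p \<in> I"
  then have "snd p \<in> br (fst p) z" "a0 (fst p) \<in> br (fst p) z"
    unfolding br_supp using a0 by (auto simp: I_def)
  then show ?thesis by (simp add: g_def d_def br_iff)
qed

text \<open>Rebuilds a state from free coordinates \<open>p\<close> on the supports and prescribed
  masses \<open>q\<close> off them; the base action takes up the remaining mass.\<close>

definition st :: "('p \<Rightarrow> 'a \<Rightarrow> real) \<Rightarrow> ('p \<times> 'a \<Rightarrow> real) \<Rightarrow> 'p \<Rightarrow> 'a \<Rightarrow> real" where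
  "st q p i a = (if a = a0 i then 1 - (\<Sum>b\<in>supp z i - {a0 i}. p (i, b)) - (\<Sum>b\<in>Y i - supp z i. q i b)
     else if a \<in> supp z i then p (i, a) else q i a)"

lemma st_aff: "aff (st q p)"
proof -
  have "(\<Sum>a\<in>supp z i - {a0 i}. st q p i a) = (\<Sum>b\<in>supp z i - {a0 i}. p (i, b))" for i
    by (intro sum.cong) (auto simp: st_def)
  moreover have "(\<Sum>a\<in>Y i - supp z i. st q p i a) = (\<Sum>b\<in>Y i - supp z i. q i b)" for i
    by (intro sum.cong) (use a0 in \<open>auto simp: st_def\<close>)
  ultimately show ?thesis unfolding aff_def sum_Y_split by (simp add: st_def)
qed

lemma st_I: "r \<in> I \<Longrightarrow> st q p (fst r) (snd r) = p r"
  by (auto simp: I_def st_def)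

lemma st_off: "a \<in> Y i - supp z i \<Longrightarrow> st q p i a = q i a"
  using a0 by (auto simp: st_def)

text \<open>
  The comparison state has the off-support masses of \<open>q\<close> and makes all players indifferent on the
  supports; it is the fixed point of the Newton map with frozen derivative.
\<close>

lemma comparator_exists:
  obtains sg where "sg > 0" "\<And>q. off z q \<le> sg \<Longrightarrow>
    \<exists>x. aff x \<and> dm z x \<le> rad \<and> (\<forall>i. \<forall>a\<in>Y i - supp z i. x i a = q i a) \<and> (\<forall>p\<in>I. g p x = 0)"
proof -
  \<comment> \<open>Makes the first Newton step at most \<open>rad / 8\<close>, half the radius of
    the ball of iteration. Together with \<open>sg \<le> rad / 4\<close> it keeps all states built
    from that ball within \<open>rad\<close> of \<open>z\<close>.\<close>
  define sg where "sg = rad / (16 * (inv_bound * NY * K))"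
  have c: "inv_bound * NY * K \<ge> 1"
    using mult_mono[OF mult_mono[OF inv_bound_ge_1 NY_ge_1] K_ge_1] by simp
  have sg: "sg > 0" "sg \<le> rad / 4" "inv_bound * NY * K * sg = rad / 16"
  proof -
    show "sg > 0" unfolding sg_def using c by simp
    show "inv_bound * NY * K * sg = rad / 16" unfolding sg_def using c by simp
    show "sg \<le> rad / 4" unfolding sg_def using c by (intro divide_left_mono) (auto simp: mult_ac)
  qed
  have "\<exists>x. aff x \<and> dm z x \<le> rad \<and> (\<forall>i. \<forall>a\<in>Y i - supp z i. x i a = q i a) \<and> (\<forall>p\<in>I. g p x = 0)"
    if q: "off z q \<le> sg" for q
  proof -
    define c where "c r = z (fst r) (snd r)" for r
    define F where "F p r = p r - (\<Sum>p'\<in>I. B r p' * g p' (st q p))" for p r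
    have np_st: "np (st q p) (st q p') = (\<Sum>s\<in>I. \<bar>p' s - p s\<bar>)" for p p'
      unfolding np_def by (intro sum.cong refl) (simp add: st_I)
    have npz: "np z (st q p) = (\<Sum>s\<in>I. \<bar>p s - c s\<bar>)" for p
      unfolding np_def c_def by (intro sum.cong refl) (simp add: st_I)
    have off_st: "off (st q p) (st q p') = 0" for p p'
      unfolding off_def by (intro sum.neutral ballI) (simp add: st_off)
    have offz: "off z (st q p) = off z q" for p
      unfolding off_def by (intro sum.cong refl) (simp add: st_off)
    have near: "dm z (st q p) \<le> rad" if "(\<Sum>s\<in>I. \<bar>p s - c s\<bar>) \<le> rad / 4" for p
      using dm_le_np_off[OF z_aff st_aff[of q p]] that q sg(2) unfolding npz offz by linarith
    have "\<exists>p. (\<Sum>s\<in>I. \<bar>p s - c s\<bar>) \<le> rad / 4 \<and> (\<forall>s\<in>I. F p s = p s)"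
    proof (rule finite_contraction_fixpoint[OF finite_I])
      show "rad / 4 > 0" by simp
      fix p p' assume p: "(\<Sum>s\<in>I. \<bar>p s - c s\<bar>) \<le> rad / 4" "(\<Sum>s\<in>I. \<bar>p' s - c s\<bar>) \<le> rad / 4"
      have "(\<Sum>s\<in>I. \<bar>F p' s - F p s\<bar>) = (\<Sum>r\<in>I. \<bar>(st q p' (fst r) (snd r) - st q p (fst r) (snd r)) - (\<Sum>p''\<in>I. B r p'' * (g p'' (st q p') - g p'' (st q p)))\<bar>)"
        by (intro sum.cong refl) (simp add: F_def st_I right_diff_distrib sum_subtractf)
      also have "\<dots> \<le> dm (st q p) (st q p') / 4"
        using newton_residual[OF st_aff st_aff near[OF p(1)] near[OF p(2)]] by (simp add: off_st)
      also have "\<dots> \<le> (\<Sum>s\<in>I. \<bar>p' s - p s\<bar>) / 2"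
        using dm_le_np_off[OF st_aff st_aff, of q p q p'] by (simp add: off_st np_st)
      finally show "(\<Sum>s\<in>I. \<bar>F p' s - F p s\<bar>) \<le> (\<Sum>s\<in>I. \<bar>p' s - p s\<bar>) / 2" .
    next
      have "(\<Sum>s\<in>I. \<bar>F c s - c s\<bar>) = (\<Sum>r\<in>I. \<bar>\<Sum>p\<in>I. B r p * g p (st q c)\<bar>)" by (simp add: F_def)
      also have "\<dots> \<le> inv_bound * (\<Sum>p\<in>I. \<bar>g p (st q c)\<bar>)" by (rule B_apply_le) simp
      also have "(\<Sum>p\<in>I. \<bar>g p (st q c)\<bar>) = Gam z (st q c)" unfolding Gam_def by (intro sum.cong) (auto simp: g_z)
      also have "inv_bound * Gam z (st q c) \<le> inv_bound * (NY * (K * dm z (st q c)))"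
      proof (intro mult_left_mono Gam_le sx_bnd[OF z])
        show "bnd (st q c)" using near[of c] rad_le by (intro bnd_near) simp
      qed simp
      also have "\<dots> \<le> inv_bound * (NY * (K * (2 * sg)))"
      proof (intro mult_left_mono)
        show "dm z (st q c) \<le> 2 * sg"
          using dm_le_np_off[OF z_aff st_aff[of q c]] q unfolding npz offz by simp
      qed auto
      also have "\<dots> = 2 * (inv_bound * NY * K * sg)" by simp
      also have "\<dots> = rad / 4 / 2" unfolding sg(3) by simp
      finally show "(\<Sum>s\<in>I. \<bar>F c s - c s\<bar>) \<le> rad / 4 / 2" .
    qed
    then obtain p where p: "(\<Sum>s\<in>I. \<bar>p s - c s\<bar>) \<le> rad / 4" "\<And>s. s \<in> I \<Longrightarrow> F p s = p s" by blast
    have B0: "(\<Sum>p'\<in>I. B r p' * g p' (st q p)) = 0" if "r \<in> I" for r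
      using p(2)[OF that] by (simp add: F_def)
    \<comment> \<open>A fixed point only says that \<open>B\<close> annihilates the vector of payoff
      differences; multiplying by \<open>H\<close> recovers that vector.\<close>
    have "g s (st q p) = 0" if s: "s \<in> I" for s
    proof -
      have "g s (st q p) = (\<Sum>p'\<in>I. if s = p' then g p' (st q p) else 0)" using s by simp
      also have "\<dots> = (\<Sum>p'\<in>I. (\<Sum>r\<in>I. H s r * B r p') * g p' (st q p))"
        using s by (intro sum.cong refl) (simp add: HB)
      also have "\<dots> = (\<Sum>r\<in>I. H s r * (\<Sum>p'\<in>I. B r p' * g p' (st q p)))"
        unfolding sum_distrib_left sum_distrib_right by (subst sum.swap) (simp add: mult.assoc)
      also have "\<dots> = 0" by (simp add: B0)
      finally show ?thesis .
    qed
    then show ?thesis using st_aff near[OF p(1)] st_off by (intro exI[of _ "st q p"]) blast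
  qed
  then show thesis by (rule that[OF sg(1)])
qed

end

section \<open>Absolutely continuous functions\<close>

definition small_variation :: "real \<Rightarrow> real \<Rightarrow> (real \<Rightarrow> real) \<Rightarrow> real \<Rightarrow> real \<Rightarrow> bool" where
  "small_variation a b f \<epsilon> \<delta> \<longleftrightarrow> (\<forall>n (l :: nat \<Rightarrow> real) r. (\<forall>j<n. a \<le> l j \<and> l j \<le> r j \<and> r j \<le> b) \<longrightarrow>
     disjoint_family_on (\<lambda>j. {l j<..<r j}) {..<n} \<longrightarrow> (\<Sum>j<n. r j - l j) < \<delta> \<longrightarrow> (\<Sum>j<n. \<bar>f (r j) - f (l j)\<bar>) < \<epsilon>)"

lemma ac_iff: "absolutely_continuous_on_interval a b f \<longleftrightarrow> (\<forall>\<epsilon>>0. \<exists>\<delta>>0. small_variation a b f \<epsilon> \<delta>)"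
  unfolding absolutely_continuous_on_interval_def small_variation_def ..

lemma small_variationD:
  fixes l r :: "nat \<Rightarrow> real"
  assumes "small_variation a b f \<epsilon> \<delta>" "\<forall>j<n. a \<le> l j \<and> l j \<le> r j \<and> r j \<le> b"
    "disjoint_family_on (\<lambda>j. {l j<..<r j}) {..<n}" "(\<Sum>j<n. r j - l j) < \<delta>"
  shows "(\<Sum>j<n. \<bar>f (r j) - f (l j)\<bar>) < \<epsilon>"
  by (rule assms(1)[unfolded small_variation_def, THEN spec, THEN spec, THEN spec, THEN mp, THEN mp, THEN mp, OF assms(2,3,4)])

lemma small_variationI:
  assumes "\<And>n (l :: nat \<Rightarrow> real) r. \<forall>j<n. a \<le> l j \<and> l j \<le> r j \<and> r j \<le> b \<Longrightarrow> disjoint_family_on (\<lambda>j. {l j<..<r j}) {..<n} \<Longrightarrow>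
    (\<Sum>j<n. r j - l j) < \<delta> \<Longrightarrow> (\<Sum>j<n. \<bar>f (r j) - f (l j)\<bar>) < \<epsilon>"
  shows "small_variation a b f \<epsilon> \<delta>"
  unfolding small_variation_def by (intro allI impI) (rule assms)

lemma ac_subset:
  assumes "absolutely_continuous_on_interval a b f" "a \<le> c" "d \<le> b"
  shows "absolutely_continuous_on_interval c d f"
  unfolding ac_iff
proof (intro allI impI)
  fix \<epsilon> :: real assume "\<epsilon> > 0"
  then obtain \<delta> where \<delta>: "\<delta> > 0" "small_variation a b f \<epsilon> \<delta>" using assms(1) unfolding ac_iff by blast
  have "small_variation c d f \<epsilon> \<delta>"
  proof (rule small_variationI)
    fix n and l r :: "nat \<Rightarrow> real"
    assume *: "\<forall>j<n. c \<le> l j \<and> l j \<le> r j \<and> r j \<le> d" "disjoint_family_on (\<lambda>j. {l j<..<r j}) {..<n}" "(\<Sum>j<n. r j - l j) < \<delta>"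
    have "\<forall>j<n. a \<le> l j \<and> l j \<le> r j \<and> r j \<le> b" using *(1) assms(2,3) by (meson order_trans)
    then show "(\<Sum>j<n. \<bar>f (r j) - f (l j)\<bar>) < \<epsilon>" using *(2,3) by (rule small_variationD[OF \<delta>(2)])
  qed
  then show "\<exists>\<delta>>0. small_variation c d f \<epsilon> \<delta>" using \<delta>(1) by blast
qed

lemma ac_uminus:
  assumes "absolutely_continuous_on_interval a b f"
  shows "absolutely_continuous_on_interval a b (\<lambda>t. - f t)"
proof -
  have "\<bar>- f x - - f y\<bar> = \<bar>f x - f y\<bar>" for x y by linarith
  then show ?thesis using assms unfolding ac_iff small_variation_def by (simp only:)
qed

text \<open>Carries absolute continuity from the coordinates of a solution to the product of the
  exponential with a mass, which involves the sum of several coordinates.\<close>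

lemma ac_dominated:
  fixes h :: "'b \<Rightarrow> real \<Rightarrow> real"
  assumes A: "finite A" and h: "\<And>j. j \<in> A \<Longrightarrow> absolutely_continuous_on_interval a b (h j)" and C: "C \<ge> 0"
    and bound: "\<And>l r. a \<le> l \<Longrightarrow> l \<le> r \<Longrightarrow> r \<le> b \<Longrightarrow> \<bar>f r - f l\<bar> \<le> C * ((r - l) + (\<Sum>j\<in>A. \<bar>h j r - h j l\<bar>))"
  shows "absolutely_continuous_on_interval a b f"
  unfolding ac_iff
proof (intro allI impI)
  fix \<epsilon> :: real assume e: "\<epsilon> > 0"
  define e' where "e' = \<epsilon> / ((C + 1) * (1 + card A))"
  have e': "e' > 0" using e C by (simp add: e'_def)
  have "\<exists>\<delta>>0. small_variation a b (h j) e' \<delta>" if "j \<in> A" for j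
    using h[OF that] e' unfolding ac_iff by blast
  then obtain \<delta> where \<delta>: "\<And>j. j \<in> A \<Longrightarrow> \<delta> j > 0" "\<And>j. j \<in> A \<Longrightarrow> small_variation a b (h j) e' (\<delta> j)"
    by metis
  define D where "D = Min (insert e' (\<delta> ` A))"
  have D: "D > 0" "D \<le> e'" "\<And>j. j \<in> A \<Longrightarrow> D \<le> \<delta> j"
    using A e' \<delta>(1) by (auto simp: D_def)
  have "small_variation a b f \<epsilon> D"
  proof (rule small_variationI)
    fix n and l r :: "nat \<Rightarrow> real"
    assume *: "\<forall>j<n. a \<le> l j \<and> l j \<le> r j \<and> r j \<le> b" "disjoint_family_on (\<lambda>j. {l j<..<r j}) {..<n}" "(\<Sum>j<n. r j - l j) < D"
    have "(\<Sum>i<n. \<bar>f (r i) - f (l i)\<bar>) \<le> (\<Sum>i<n. C * ((r i - l i) + (\<Sum>j\<in>A. \<bar>h j (r i) - h j (l i)\<bar>)))"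
    proof (intro sum_mono)
      fix i assume "i \<in> {..<n}"
      then have "a \<le> l i" "l i \<le> r i" "r i \<le> b" using *(1) by auto
      then show "\<bar>f (r i) - f (l i)\<bar> \<le> C * ((r i - l i) + (\<Sum>j\<in>A. \<bar>h j (r i) - h j (l i)\<bar>))" by (rule bound)
    qed
    also have "\<dots> = C * ((\<Sum>i<n. r i - l i) + (\<Sum>i<n. \<Sum>j\<in>A. \<bar>h j (r i) - h j (l i)\<bar>))"
      by (simp only: sum_distrib_left[symmetric] sum.distrib)
    also have "(\<Sum>i<n. \<Sum>j\<in>A. \<bar>h j (r i) - h j (l i)\<bar>) = (\<Sum>j\<in>A. \<Sum>i<n. \<bar>h j (r i) - h j (l i)\<bar>)"
      by (rule sum.swap)
    also have "C * ((\<Sum>i<n. r i - l i) + (\<Sum>j\<in>A. \<Sum>i<n. \<bar>h j (r i) - h j (l i)\<bar>)) \<le> C * (e' + (\<Sum>j\<in>A. e'))"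
    proof (intro mult_left_mono add_mono sum_mono C)
      show "(\<Sum>i<n. r i - l i) \<le> e'" using *(3) D(2) by linarith
      fix j assume j: "j \<in> A"
      have "(\<Sum>i<n. r i - l i) < \<delta> j" using *(3) D(3)[OF j] by linarith
      from small_variationD[OF \<delta>(2)[OF j] *(1,2) this] show "(\<Sum>i<n. \<bar>h j (r i) - h j (l i)\<bar>) \<le> e'" by simp
    qed
    also have "\<dots> = C * ((1 + card A) * e')" by (simp add: algebra_simps)
    also have "\<dots> < (C + 1) * ((1 + card A) * e')" using e' by (intro mult_strict_right_mono) auto
    also have "\<dots> = \<epsilon>"
    proof -
      have "(C + 1) * (1 + real (card A)) \<noteq> 0" using C by simp
      then show ?thesis unfolding e'_def by (simp add: mult.assoc[symmetric])
    qed
    finally show "(\<Sum>j<n. \<bar>f (r j) - f (l j)\<bar>) < \<epsilon>" .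
  qed
  then show "\<exists>\<delta>>0. small_variation a b f \<epsilon> \<delta>" using D(1) by blast
qed

text \<open>Absolute continuity in the form used with gauges: those pieces of a tagged division that
  lie in an open set of small measure contribute little variation.\<close>

lemma ac_small_on_small_cover:
  assumes ac: "absolutely_continuous_on_interval a b f" and e: "\<epsilon> > 0"
  shows "\<exists>\<delta>>0. \<forall>p q W. p tagged_division_of {a..b} \<longrightarrow> q \<subseteq> p \<longrightarrow> open W \<longrightarrow> emeasure lborel W < ennreal \<delta> \<longrightarrow>
    (\<forall>(t, k)\<in>q. k \<subseteq> W) \<longrightarrow> (\<Sum>(t, k)\<in>q. \<bar>f (Sup k) - f (Inf k)\<bar>) < \<epsilon>"
proof -
  obtain \<delta> where \<delta>: "\<delta> > 0" "small_variation a b f \<epsilon> \<delta>" using ac e unfolding ac_iff by blast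
  show ?thesis
  proof (intro exI conjI allI impI)
    fix p q W
    assume p: "p tagged_division_of {a..b}" and q: "q \<subseteq> p" and W: "open W" "emeasure lborel W < ennreal \<delta>"
      and qW: "\<forall>(t, k)\<in>q. k \<subseteq> W"
    have "finite q" using tagged_division_ofD(1)[OF p] q by (rule finite_subset[rotated])
    then obtain h where h: "bij_betw h {..<card q} q" using ex_bij_betw_nat_finite[of q] by (auto simp: atLeast0LessThan)
    define n where "n = card q"
    define l where "l j = Inf (snd (h j))" for j
    define r where "r j = Sup (snd (h j))" for j
    have mem: "h j \<in> q" if "j < n" for j using h that by (auto simp: bij_betw_def n_def)
    have box: "snd (h j) = {l j..r j} \<and> a \<le> l j \<and> l j \<le> r j \<and> r j \<le> b" if j: "j < n" for j
    proof -
      have hp: "(fst (h j), snd (h j)) \<in> p" using mem[OF j] q by auto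
      obtain c d where cd: "snd (h j) = cbox c d" using tagged_division_ofD(4)[OF p hp] by blast
      have "fst (h j) \<in> snd (h j)" by (rule tagged_division_ofD(2)[OF p hp])
      then have "c \<le> d" using cd by auto
      moreover have "{c..d} \<subseteq> {a..b}" using tagged_division_ofD(3)[OF p hp] cd by simp
      ultimately show ?thesis using cd by (simp add: l_def r_def)
    qed
    have disj: "disjoint_family_on (\<lambda>j. {l j<..<r j}) {..<n}"
      unfolding disjoint_family_on_def
    proof (intro ballI impI)
      fix i j assume ij: "i \<in> {..<n}" "j \<in> {..<n}" "i \<noteq> j"
      have "h i \<noteq> h j" using h ij by (auto simp: bij_betw_def inj_on_def n_def)
      then have ne: "(fst (h i), snd (h i)) \<noteq> (fst (h j), snd (h j))" by simp
      have "interior (snd (h i)) \<inter> interior (snd (h j)) = {}"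
        using mem[of i] mem[of j] ij q by (intro tagged_division_ofD(5)[OF p _ _ ne]) auto
      then show "{l i<..<r i} \<inter> {l j<..<r j} = {}" using box[of i] box[of j] ij by (simp add: interior_atLeastAtMost_real)
    qed
    have "ennreal (\<Sum>j<n. r j - l j) = (\<Sum>j<n. ennreal (r j - l j))"
      using box by (intro sum_ennreal[symmetric]) auto
    also have "\<dots> = (\<Sum>j<n. emeasure lborel {l j<..<r j})"
      using box by (intro sum.cong refl) simp
    also have "\<dots> = emeasure lborel (\<Union>j<n. {l j<..<r j})"
      using disj by (intro sum_emeasure) auto
    also have "\<dots> \<le> emeasure lborel W"
    proof (rule emeasure_mono)
      show "(\<Union>j<n. {l j<..<r j}) \<subseteq> W"
      proof (rule UN_least)
        fix j assume j: "j \<in> {..<n}"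
        have "snd (h j) \<subseteq> W" using bspec[OF qW mem[of j]] j by (simp add: case_prod_beta)
        then show "{l j<..<r j} \<subseteq> W" using box[of j] j by auto
      qed
      show "W \<in> sets lborel" using W(1) by simp
    qed
    also have "\<dots> < ennreal \<delta>" by (rule W(2))
    finally have "(\<Sum>j<n. r j - l j) < \<delta>" using \<delta>(1) by (subst (asm) ennreal_less_iff) (use box in \<open>auto intro!: sum_nonneg\<close>)
    with disj box have "(\<Sum>j<n. \<bar>f (r j) - f (l j)\<bar>) < \<epsilon>" by (intro small_variationD[OF \<delta>(2)]) auto
    also have "(\<Sum>j<n. \<bar>f (r j) - f (l j)\<bar>) = (\<Sum>(t, k)\<in>q. \<bar>f (Sup k) - f (Inf k)\<bar>)"
      unfolding l_def r_def case_prod_beta n_def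
      by (rule sum.reindex_bij_betw[OF h, where g="\<lambda>x. \<bar>f (Sup (snd x)) - f (Inf (snd x))\<bar>"])
    finally show "(\<Sum>(t, k)\<in>q. \<bar>f (Sup k) - f (Inf k)\<bar>) < \<epsilon>" .
  qed (rule \<delta>(1))
qed

text \<open>A gauge argument. Pieces tagged in the exceptional null set stay inside a small open set
  and are controlled by absolute continuity; at all other tags differentiability gives
  \<open>- \<epsilon>\<close> times the length as a lower bound.\<close>

lemma ac_mono:
  assumes ac: "absolutely_continuous_on_interval a b f" and ab: "a \<le> b"
    and ae: "AE t in lborel. t \<in> {a..b} \<longrightarrow> (\<exists>D\<ge>0. (f has_real_derivative D) (at t within {a..b}))"
  shows "f a \<le> f b"
proof (rule field_le_epsilon)
  fix e :: real assume e: "e > 0"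
  define \<epsilon> where "\<epsilon> = e / (1 + (b - a))"
  have \<epsilon>: "\<epsilon> > 0" using e ab by (simp add: \<epsilon>_def)
  obtain \<delta> where \<delta>: "\<delta> > 0" "\<forall>p q W. p tagged_division_of {a..b} \<longrightarrow> q \<subseteq> p \<longrightarrow> open W \<longrightarrow> emeasure lborel W < ennreal \<delta> \<longrightarrow>
    (\<forall>(t, k)\<in>q. k \<subseteq> W) \<longrightarrow> (\<Sum>(t, k)\<in>q. \<bar>f (Sup k) - f (Inf k)\<bar>) < \<epsilon>"
    using ac_small_on_small_cover[OF ac \<epsilon>] by (elim exE conjE) (rule that)
  obtain E where E: "{t \<in> space lborel. \<not> (t \<in> {a..b} \<longrightarrow> (\<exists>D\<ge>0. (f has_real_derivative D) (at t within {a..b})))} \<subseteq> E"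
    "emeasure lborel E = 0" "E \<in> sets lborel"
    using ae by (rule AE_E)
  have Eb: "E \<in> sets borel" using E(3) by simp
  obtain W where W: "open W" "E \<subseteq> W" "emeasure lborel (W - E) < ennreal \<delta>"
    by (rule outer_regular_lborel[OF Eb, of \<delta>]) (use \<delta>(1) in auto)
  have "emeasure lborel W = emeasure lborel (W - E)"
    using W E by (subst emeasure_Diff_null_set) auto
  then have Wd: "emeasure lborel W < ennreal \<delta>" using W(3) by simp
  have "\<exists>r>0. \<forall>s\<in>{a..b}. \<bar>s - t\<bar> < r \<longrightarrow> (s \<ge> t \<longrightarrow> f s - f t \<ge> - \<epsilon> * (s - t)) \<and> (s \<le> t \<longrightarrow> f t - f s \<ge> - \<epsilon> * (t - s))"
    if t: "t \<in> {a..b}" "t \<notin> E" for t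
  proof -
    obtain D where D: "D \<ge> 0" "(f has_real_derivative D) (at t within {a..b})" using E(1) t by auto
    have "(f has_derivative (*) D) (at t within {a..b})" using D(2) by (simp add: has_field_derivative_def)
    then obtain r where r: "r > 0" "\<And>s. s \<in> {a..b} \<Longrightarrow> \<bar>s - t\<bar> < r \<Longrightarrow> \<bar>f s - f t - D * (s - t)\<bar> \<le> \<epsilon> * \<bar>s - t\<bar>"
      using \<epsilon> unfolding has_derivative_within_alt by (metis real_norm_def)
    have "(s \<ge> t \<longrightarrow> f s - f t \<ge> - \<epsilon> * (s - t)) \<and> (s \<le> t \<longrightarrow> f t - f s \<ge> - \<epsilon> * (t - s))"
      if s: "s \<in> {a..b}" "\<bar>s - t\<bar> < r" for s
    proof (intro conjI impI)
      assume st: "t \<le> s"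
      have ab: "\<bar>s - t\<bar> = s - t" using st by simp
      have "0 \<le> D * (s - t)" using D(1) st by simp
      then show "- \<epsilon> * (s - t) \<le> f s - f t"
        using r(2)[OF s] unfolding ab abs_le_iff by (simp add: algebra_simps)
    next
      assume st: "s \<le> t"
      have ab: "\<bar>s - t\<bar> = t - s" using st by simp
      have "0 \<le> D * (t - s)" using D(1) st by simp
      then show "- \<epsilon> * (t - s) \<le> f t - f s"
        using r(2)[OF s] unfolding ab abs_le_iff by (simp add: algebra_simps)
    qed
    then show ?thesis using r(1) by blast
  qed
  then obtain rr where rr: "\<And>t. t \<in> {a..b} \<Longrightarrow> t \<notin> E \<Longrightarrow> rr t > 0"
    "\<And>t s. t \<in> {a..b} \<Longrightarrow> t \<notin> E \<Longrightarrow> s \<in> {a..b} \<Longrightarrow> \<bar>s - t\<bar> < rr t \<Longrightarrow>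
      (s \<ge> t \<longrightarrow> f s - f t \<ge> - \<epsilon> * (s - t)) \<and> (s \<le> t \<longrightarrow> f t - f s \<ge> - \<epsilon> * (t - s))"
    by metis
  \<comment> \<open>At exceptional tags the gauge is the small open set itself, elsewhere in the
    interval the ball on which the derivative estimate holds; the last case is a default outside the
    interval.\<close>
  define \<gamma> where "\<gamma> t = (if t \<in> E then W else if t \<in> {a..b} then ball t (rr t) else ball t 1)" for t
  have "gauge \<gamma>" unfolding gauge_def \<gamma>_def using W rr(1) by auto
  then obtain p where p: "p tagged_division_of {a..b}" "\<gamma> fine p" by (rule fine_division_exists_real)
  have fine: "k \<subseteq> \<gamma> t" if "(t, k) \<in> p" for t k using p(2) that unfolding fine_def by blast
  have fin_p: "finite p" by (rule tagged_division_ofD(1)[OF p(1)])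
  define q where "q = {x \<in> p. fst x \<in> E}"
  have len: "(\<Sum>(t, k)\<in>p. Sup k - Inf k) = b - a" using additive_tagged_division_1[OF ab p(1), of "\<lambda>x. x"] .
  have tot: "(\<Sum>(t, k)\<in>p. f (Sup k) - f (Inf k)) = f b - f a" by (rule additive_tagged_division_1[OF ab p(1)])
  have bad: "(\<Sum>(t, k)\<in>q. \<bar>f (Sup k) - f (Inf k)\<bar>) < \<epsilon>"
  proof (rule \<delta>(2)[THEN spec, THEN spec, THEN spec, THEN mp, THEN mp, THEN mp, THEN mp, THEN mp, OF p(1) _ W(1) Wd])
    show "q \<subseteq> p" by (auto simp: q_def)
    have "k \<subseteq> W" if "(t, k) \<in> p" "t \<in> E" for t k using fine[OF that(1)] that(2) by (simp add: \<gamma>_def)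
    then show "\<forall>(t, k)\<in>q. k \<subseteq> W" unfolding q_def by fastforce
  qed
  have piece: "Inf k \<le> Sup k \<and> (t \<notin> E \<longrightarrow> - \<epsilon> * (Sup k - Inf k) \<le> f (Sup k) - f (Inf k))" if tk: "(t, k) \<in> p" for t k
  proof -
    obtain c d where cd: "k = cbox c d" using tagged_division_ofD(4)[OF p(1) tk] by blast
    have tm: "t \<in> k" by (rule tagged_division_ofD(2)[OF p(1) tk])
    have cd': "c \<le> t" "t \<le> d" using tm cd by auto
    have sub: "k \<subseteq> {a..b}" by (rule tagged_division_ofD(3)[OF p(1) tk])
    have tab: "t \<in> {a..b}" "c \<in> {a..b}" "d \<in> {a..b}" using sub tm cd cd' by auto
    have SI: "Sup k = d" "Inf k = c" using cd cd' by auto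
    have "- \<epsilon> * (d - c) \<le> f d - f c" if tE: "t \<notin> E"
    proof -
      have "k \<subseteq> ball t (rr t)" using fine[OF tk] tE tab(1) by (simp add: \<gamma>_def)
      moreover have "c \<in> k" "d \<in> k" using cd cd' by auto
      ultimately have "\<bar>c - t\<bar> < rr t" "\<bar>d - t\<bar> < rr t" by (auto simp: dist_real_def)
      then have "- \<epsilon> * (d - t) \<le> f d - f t" "- \<epsilon> * (t - c) \<le> f t - f c"
        using rr(2)[OF tab(1) tE tab(2)] rr(2)[OF tab(1) tE tab(3)] cd' by auto
      moreover have "- \<epsilon> * (d - c) = - \<epsilon> * (d - t) + - \<epsilon> * (t - c)" by (simp add: algebra_simps)
      ultimately show ?thesis by linarith
    qed
    then show ?thesis using SI cd' by auto
  qed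
  have "- \<epsilon> * (b - a) = (\<Sum>(t, k)\<in>p. - \<epsilon> * (Sup k - Inf k))"
    unfolding len[symmetric] by (simp add: sum_distrib_left case_prod_beta)
  also have "\<dots> \<le> (\<Sum>(t, k)\<in>p. (f (Sup k) - f (Inf k)) + (if t \<in> E then \<bar>f (Sup k) - f (Inf k)\<bar> else 0))"
  proof (intro sum_mono)
    fix x assume "x \<in> p"
    then obtain t k where x: "x = (t, k)" "(t, k) \<in> p" by (cases x) auto
    have "- \<epsilon> * (Sup k - Inf k) \<le> 0" using \<epsilon> piece[OF x(2)] by (intro mult_nonpos_nonneg) auto
    then show "(case x of (t, k) \<Rightarrow> - \<epsilon> * (Sup k - Inf k)) \<le>
        (case x of (t, k) \<Rightarrow> (f (Sup k) - f (Inf k)) + (if t \<in> E then \<bar>f (Sup k) - f (Inf k)\<bar> else 0))"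
      using piece[OF x(2)] unfolding x(1) by (cases "t \<in> E") auto
  qed
  also have "\<dots> = (f b - f a) + (\<Sum>x\<in>p. if fst x \<in> E then \<bar>f (Sup (snd x)) - f (Inf (snd x))\<bar> else 0)"
    unfolding tot[symmetric] by (simp add: sum.distrib case_prod_beta)
  also have "(\<Sum>x\<in>p. if fst x \<in> E then \<bar>f (Sup (snd x)) - f (Inf (snd x))\<bar> else 0) = (\<Sum>x\<in>q. \<bar>f (Sup (snd x)) - f (Inf (snd x))\<bar>)"
    unfolding q_def by (rule sum.inter_filter[OF fin_p, symmetric])
  finally have "f a \<le> f b + (\<epsilon> + \<epsilon> * (b - a))" using bad by (simp add: case_prod_beta)
  also have "\<epsilon> + \<epsilon> * (b - a) = \<epsilon> * (1 + (b - a))" by (simp only: distrib_left mult_1_right)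
  also have "\<dots> = e" using ab by (simp add: \<epsilon>_def)
  finally show "f a \<le> f b + e" .
qed

lemma ac_const:
  assumes ac: "absolutely_continuous_on_interval a b f" and ab: "a \<le> b"
    and ae: "AE t in lborel. t \<in> {a..b} \<longrightarrow> (f has_real_derivative 0) (at t within {a..b})"
  shows "f a = f b"
proof (rule antisym)
  show "f a \<le> f b" using ac ab
  proof (rule ac_mono)
    show "AE t in lborel. t \<in> {a..b} \<longrightarrow> (\<exists>D\<ge>0. (f has_real_derivative D) (at t within {a..b}))"
      using ae by eventually_elim auto
  qed
  have "- f a \<le> - f b" using ac_uminus[OF ac] ab
  proof (rule ac_mono)
    show "AE t in lborel. t \<in> {a..b} \<longrightarrow> (\<exists>D\<ge>0. ((\<lambda>t. - f t) has_real_derivative D) (at t within {a..b}))"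
      using ae
    proof eventually_elim
      case (elim t)
      then show ?case using DERIV_minus[of f 0 t "{a..b}"] by auto
    qed
  qed
  then show "f b \<le> f a" by simp
qed

section \<open>Indifference in finite time\<close>

lemma exp_second_order:
  fixes h :: real
  assumes "\<bar>h\<bar> \<le> 1"
  shows "\<bar>exp (- h) - 1 + h\<bar> \<le> h\<^sup>2"
proof (cases "h \<ge> 0")
  case True
  then show ?thesis using one_minus_exp_bounds[of h] by simp
next
  case False
  have "exp (- h) \<le> 1 + (- h) + (- h)\<^sup>2" using False assms by (intro exp_bound) auto
  moreover have "1 + (- h) \<le> exp (- h)" by (rule exp_ge_add_one_self)
  ultimately show ?thesis by simp
qed

section \<open>Isolation of regular equilibria and the potential gap\<close>

context regular_point
begin

lemma supp_lower: "\<exists>c>0. \<forall>i. \<forall>a\<in>supp z i. c \<le> z i a"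
proof -
  define V where "V = insert 1 (\<Union>i\<in>UNIV. z i ` supp z i)"
  have V: "finite V" "V \<noteq> {}" unfolding V_def by auto
  have "Min V \<in> V" using V by (rule Min_in)
  moreover have "v > 0" if "v \<in> V" for v
    using that sx_nonneg[OF z] by (fastforce simp: V_def supp_def less_le)
  ultimately have "Min V > 0" by blast
  moreover have "Min V \<le> z i a" if "a \<in> supp z i" for i a
    using that V(1) by (intro Min_le) (auto simp: V_def)
  ultimately show ?thesis by blast
qed

lemma near_facts:
  "\<exists>r>0. r \<le> rad \<and> (\<forall>m. sx m \<longrightarrow> dm z m \<le> r \<longrightarrow> (\<forall>i. br i m \<subseteq> supp z i))"
proof -
  obtain h where h: "h > 0" "\<forall>z' m. eqv z' z \<longrightarrow> sx z' \<longrightarrow> sx m \<longrightarrow> dm z' m < h \<longrightarrow> (\<forall>j. br j m \<subseteq> br j z)"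
    using br_gap[OF z] by blast
  show ?thesis
  proof (intro exI[of _ "min rad (h / 2)"] conjI allI impI)
    show "min rad (h / 2) > 0" using h(1) by simp
    show "min rad (h / 2) \<le> rad" by simp
    fix m i assume m: "sx m" "dm z m \<le> min rad (h / 2)"
    then have "dm z m < h" using h(1) by linarith
    then show "br i m \<subseteq> supp z i"
      using h(2)[rule_format, OF eqv_refl z m(1)] unfolding br_supp by blast
  qed
qed

text \<open>A nearby equilibrium has no mass off the supports, since no action there is optimal, and
  has positive mass on all of them, so all supported actions are optimal. Both equilibria then have
  vanishing payoff differences and equal off-support masses.\<close>

lemma isolated: "\<exists>r>0. \<forall>z'. sx z' \<and> G z' = 0 \<and> dm z z' \<le> r \<longrightarrow> dm z z' = 0"
proof -
  obtain c where c: "c > 0" "\<And>i a. a \<in> supp z i \<Longrightarrow> c \<le> z i a" using supp_lower by blast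
  obtain r where r: "r > 0" "r \<le> rad" "\<forall>m. sx m \<longrightarrow> dm z m \<le> r \<longrightarrow> (\<forall>i. br i m \<subseteq> supp z i)"
    using near_facts by blast
  show ?thesis
  proof (intro exI[of _ "min r (c / 2)"] conjI allI impI)
    show "min r (c / 2) > 0" using r c by simp
    fix z' assume *: "sx z' \<and> G z' = 0 \<and> dm z z' \<le> min r (c / 2)"
    then have z': "sx z'" "G z' = 0" "dm z z' \<le> r" "dm z z' \<le> c / 2" by auto
    have br: "br i z' \<subseteq> supp z i" for i using r(3) z'(1,3) by blast
    have sup: "a \<in> br i z'" if "a \<in> Y i" "z' i a \<noteq> 0" for i a
      using z'(2) that unfolding G_eq_0_iff[OF z'(1)] by blast
    have off0: "off z z' = 0"
      unfolding off_def
    proof (intro sum.neutral ballI)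
      fix i a assume a: "a \<in> Y i - supp z i"
      have "z' i a = 0" using sup[of a i] br[of i] a by blast
      moreover have "z i a = 0" using a by (simp add: supp_def)
      ultimately show "\<bar>z' i a - z i a\<bar> = 0" by simp
    qed
    have some_br: "a \<in> br i z'" if a: "a \<in> supp z i" for i a
    proof -
      have aY: "a \<in> Y i" using a supp_subset by blast
      have "z' i a > 0" using dm_ge_coord[OF aY, of z' z] c(2)[OF a] c(1) z'(4) by linarith
      then show ?thesis using sup[OF aY] by simp
    qed
    have g0: "g p z' = 0" if "p \<in> I" for p
    proof -
      have "snd p \<in> br (fst p) z'" "a0 (fst p) \<in> br (fst p) z'" using that some_br a0 by (auto simp: I_def)
      then show ?thesis by (simp add: g_def d_def br_iff)
    qed
    have "Gam z z' = 0" unfolding Gam_def by (intro sum.neutral) (simp add: g0 g_z)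
    then have "dm z z' \<le> 0"
      using nondegenerate[OF z_aff sx_aff[OF z'(1)]] z'(3) r(2) off0 by simp
    then show "dm z z' = 0" using dm_nonneg[of z z'] by linarith
  qed
qed

text \<open>At a state that is indifferent on the supports, redistributing mass within them has no
  first-order effect on the potential; only off-support increments remain.\<close>

lemma U_comparison:
  assumes x: "aff x" "aff x'" "bnd x" "bnd x'" and g0: "\<And>p. p \<in> I \<Longrightarrow> g p x = 0"
  shows "\<bar>U x' - U x - (\<Sum>i\<in>UNIV. \<Sum>a\<in>Y i - supp z i. (x' i a - x i a) * d i a (a0 i) x)\<bar> \<le> K * (dm x x')\<^sup>2"
proof -
  define w where "w i a = x' i a - x i a" for i a
  have "U (x(j := w j)) = (\<Sum>a\<in>Y j - supp z j. w j a * d j a (a0 j) x)" for j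
  proof -
    have w0: "(\<Sum>e\<in>Y j. w j e) = 0" using x by (simp add: w_def sum_subtractf aff_def)
    have "U (x(j := w j)) = (\<Sum>e\<in>Y j. w j e * d j e (a0 j) x) + (\<Sum>e\<in>Y j. w j e) * pay j (a0 j) x"
      unfolding U_upd_pay d_def by (simp add: right_diff_distrib sum_subtractf sum_distrib_right)
    also have "\<dots> = (\<Sum>e\<in>Y j. w j e * d j e (a0 j) x)" by (simp add: w0)
    also have "(\<Sum>e\<in>supp z j - {a0 j}. w j e * d j e (a0 j) x) = 0"
    proof (intro sum.neutral ballI)
      fix e assume "e \<in> supp z j - {a0 j}"
      then have "(j, e) \<in> I" by (simp add: I_def)
      from g0[OF this] show "w j e * d j e (a0 j) x = 0" by (simp add: g_def)
    qed
    then have "(\<Sum>e\<in>Y j. w j e * d j e (a0 j) x) = (\<Sum>a\<in>Y j - supp z j. w j a * d j a (a0 j) x)"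
      unfolding sum_Y_split by simp
    finally show ?thesis .
  qed
  then show ?thesis using U_taylor[OF x(3,4)] unfolding w_def by simp
qed

text \<open>
  Off the support masses decay freely, so relative to the comparison state the potential gap \<open>V\<close>
  satisfies \<open>V' \<ge> const * sqrt \<bar>V\<bar>\<close> and therefore vanishes after a finite time.
\<close>

lemma indifferent_in_finite_time:
  assumes m: "wsol m" and conv: "((\<lambda>t. dm z (m t)) \<longlongrightarrow> 0) at_top"
  shows "\<exists>n :: nat. \<forall>p\<in>I. g p (m (real n)) = 0"
proof -
  obtain c where c: "c > 0" "\<And>i a. a \<in> supp z i \<Longrightarrow> c \<le> z i a" using supp_lower by blast
  obtain r where r: "r > 0" "r \<le> rad" "\<forall>m. sx m \<longrightarrow> dm z m \<le> r \<longrightarrow> (\<forall>i. br i m \<subseteq> supp z i)"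
    using near_facts by blast
  obtain sg where sg: "sg > 0" and comp: "\<forall>q. off z q \<le> sg \<longrightarrow>
    (\<exists>x. aff x \<and> dm z x \<le> rad \<and> (\<forall>i. \<forall>a\<in>Y i - supp z i. x i a = q i a) \<and> (\<forall>p\<in>I. g p x = 0))"
    using comparator_exists by metis
  \<comment> \<open>Chosen so that \<open>2 * c1 * (1 + NY) = c / 2\<close>, half the smallest
    supported mass.\<close>
  define c1 where "c1 = c / (4 * (1 + NY))"
  have NY1: "1 + NY > 0" using NY_pos(1) by linarith
  have c1: "c1 > 0" using c(1) NY1 by (simp add: c1_def)
  \<comment> \<open>The four bounds ensure, in order, that best responses stay in the supports, that
    a comparison state exists, that supported masses stay above \<open>c / 2\<close>, and that the
    error from evaluating at the comparison state uses up at most half of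
    \<open>2 * c1 * Ga t\<close>.\<close>
  define r0 where "r0 = min r (min sg (min (c / 2) (c1 / (K * kN))))"
  have KkN: "K * kN > 0" by (rule mult_pos_pos[OF K_pos(1) kN_pos(1)])
  have r0: "r0 > 0" "r0 \<le> r" "r0 \<le> sg" "r0 \<le> c / 2" "K * kN * r0 \<le> c1"
  proof -
    show "r0 > 0" using r sg c c1 KkN by (simp add: r0_def)
    show "r0 \<le> r" by (simp add: r0_def)
    show "r0 \<le> sg" by (simp add: r0_def)
    show "r0 \<le> c / 2" unfolding r0_def by (meson min.cobounded1 min.cobounded2 order_trans)
    have "r0 \<le> c1 / (K * kN)" by (simp add: r0_def)
    then show "K * kN * r0 \<le> c1" using KkN by (simp add: pos_le_divide_eq mult.commute)
  qed
  obtain T0 where T0: "\<And>t. t \<ge> T0 \<Longrightarrow> dm z (m t) < r0"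
    using order_tendstoD(2)[OF conv r0(1)] unfolding eventually_at_top_linorder by blast
  define T where "T = max T0 0"
  have T: "T \<ge> 0" "\<And>t. t \<ge> T \<Longrightarrow> dm z (m t) \<le> r0" using T0 by (auto simp: T_def less_imp_le)
  have sx: "sx (m t)" if "t \<ge> T" for t using wsol_sx[OF m] that T(1) by simp
  have brm: "br i (m t) \<subseteq> supp z i" if "t \<ge> T" for i t
    using r(3) sx[OF that] T(2)[OF that] r0(2) by (meson order_trans)
  have low: "c / 2 \<le> m t i a" if "t \<ge> T" "a \<in> supp z i" for t i a
  proof -
    have aY: "a \<in> Y i" using that supp_subset by blast
    show ?thesis using dm_ge_coord[OF aY, of "m t" z] T(2)[OF that(1)] r0(4) c(2)[OF that(2)] by linarith
  qed
  have decay: "m t i a = exp (s - t) * m s i a" if st: "s \<ge> T" "t \<ge> T" and a: "a \<in> Y i - supp z i" for s t i a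
  proof -
    have aY: "a \<in> Y i" using a by simp
    have *: "exp t * m t i a = exp s * m s i a" if st': "T \<le> s" "s \<le> t" for s t
    proof (rule wsol_const[OF m aY])
      show "0 \<le> s" using st' T(1) by simp
      show "a \<notin> br i (m r)" if "s \<le> r" for r using brm[of r i] that st' a by auto
    qed (use st' in auto)
    have "exp t * m t i a = exp s * m s i a" using *[of s t] *[of t s] st by (cases "s \<le> t") auto
    then show ?thesis by (simp add: exp_diff field_simps)
  qed
  have "\<exists>x. T \<le> t \<longrightarrow> aff x \<and> dm z x \<le> rad \<and> (\<forall>i. \<forall>a\<in>Y i - supp z i. x i a = m t i a) \<and> (\<forall>p\<in>I. g p x = 0)" for t
  proof (cases "T \<le> t")
    case True
    have "off z (m t) \<le> sg" using off_le_dm[of z "m t"] T(2)[OF True] r0(3) by linarith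
    then show ?thesis using comp by blast
  qed simp
  then obtain xh where xh: "\<And>t. T \<le> t \<Longrightarrow> aff (xh t)" "\<And>t. T \<le> t \<Longrightarrow> dm z (xh t) \<le> rad"
    "\<And>t i a. T \<le> t \<Longrightarrow> a \<in> Y i - supp z i \<Longrightarrow> xh t i a = m t i a" "\<And>t p. T \<le> t \<Longrightarrow> p \<in> I \<Longrightarrow> g p (xh t) = 0"
    by metis
  have bx: "bnd (xh t)" if "T \<le> t" for t using xh(2)[OF that] rad_le by (intro bnd_near) simp
  have mrad: "dm z (m t) \<le> rad" if "T \<le> t" for t using T(2)[OF that] r0(2) r(2) by linarith
  define Ga where "Ga t = (\<Sum>p\<in>I. \<bar>g p (m t)\<bar>)" for t
  have Ga0: "Ga t \<ge> 0" for t unfolding Ga_def by (intro sum_nonneg) auto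
  have dist: "dm (xh t) (m t) \<le> kN * Ga t" if t: "T \<le> t" for t
  proof -
    have "off (xh t) (m t) = 0" unfolding off_def by (intro sum.neutral ballI) (simp add: xh(3)[OF t])
    moreover have "Gam (xh t) (m t) = Ga t" unfolding Gam_def Ga_def by (intro sum.cong refl) (simp add: xh(4)[OF t])
    ultimately show ?thesis using nondegenerate[OF xh(1)[OF t] sx_aff[OF sx[OF t]] xh(2)[OF t] mrad[OF t]] by simp
  qed
  \<comment> \<open>Comparison states differ only through their off-support masses, so the
    nondegeneracy estimate makes them Lipschitz in time although each was merely chosen.\<close>
  have xlip: "dm (xh s) (xh t) \<le> kN * (NY * \<bar>t - s\<bar>)" if st: "T \<le> s" "T \<le> t" for s t
  proof -
    have f1: "Gam (xh s) (xh t) = 0" unfolding Gam_def by (intro sum.neutral ballI) (simp add: xh(4) st)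
    have f2: "off (xh s) (xh t) = off (m s) (m t)" unfolding off_def by (intro sum.cong refl) (simp add: xh(3) st)
    have f3: "off (m s) (m t) \<le> NY * \<bar>t - s\<bar>"
      using off_le_dm[of "m s" "m t"] wsol_lipschitz[OF m, of s t] st T(1) by simp
    have "dm (xh s) (xh t) \<le> kN * off (m s) (m t)"
      using nondegenerate[OF xh(1)[OF st(1)] xh(1)[OF st(2)] xh(2)[OF st(1)] xh(2)[OF st(2)]] f1 f2 by simp
    also have "\<dots> \<le> kN * (NY * \<bar>t - s\<bar>)" by (rule mult_left_mono[OF f3 kN_pos(2)])
    finally show ?thesis .
  qed
  \<comment> \<open>The derivative of the potential along the comparison states: off-support masses
    decay with velocity \<open>- m t i a\<close>, and everything else is of second order.\<close>
  define E where "E t = (\<Sum>i\<in>UNIV. \<Sum>a\<in>Y i - supp z i. m t i a * (- d i a (a0 i) (xh t)))" for t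
  define pb where "pb = K * NY + K"
  have pb: "\<bar>d i a (a0 i) (xh t)\<bar> \<le> pb" if t: "T \<le> t" and a: "a \<in> Y i" for i a t
  proof -
    have "\<bar>d i a (a0 i) z\<bar> \<le> K * NY"
      unfolding d_def pay_def using z a by (intro U_bounded sx_upd_ind) auto
    moreover have "\<bar>d i a (a0 i) (xh t) - d i a (a0 i) z\<bar> \<le> K * dm z (xh t)" by (rule d_lipschitz[OF sx_bnd[OF z] bx[OF t]])
    moreover have "K * dm z (xh t) \<le> K * 1" using xh(2)[OF t] rad_le by (intro mult_left_mono) auto
    ultimately show ?thesis unfolding pb_def by linarith
  qed
  have pb0: "pb \<ge> 0" by (simp add: pb_def)
  define CW where "CW = K * (kN * NY)\<^sup>2 + NY * pb"
  have Wq: "\<bar>U (xh t) - U (xh s) - (t - s) * E s\<bar> \<le> CW * (t - s)\<^sup>2" if st: "T \<le> s" "T \<le> t" "\<bar>t - s\<bar> \<le> 1" for s t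
  proof -
    define D where "D = (\<Sum>i\<in>UNIV. \<Sum>a\<in>Y i - supp z i. (xh t i a - xh s i a) * d i a (a0 i) (xh s))"
    have "\<bar>U (xh t) - U (xh s) - D\<bar> \<le> K * (dm (xh s) (xh t))\<^sup>2"
      unfolding D_def using xh(1,4) bx st by (intro U_comparison) auto
    also have "\<dots> \<le> K * (kN * (NY * \<bar>t - s\<bar>))\<^sup>2"
      using xlip[OF st(1,2)] by (intro mult_left_mono power_mono) auto
    also have "\<dots> = K * (kN * NY)\<^sup>2 * (t - s)\<^sup>2" by (simp add: power_mult_distrib)
    finally have 1: "\<bar>U (xh t) - U (xh s) - D\<bar> \<le> K * (kN * NY)\<^sup>2 * (t - s)\<^sup>2" .
    \<comment> \<open>The decay is exactly exponential, so the only discrepancy is the second-order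
      remainder of the exponential.\<close>
    have eq: "D - (t - s) * E s = (\<Sum>i\<in>UNIV. \<Sum>a\<in>Y i - supp z i. (exp (- (t - s)) - 1 + (t - s)) * m s i a * d i a (a0 i) (xh s))"
      unfolding D_def E_def sum_distrib_left sum_subtractf[symmetric]
    proof (intro sum.cong refl)
      fix i a assume a: "a \<in> Y i - supp z i"
      have x1: "xh t i a = exp (s - t) * m s i a" using xh(3)[OF st(2) a] decay[OF st(1,2) a] by simp
      have x2: "xh s i a = m s i a" by (rule xh(3)[OF st(1) a])
      show "(xh t i a - xh s i a) * d i a (a0 i) (xh s) - (t - s) * (m s i a * (- d i a (a0 i) (xh s)))
        = (exp (- (t - s)) - 1 + (t - s)) * m s i a * d i a (a0 i) (xh s)"
        unfolding x1 x2 by (simp add: algebra_simps)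
    qed
    have "\<bar>D - (t - s) * E s\<bar> \<le> (\<Sum>i\<in>UNIV. \<Sum>a\<in>Y i - supp z i. \<bar>(exp (- (t - s)) - 1 + (t - s)) * m s i a * d i a (a0 i) (xh s)\<bar>)"
      unfolding eq by (rule order_trans[OF sum_abs sum_mono[OF sum_abs]])
    also have "\<dots> \<le> (\<Sum>i\<in>UNIV. \<Sum>a\<in>Y i - supp z i. (t - s)\<^sup>2 * 1 * pb)"
    proof (intro sum_mono)
      fix i a assume a: "a \<in> Y i - supp z i"
      then have aY: "a \<in> Y i" by simp
      show "\<bar>(exp (- (t - s)) - 1 + (t - s)) * m s i a * d i a (a0 i) (xh s)\<bar> \<le> (t - s)\<^sup>2 * 1 * pb"
        unfolding abs_mult
        using exp_second_order[OF st(3)] sx_nonneg[OF sx[OF st(1)] aY] sx_le_1[OF sx[OF st(1)] aY] pb[OF st(1) aY]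
        by (intro mult_mono) (auto simp: abs_le_iff)
    qed
    also have "\<dots> \<le> (\<Sum>i\<in>(UNIV :: 'p set). \<Sum>a\<in>Y i. (t - s)\<^sup>2 * 1 * pb)"
      using pb0 by (intro sum_mono sum_mono2) auto
    also have "\<dots> = NY * pb * (t - s)\<^sup>2" by (simp add: NY_def sum_distrib_left sum_distrib_right mult_ac)
    finally have 2: "\<bar>D - (t - s) * E s\<bar> \<le> NY * pb * (t - s)\<^sup>2" .
    show ?thesis using 1 2 unfolding CW_def distrib_right by linarith
  qed
  define V where "V t = U (m t) - U (xh t)" for t
  have Vder: "(V has_real_derivative (G (m t) - E t)) (at t)" if t: "T < t" for t
  proof -
    have "((\<lambda>t. U (xh t)) has_real_derivative E t) (at t)"
      by (rule has_derivative_from_local_quadratic_bound[where f="\<lambda>t. U (xh t)" and g=E and a=T and C=CW, OF Wq t])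
    then show ?thesis unfolding V_def using wsol_U_derivative[OF m, of t] t T(1) by (intro DERIV_diff) auto
  qed
  \<comment> \<open>On the supports each mass is at least \<open>c / 2\<close>, which gives
    \<open>2 * c1 * Ga t\<close>. Off the supports the loss at \<open>m t\<close> is compared with
    the loss at \<open>xh t\<close>; the difference is at most \<open>K * dm (xh t) (m t)\<close>
    times the small off-support mass, at most \<open>c1 * Ga t\<close>.\<close>
  have Vlow: "G (m t) - E t \<ge> c1 * Ga t" if t: "T \<le> t" for t
  proof -
    define y where "y i a = mx i (m t) - pay i a (m t)" for i a
    have y0: "y i a \<ge> 0" if "a \<in> Y i" for i a using mx_ge[OF that, of "m t"] by (simp add: y_def)
    have d: "d i a b (m t) = y i b - y i a" for i a b by (simp add: d_def y_def)
    define dd where "dd = dm (xh t) (m t)"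
    have player: "2 * c1 * (\<Sum>a\<in>supp z i - {a0 i}. \<bar>d i a (a0 i) (m t)\<bar>) +
        (\<Sum>a\<in>Y i - supp z i. m t i a * (- d i a (a0 i) (xh t))) - K * dd * (\<Sum>a\<in>Y i - supp z i. m t i a)
      \<le> (\<Sum>a\<in>Y i. m t i a * y i a)" for i
    proof -
      have yS: "y i a \<ge> 0" if "a \<in> supp z i" for a using that supp_subset by (intro y0) blast
      define Sy where "Sy = y i (a0 i) + (\<Sum>a\<in>supp z i - {a0 i}. y i a)"
      have yy: "(\<Sum>a\<in>supp z i - {a0 i}. y i a) \<ge> 0" by (intro sum_nonneg y0) (use supp_subset in auto)
      have Sy0: "Sy \<ge> 0" "y i (a0 i) \<le> Sy" "(\<Sum>a\<in>supp z i - {a0 i}. y i a) \<le> Sy"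
        using y0[OF a0_Y, of i] yy by (auto simp: Sy_def)
      have "(\<Sum>a\<in>supp z i - {a0 i}. \<bar>d i a (a0 i) (m t)\<bar>) \<le> (\<Sum>a\<in>supp z i - {a0 i}. y i (a0 i) + y i a)"
      proof (intro sum_mono)
        fix a assume "a \<in> supp z i - {a0 i}"
        then have "a \<in> Y i" using supp_subset by blast
        then show "\<bar>d i a (a0 i) (m t)\<bar> \<le> y i (a0 i) + y i a" unfolding d using y0[of a i] y0[OF a0_Y, of i] by linarith
      qed
      also have "\<dots> = real (card (supp z i - {a0 i})) * y i (a0 i) + (\<Sum>a\<in>supp z i - {a0 i}. y i a)" by (simp add: sum.distrib)
      also have "\<dots> \<le> NY * Sy + Sy"
      proof (intro add_mono mult_mono Sy0)
        have "card (supp z i - {a0 i}) \<le> card (Y i)" by (intro card_mono) (use supp_subset in auto)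
        also have "real (card (Y i)) \<le> NY" unfolding NY_def
          by (simp only: of_nat_sum) (rule member_le_sum[where f="\<lambda>i. real (card (Y i))"], auto)
        finally show "real (card (supp z i - {a0 i})) \<le> NY" by simp
      qed (use y0[OF a0_Y, of i] in auto)
      finally have "(\<Sum>a\<in>supp z i - {a0 i}. \<bar>d i a (a0 i) (m t)\<bar>) \<le> (1 + NY) * Sy" by (simp add: algebra_simps)
      then have "2 * c1 * (\<Sum>a\<in>supp z i - {a0 i}. \<bar>d i a (a0 i) (m t)\<bar>) \<le> 2 * c1 * ((1 + NY) * Sy)"
        using c1 by (intro mult_left_mono) auto
      also have "\<dots> = c / 2 * Sy" using NY1 by (simp add: c1_def field_simps)
      also have "c / 2 * Sy \<le> m t i (a0 i) * y i (a0 i) + (\<Sum>a\<in>supp z i - {a0 i}. m t i a * y i a)"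
        unfolding Sy_def distrib_left sum_distrib_left
        using low[OF t] a0[of i] a0_Y[of i] yS by (intro add_mono sum_mono mult_right_mono) auto
      finally have 1: "2 * c1 * (\<Sum>a\<in>supp z i - {a0 i}. \<bar>d i a (a0 i) (m t)\<bar>) \<le>
          m t i (a0 i) * y i (a0 i) + (\<Sum>a\<in>supp z i - {a0 i}. m t i a * y i a)" .
      have "(\<Sum>a\<in>Y i - supp z i. m t i a * (- d i a (a0 i) (xh t)) - K * dd * m t i a) \<le> (\<Sum>a\<in>Y i - supp z i. m t i a * y i a)"
      proof (intro sum_mono)
        fix a assume "a \<in> Y i - supp z i"
        then have aY: "a \<in> Y i" by simp
        have "\<bar>d i a (a0 i) (m t) - d i a (a0 i) (xh t)\<bar> \<le> K * dd"
          unfolding dd_def by (rule d_lipschitz[OF bx[OF t] sx_bnd[OF sx[OF t]]])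
        moreover have "- d i a (a0 i) (m t) \<le> y i a" unfolding d using y0[OF a0_Y, of i] by simp
        ultimately have "- d i a (a0 i) (xh t) - K * dd \<le> y i a" by linarith
        then have "m t i a * (- d i a (a0 i) (xh t) - K * dd) \<le> m t i a * y i a"
          by (rule mult_left_mono[OF _ sx_nonneg[OF sx[OF t] aY]])
        then show "m t i a * (- d i a (a0 i) (xh t)) - K * dd * m t i a \<le> m t i a * y i a" by (simp add: algebra_simps)
      qed
      then have 2: "(\<Sum>a\<in>Y i - supp z i. m t i a * (- d i a (a0 i) (xh t))) - K * dd * (\<Sum>a\<in>Y i - supp z i. m t i a)
          \<le> (\<Sum>a\<in>Y i - supp z i. m t i a * y i a)"
        by (simp add: sum_subtractf sum_distrib_left)
      show ?thesis using 1 2 unfolding sum_Y_split[of "\<lambda>a. m t i a * y i a"] by linarith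
    qed
    have "(\<Sum>i\<in>UNIV. 2 * c1 * (\<Sum>a\<in>supp z i - {a0 i}. \<bar>d i a (a0 i) (m t)\<bar>) +
        (\<Sum>a\<in>Y i - supp z i. m t i a * (- d i a (a0 i) (xh t))) - K * dd * (\<Sum>a\<in>Y i - supp z i. m t i a))
      \<le> (\<Sum>i\<in>UNIV. \<Sum>a\<in>Y i. m t i a * y i a)" by (intro sum_mono player)
    also have "\<dots> = G (m t)" unfolding G_eq[OF sx[OF t]] y_def ..
    also have "(\<Sum>i\<in>UNIV. 2 * c1 * (\<Sum>a\<in>supp z i - {a0 i}. \<bar>d i a (a0 i) (m t)\<bar>) +
        (\<Sum>a\<in>Y i - supp z i. m t i a * (- d i a (a0 i) (xh t))) - K * dd * (\<Sum>a\<in>Y i - supp z i. m t i a))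
      = 2 * c1 * Ga t + E t - K * dd * (\<Sum>i\<in>UNIV. \<Sum>a\<in>Y i - supp z i. m t i a)"
      unfolding Ga_def g_def sum_I[of "\<lambda>i a. \<bar>d i a (a0 i) (m t)\<bar>"] E_def
      by (simp add: sum.distrib sum_subtractf sum_distrib_left)
    finally have main: "2 * c1 * Ga t + E t - K * dd * (\<Sum>i\<in>UNIV. \<Sum>a\<in>Y i - supp z i. m t i a) \<le> G (m t)" .
    have "(\<Sum>i\<in>UNIV. \<Sum>a\<in>Y i - supp z i. m t i a) = off z (m t)"
      unfolding off_def
    proof (intro sum.cong refl)
      fix i a assume a: "a \<in> Y i - supp z i"
      then have "z i a = 0" by (simp add: supp_def)
      then show "m t i a = \<bar>m t i a - z i a\<bar>" using sx_nonneg[OF sx[OF t], of a i] a by simp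
    qed
    also have "\<dots> \<le> r0" using off_le_dm[of z "m t"] T(2)[OF t] by linarith
    finally have so: "(\<Sum>i\<in>UNIV. \<Sum>a\<in>Y i - supp z i. m t i a) \<le> r0" .
    have "K * dd * (\<Sum>i\<in>UNIV. \<Sum>a\<in>Y i - supp z i. m t i a) \<le> K * (kN * Ga t) * r0"
      using so dist[OF t] Ga0[of t] unfolding dd_def
      by (intro mult_mono) (auto intro!: sum_nonneg mult_nonneg_nonneg sx_nonneg[OF sx[OF t]])
    also have "\<dots> = (K * kN * r0) * Ga t" by simp
    also have "\<dots> \<le> c1 * Ga t" using r0(5) Ga0 by (rule mult_right_mono)
    finally show ?thesis using main by linarith
  qed
  \<comment> \<open>The two states have the same off-support masses, so the first-order term of
    \<open>U_comparison\<close> is 0 and the gap is quadratic in their distance.\<close>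
  have Vabs: "\<bar>V t\<bar> \<le> K * (kN * Ga t)\<^sup>2" if t: "T \<le> t" for t
  proof -
    have "(\<Sum>i\<in>UNIV. \<Sum>a\<in>Y i - supp z i. (m t i a - xh t i a) * d i a (a0 i) (xh t)) = 0"
      by (intro sum.neutral ballI) (simp add: xh(3)[OF t])
    then have "\<bar>V t\<bar> \<le> K * (dm (xh t) (m t))\<^sup>2"
      using U_comparison[OF xh(1)[OF t] sx_aff[OF sx[OF t]] bx[OF t] sx_bnd[OF sx[OF t]] xh(4)[OF t]] by (simp add: V_def)
    also have "\<dots> \<le> K * (kN * Ga t)\<^sup>2" using dist[OF t] by (intro mult_left_mono power_mono) auto
    finally show ?thesis .
  qed
  define c2 where "c2 = c1 / (sqrt K * kN)"
  have sK: "sqrt K * kN > 0" by (intro mult_pos_pos kN_pos) simp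
  have c2: "c2 > 0" using c1 sK by (simp add: c2_def)
  have Vsqrt: "G (m t) - E t \<ge> c2 * sqrt \<bar>V t\<bar>" if t: "T < t" for t
  proof -
    have "sqrt \<bar>V t\<bar> \<le> sqrt (K * (kN * Ga t)\<^sup>2)" using Vabs[of t] t by (intro real_sqrt_le_mono) simp
    also have "\<dots> = sqrt K * kN * Ga t" using Ga0[of t] by (simp add: real_sqrt_mult)
    finally have "c2 * sqrt \<bar>V t\<bar> \<le> c2 * (sqrt K * kN * Ga t)" using c2 by (intro mult_left_mono) auto
    also have "\<dots> = c1 * Ga t" using less_imp_neq[OF kN_pos(1), THEN not_sym] by (simp add: c2_def)
    also have "\<dots> \<le> G (m t) - E t" using Vlow[of t] t by simp
    finally show ?thesis .
  qed
  have Vlim: "(V \<longlongrightarrow> 0) at_top"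
  proof (rule Lim_null_comparison)
    show "eventually (\<lambda>t. norm (V t) \<le> K * (kN * (NY * (K * dm z (m t))))\<^sup>2) at_top"
    proof (rule eventually_at_top_linorderI[of T])
      fix t assume t: "T \<le> t"
      have "Ga t = Gam z (m t)" unfolding Ga_def Gam_def by (intro sum.cong refl) (simp add: g_z)
      also have "\<dots> \<le> NY * (K * dm z (m t))" by (rule Gam_le[OF sx_bnd[OF z] sx_bnd[OF sx[OF t]]])
      finally have *: "K * (kN * Ga t)\<^sup>2 \<le> K * (kN * (NY * (K * dm z (m t))))\<^sup>2"
        using Ga0[of t] by (intro mult_left_mono power_mono) auto
      show "norm (V t) \<le> K * (kN * (NY * (K * dm z (m t))))\<^sup>2" unfolding real_norm_def by (rule order_trans[OF Vabs[OF t] *])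
    qed
    have "((\<lambda>t. K * (kN * (NY * (K * dm z (m t))))\<^sup>2) \<longlongrightarrow> K * (kN * (NY * (K * 0)))\<^sup>2) at_top"
      by (intro tendsto_intros conv)
    then show "((\<lambda>t. K * (kN * (NY * (K * dm z (m t))))\<^sup>2) \<longlongrightarrow> 0) at_top" by simp
  qed
  obtain T1 where T1: "T < T1" "\<And>t. T1 \<le> t \<Longrightarrow> V t = 0"
    using finite_time_extinction[OF Vder Vsqrt c2 Vlim] by blast
  obtain n :: nat where n: "T1 < real n" using reals_Archimedean2 by blast
  \<comment> \<open>\<open>V\<close> is identically 0 around this time, so its derivative vanishes;
    the lower bound \<open>c1 * Ga\<close> on the derivative then forces exact indifference.\<close>
  have "(V has_real_derivative 0) (at (real n))"
  proof (rule has_field_derivative_transform_within_open[of "\<lambda>_. 0" 0 "real n" "{T1<..}"])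
    show "((\<lambda>_. 0) has_real_derivative 0) (at (real n))" by (rule DERIV_const)
    show "0 = V x" if "x \<in> {T1<..}" for x using T1(2)[of x] that by simp
  qed (use n in auto)
  then have "G (m (real n)) - E (real n) = 0"
    using Vder[of "real n"] n T1(1) by (intro DERIV_unique[of V _ "real n"]) auto
  then have "c1 * Ga (real n) \<le> 0" using Vlow[of "real n"] n T1(1) by simp
  then have "Ga (real n) = 0" using c1 Ga0[of "real n"] by (simp add: mult_le_0_iff)
  then have "\<forall>p\<in>I. \<bar>g p (m (real n))\<bar> = 0"
    unfolding Ga_def by (subst (asm) sum_nonneg_eq_0_iff) auto
  then show ?thesis by auto
qed

text \<open>A duplicate of the base action would give the Hessian a zero row, which is impossible
  for an invertible matrix. Indifference reached in a mixed limit is therefore never the trivial one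
  between duplicates.\<close>

lemma support_not_dup:
  assumes "(i, a) \<in> I"
  shows "\<not> dup i a (a0 i)"
proof
  assume du: "dup i a (a0 i)"
  have aY: "a \<in> Y i" using assms supp_subset by (auto simp: I_def)
  have "H (i, a) r = 0" for r
    unfolding H_def dd_def using d_dup[OF aY a0_Y du] by simp
  then have "(\<Sum>r\<in>I. H (i, a) r * B r (i, a)) = 0" by simp
  then show False using HB[OF assms assms] by simp
qed

end

section \<open>Solutions of the best-response dynamics\<close>

context labeled_game
begin

definition coords :: "('p \<Rightarrow> 'a \<Rightarrow> real) \<Rightarrow> 'p \<Rightarrow> nat \<Rightarrow> real" where
  "coords m = (\<lambda>i. \<lambda>k\<in>J i. m i (y i (Suc k)))"

lemma mixture_coords:
  assumes "sum v (Y i) = 1" "a \<in> Y i"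
  shows "mixture (Y i) (y i) (\<lambda>k\<in>J i. v (y i (Suc k))) a = v a"
  using assms(2)
proof (cases rule: action_cases)
  case 1
  show ?thesis using assms(1) unfolding 1 mixture_1 sum_Y by simp
next
  case (2 k)
  show ?thesis unfolding 2(2) mixture_Suc[OF 2(1)] using 2(1) by simp
qed

lemma mass_coords: "sx z \<Longrightarrow> a \<in> Y i \<Longrightarrow> mass (coords z) i a = z i a"
  unfolding coords_def by (rule mixture_coords[OF sx_sum])

lemma coords_X: "sx z \<Longrightarrow> coords z \<in> X"
  unfolding X_iff
proof
  assume z: "sx z"
  show "coords z \<in> space S" by (simp add: space_S coords_def)
  have "sx (mass (coords z)) = sx z" by (rule sx_cong) (rule mass_coords[OF z])
  then show "sx (mass (coords z))" using z by simp
qed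

lemma mixed_iff: "z \<in> mixed_strategies (card (Y i)) \<longleftrightarrow> x(i := z) \<in> X" if "x \<in> X"
  using that by (auto simp: strategies_def)

lemma expectation_upd: "expectation Y y u (x(i := z)) = (\<Sum>a\<in>Y i. mixture (Y i) (y i) z a * pay i a (mass x))"
  unfolding expectation_U mass_upd U_upd_pay ..

lemma best_response_expectation_le:
  assumes x: "x \<in> X" and z: "z \<in> mixed_strategies (card (Y i))"
  shows "expectation Y y u (x(i := z)) \<le> mx i (mass x)"
    and "(\<And>a. a \<in> Y i \<Longrightarrow> mixture (Y i) (y i) z a \<noteq> 0 \<Longrightarrow> a \<in> br i (mass x)) \<Longrightarrow> expectation Y y u (x(i := z)) = mx i (mass x)"
    and "expectation Y y u (x(i := z)) = mx i (mass x) \<Longrightarrow> a \<in> Y i \<Longrightarrow> mixture (Y i) (y i) z a \<noteq> 0 \<Longrightarrow> a \<in> br i (mass x)"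
proof -
  let ?v = "mixture (Y i) (y i) z"
  have s: "sx (mass (x(i := z)))" using X_sx z mixed_iff[OF x] by blast
  have v: "0 \<le> ?v a" if "a \<in> Y i" for a using sx_nonneg[OF s that] by simp
  have v1: "(\<Sum>a\<in>Y i. ?v a) = 1" using sx_sum[OF s, of i] by simp
  have "mx i (mass x) - expectation Y y u (x(i := z)) = (\<Sum>a\<in>Y i. ?v a * mx i (mass x)) - (\<Sum>a\<in>Y i. ?v a * pay i a (mass x))"
    unfolding expectation_upd sum_distrib_right[symmetric] v1 by simp
  also have "\<dots> = (\<Sum>a\<in>Y i. ?v a * (mx i (mass x) - pay i a (mass x)))"
    by (simp add: right_diff_distrib sum_subtractf)
  finally have e: "mx i (mass x) - expectation Y y u (x(i := z)) = (\<Sum>a\<in>Y i. ?v a * (mx i (mass x) - pay i a (mass x)))" .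
  have nn: "0 \<le> ?v a * (mx i (mass x) - pay i a (mass x))" if "a \<in> Y i" for a
    using v[OF that] mx_ge[OF that, of "mass x"] by simp
  show "expectation Y y u (x(i := z)) \<le> mx i (mass x)" 
  proof -
    have "0 \<le> (\<Sum>a\<in>Y i. ?v a * (mx i (mass x) - pay i a (mass x)))" by (rule sum_nonneg[OF nn])
    then show ?thesis using e by linarith
  qed
  show "expectation Y y u (x(i := z)) = mx i (mass x)"
    if *: "\<And>a. a \<in> Y i \<Longrightarrow> ?v a \<noteq> 0 \<Longrightarrow> a \<in> br i (mass x)"
  proof -
    have "?v a * (mx i (mass x) - pay i a (mass x)) = 0" if a: "a \<in> Y i" for a
      using *[OF a] by (cases "?v a = 0") (auto simp: br_iff)
    then have "(\<Sum>a\<in>Y i. ?v a * (mx i (mass x) - pay i a (mass x))) = 0" by (simp only: sum.neutral_const sum.cong)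
    then show ?thesis using e by simp
  qed
  show "a \<in> br i (mass x)" if *: "expectation Y y u (x(i := z)) = mx i (mass x)" "a \<in> Y i" "?v a \<noteq> 0"
  proof -
    have "(\<Sum>a\<in>Y i. ?v a * (mx i (mass x) - pay i a (mass x))) = 0" using e *(1) by simp
    then have "\<forall>a\<in>Y i. ?v a * (mx i (mass x) - pay i a (mass x)) = 0"
      by (subst (asm) sum_nonneg_eq_0_iff) (use nn in auto)
    then have "?v a * (mx i (mass x) - pay i a (mass x)) = 0" using *(2) by blast
    then show ?thesis using *(2,3) by (simp add: br_iff)
  qed
qed

lemma mx_expectation_attained:
  assumes x: "x \<in> X"
  shows "\<exists>z\<in>mixed_strategies (card (Y i)). expectation Y y u (x(i := z)) = mx i (mass x)"
proof -
  obtain a where a: "a \<in> br i (mass x)" using br_ne by blast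
  then have aY: "a \<in> Y i" using br_subset by blast
  let ?z = "\<lambda>k\<in>J i. ind a (y i (Suc k))"
  have 1: "sum (ind a) (Y i) = 1" using aY by (simp add: ind_def)
  note v = mixture_coords[OF 1]
  have "x(i := ?z) \<in> space S" using X_space[OF x] by (simp add: space_S)
  moreover have "sx (mass (x(i := ?z)))"
  proof -
    have *: "0 \<le> mass (x(i := ?z)) j b" if b: "b \<in> Y j" for j b
      using b v[of b] sx_nonneg[OF X_sx[OF x] b] by (cases "j = i") (auto simp: ind_def)
    show ?thesis unfolding sx_def sum_mass by (intro allI conjI ballI refl) (rule *)
  qed
  ultimately have z: "?z \<in> mixed_strategies (card (Y i))" using mixed_iff[OF x] by (simp only: X_iff)
  have "expectation Y y u (x(i := ?z)) = mx i (mass x)"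
  proof (rule best_response_expectation_le(2)[OF x z])
    fix b assume "b \<in> Y i" "mixture (Y i) (y i) ?z b \<noteq> 0"
    then show "b \<in> br i (mass x)" using a v[of b] by (simp add: ind_def split: if_splits)
  qed
  with z show ?thesis by blast
qed

text \<open>The expected potential is the average of the payoffs with the player's own masses as
  weights, so it is maximal exactly when only optimal actions are charged.\<close>

lemma best_responses_iff:
  assumes x: "x \<in> X"
  shows "z \<in> best_responses Y y u i x \<longleftrightarrow> z \<in> mixed_strategies (card (Y i)) \<and>
    (\<forall>a\<in>Y i. mixture (Y i) (y i) z a \<noteq> 0 \<longrightarrow> a \<in> br i (mass x))"
proof
  assume z: "z \<in> best_responses Y y u i x"
  then have zm: "z \<in> mixed_strategies (card (Y i))" by (simp add: best_responses_def)
  obtain z' where z': "z' \<in> mixed_strategies (card (Y i))" "expectation Y y u (x(i := z')) = mx i (mass x)"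
    using mx_expectation_attained[OF x] by blast
  then have "mx i (mass x) \<le> expectation Y y u (x(i := z))" using z by (auto simp: best_responses_def)
  then have "expectation Y y u (x(i := z)) = mx i (mass x)" using best_response_expectation_le(1)[OF x zm] by linarith
  then show "z \<in> mixed_strategies (card (Y i)) \<and> (\<forall>a\<in>Y i. mixture (Y i) (y i) z a \<noteq> 0 \<longrightarrow> a \<in> br i (mass x))"
    using zm best_response_expectation_le(3)[OF x zm] by blast
next
  assume *: "z \<in> mixed_strategies (card (Y i)) \<and> (\<forall>a\<in>Y i. mixture (Y i) (y i) z a \<noteq> 0 \<longrightarrow> a \<in> br i (mass x))"
  have "expectation Y y u (x(i := z)) = mx i (mass x)" using * by (intro best_response_expectation_le(2)[OF x]) auto
  then show "z \<in> best_responses Y y u i x"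
    using * best_response_expectation_le(1)[OF x] by (simp add: best_responses_def)
qed

lemma nash_iff: "nash Y y u x \<longleftrightarrow> x \<in> X \<and> G (mass x) = 0"
proof (cases "x \<in> X")
  case True
  then have "x i \<in> mixed_strategies (card (Y i))" for i by (simp add: strategies_def)
  then show ?thesis
    unfolding nash_def BR_def mem_Collect_eq best_responses_iff[OF True] G_eq_0_iff[OF X_sx[OF True]] by auto
qed (simp add: nash_def)

lemma exp_mass_lipschitz:
  assumes x: "\<And>t. t \<ge> 0 \<Longrightarrow> x t \<in> X" and a: "a \<in> Y i" and lr: "0 \<le> l" "l \<le> r" "r \<le> c"
  shows "\<bar>exp r * mass (x r) i a - exp l * mass (x l) i a\<bar> \<le> exp c * ((r - l) + (\<Sum>k\<in>J i. \<bar>x r i k - x l i k\<bar>))"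
proof -
  have "\<bar>mass (x r) i a - mass (x l) i a\<bar> \<le> (\<Sum>k\<in>J i. \<bar>x r i k - x l i k\<bar>)"
    using a
  proof (cases rule: action_cases)
    case 1
    have "mass (x r) i a - mass (x l) i a = - (\<Sum>k\<in>J i. x r i k - x l i k)"
      unfolding 1 mixture_1 by (simp add: sum_subtractf)
    then show ?thesis by (simp add: sum_abs)
  next
    case (2 k)
    show ?thesis unfolding 2(2) mixture_Suc[OF 2(1)]
      by (rule member_le_sum[OF 2(1), where f="\<lambda>k. \<bar>x r i k - x l i k\<bar>"]) (auto simp: J_def)
  qed
  then have 1: "exp l * \<bar>mass (x r) i a - mass (x l) i a\<bar> \<le> exp c * (\<Sum>k\<in>J i. \<bar>x r i k - x l i k\<bar>)"
    using lr by (intro mult_mono) auto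
  have m: "0 \<le> mass (x r) i a" "mass (x r) i a \<le> 1"
    using sx_nonneg[OF X_sx[OF x] a] sx_le_1[OF X_sx[OF x] a] lr by auto
  have "1 + (l - r) \<le> exp (l - r)" by (rule exp_ge_add_one_self)
  then have "exp r * (1 + (l - r)) \<le> exp r * exp (l - r)" by (rule mult_left_mono) simp
  then have "exp r - exp l \<le> exp r * (r - l)" by (simp add: exp_add[symmetric] algebra_simps)
  also have "\<dots> \<le> exp c * (r - l)" using lr by (intro mult_right_mono) auto
  finally have "(exp r - exp l) * mass (x r) i a \<le> (exp c * (r - l)) * 1"
    using m lr by (intro mult_mono) auto
  moreover have "0 \<le> (exp r - exp l) * mass (x r) i a" using m lr by simp
  moreover have "exp r * mass (x r) i a - exp l * mass (x l) i a =
      (exp r - exp l) * mass (x r) i a + exp l * (mass (x r) i a - mass (x l) i a)" by (simp add: algebra_simps)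
  ultimately have "\<bar>exp r * mass (x r) i a - exp l * mass (x l) i a\<bar> \<le> exp c * (r - l) + exp l * \<bar>mass (x r) i a - mass (x l) i a\<bar>"
    using abs_triangle_ineq[of "(exp r - exp l) * mass (x r) i a" "exp l * (mass (x r) i a - mass (x l) i a)"]
    by (simp add: abs_mult)
  then show ?thesis using 1 unfolding distrib_left by linarith
qed

text \<open>Multiplying by \<open>exp t\<close> turns the drift towards the target into a
  nonnegative almost-everywhere derivative that vanishes for non-optimal actions; absolute
  continuity integrates both facts.\<close>

lemma br_solution_wsol:
  assumes sol: "br_solution Y y u x0 x"
  shows "wsol (\<lambda>t. mass (x t))" "starts (\<lambda>t. mass (x t)) x0"
proof -
  have x0: "x 0 = x0" and x: "\<And>t. t \<ge> 0 \<Longrightarrow> x t \<in> X"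
    and ac: "\<And>i k c. k \<in> J i \<Longrightarrow> c \<ge> 0 \<Longrightarrow> absolutely_continuous_on_interval 0 c (\<lambda>t. x t i k)"
    and ae: "AE t in lborel. t \<ge> 0 \<longrightarrow> (\<exists>b \<in> BR Y y u (x t). \<forall>i. \<forall>k\<in>J i.
           ((\<lambda>s. x s i k) has_real_derivative (b i k - x t i k)) (at t within {0..}))"
    using sol unfolding br_solution_def J_def[symmetric] by simp_all
  show "starts (\<lambda>t. mass (x t)) x0" by (simp add: starts_def x0)
  have acF: "absolutely_continuous_on_interval s t (\<lambda>t. exp t * mass (x t) i a)"
    if a: "a \<in> Y i" and st: "0 \<le> s" "s \<le> t" for a i s t
  proof (rule ac_dominated[where A="J i" and h="\<lambda>k t. x t i k" and C="exp t"])
    fix k assume "k \<in> J i"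
    then have "absolutely_continuous_on_interval 0 t (\<lambda>t. x t i k)" using ac st by simp
    then show "absolutely_continuous_on_interval s t (\<lambda>t. x t i k)" by (rule ac_subset) (use st in auto)
  next
    fix l r assume lr: "s \<le> l" "l \<le> r" "r \<le> t"
    have "0 \<le> l" using lr st by linarith
    with lr show "\<bar>exp r * mass (x r) i a - exp l * mass (x l) i a\<bar> \<le> exp t * ((r - l) + (\<Sum>k\<in>J i. \<bar>x r i k - x l i k\<bar>))"
      by (intro exp_mass_lipschitz x a)
  qed (simp_all add: J_def)
  have der: "AE t in lborel. t \<ge> 0 \<longrightarrow> (\<forall>i. \<forall>a\<in>Y i. \<exists>D\<ge>0. (a \<notin> br i (mass (x t)) \<longrightarrow> D = 0) \<and>
      ((\<lambda>t. exp t * mass (x t) i a) has_real_derivative D) (at t within {0..}))"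
    using ae
  proof eventually_elim
    case (elim t)
    show ?case
    proof (intro impI allI ballI)
      fix i a assume t: "t \<ge> 0" and a: "a \<in> Y i"
      obtain b where b: "b \<in> BR Y y u (x t)"
        "\<forall>i. \<forall>k\<in>J i. ((\<lambda>s. x s i k) has_real_derivative (b i k - x t i k)) (at t within {0..})"
        using elim t by blast
      have bi: "b i \<in> best_responses Y y u i (x t)" for i using b(1) by (simp add: BR_def)
      have bX: "b \<in> X" using bi by (simp add: best_responses_def strategies_def)
      have md: "((\<lambda>s. mass (x s) i a) has_real_derivative (mass b i a - mass (x t) i a)) (at t within {0..})"
        using a
      proof (cases rule: action_cases)
        case 1
        have "((\<lambda>s. 1 - (\<Sum>k\<in>J i. x s i k)) has_real_derivative (0 - (\<Sum>k\<in>J i. b i k - x t i k))) (at t within {0..})"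
          using b(2) by (intro DERIV_diff DERIV_const DERIV_sum) blast
        then show ?thesis unfolding 1 mixture_1 by (simp add: sum_subtractf)
      next
        case (2 k)
        show ?thesis unfolding 2(2) mixture_Suc[OF 2(1)] using b(2) 2(1) by blast
      qed
      have "((\<lambda>s. exp s * mass (x s) i a) has_real_derivative
          (exp t * mass (x t) i a + (mass b i a - mass (x t) i a) * exp t)) (at t within {0..})"
        by (rule DERIV_mult[OF has_field_derivative_at_within[OF DERIV_exp] md])
      then have "((\<lambda>s. exp s * mass (x s) i a) has_real_derivative (exp t * mass b i a)) (at t within {0..})"
        by (simp add: algebra_simps)
      moreover have "exp t * mass b i a \<ge> 0" using sx_nonneg[OF X_sx[OF bX] a] by simp
      moreover have "a \<notin> br i (mass (x t)) \<longrightarrow> exp t * mass b i a = 0"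
        using bi[of i] a unfolding best_responses_iff[OF x[OF t]] by auto
      ultimately show "\<exists>D\<ge>0. (a \<notin> br i (mass (x t)) \<longrightarrow> D = 0) \<and>
          ((\<lambda>t. exp t * mass (x t) i a) has_real_derivative D) (at t within {0..})" by blast
    qed
  qed
  show "wsol (\<lambda>t. mass (x t))"
  proof (rule wsolI)
    show "sx (mass (x t))" if "t \<ge> 0" for t by (rule X_sx[OF x[OF that]])
    show "exp s * mass (x s) i a \<le> exp t * mass (x t) i a" if a: "a \<in> Y i" and st: "0 \<le> s" "s \<le> t" for i a s t
    proof (rule ac_mono[OF acF[OF a st] st(2)])
      show "AE r in lborel. r \<in> {s..t} \<longrightarrow> (\<exists>D\<ge>0. ((\<lambda>t. exp t * mass (x t) i a) has_real_derivative D) (at r within {s..t}))"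
        using der
      proof eventually_elim
        case (elim r)
        show ?case
        proof
          assume "r \<in> {s..t}"
          then have "0 \<le> r" using st by simp
          then obtain D where "D \<ge> 0" "((\<lambda>t. exp t * mass (x t) i a) has_real_derivative D) (at r within {0..})"
            using elim a by blast
          then show "\<exists>D\<ge>0. ((\<lambda>t. exp t * mass (x t) i a) has_real_derivative D) (at r within {s..t})"
            using DERIV_subset[of _ D r "{0..}" "{s..t}"] st by auto
        qed
      qed
    qed
    show "exp t * mass (x t) i a = exp s * mass (x s) i a"
      if a: "a \<in> Y i" and st: "0 \<le> s" "s \<le> t" and nbr: "\<And>r. s \<le> r \<Longrightarrow> r \<le> t \<Longrightarrow> a \<notin> br i (mass (x r))" for i a s t
    proof (rule ac_const[OF acF[OF a st] st(2), symmetric])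
      show "AE r in lborel. r \<in> {s..t} \<longrightarrow> ((\<lambda>t. exp t * mass (x t) i a) has_real_derivative 0) (at r within {s..t})"
        using der
      proof eventually_elim
        case (elim r)
        show ?case
        proof
          assume r: "r \<in> {s..t}"
          then have "0 \<le> r" using st by simp
          then have "((\<lambda>t. exp t * mass (x t) i a) has_real_derivative 0) (at r within {0..})"
            using elim a nbr[of r] r by auto
          then show "((\<lambda>t. exp t * mass (x t) i a) has_real_derivative 0) (at r within {s..t})"
            by (rule DERIV_subset) (use st in auto)
        qed
      qed
    qed
  qed
qed

end

section \<open>Nondegeneracy in coordinates\<close>

context labeled_game
begin

lemma y_Suc_ne: "k \<in> J i \<Longrightarrow> y i (Suc k) \<noteq> y i (Suc 0)"
proof
  assume k: "k \<in> J i" "y i (Suc k) = y i (Suc 0)"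
  have "Suc k = Suc 0" using card_pos[of i] by (intro y_inj[OF J_Suc[OF k(1)] _ k(2)]) simp
  then show False using k(1) by (simp add: J_def)
qed

lemma y_Suc_inj: "k \<in> J i \<Longrightarrow> l \<in> J i \<Longrightarrow> y i (Suc k) = y i (Suc l) \<Longrightarrow> k = l"
  using y_inj[OF J_Suc J_Suc, of k i l] by simp

lemma mixture_upd_coord:
  assumes k: "k \<in> J i" and a: "a \<in> Y i"
  shows "mixture (Y i) (y i) (v(k := s)) a = mixture (Y i) (y i) v a + (s - v k) * dl (y i (Suc k)) (y i (Suc 0)) a"
  using mixture_upd[OF k a, of v s] mixture_upd[OF k a, of v "v k"] by (simp add: algebra_simps)

text \<open>Varying coordinate \<open>k\<close> shifts mass between the first action and action
  \<open>k + 1\<close>, and \<open>F\<close> is linear in that player's masses, so the derivative is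
  the difference of the two pure values.\<close>

lemma partial_deriv_multilinear:
  assumes k: "k \<in> J i" and lin: "\<And>m v. F (m(i := v)) = (\<Sum>a\<in>Y i. v a * F (m(i := ind a)))"
  shows "partial_deriv i k (\<lambda>x. F (mass x)) x =
    F ((mass x)(i := ind (y i (Suc k)))) - F ((mass x)(i := ind (y i (Suc 0))))"
proof -
  let ?a = "y i (Suc k)" and ?b = "y i (Suc 0)"
  let ?Fe = "\<lambda>e. F ((mass x)(i := ind e))"
  have aY: "?a \<in> Y i" by (rule y_mem[OF J_Suc[OF k]])
  have pick: "(\<Sum>e\<in>Y i. ind c e * ?Fe e) = ?Fe c" if "c \<in> Y i" for c
  proof -
    have "(\<Sum>e\<in>Y i. ind c e * ?Fe e) = (\<Sum>e\<in>Y i. if e = c then ?Fe e else 0)"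
      by (intro sum.cong refl) (simp add: ind_def)
    also have "\<dots> = ?Fe c" using that by simp
    finally show ?thesis .
  qed
  have dl_sum: "(\<Sum>e\<in>Y i. dl ?a ?b e * ?Fe e) = ?Fe ?a - ?Fe ?b"
    unfolding dl_def left_diff_distrib sum_subtractf by (simp only: pick[OF aY] pick[OF y1_mem])
  have e: "F (mass (x(i := (x i)(k := s)))) = (\<Sum>e\<in>Y i. mass x i e * ?Fe e) + (s - x i k) * (?Fe ?a - ?Fe ?b)" for s
  proof -
    have "F (mass (x(i := (x i)(k := s)))) = (\<Sum>e\<in>Y i. (mass x i e + (s - x i k) * dl ?a ?b e) * ?Fe e)"
      unfolding mass_upd lin[of _ "mixture (Y i) (y i) ((x i)(k := s))"] by (intro sum.cong refl) (simp add: mixture_upd_coord[OF k])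
    also have "\<dots> = (\<Sum>e\<in>Y i. mass x i e * ?Fe e) + (s - x i k) * (\<Sum>e\<in>Y i. dl ?a ?b e * ?Fe e)"
      by (simp add: distrib_right sum.distrib sum_distrib_left mult.assoc)
    finally show ?thesis unfolding dl_sum .
  qed
  show ?thesis unfolding partial_deriv_def e
    by (rule DERIV_imp_deriv) (auto intro!: derivative_eq_intros)
qed

lemma partial_deriv_expectation:
  assumes "k \<in> J i"
  shows "partial_deriv i k (expectation Y y u) x = d i (y i (Suc k)) (y i (Suc 0)) (mass x)"
proof -
  have *: "expectation Y y u = (\<lambda>x. U (mass x))" by (rule ext) (rule expectation_U)
  show ?thesis
    unfolding * d_def pay_def by (rule partial_deriv_multilinear[OF assms U_upd_pay[unfolded pay_def]])
qed

text \<open>For \<open>i = j\<close> both sides are 0, because payoff differences ignore the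
  player's own masses.\<close>

lemma partial_deriv2_expectation:
  assumes k: "k \<in> J i" and l: "l \<in> J j"
  shows "partial_deriv i k (partial_deriv j l (expectation Y y u)) x =
    dd i (y i (Suc k)) (y i (Suc 0)) j (y j (Suc l)) (y j (Suc 0)) (mass x)"
proof -
  let ?D = "d j (y j (Suc l)) (y j (Suc 0))"
  have D: "partial_deriv j l (expectation Y y u) = (\<lambda>x. ?D (mass x))"
    by (rule ext) (rule partial_deriv_expectation[OF l])
  show ?thesis
  proof (cases "i = j")
    case True
    have "?D (mass (x(i := (x i)(k := s)))) = ?D (mass x)" for s
      unfolding mass_upd True by (rule d_upd_same)
    then have "partial_deriv i k (\<lambda>x. ?D (mass x)) x = 0" unfolding partial_deriv_def by simp
    then show ?thesis unfolding D True by simp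
  next
    case False
    have "partial_deriv i k (\<lambda>x. ?D (mass x)) x =
        dd j (y j (Suc l)) (y j (Suc 0)) i (y i (Suc k)) (y i (Suc 0)) (mass x)"
      unfolding dd_def by (rule partial_deriv_multilinear[OF k d_upd[OF False]])
    also have "\<dots> = dd i (y i (Suc k)) (y i (Suc 0)) j (y j (Suc l)) (y j (Suc 0)) (mass x)"
      using False y_mem[OF J_Suc[OF l]] by (intro dd_commute) auto
    finally show ?thesis unfolding D .
  qed
qed

lemma nondegenerate_regular_point:
  assumes z: "sx z" "G z = 0" and x: "\<And>i a. a \<in> Y i \<Longrightarrow> mass x i a = z i a"
    and front: "\<And>i. y i ` {1..card (supp z i)} = supp z i"
    and first: "first_order_nondegenerate Y y u x" and second: "second_order_nondegenerate Y y u x"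
  shows "\<exists>B. regular_point Y u z (\<lambda>i. y i (Suc 0)) B"
proof -
  have support: "support (Y i) (y i) (x i) = supp z i" for i using x by (auto simp: support_def supp_def)
  have ev: "eqv (mass x) z" by (rule eqv_coordwise[OF x])
  have n_le: "card (supp z i) \<le> card (Y i)" for i by (rule card_mono[OF fin supp_subset])
  have n_pos: "1 \<le> card (supp z i)" for i
  proof -
    have "supp z i \<noteq> {}"
    proof
      assume "supp z i = {}"
      then have "sum (z i) (Y i) = 0" by (intro sum.neutral) (auto simp: supp_def)
      then show False using sx_sum[OF z(1), of i] by simp
    qed
    then show ?thesis by (simp add: Suc_le_eq card_gt_0_iff)
  qed
  have a0: "y i (Suc 0) \<in> supp z i" for i
  proof -
    have "y i 1 \<in> y i ` {1..card (supp z i)}" using n_pos[of i] by (intro imageI) simp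
    then show ?thesis unfolding front by simp
  qed
  have sub: "supp z i \<subseteq> br i z" for i using G_eq_0_iff[OF z(1)] z(2) by (auto simp: supp_def)
  have br: "br i z = supp z i" for i
  proof (rule subset_antisym[OF _ sub], rule subsetI, rule ccontr)
    fix a assume a: "a \<in> br i z" "a \<notin> supp z i"
    have aY: "a \<in> Y i" using a(1) br_subset by blast
    then show False
    proof (cases rule: action_cases)
      case 1
      then show False using a(2) a0 by simp
    next
      case (2 k)
      \<comment> \<open>Coordinate \<open>k\<close> belongs to action number \<open>k + 1\<close>,
        so an unsupported action corresponds to \<open>k \<ge> card (supp z i)\<close>, the range in
        the first-order condition.\<close>
      have "Suc k \<notin> {1..card (supp z i)}" using a(2) unfolding 2(2) by (metis front imageI)
      then have "k \<in> {card (supp z i)..card (Y i) - 1}" using 2(1) by (auto simp: J_def)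
      then have "partial_deriv i k (expectation Y y u) x \<noteq> 0"
        using first unfolding first_order_nondegenerate_def support by blast
      then have "d i a (y i (Suc 0)) z \<noteq> 0"
        unfolding partial_deriv_expectation[OF 2(1)] 2(2) eqv_d[OF ev] .
      moreover have "d i a (y i (Suc 0)) z = 0"
        using a(1) subsetD[OF sub a0, of i] by (simp add: d_def br_iff)
      ultimately show False by simp
    qed
  qed
  define Q where "Q = {(i, k). card (supp z i) \<ge> 2 \<and> 1 \<le> k \<and> k \<le> card (supp z i) - 1}"
  define M where "M = (\<lambda>(i, k) (j, l). partial_deriv i k (partial_deriv j l (expectation Y y u)) x)"
  \<comment> \<open>Sends a coordinate to its action and thereby the Hessian indices bijectively to
    the supported actions other than the base action.\<close>
  define \<phi> where "\<phi> = (\<lambda>(i, k). (i, y i (Suc k)))"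
  let ?I = "SIGMA i:UNIV. supp z i - {y i (Suc 0)}"
  let ?H = "\<lambda>p r. dd (fst p) (snd p) (y (fst p) (Suc 0)) (fst r) (snd r) (y (fst r) (Suc 0)) z"
  have "invertible_matrix_on Q M"
    using second unfolding second_order_nondegenerate_def Let_def support Q_def M_def .
  then obtain B where B: "\<And>p q. p \<in> Q \<Longrightarrow> q \<in> Q \<Longrightarrow> (\<Sum>r\<in>Q. M p r * B r q) = (if p = q then 1 else 0) \<and>
      (\<Sum>r\<in>Q. B p r * M r q) = (if p = q then 1 else 0)"
    unfolding invertible_matrix_on_def by blast
  have QJ: "k \<in> J i" "Suc k \<in> {1..card (supp z i)}" if "(i, k) \<in> Q" for i k
    using that n_le[of i] by (auto simp: Q_def J_def)
  have inj: "inj_on \<phi> Q"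
  proof (rule inj_onI)
    fix p q assume pq: "p \<in> Q" "q \<in> Q" "\<phi> p = \<phi> q"
    obtain i k j l where ik: "p = (i, k)" "q = (j, l)" by (cases p, cases q) auto
    have "j = i" "y i (Suc k) = y i (Suc l)" using pq(3) by (auto simp: \<phi>_def ik)
    moreover have "k \<in> J i" "l \<in> J j" using pq QJ(1) by (auto simp: ik)
    ultimately show "p = q" using y_Suc_inj[of k i l] by (simp add: ik)
  qed
  have img: "\<phi> ` Q = ?I"
  proof
    show "\<phi> ` Q \<subseteq> ?I"
    proof
      fix q assume "q \<in> \<phi> ` Q"
      then obtain i k where ik: "(i, k) \<in> Q" "q = (i, y i (Suc k))" by (auto simp: \<phi>_def)
      have "y i (Suc k) \<in> supp z i" using imageI[OF QJ(2)[OF ik(1)], of "y i"] unfolding front .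
      then show "q \<in> ?I" using y_Suc_ne[OF QJ(1)[OF ik(1)]] ik(2) by simp
    qed
    show "?I \<subseteq> \<phi> ` Q"
    proof
      fix q assume "q \<in> ?I"
      then obtain i a where ia: "q = (i, a)" "a \<in> supp z i" "a \<noteq> y i (Suc 0)" by auto
      have "a \<in> y i ` {1..card (supp z i)}" using ia(2) unfolding front .
      then obtain n where n: "n \<in> {1..card (supp z i)}" "a = y i n" by blast
      have "n \<noteq> 1" using n(2) ia(3) by auto
      then have "(i, n - 1) \<in> Q" "Suc (n - 1) = n" using n(1) by (auto simp: Q_def)
      then show "q \<in> \<phi> ` Q" using n(2) ia(1) by (intro image_eqI[of _ _ "(i, n - 1)"]) (auto simp: \<phi>_def)
    qed
  qed
  have bij\<phi>: "bij_betw \<phi> Q ?I" unfolding bij_betw_def using inj img by blast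
  have HM: "?H (\<phi> p) (\<phi> r) = M p r" if pr: "p \<in> Q" "r \<in> Q" for p r
  proof -
    obtain i k j l where ik: "p = (i, k)" "r = (j, l)" by (cases p, cases r) auto
    have J: "k \<in> J i" "l \<in> J j" using pr QJ(1) by (auto simp: ik)
    have "dd i a b j e f (mass x) = dd i a b j e f z" for a b e f
      unfolding dd_def by (simp only: eqv_d[OF eqv_upd[OF ev]])
    then show ?thesis unfolding M_def \<phi>_def ik using partial_deriv2_expectation[OF J, of x] by simp
  qed
  define \<psi> where "\<psi> = inv_into Q \<phi>"
  have \<psi>: "\<psi> (\<phi> p) = p" if "p \<in> Q" for p unfolding \<psi>_def by (rule inv_into_f_f[OF inj that])
  show ?thesis
  proof (intro exI regular_point.intro regular_point_axioms.intro)
    show "finite_game Y" by unfold_locales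
    show "sx z" by (rule z(1))
    show "y i (Suc 0) \<in> supp z i" for i by (rule a0)
    show "br i z = supp z i" for i by (rule br)
    fix p q assume "p \<in> ?I" "q \<in> ?I"
    then obtain p' q' where p': "p = \<phi> p'" "p' \<in> Q" and q': "q = \<phi> q'" "q' \<in> Q"
      unfolding img[symmetric] by blast
    have eq: "p = q \<longleftrightarrow> p' = q'" unfolding p'(1) q'(1) using inj_on_eq_iff[OF inj p'(2) q'(2)] .
    have "(\<Sum>r\<in>?I. ?H p r * B (\<psi> r) (\<psi> q)) = (\<Sum>r\<in>Q. ?H p (\<phi> r) * B (\<psi> (\<phi> r)) (\<psi> q))"
      by (rule sum.reindex_bij_betw[OF bij\<phi>, symmetric])
    also have "\<dots> = (\<Sum>r\<in>Q. M p' r * B r q')"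
      by (intro sum.cong refl) (simp only: p'(1) q'(1) HM[OF p'(2)] \<psi> q'(2))
    finally have 1: "(\<Sum>r\<in>?I. ?H p r * B (\<psi> r) (\<psi> q)) = (if p = q then 1 else 0)"
      unfolding eq using B[OF p'(2) q'(2)] by simp
    have "(\<Sum>r\<in>?I. B (\<psi> p) (\<psi> r) * ?H r q) = (\<Sum>r\<in>Q. B (\<psi> p) (\<psi> (\<phi> r)) * ?H (\<phi> r) q)"
      by (rule sum.reindex_bij_betw[OF bij\<phi>, symmetric])
    also have "\<dots> = (\<Sum>r\<in>Q. B p' r * M r q')"
      by (intro sum.cong refl) (simp only: p'(1) q'(1) HM[OF _ q'(2)] \<psi> p'(2))
    finally have 2: "(\<Sum>r\<in>?I. B (\<psi> p) (\<psi> r) * ?H r q) = (if p = q then 1 else 0)"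
      unfolding eq using B[OF p'(2) q'(2)] by simp
    show "(\<Sum>r\<in>?I. ?H p r * B (\<psi> r) (\<psi> q)) = (if p = q then 1 else 0) \<and>
        (\<Sum>r\<in>?I. B (\<psi> p) (\<psi> r) * ?H r q) = (if p = q then 1 else 0)"
      using 1 2 by blast
  qed
qed

section \<open>Convergence of nonresonant solutions\<close>

lemma coords_nash:
  assumes z: "sx z" "G z = 0"
  shows "nash Y y u (coords z)"
proof -
  have "G (mass (coords z)) = 0"
    using z(2) unfolding G_eq_0_iff[OF z(1)] G_eq_0_iff[OF X_sx[OF coords_X[OF z(1)]]]
    by (simp add: mass_coords[OF z(1)] br_cong[of "mass (coords z)" z, OF mass_coords[OF z(1)]])
  then show ?thesis using coords_X[OF z(1)] by (simp add: nash_iff)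
qed

text \<open>Regularity is stated for a labelling adapted to the equilibrium, while
  \<open>regular_point\<close> mentions actions only. The conclusion is obtained in the adapted
  labelling and is then free of labels.\<close>

lemma equilibrium_regular_point:
  assumes reg: "regular_game Y y u" and z: "sx z" "G z = 0"
  shows "\<exists>a0 B. regular_point Y u z a0 B"
proof -
  let ?x = "coords z"
  have "nash Y y u ?x" by (rule coords_nash[OF z])
  then have "regular_equilibrium Y y u ?x" using reg by (simp add: regular_game_def)
  then obtain y' where y': "adapted_labeling Y y ?x y'"
      "first_order_nondegenerate Y y' u (relabel Y y y' ?x)" "second_order_nondegenerate Y y' u (relabel Y y y' ?x)"
    unfolding regular_equilibrium_def by blast
  interpret L: labeled_game Y u y' by unfold_locales (use y'(1) in \<open>simp add: adapted_labeling_def\<close>)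
  have supp: "support (Y i) (y i) (?x i) = supp z i" for i
    using mass_coords[OF z(1)] by (auto simp: support_def supp_def)
  have "\<exists>B. regular_point Y u z (\<lambda>i. y' i (Suc 0)) B"
  proof (rule L.nondegenerate_regular_point[OF z])
    show "first_order_nondegenerate Y y' u (relabel Y y y' ?x)" "second_order_nondegenerate Y y' u (relabel Y y y' ?x)"
      by (rule y')+
    show "y' i ` {1..card (supp z i)} = supp z i" for i
      using y'(1) unfolding adapted_labeling_def supp by blast
    show "mixture (Y i) (y' i) (relabel Y y y' ?x i) a = z i a" if a: "a \<in> Y i" for i a
    proof -
      have "relabel Y y y' ?x i = (\<lambda>k\<in>J i. mass ?x i (y' i (Suc k)))" by (simp add: relabel_def J_def)
      then have "mixture (Y i) (y' i) (relabel Y y y' ?x i) a = mass ?x i a"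
        using L.mixture_coords[OF sum_mass a] by simp
      then show ?thesis using mass_coords[OF z(1) a] by simp
    qed
  qed
  then show ?thesis by blast
qed

lemma tendsto_coords:
  fixes x :: "real \<Rightarrow> 'p \<Rightarrow> nat \<Rightarrow> real"
  assumes x: "\<And>t. t \<ge> 0 \<Longrightarrow> x t \<in> X" and z: "sx z" and lim: "((\<lambda>t. dm z (mass (x t))) \<longlongrightarrow> 0) at_top"
  shows "(x \<longlongrightarrow> coords z) at_top"
  unfolding tendsto_fun_iff
proof (intro allI)
  fix i k
  show "((\<lambda>t. x t i k) \<longlongrightarrow> coords z i k) at_top"
  proof (cases "k \<in> J i")
    case True
    have "((\<lambda>t. x t i k - coords z i k) \<longlongrightarrow> 0) at_top"
    proof (rule Lim_null_comparison[OF always_eventually lim], rule allI)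
      fix t
      show "norm (x t i k - coords z i k) \<le> dm z (mass (x t))"
        using dm_ge_coord[OF y_mem[OF J_Suc[OF True]], of "mass (x t)" z] True
        by (simp add: mixture_Suc coords_def)
    qed
    then show ?thesis by (simp add: LIM_zero_iff)
  next
    case False
    have "eventually (\<lambda>t. x t i k = coords z i k) at_top"
    proof (rule eventually_at_top_linorderI[of 0])
      fix t :: real assume "0 \<le> t"
      then have "x t i \<in> extensional (J i)" using X_space[OF x] by (simp add: space_S)
      then show "x t i k = coords z i k" using False by (simp add: extensional_def coords_def)
    qed
    then show ?thesis by (rule tendsto_eventually)
  qed
qed

text \<open>Two actions in the support of the limit would, at some integer time, be exactly
  indifferent without being duplicates, contrary to nonresonance. So every support is a single
  action.\<close>

lemma nonresonant_solution_converges: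
  assumes reg: "regular_game Y y u" and sol: "br_solution Y y u x0 x"
    and nonres: "\<not> (\<exists>m. wsol m \<and> starts m x0 \<and>
      (\<exists>n :: nat. \<exists>i a b. a \<in> Y i \<and> b \<in> Y i \<and> \<not> dup i a b \<and> d i a b (m (real n)) = 0))"
  shows "\<exists>xs. nash Y y u xs \<and> pure Y y xs \<and> (x \<longlongrightarrow> xs) at_top"
proof -
  let ?m = "\<lambda>t. mass (x t)"
  have m: "wsol ?m" "starts ?m x0" by (rule br_solution_wsol[OF sol])+
  have iso: "\<exists>r>0. \<forall>z'. sx z' \<and> G z' = 0 \<and> dm z z' \<le> r \<longrightarrow> dm z z' = 0" if "sx z" "G z = 0" for z
  proof -
    obtain a0 B where "regular_point Y u z a0 B" using equilibrium_regular_point[OF reg \<open>sx z\<close> \<open>G z = 0\<close>] by blast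
    then show ?thesis by (rule regular_point.isolated)
  qed
  obtain z where z: "sx z" "G z = 0" and lim: "((\<lambda>t. dm z (?m t)) \<longlongrightarrow> 0) at_top"
    by (rule wsol_converges[OF m(1) iso])
  obtain a0 B where "regular_point Y u z a0 B" using equilibrium_regular_point[OF reg z] by blast
  then interpret R: regular_point Y u z a0 B .
  obtain n :: nat where n: "\<forall>p\<in>R.I. R.g p (?m (real n)) = 0"
    using R.indifferent_in_finite_time[OF m(1) lim] by blast
  have single: "supp z i = {a0 i}" for i
  proof -
    have False if a: "a \<in> supp z i" "a \<noteq> a0 i" for a
    proof -
      have p: "(i, a) \<in> R.I" using a by (simp add: R.I_def)
      then have "d i a (a0 i) (?m (real n)) = 0" using n by (auto simp: R.g_def)
      moreover have "\<not> dup i a (a0 i)" by (rule R.support_not_dup[OF p])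
      moreover have "a \<in> Y i" "a0 i \<in> Y i" using a(1) R.a0[of i] supp_subset by blast+
      ultimately show False using nonres m by blast
    qed
    then show ?thesis using R.a0[of i] by blast
  qed
  have zv: "z i b = (if b = a0 i then 1 else 0)" if b: "b \<in> Y i" for i b
  proof -
    have a0Y: "a0 i \<in> Y i" using R.a0[of i] supp_subset by blast
    have zero: "z i c = 0" if "c \<in> Y i" "c \<noteq> a0 i" for c using single[of i] that by (auto simp: supp_def)
    have "1 = (\<Sum>c\<in>Y i. z i c)" using sx_sum[OF z(1), of i] by simp
    also have "\<dots> = z i (a0 i) + (\<Sum>c\<in>Y i - {a0 i}. z i c)" by (rule sum.remove[OF fin a0Y])
    also have "(\<Sum>c\<in>Y i - {a0 i}. z i c) = 0" by (intro sum.neutral) (use zero in auto)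
    finally show ?thesis using zero[OF b] by auto
  qed
  have X: "x t \<in> X" if "t \<ge> 0" for t using sol that by (simp add: br_solution_def)
  have "nash Y y u (coords z)" by (rule coords_nash[OF z])
  moreover have "pure Y y (coords z)"
    unfolding pure_def
  proof (intro allI bexI[where x="a0 i" for i] ballI)
    fix i b assume "b \<in> Y i"
    then show "mixture (Y i) (y i) (coords z i) b = (if b = a0 i then 1 else 0)"
      using mass_coords[OF z(1)] zv by simp
  next
    show "a0 i \<in> Y i" for i using R.a0[of i] supp_subset by blast
  qed
  moreover have "(x \<longlongrightarrow> coords z) at_top" by (rule tendsto_coords[OF X z(1) lim])
  ultimately show ?thesis by blast
qed

end

theorem theorem1p1:
  fixes Y :: "'p::finite \<Rightarrow> 'a set"
    and y :: "'p \<Rightarrow> nat \<Rightarrow> 'a"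
    and util :: "'p \<Rightarrow> ('p \<Rightarrow> 'a) \<Rightarrow> real"
    and u :: "('p \<Rightarrow> 'a) \<Rightarrow> real"
    and w :: "'p \<Rightarrow> real"
  assumes "CARD('p) \<ge> 2"
    and "\<And>i. finite (Y i)"
    and "\<And>i. Y i \<noteq> {}"
    and "labeling Y y"
    and "weighted_potential Y util u w"
    and "regular_game Y y u"
  shows "AE x0 in strategy_measure Y. x0 \<in> strategies Y \<longrightarrow>
           (\<forall>x. br_solution Y y u x0 x \<longrightarrow>
              (\<exists>xs. nash Y y u xs \<and> pure Y y xs \<and> (x \<longlongrightarrow> xs) at_top))"
proof -
  interpret labeled_game Y u y by unfold_locales (rule assms(2-4))+
  obtain N where N: "N \<in> null_sets S" and sub: "{x0 \<in> X. \<exists>m. wsol m \<and> starts m x0 \<and>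
      (\<exists>n :: nat. \<exists>i a b. a \<in> Y i \<and> b \<in> Y i \<and> \<not> dup i a b \<and> d i a b (m (real n)) = 0)} \<subseteq> N"
    using resonant_start_negligible unfolding negl_def by blast
  show ?thesis
  proof (rule AE_I'[OF N], rule subsetI, rule ccontr)
    fix x0
    assume bad: "x0 \<in> {x0 \<in> space S. \<not> (x0 \<in> X \<longrightarrow> (\<forall>x. br_solution Y y u x0 x \<longrightarrow>
        (\<exists>xs. nash Y y u xs \<and> pure Y y xs \<and> (x \<longlongrightarrow> xs) at_top)))}" and "x0 \<notin> N"
    from bad obtain x where x: "x0 \<in> X" "br_solution Y y u x0 x"
      "\<not> (\<exists>xs. nash Y y u xs \<and> pure Y y xs \<and> (x \<longlongrightarrow> xs) at_top)" by blast
    have "\<not> (\<exists>m. wsol m \<and> starts m x0 \<and>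
        (\<exists>n :: nat. \<exists>i a b. a \<in> Y i \<and> b \<in> Y i \<and> \<not> dup i a b \<and> d i a b (m (real n)) = 0))"
      using x(1) sub \<open>x0 \<notin> N\<close> by blast
    from nonresonant_solution_converges[OF assms(6) x(2) this] x(3) show False by blast
  qed
qed

end
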